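(* Let $L>0$, $\mathbb{T}^2=\mathbb{R}^2/(L\mathbb{Z})^2$, $\mathbf{u}_0\in L^2(\mathbb{T}^2)$ (vector-valued, $\mathbb{R}^2$), $T>0$, and fix $\epsilon>0$. Suppose $\boldsymbol{\eta}^\epsilon:\mathbb{R}^2\to\mathbb{R}^2$ is bounded and Lipschitz continuous with Lipschitz constant $1$. Then weak solutions on $[0,T]$ of the calmed Kuramoto-Sivashinsky equation $$\partial_t\mathbf{u}+(\boldsymbol{\eta}^\epsilon(\mathbf{u})\cdot\nabla)\mathbf{u}+\triangle\mathbf{u}+\triangle^2\mathbf{u}=\mathbf{0},\qquad \mathbf{u}(\mathbf{x},0)=\mathbf{u}_0(\mathbf{x}),$$ with periodic boundary conditions on $\mathbb{T}^2$ exist, are unique, and depend continuously on the initial data (in $L^2(\mathbb{T}^2)$) in $L^\infty(0,T;L^2(\mathbb{T}^2))\cap L^2(0,T;H^2(\mathbb{T}^2))$.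
   Context: $L^2(\mathbb{T}^2)$ and $H^s(\mathbb{T}^2)$ denote the spaces of periodic real $\mathbb{R}^2$-valued functions. Given $\mathbf{u}_0\in L^2(\mathbb{T}^2)$ and $T>0$, a weak solution of the calmed equation on $[0,T]$ is a function $\mathbf{u}\in L^2([0,T];H^2(\mathbb{T}^2))\cap C([0,T];L^2(\mathbb{T}^2))$ with $\partial_t\mathbf{u}\in L^2(0,T;H^{-2}(\mathbb{T}^2))$ such that the equation holds in the sense of $L^2(0,T;H^{-2}(\mathbb{T}^2))$ and the initial condition holds in the sense of $C([0,T];L^2(\mathbb{T}^2))$. Here $(\boldsymbol{\eta}^\epsilon(\mathbf{u})\cdot\nabla)\mathbf{u}=\sum_{j=1}^2\eta^\epsilon_j(\mathbf{u})\,\partial_j\mathbf{u}$. Lipschitz constant $1$ means $|\boldsymbol{\eta}^\epsilon(\mathbf{x})-\boldsymbol{\eta}^\epsilon(\mathbf{y})|\le|\mathbf{x}-\mathbf{y}|$ for all $\mathbf{x},\mathbf{y}\in\mathbb{R}^2$. *)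

theory Defs
  imports "HOL-Analysis.Analysis" "HOL-Probability.Essential_Supremum"
begin

section \<open>Smooth functions\<close>

text \<open>Being the greatest fixed point, this says that all iterated directional derivatives of
  \<open>f\<close> exist and are Frechet differentiable everywhere, i.e. that \<open>f\<close> is \<open>C\<close>-infinity.\<close>

coinductive smooth :: "('a::euclidean_space \<Rightarrow> real) \<Rightarrow> bool" where
  "\<lbrakk>\<forall>x. f differentiable (at x); \<forall>h. smooth (\<lambda>x. frechet_derivative f (at x) h)\<rbrakk> \<Longrightarrow> smooth f"

definition test_function_on :: "real \<Rightarrow> (real \<Rightarrow> real) \<Rightarrow> bool" where
  "test_function_on T \<phi> \<longleftrightarrow>
     smooth \<phi> \<and> (\<exists>a b. 0 < a \<and> b < T \<and> (\<forall>t. t \<notin> {a..b} \<longrightarrow> \<phi> t = 0))"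


section \<open>Function spaces on the torus of side length \<open>L\<close>\<close>

text \<open>Functions on the torus are \<open>L\<close>-periodic functions on the plane, and integrals over the torus
  are integrals over one period cell. Elements of the spaces below are functions rather than
  classes modulo null sets, so the norms are seminorms and equality in a space means equality
  almost everywhere.\<close>

definition periodic :: "real \<Rightarrow> (real^2 \<Rightarrow> 'b) \<Rightarrow> bool" where
  "periodic L f \<longleftrightarrow> (\<forall>x j. f (x + L *\<^sub>R axis j 1) = f x)"

definition cell :: "real \<Rightarrow> (real^2) set" where
  "cell L = cbox 0 (\<chi> i. L)"

definition L2 :: "real \<Rightarrow> (real^2 \<Rightarrow> real^2) set" where
  "L2 L = {u. periodic L u \<and> u \<in> borel_measurable lebesgue \<and>
              set_integrable lebesgue (cell L) (\<lambda>x. (norm (u x))\<^sup>2)}"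

definition l2_inner :: "real \<Rightarrow> (real^2 \<Rightarrow> real^2) \<Rightarrow> (real^2 \<Rightarrow> real^2) \<Rightarrow> real" where
  "l2_inner L u v = (LINT x:cell L|lebesgue. u x \<bullet> v x)"

definition l2_norm :: "real \<Rightarrow> (real^2 \<Rightarrow> real^2) \<Rightarrow> real" where
  "l2_norm L u = sqrt (l2_inner L u u)"

definition is_weak_partial ::
  "real \<Rightarrow> 2 \<Rightarrow> (real^2 \<Rightarrow> real^2) \<Rightarrow> (real^2 \<Rightarrow> real^2) \<Rightarrow> bool" where
  "is_weak_partial L j u w \<longleftrightarrow> u \<in> L2 L \<and> w \<in> L2 L \<and>
     (\<forall>\<phi>. smooth \<phi> \<and> periodic L \<phi> \<longrightarrow>
        (LINT x:cell L|lebesgue. frechet_derivative \<phi> (at x) (axis j 1) *\<^sub>R u x)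
          = - (LINT x:cell L|lebesgue. \<phi> x *\<^sub>R w x))"

text \<open>A representative of the weak derivative, which is unique up to null sets; only meaningful
  for functions that have one.\<close>

definition weak_partial :: "real \<Rightarrow> 2 \<Rightarrow> (real^2 \<Rightarrow> real^2) \<Rightarrow> (real^2 \<Rightarrow> real^2)" where
  "weak_partial L j u = (SOME w. is_weak_partial L j u w)"

primrec Sob :: "real \<Rightarrow> nat \<Rightarrow> (real^2 \<Rightarrow> real^2) set" where
  "Sob L 0 = L2 L"
| "Sob L (Suc k) = {u \<in> L2 L. \<forall>j. \<exists>w \<in> Sob L k. is_weak_partial L j u w}"

primrec sob_sqnorm :: "real \<Rightarrow> nat \<Rightarrow> (real^2 \<Rightarrow> real^2) \<Rightarrow> real" where
  "sob_sqnorm L 0 u = (l2_norm L u)\<^sup>2"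
| "sob_sqnorm L (Suc k) u =
     (l2_norm L u)\<^sup>2 + (\<Sum>j\<in>UNIV. sob_sqnorm L k (weak_partial L j u))"

abbreviation H2 :: "real \<Rightarrow> (real^2 \<Rightarrow> real^2) set" where
  "H2 L \<equiv> Sob L 2"

definition h2_norm :: "real \<Rightarrow> (real^2 \<Rightarrow> real^2) \<Rightarrow> real" where
  "h2_norm L u = sqrt (sob_sqnorm L 2 u)"

definition lap :: "real \<Rightarrow> (real^2 \<Rightarrow> real^2) \<Rightarrow> (real^2 \<Rightarrow> real^2)" where
  "lap L u = (\<lambda>x. \<Sum>j\<in>UNIV. weak_partial L j (weak_partial L j u) x)"

text \<open>The space of order \<open>-2\<close> is the dual of \<open>H2\<close>: its elements are functionals of which only
  the values on \<open>H2\<close> matter. A square integrable function \<open>u\<close> is identified with the functional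
  \<open>l2_inner L u\<close>.\<close>

type_synonym functional = "(real^2 \<Rightarrow> real^2) \<Rightarrow> real"

definition Hm2 :: "real \<Rightarrow> functional set" where
  "Hm2 L = {F. (\<forall>v\<in>H2 L. \<forall>w\<in>H2 L. \<forall>a b.
                   F (\<lambda>x. a *\<^sub>R v x + b *\<^sub>R w x) = a * F v + b * F w) \<and>
               (\<exists>C. \<forall>v\<in>H2 L. \<bar>F v\<bar> \<le> C * h2_norm L v)}"

definition hm2_norm :: "real \<Rightarrow> functional \<Rightarrow> real" where
  "hm2_norm L F = (SUP v\<in>{v \<in> H2 L. h2_norm L v \<le> 1}. \<bar>F v\<bar>)"


section \<open>Functions of time with values in a seminormed space\<close>

text \<open>Here \<open>V\<close> is the underlying set of the space and \<open>N\<close> its seminorm.\<close>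

definition strongly_measurable ::
  "real \<Rightarrow> 'v::minus set \<Rightarrow> ('v \<Rightarrow> real) \<Rightarrow> (real \<Rightarrow> 'v) \<Rightarrow> bool" where
  "strongly_measurable T V N u \<longleftrightarrow>
     (\<exists>s :: nat \<Rightarrow> real \<Rightarrow> 'v.
        (\<forall>n. simple_function (lebesgue_on {0..T}) (s n) \<and> s n ` {0..T} \<subseteq> V) \<and>
        (AE t in lebesgue_on {0..T}. (\<lambda>n. N (s n t - u t)) \<longlonglongrightarrow> 0))"

definition L2_time ::
  "real \<Rightarrow> 'v::minus set \<Rightarrow> ('v \<Rightarrow> real) \<Rightarrow> (real \<Rightarrow> 'v) set" where
  "L2_time T V N = {u. (AE t in lebesgue_on {0..T}. u t \<in> V) \<and> strongly_measurable T V N u \<and>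
                       integrable (lebesgue_on {0..T}) (\<lambda>t. (N (u t))\<^sup>2)}"

definition L2_time_norm :: "real \<Rightarrow> ('v \<Rightarrow> real) \<Rightarrow> (real \<Rightarrow> 'v) \<Rightarrow> real" where
  "L2_time_norm T N u = sqrt (LINT t|lebesgue_on {0..T}. (N (u t))\<^sup>2)"

definition Linf_time_norm :: "real \<Rightarrow> ('v \<Rightarrow> real) \<Rightarrow> (real \<Rightarrow> 'v) \<Rightarrow> ereal" where
  "Linf_time_norm T N u = esssup (lebesgue_on {0..T}) (\<lambda>t. ereal (N (u t)))"

definition C_time :: "real \<Rightarrow> 'v::minus set \<Rightarrow> ('v \<Rightarrow> real) \<Rightarrow> (real \<Rightarrow> 'v) set" where
  "C_time T V N = {u. \<forall>t\<in>{0..T}. u t \<in> V \<and> ((\<lambda>s. N (u s - u t)) \<longlongrightarrow> 0) (at t within {0..T})}"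

text \<open>\<open>g\<close> is the distributional time derivative of \<open>u\<close>; the identity of functionals is written
  out by pairing both sides with an arbitrary element of \<open>H2\<close>.\<close>

definition is_time_derivative ::
  "real \<Rightarrow> real \<Rightarrow> (real \<Rightarrow> real^2 \<Rightarrow> real^2) \<Rightarrow> (real \<Rightarrow> functional) \<Rightarrow> bool" where
  "is_time_derivative L T u g \<longleftrightarrow>
     (\<forall>\<phi> v. test_function_on T \<phi> \<and> v \<in> H2 L \<longrightarrow>
        (LINT t|lebesgue_on {0..T}. deriv \<phi> t * l2_inner L (u t) v)
          = - (LINT t|lebesgue_on {0..T}. \<phi> t * g t v))"


section \<open>The calmed Kuramoto-Sivashinsky equation\<close>

definition calmed_advection ::
  "real \<Rightarrow> (real^2 \<Rightarrow> real^2) \<Rightarrow> (real^2 \<Rightarrow> real^2) \<Rightarrow> (real^2 \<Rightarrow> real^2)" where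
  "calmed_advection L \<eta> u = (\<lambda>x. \<Sum>j\<in>UNIV. (\<eta> (u x) $ j) *\<^sub>R weak_partial L j u x)"

text \<open>The bi-Laplacian of \<open>u\<close> in \<open>H2\<close> is the functional sending \<open>v\<close> to the inner product of the
  Laplacians of \<open>u\<close> and \<open>v\<close>, the continuous extension to \<open>H2\<close> of the distributional one.\<close>

definition bilap :: "real \<Rightarrow> (real^2 \<Rightarrow> real^2) \<Rightarrow> functional" where
  "bilap L u = (\<lambda>v. l2_inner L (lap L u) (lap L v))"

definition weak_solution ::
  "real \<Rightarrow> real \<Rightarrow> (real^2 \<Rightarrow> real^2) \<Rightarrow> (real^2 \<Rightarrow> real^2) \<Rightarrow> (real \<Rightarrow> real^2 \<Rightarrow> real^2) \<Rightarrow> bool" where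
  "weak_solution L T \<eta> u0 u \<longleftrightarrow>
     u \<in> L2_time T (H2 L) (h2_norm L) \<and>
     u \<in> C_time T (L2 L) (l2_norm L) \<and>
     (\<exists>g \<in> L2_time T (Hm2 L) (hm2_norm L).
        is_time_derivative L T u g \<and>
        (AE t in lebesgue_on {0..T}. \<forall>v\<in>H2 L.
           g t v + l2_inner L (calmed_advection L \<eta> (u t)) v
             + l2_inner L (lap L (u t)) v + bilap L (u t) v = 0)) \<and>
     (AE x in lebesgue. u 0 x = u0 x)"

end

theory Submission
  imports Defs
begin

text \<open>Write \<open>q k\<close> for the squared length of the frequency \<open>k\<close>, \<open>\<lambda> k = (q k)\<^sup>2 - q k\<close> for the symbol of the linear part,
  and \<open>M\<close> for a bound on \<open>\<eta>\<close>.

  The difference \<open>w = u - v\<close> of two solutions satisfies an energy inequality: the nonlinear term is bounded by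
  \<open>M \<bar>\<nabla>w\<bar> \<bar>w\<bar> + \<bar>\<nabla>v\<bar> \<bar>w\<bar>\<^sup>2\<close> pointwise, because \<open>\<eta>\<close> is bounded and Lipschitz, and one factor \<open>w\<close> of the
  second summand is put into the sup norm, which \<open>H\<^sup>2\<close> controls. Part of the bi-Laplacian absorbs this, leaving
  \<open>(\<parallel>w\<parallel>\<^sup>2)' + \<parallel>w\<parallel>\<^sup>2 / 2 \<le> b \<parallel>w\<parallel>\<^sup>2\<close>, with the \<open>H\<^sup>2\<close> norm in the second place and \<open>L\<^sup>2\<close> norms elsewhere, for a \<open>b\<close>
  that is integrable and depends on \<open>v\<close> only. Gronwall's lemma gives uniqueness and continuous dependence.

  For existence, the calming makes the nonlinearity \<open>N\<close> bounded from \<open>H\<^sup>1\<close> to \<open>L\<^sup>2\<close> with linear growth, so all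
  Fourier coefficients of \<open>N(u)\<close> are bounded by a multiple of the \<open>H\<^sup>1\<close> norm of \<open>u\<close>. The Duhamel integral gains four
  derivatives up to a singularity in time, enough to make the coefficients \<open>d k\<close> of \<open>u - e\<^bsup>-t\<lambda>\<^esup> u0\<close> decay like
  \<open>(1 + q k)\<^bsup>-5/4\<^esup>\<close>. Hence Picard iteration converges coefficientwise in a weighted sup norm over \<open>t\<close> and \<open>k\<close>, on the
  whole time interval because of a weight \<open>e\<^bsup>\<beta>t\<^esup>\<close>. The fixed point is smooth enough for positive times
  to be a weak solution.\<close>

section \<open>Trigonometric functions on the torus\<close>

text \<open>The obstacle to a contraction in a Hilbert space is that no Lipschitz estimate of the
  nonlinearity from H1 to L2 is at hand: in a difference, the product of \<open>w\<close> in H1 with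
  the gradient of \<open>v\<close> in L2 need not be square integrable. Its integral against a
  bounded function is controlled, however, and the basis functions are bounded by
  \<open>2 / L\<close>. So each Fourier coefficient of the nonlinearity is locally Lipschitz on H1,
  uniformly in the frequency, which is why the iteration uses a sup norm over frequencies. The
  exponents follow. The smoothing price \<open>5 / 8\<close> in time buys the decay
  \<open>(1 + q k) powr (- 5 / 4)\<close>, which suffices for H1 because
  \<open>(1 + q k) powr (- 3 / 2)\<close> is summable over a plane lattice. Data in L2 make the H1
  norm grow like \<open>t powr (- 1 / 4)\<close> at time 0, and \<open>5 / 8 + 1 / 4 < 1\<close>
  leaves \<open>1 / 16\<close> to be spent on the exponential weight. Two weights occur, since the
  Lipschitz constant depends on the ball and hence on the weight that keeps the iterates in it. The
  energy argument works with finitely many coefficients, each absolutely continuous in time, and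
  lets the frequencies exhaust the lattice only at the end.\<close>

lemma periodic_axis:
  "periodic L f \<Longrightarrow> f (x + L *\<^sub>R axis j 1) = f x"
  by (simp add: periodic_def)

text \<open>Cut the shifted cell at the face where coordinate \<open>j\<close> equals
  \<open>L\<close>. By periodicity the slab beyond that face is a copy of the slab that the shift
  leaves uncovered at the bottom.\<close>

lemma integral_cell_shift:
  fixes f :: "real^2 \<Rightarrow> real"
  assumes "continuous_on UNIV f" "periodic L f" "0 \<le> h" "h \<le> L"
  shows "integral (cell L) (\<lambda>x. f (x + h *\<^sub>R axis j 1)) = integral (cell L) f"
proof -
  define e :: "real^2" where "e = axis j 1"
  define b :: "real^2" where "b = (\<chi> i. L)"
  have e: "e \<in> Basis" by (simp add: e_def)
  have int: "f integrable_on cbox c d" for c d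
    using assms(1) by (intro integrable_continuous continuous_on_subset[OF assms(1)]) auto
  have comp: "x \<bullet> e = x $ j" for x by (simp add: e_def inner_axis)
  have ej: "e $ i = (if i = j then 1 else 0)" for i by (simp add: e_def axis_def)
  have s1: "cbox (h *\<^sub>R e) (b + h *\<^sub>R e) \<inter> {x. x \<bullet> e \<le> L} = cbox (h *\<^sub>R e) b"
    using assms(3,4) by (auto simp: mem_box_cart comp ej b_def split: if_splits) (smt (verit))+
  have s2: "cbox (h *\<^sub>R e) (b + h *\<^sub>R e) \<inter> {x. x \<bullet> e \<ge> L} = cbox (0 + L *\<^sub>R e) ((b - (L - h) *\<^sub>R e) + L *\<^sub>R e)"
    using assms(3,4) by (auto simp: mem_box_cart comp ej b_def split: if_splits) (smt (verit))+
  have s3: "cbox 0 b \<inter> {x. x \<bullet> e \<le> h} = cbox 0 (b - (L - h) *\<^sub>R e)"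
    using assms(3,4) by (auto simp: mem_box_cart comp ej b_def split: if_splits) (smt (verit))+
  have s4: "cbox 0 b \<inter> {x. x \<bullet> e \<ge> h} = cbox (h *\<^sub>R e) b"
    using assms(3,4) by (auto simp: mem_box_cart comp ej b_def split: if_splits) (smt (verit))+
  have per: "f \<circ> (+) (L *\<^sub>R e) = f"
    using assms(2) by (auto simp: e_def periodic_def fun_eq_iff add.commute)
  have "integral (cbox (h *\<^sub>R e) (b + h *\<^sub>R e)) f
      = integral (cbox (h *\<^sub>R e) b) f + integral (cbox (0 + L *\<^sub>R e) ((b - (L - h) *\<^sub>R e) + L *\<^sub>R e)) f"
    by (rule integral_unique, rule has_integral_split[OF _ _ e, where c = L])
       (auto simp only: s1 s2 intro: integrable_integral int)
  also have "integral (cbox (0 + L *\<^sub>R e) ((b - (L - h) *\<^sub>R e) + L *\<^sub>R e)) f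
      = integral (cbox 0 (b - (L - h) *\<^sub>R e)) f"
    using integral_shift_cbox_plus[of 0 "b - (L - h) *\<^sub>R e" f "L *\<^sub>R e"] per by simp
  also have "integral (cbox (h *\<^sub>R e) b) f + integral (cbox 0 (b - (L - h) *\<^sub>R e)) f = integral (cbox 0 b) f"
    by (subst add.commute, rule integral_unique[symmetric], rule has_integral_split[OF _ _ e, where c = h])
       (auto simp only: s3 s4 intro: integrable_integral int)
  finally show ?thesis
    using integral_shift_cbox_plus[of 0 b f "h *\<^sub>R e"]
    by (simp add: cell_def b_def e_def o_def add.commute)
qed

lemma has_derivative_frechet:
  "f differentiable (at x) \<Longrightarrow> (f has_derivative frechet_derivative f (at x)) (at x)"
  by (simp add: frechet_derivative_works)

text \<open>The integral of a shifted copy of \<open>f\<close> does not depend on the shift, so its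
  derivative at shift 0, taken under the integral sign, vanishes. The derivative is one-sided
  because the shift lemma covers only shifts between 0 and \<open>L\<close>.\<close>

lemma integral_cell_partial:
  fixes f :: "real^2 \<Rightarrow> real"
  assumes d: "\<And>x. f differentiable (at x)" and per: "periodic L f" and L: "L > 0"
    and c: "continuous_on UNIV (\<lambda>x. frechet_derivative f (at x) (axis j 1))"
  shows "integral (cell L) (\<lambda>x. frechet_derivative f (at x) (axis j 1)) = 0"
proof -
  define e :: "real^2" where "e = axis j 1"
  let ?g = "\<lambda>x. frechet_derivative f (at x) e"
  have cf: "continuous_on UNIV f"
    using d by (simp add: differentiable_imp_continuous_on differentiable_on_def differentiable_at_withinI)
  have D: "((\<lambda>h. integral (cbox 0 (\<chi> i. L)) (\<lambda>x. f (x + h *\<^sub>R e))) has_field_derivative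
        integral (cbox 0 (\<chi> i. L)) (\<lambda>x. ?g (x + 0 *\<^sub>R e))) (at 0 within {0..L})"
  proof (rule leibniz_rule_field_derivative)
    fix h :: real and x :: "real^2"
    have "((\<lambda>h. f (x + h *\<^sub>R e)) has_derivative (\<lambda>s. frechet_derivative f (at (x + h *\<^sub>R e)) (s *\<^sub>R e))) (at h within {0..L})"
      by (rule has_derivative_compose[where g = f and f = "\<lambda>h. x + h *\<^sub>R e"])
         (auto intro!: derivative_eq_intros has_derivative_frechet d)
    then show "((\<lambda>h. f (x + h *\<^sub>R e)) has_field_derivative ?g (x + h *\<^sub>R e)) (at h within {0..L})"
      by (simp add: has_field_derivative_def mult_commute_abs
          linear_cmul[OF bounded_linear.linear[OF has_derivative_bounded_linear[OF has_derivative_frechet[OF d]]]])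
  next
    fix h show "(\<lambda>x. f (x + h *\<^sub>R e)) integrable_on cbox 0 (\<chi> i. L)"
      by (intro integrable_continuous continuous_on_compose2[OF cf] continuous_intros) auto
  next
    show "continuous_on ({0..L} \<times> cbox 0 (\<chi> i. L)) (\<lambda>(h, x). ?g (x + h *\<^sub>R e))"
      unfolding split_beta e_def
      by (intro continuous_on_compose2[OF c] continuous_intros) auto
  qed (use L in auto)
  have "((\<lambda>h. integral (cbox 0 (\<chi> i. L)) (\<lambda>x. f (x + h *\<^sub>R e))) has_field_derivative 0) (at 0 within {0..L})"
    by (rule has_field_derivative_transform_within[where d = 1 and f = "\<lambda>_. integral (cell L) f"])
       (use L integral_cell_shift[OF cf per] in \<open>auto simp: e_def cell_def\<close>)
  then have "integral (cbox 0 (\<chi> i. L)) (\<lambda>x. ?g (x + 0 *\<^sub>R e)) = 0"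
    using D L
    by (intro vector_derivative_unique_within[of 0 "{0..L}"])
       (auto simp: at_within_Icc_at_right has_real_derivative_iff_has_vector_derivative)
  then show ?thesis by (simp add: cell_def e_def)
qed

definition kap :: "real \<Rightarrow> int \<times> int \<Rightarrow> real^2" where
  "kap L k = (\<chi> i. 2 * pi / L * of_int (if i = 1 then fst k else snd k))"

lemma kap_uminus [simp]: "kap L (- k) = - kap L k"
  by (simp add: kap_def vec_eq_iff)

lemma kap_add: "kap L (k + l) = kap L k + kap L l"
  by (simp add: kap_def vec_eq_iff algebra_simps add_divide_distrib diff_divide_distrib)

lemma kap_diff: "kap L (k - l) = kap L k - kap L l"
  by (simp add: kap_def vec_eq_iff algebra_simps add_divide_distrib diff_divide_distrib)

lemma kap_0 [simp]: "kap L 0 = 0"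
  by (simp add: kap_def vec_eq_iff)

lemma kap_eq_0_iff [simp]: "L > 0 \<Longrightarrow> kap L k = 0 \<longleftrightarrow> k = 0"
  by (cases k) (simp add: kap_def vec_eq_iff forall_2 zero_prod_def)

lemma kap_periodic:
  assumes "L > 0"
  shows "\<exists>n::int. kap L k \<bullet> (x + L *\<^sub>R axis j 1) = kap L k \<bullet> x + 2 * pi * n"
  using assms by (intro exI[of _ "if j = 1 then fst k else snd k"])
    (auto simp: inner_add_right inner_axis kap_def)

text \<open>Carrying a cosine and a sine coefficient together makes the functions of one frequency
  closed under differentiation, which sends \<open>(a, b)\<close> to a multiple of
  \<open>(b, - a)\<close>. Smoothness is then a one-line coinduction.\<close>

definition trig :: "real \<Rightarrow> int \<times> int \<Rightarrow> real \<Rightarrow> real \<Rightarrow> real^2 \<Rightarrow> real" where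
  "trig L k a b x = a * cos (kap L k \<bullet> x) + b * sin (kap L k \<bullet> x)"

lemma trig_has_derivative:
  "(trig L k a b has_derivative (\<lambda>h. (kap L k \<bullet> h) * trig L k b (- a) x)) (at x)"
  unfolding trig_def
  by (auto intro!: derivative_eq_intros simp: algebra_simps fun_eq_iff)

lemma frechet_trig:
  "frechet_derivative (trig L k a b) (at x) = (\<lambda>h. (kap L k \<bullet> h) * trig L k b (- a) x)"
  using frechet_derivative_at[OF trig_has_derivative] by metis

lemma trig_differentiable: "trig L k a b differentiable (at x)"
  unfolding differentiable_def using trig_has_derivative by blast

lemma smooth_trig: "smooth (trig L k a b)"
proof -
  have "\<exists>a b. f = trig L k a b \<Longrightarrow> smooth f" for f
  proof (coinduction arbitrary: f rule: smooth.coinduct)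
    case smooth
    then obtain a b where f: "f = trig L k a b" by blast
    have "(\<lambda>x. frechet_derivative f (at x) h) = trig L k ((kap L k \<bullet> h) * b) ((kap L k \<bullet> h) * (- a))" for h
      by (auto simp: f frechet_trig fun_eq_iff trig_def algebra_simps)
    moreover have "f differentiable (at x)" for x
      unfolding f by (rule trig_differentiable)
    ultimately show ?case by metis
  qed
  then show ?thesis by blast
qed

lemma cos_kap_shift: "L > 0 \<Longrightarrow> cos (kap L k \<bullet> (x + L *\<^sub>R axis j 1)) = cos (kap L k \<bullet> x)"
  and sin_kap_shift: "L > 0 \<Longrightarrow> sin (kap L k \<bullet> (x + L *\<^sub>R axis j 1)) = sin (kap L k \<bullet> x)"
  using kap_periodic[of L k x j]
  by (auto simp: cos_add sin_add sin_integer_2pi cos_integer_2pi)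

lemma periodic_trig: "L > 0 \<Longrightarrow> periodic L (trig L k a b)"
  by (simp add: periodic_def trig_def cos_kap_shift sin_kap_shift)

lemma continuous_trig [continuous_intros]:
  fixes f :: "'a::metric_space \<Rightarrow> real^2"
  shows "continuous_on S f \<Longrightarrow> continuous_on S (\<lambda>x. trig L k a b (f x))"
  unfolding trig_def by (intro continuous_intros)

lemma abs_trig_le: "\<bar>trig L k a b x\<bar> \<le> \<bar>a\<bar> + \<bar>b\<bar>"
proof -
  have "\<bar>a * cos (kap L k \<bullet> x)\<bar> \<le> \<bar>a\<bar>" "\<bar>b * sin (kap L k \<bullet> x)\<bar> \<le> \<bar>b\<bar>"
    by (simp_all add: abs_mult mult_left_le)
  then show ?thesis unfolding trig_def by linarith
qed

lemma integral_trig: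
  assumes "L > 0" "k \<noteq> 0"
  shows "integral (cell L) (trig L k a b) = 0"
proof -
  obtain j where j: "kap L k $ j \<noteq> 0"
    using assms by (metis kap_eq_0_iff vec_eq_iff zero_index)
  \<comment> \<open>\<open>trig L k a b\<close> is a partial derivative of
    \<open>trig L k (- b) a\<close>, up to the factor \<open>kap L k $ j\<close>, which is nonzero
    by the choice of \<open>j\<close>.\<close>
  have "integral (cell L) (\<lambda>x. frechet_derivative (trig L k (- b) a) (at x) (axis j 1)) = 0"
    using assms
    by (intro integral_cell_partial periodic_trig trig_differentiable)
       (auto simp: frechet_trig intro!: continuous_intros)
  then show ?thesis using j by (simp add: frechet_trig inner_axis)
qed

section \<open>Integration over one period cell\<close>

abbreviation mu :: "real \<Rightarrow> (real^2) measure" where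
  "mu L \<equiv> lebesgue_on (cell L)"

lemma cell_sets [simp, measurable]: "cell L \<in> sets lebesgue"
  by (simp add: cell_def)

lemma finite_measure_mu: "finite_measure (mu L)"
  by (intro finite_measure_lebesgue_on) (simp add: cell_def)

lemma set_integral_cell:
  fixes f :: "real^2 \<Rightarrow> 'b::{banach, second_countable_topology}"
  shows "set_lebesgue_integral lebesgue (cell L) f = integral\<^sup>L (mu L) f"
  by (simp add: set_lebesgue_integral_def integral_restrict_space)

lemma set_integrable_cell:
  fixes f :: "real^2 \<Rightarrow> 'b::{banach, second_countable_topology}"
  shows "set_integrable lebesgue (cell L) f \<longleftrightarrow> integrable (mu L) f"
  by (simp add: set_integrable_def integrable_restrict_space)

lemma measure_mu:
  assumes "L > 0" shows "measure (mu L) (cell L) = L\<^sup>2"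
proof -
  have "(\<Prod>b\<in>(Basis::(real^2) set). (\<chi> i. L) \<bullet> b) = L\<^sup>2"
  proof -
    have "(\<Prod>b\<in>(Basis::(real^2) set). (\<chi> i. L) \<bullet> b) = (\<Prod>b\<in>(Basis::(real^2) set). L)"
      by (intro prod.cong) (auto simp: Basis_vec_def inner_axis)
    then show ?thesis by simp
  qed
  moreover have "\<forall>b\<in>(Basis::(real^2) set). 0 \<le> (\<chi> i. L) \<bullet> b"
    using assms by (auto simp: Basis_vec_def inner_axis)
  ultimately show ?thesis
    using assms by (simp add: measure_restrict_space cell_def measure_lborel_cbox_eq less_eq_vec_def)
qed

lemma borel_measurable_mu_cont: "continuous_on UNIV f \<Longrightarrow> f \<in> borel_measurable (mu L)"
  by (metis borel_measurable_continuous_onI measurable_completion measurable_lborel2 measurable_restrict_space1)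

lemma trig_measurable [measurable]: "trig L k a b \<in> borel_measurable (mu L)"
  by (intro borel_measurable_mu_cont continuous_intros)

lemma integrable_bounded_mult:
  fixes f :: "'a \<Rightarrow> 'b::{banach, second_countable_topology}"
  assumes "integrable M f" "g \<in> borel_measurable M" "\<And>x. \<bar>g x\<bar> \<le> C"
  shows "integrable M (\<lambda>x. g x *\<^sub>R f x)"
proof -
  have "integrable M (\<lambda>x. C * norm (f x))" using assms by simp
  then show ?thesis
    by (rule Bochner_Integration.integrable_bound) (use assms in \<open>auto intro!: borel_measurable_scaleR mult_right_mono AE_I2 order.trans[OF _ abs_ge_self]\<close>)
qed

lemma integrable_trig: "integrable (mu L) (trig L k a b)"
  by (intro finite_measure.integrable_const_bound[OF finite_measure_mu, of _ "\<bar>a\<bar> + \<bar>b\<bar>"])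
     (auto intro!: AE_I2 abs_trig_le)

lemma lint_trig:
  assumes "L > 0" shows "integral\<^sup>L (mu L) (trig L k a b) = (if k = 0 then a * L\<^sup>2 else 0)"
proof (cases "k = 0")
  case True
  then have "trig L k a b = (\<lambda>x. a)" by (simp add: trig_def fun_eq_iff)
  then show ?thesis using True measure_mu[OF assms] by simp
next
  case False
  then show ?thesis
    using lebesgue_integral_eq_integral[OF integrable_trig, of "L"] integral_trig[OF assms False] by simp
qed

lemma trig_mult:
  "trig L k a b x * trig L m c d x
   = trig L (k - m) ((a * c + b * d) / 2) ((b * c - a * d) / 2) x
   + trig L (k + m) ((a * c - b * d) / 2) ((a * d + b * c) / 2) x"
  unfolding trig_def kap_diff kap_add inner_diff_left inner_add_left cos_diff cos_add sin_diff sin_add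
  by (simp add: field_simps)

inductive_set trig_poly :: "real \<Rightarrow> (real^2 \<Rightarrow> real) set" for L where
  base: "trig L k a b \<in> trig_poly L"
| add: "f \<in> trig_poly L \<Longrightarrow> g \<in> trig_poly L \<Longrightarrow> (\<lambda>x. f x + g x) \<in> trig_poly L"

lemma trig_poly_mult:
  assumes "f \<in> trig_poly L" "g \<in> trig_poly L"
  shows "(\<lambda>x. f x * g x) \<in> trig_poly L"
  using assms
proof (induction arbitrary: g rule: trig_poly.induct)
  case (base k a b)
  from base show ?case
  proof (induction rule: trig_poly.induct)
    case (base k a b)
    show ?case unfolding trig_mult by (intro trig_poly.intros)
  next
    case (add f g) then show ?case by (simp add: distrib_left trig_poly.add)
  qed
next
  case (add f g) then show ?case by (simp add: distrib_right trig_poly.add)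
qed

lemma trig_poly_const: "(\<lambda>x. c) \<in> trig_poly L"
  using trig_poly.base[of L 0 c 0] by (simp add: trig_def[abs_def])

lemma trig_poly_compose:
  assumes "real_polynomial_function p" "f \<in> trig_poly L"
  shows "(\<lambda>x. p (f x)) \<in> trig_poly L"
  using assms(1)
proof (induction rule: real_polynomial_function.induct)
  case (linear p)
  then have "p y = y * p 1" for y
    using bounded_linear.linear[OF linear] linear_scale[of p y 1] by simp
  then have "(\<lambda>x. p (f x)) = (\<lambda>x. f x * p 1)" by metis
  then show ?case using trig_poly_mult[OF assms(2) trig_poly_const] by simp
qed (auto intro: trig_poly_const trig_poly.add trig_poly_mult)

lemma cos_coordinate_trig_poly: "(\<lambda>x. cos (2 * pi / L * (x $ j - c))) \<in> trig_poly L"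
proof -
  define k :: "int \<times> int" where "k = (if j = 1 then (1, 0) else (0, 1))"
  define w where "w = 2 * pi / L"
  have "kap L k \<bullet> x = w * x $ j" for x :: "real^2"
    using exhaust_2[of j] by (auto simp: kap_def inner_vec_def sum_2 k_def w_def)
  then have "(\<lambda>x. cos (w * (x $ j - c))) = trig L k (cos (w * c)) (sin (w * c))"
    by (simp add: fun_eq_iff trig_def cos_diff right_diff_distrib mult_ac)
  then show ?thesis by (simp add: trig_poly.base w_def)
qed

text \<open>The ramps \<open>G m\<close> converge to the indicator of the half line beyond
  \<open>q\<close>, and Weierstrass replaces each by a polynomial within \<open>1 / (m + 1)\<close>.
  The bound 2 provides the dominating function when the limit is taken under an integral.\<close>

lemma poly_approx_step:
  "\<exists>P :: nat \<Rightarrow> real \<Rightarrow> real. (\<forall>m. real_polynomial_function (P m)) \<and>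
     (\<forall>y\<in>{-1..1}. (\<forall>m. \<bar>P m y\<bar> \<le> 2) \<and> (\<lambda>m. P m y) \<longlonglongrightarrow> (if y > q then 1 else 0))"
proof -
  define G where "G m y = min 1 (max 0 (real m * (y - q)))" for m y
  have "\<exists>p. real_polynomial_function p \<and> (\<forall>y\<in>{-1..1}. \<bar>G m y - p y\<bar> < inverse (real (Suc m)))" for m
  proof -
    have "continuous_on {-1..1} (G m)" unfolding G_def by (intro continuous_intros)
    from Stone_Weierstrass_real_polynomial_function[OF _ this, of "inverse (real (Suc m))"]
    show ?thesis by (metis compact_Icc inverse_positive_iff_positive of_nat_0_less_iff zero_less_Suc)
  qed
  then obtain P where P: "\<And>m. real_polynomial_function (P m)"
      "\<And>m y. y \<in> {-1..1} \<Longrightarrow> \<bar>G m y - P m y\<bar> < inverse (real (Suc m))" by metis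
  have lim: "(\<lambda>m. P m y) \<longlonglongrightarrow> (if y > q then 1 else 0)" if y: "y \<in> {-1..1}" for y
  proof -
    have G: "(\<lambda>m. G m y) \<longlonglongrightarrow> (if y > q then 1 else 0)"
    proof (cases "y > q")
      case True
      obtain N where N: "real N > 1 / (y - q)" using reals_Archimedean2 by blast
      have "\<forall>m\<ge>N. G m y = 1"
      proof (intro allI impI)
        fix m assume "N \<le> m"
        then have "real m > 1 / (y - q)" using N by linarith
        then have "real m * (y - q) > 1" using True by (simp add: field_simps)
        then show "G m y = 1" by (simp add: G_def)
      qed
      then show ?thesis using True by (auto intro: tendsto_eventually eventually_sequentiallyI)
    next
      case False
      then have "real m * (y - q) \<le> 0" for m by (simp add: mult_nonneg_nonpos)
      then have "G m y = 0" for m by (simp add: G_def max_absorb1)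
      then show ?thesis using False by simp
    qed
    have "(\<lambda>m. P m y - G m y) \<longlonglongrightarrow> 0"
      by (rule Lim_null_comparison[OF _ LIMSEQ_inverse_real_of_nat])
         (use P(2)[OF y] in \<open>auto intro!: always_eventually less_imp_le simp: abs_minus_commute\<close>)
    from tendsto_add[OF this G] show ?thesis by simp
  qed
  have "\<bar>P m y\<bar> \<le> 2" if "y \<in> {-1..1}" for m y
  proof -
    have "inverse (real (Suc m)) \<le> 1" by (simp add: inverse_le_1_iff)
    moreover have "\<bar>G m y\<bar> \<le> 1" by (auto simp: G_def)
    ultimately show ?thesis using P(2)[OF that, of m] by linarith
  qed
  with P(1) lim show ?thesis by blast
qed

text \<open>On a circle of circumference \<open>L\<close>, a point lies in the arc exactly if its
  angle \<open>th\<close> from the centre is below the half angle \<open>rho\<close>. The difficulty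
  is that \<open>th\<close> may exceed \<open>pi\<close>, where cosine increases again.\<close>

lemma cos_arc_iff:
  assumes "0 \<le> a" "a < b" "b \<le> L" "0 \<le> x" "x \<le> L"
  shows "cos (2 * pi / L * (x - (a + b) / 2)) > cos (2 * pi / L * ((b - a) / 2)) \<longleftrightarrow> a < x \<and> x < b"
proof -
  have L: "L > 0" using assms by linarith
  define th rho where "th = 2 * pi / L * \<bar>x - (a + b) / 2\<bar>" and "rho = 2 * pi / L * ((b - a) / 2)"
  have w: "2 * pi / L > 0" using L by simp
  have "th = \<bar>2 * pi / L * (x - (a + b) / 2)\<bar>" using w by (simp only: th_def abs_mult abs_of_pos)
  then have c: "cos (2 * pi / L * (x - (a + b) / 2)) = cos th" by (simp only: cos_abs_real)
  have "\<bar>x - (a + b) / 2\<bar> \<le> L - (b - a) / 2" "(b - a) / 2 \<le> L / 2"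
    using assms by (auto simp: abs_if field_simps)
  then have "th \<le> 2 * pi / L * (L - (b - a) / 2)" "rho \<le> 2 * pi / L * (L / 2)"
    unfolding th_def rho_def by (simp_all only: mult_left_mono less_imp_le[OF w])
  then have th: "th \<le> 2 * pi - rho" and rho: "rho \<le> pi"
    using L by (auto simp: rho_def field_simps)
  have pos: "0 \<le> th" "0 < rho" using w assms by (auto simp: th_def rho_def)
  have "cos rho < cos th \<longleftrightarrow> th < rho"
  proof (cases "th \<le> pi")
    case True
    then show ?thesis using pos rho by (simp add: cos_mono_less_eq)
  next
    case False
    \<comment> \<open>Beyond \<open>pi\<close> the angle is folded back to
      \<open>2 * pi - th\<close>, which is still at least \<open>rho\<close> because point and arc
      both lie in \<open>{0..L}\<close>.\<close>
    have "cos th = cos (2 * pi - th)" by (simp add: cos_diff)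
    moreover have "cos (2 * pi - th) \<le> cos rho"
      using False th pos rho by (subst cos_mono_le_eq) auto
    ultimately show ?thesis using False rho by auto
  qed
  also have "th < rho \<longleftrightarrow> \<bar>x - (a + b) / 2\<bar> < (b - a) / 2"
    unfolding th_def rho_def by (simp only: mult_less_cancel_left_pos[OF w])
  also have "\<dots> \<longleftrightarrow> a < x \<and> x < b" by (auto simp: abs_if field_simps)
  finally show ?thesis unfolding c rho_def .
qed

lemma AE_interior: "AE x in mu L. x \<in> box 0 (\<chi> i. L)"
proof -
  have "cell L - box 0 (\<chi> i. L) \<in> null_sets lebesgue"
    unfolding cell_def negligible_iff_null_sets[symmetric] by (rule negligible_frontier_interval)
  then have "AE x in lebesgue. x \<notin> cell L - box 0 (\<chi> i. L)" by (rule AE_not_in)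
  then show ?thesis by (subst AE_restrict_space_iff) (auto elim!: eventually_mono)
qed

lemma sets_mu_borel: "A \<in> sets borel \<Longrightarrow> A \<inter> cell L \<in> sets (mu L)"
  by (auto simp: sets_restrict_space Int_commute intro!: image_eqI[of _ _ A] sets_completionI_sets)

lemma indicator_mu [measurable]:
  "A \<in> sets borel \<Longrightarrow> (indicator A :: _ \<Rightarrow> real) \<in> borel_measurable (mu L)"
  by (intro measurable_restrict_space1 measurable_completion) simp

section \<open>Completeness of the trigonometric system\<close>

text \<open>Trigonometric polynomials in one coordinate approximate the indicator functions of short arcs, which are
  superlevel sets of a shifted cosine. Products of two of them yield boxes.\<close>

locale orth_trig =
  fixes L :: real and f :: "real^2 \<Rightarrow> real"
  assumes L: "L > 0" and f: "integrable (mu L) f"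
    and orth: "\<And>k a b. (\<integral>x. trig L k a b x * f x \<partial>mu L) = 0"
begin

lemma trig_poly_meas: "g \<in> trig_poly L \<Longrightarrow> g \<in> borel_measurable (mu L)"
  by (induction rule: trig_poly.induct) auto

lemma trig_poly_bounded: "g \<in> trig_poly L \<Longrightarrow> \<exists>C. \<forall>x. \<bar>g x\<bar> \<le> C"
proof (induction rule: trig_poly.induct)
  case (base k a b) then show ?case using abs_trig_le by blast
next
  case (add f g)
  then obtain C D where "\<forall>x. \<bar>f x\<bar> \<le> C" "\<forall>x. \<bar>g x\<bar> \<le> D" by blast
  then have "\<forall>x. \<bar>f x + g x\<bar> \<le> C + D" by (meson abs_triangle_ineq add_mono order_trans)
  then show ?case by blast
qed

lemma integrable_trig_poly: "g \<in> trig_poly L \<Longrightarrow> integrable (mu L) (\<lambda>x. g x * f x)"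
  using trig_poly_bounded[of g] integrable_bounded_mult[OF f trig_poly_meas, of g] by auto

lemma orth_trig_poly: "g \<in> trig_poly L \<Longrightarrow> (\<integral>x. g x * f x \<partial>mu L) = 0"
  by (induction rule: trig_poly.induct) (auto simp: orth distrib_right integrable_trig_poly)

lemma orth_sub_box:
  assumes ab: "\<And>j. 0 \<le> a $ j" "\<And>j. a $ j < b $ j" "\<And>j. b $ j \<le> L"
  shows "(\<integral>x. indicator (box a b) x * f x \<partial>mu L) = 0"
proof -
  define q where "q j = cos (2 * pi / L * ((b $ j - a $ j) / 2))" for j :: 2
  define y where "y j x = cos (2 * pi / L * (x $ j - (a $ j + b $ j) / 2))" for j :: 2 and x :: "real^2"
  have "\<forall>j. \<exists>P :: nat \<Rightarrow> real \<Rightarrow> real. (\<forall>m. real_polynomial_function (P m)) \<and>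
     (\<forall>y\<in>{-1..1}. (\<forall>m. \<bar>P m y\<bar> \<le> 2) \<and> (\<lambda>m. P m y) \<longlonglongrightarrow> (if y > q j then 1 else 0))"
    using poly_approx_step by blast
  then obtain P where P: "\<And>j m. real_polynomial_function (P j m)"
     "\<And>j m y. y \<in> {-1..1} \<Longrightarrow> \<bar>P j m y\<bar> \<le> 2"
     "\<And>j y. y \<in> {-1..1} \<Longrightarrow> (\<lambda>m. P j m y) \<longlonglongrightarrow> (if y > q j then 1 else (0::real))" by metis
  have y: "y j x \<in> {-1..1}" for j x by (simp add: y_def)
  have tp: "(\<lambda>x. P 1 m (y 1 x) * P 2 m (y 2 x)) \<in> trig_poly L" for m
    unfolding y_def
    by (rule trig_poly_mult[OF trig_poly_compose[OF P(1) cos_coordinate_trig_poly]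
          trig_poly_compose[OF P(1) cos_coordinate_trig_poly]])
  have ind: "indicator (box a b) x = (if y 1 x > q 1 then 1 else 0) * (if y 2 x > q 2 then 1 else (0::real))"
    if "x \<in> cell L" for x
  proof -
    have "y j x > q j \<longleftrightarrow> a $ j < x $ j \<and> x $ j < b $ j" for j
      using that ab unfolding y_def q_def
      by (intro cos_arc_iff) (auto simp: cell_def mem_box_cart)
    then show ?thesis by (auto simp: indicator_def mem_box_cart forall_2)
  qed
  have "(\<lambda>m. \<integral>x. P 1 m (y 1 x) * P 2 m (y 2 x) * f x \<partial>mu L) \<longlonglongrightarrow> (\<integral>x. indicator (box a b) x * f x \<partial>mu L)"
  proof (rule integral_dominated_convergence[where w = "\<lambda>x. 4 * norm (f x)"])
    show "AE x in mu L. (\<lambda>m. P 1 m (y 1 x) * P 2 m (y 2 x) * f x) \<longlonglongrightarrow> indicator (box a b) x * f x"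
    proof (rule AE_I2)
      fix x assume "x \<in> space (mu L)"
      then have x: "x \<in> cell L" by simp
      show "(\<lambda>m. P 1 m (y 1 x) * P 2 m (y 2 x) * f x) \<longlonglongrightarrow> indicator (box a b) x * f x"
        unfolding ind[OF x] by (intro tendsto_intros P y)
    qed
    have "\<bar>P 1 m (y 1 x)\<bar> * \<bar>P 2 m (y 2 x)\<bar> \<le> 2 * 2" for m x
      by (intro mult_mono P y) auto
    then show "AE x in mu L. norm (P 1 m (y 1 x) * P 2 m (y 2 x) * f x) \<le> 4 * norm (f x)" for m
      by (auto intro!: AE_I2 mult_right_mono simp: abs_mult)
    show "(\<lambda>x. indicator (box a b) x * f x) \<in> borel_measurable (mu L)"
      using f by (intro borel_measurable_times indicator_mu borel_measurable_integrable) auto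
    show "(\<lambda>x. P 1 m (y 1 x) * P 2 m (y 2 x) * f x) \<in> borel_measurable (mu L)" for m
      using f trig_poly_meas[OF tp] by auto
  qed (use f in auto)
  moreover have "(\<integral>x. P 1 m (y 1 x) * P 2 m (y 2 x) * f x \<partial>mu L) = 0" for m
    using orth_trig_poly[OF tp] by simp
  ultimately show ?thesis by (simp add: LIMSEQ_const_iff)
qed

text \<open>Inside the open cell a box and its clipped version agree, and the boundary of the cell
  is a null set. The clipped box is either empty or admissible for
  \<open>orth_sub_box\<close>.\<close>

lemma orth_box: "(\<integral>x. indicator (box a b) x * f x \<partial>mu L) = 0"
proof -
  define a' b' :: "real^2" where "a' = (\<chi> j. max 0 (a $ j))" and "b' = (\<chi> j. min L (b $ j))"
  have m: "(\<lambda>x. indicator (box a b) x * f x) \<in> borel_measurable (mu L)" for a b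
    using f by (intro borel_measurable_times indicator_mu borel_measurable_integrable) auto
  have "(\<integral>x. indicator (box a b) x * f x \<partial>mu L) = (\<integral>x. indicator (box a' b') x * f x \<partial>mu L)"
    by (rule integral_cong_AE[OF m m]) (use AE_interior in \<open>eventually_elim, auto simp: indicator_def mem_box_cart a'_def b'_def\<close>)
  also have "\<dots> = 0"
  proof (cases "\<forall>j. a' $ j < b' $ j")
    case True
    then show ?thesis by (intro orth_sub_box) (auto simp: a'_def b'_def)
  next
    case False
    then have "box a' b' = {}" by (auto simp: interval_eq_empty_cart not_less)
    then show ?thesis by simp
  qed
  finally show ?thesis .
qed

text \<open>Open boxes form a generator of the Borel sets that is stable under intersection.
  Complements are handled by orthogonality to the constant 1, which is the frequency 0.\<close>

lemma orth_borel:
  assumes "A \<in> sets borel" shows "(\<integral>x. indicator A x * f x \<partial>mu L) = 0"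
proof -
  have i: "integrable (mu L) (\<lambda>x. indicator A x * f x)" if "A \<in> sets borel" for A
    using integrable_bounded_mult[OF f indicator_mu[OF that], of 1] by (auto simp: indicator_def)
  have sb: "sigma_sets UNIV (range (\<lambda>(a, b). box a b)) = sets (borel :: (real^2) measure)"
    unfolding borel_eq_box by simp
  have A: "A \<in> sigma_sets UNIV (range (\<lambda>(a, b). box a b))" using assms sb by blast
  have st: "Int_stable (range (\<lambda>(a, b). box a (b::real^2)))"
    proof (rule Int_stableI)
      fix A B :: "(real^2) set" assume "A \<in> range (\<lambda>(a, b). box a b)" "B \<in> range (\<lambda>(a, b). box a b)"
      then obtain a b c d where "A = box a b" "B = box c d" by auto
      then show "A \<inter> B \<in> range (\<lambda>(a, b). box a b)"
        by (simp only: box_Int_box) (metis (mono_tags, lifting) case_prod_conv rangeI)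
    qed
  have "range (\<lambda>(a, b). box a (b::real^2)) \<subseteq> Pow UNIV" by simp
  from st this A show ?thesis
  proof (induction rule: sigma_sets_induct_disjoint)
    case (basic A)
    then show ?case using orth_box by auto
  next
    case (compl A)
    have "(\<integral>x. indicator (UNIV - A) x * f x \<partial>mu L) = (\<integral>x. f x - indicator A x * f x \<partial>mu L)"
      by (intro Bochner_Integration.integral_cong) (auto simp: indicator_def)
    also have "\<dots> = 0"
      using compl f i sb orth[of 0 1 0] by (subst Bochner_Integration.integral_diff) (auto simp: trig_def)
    finally show ?case .
  next
    case (union A)
    have "set_lebesgue_integral (mu L) (\<Union>i. A i \<inter> cell L) f = (\<Sum>i. set_lebesgue_integral (mu L) (A i \<inter> cell L) f)"
    proof (rule lebesgue_integral_countable_add)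
      have "(\<Union>i. A i) \<in> sets borel" using union sb by blast
      from i[OF this] show "set_integrable (mu L) (\<Union>i. A i \<inter> cell L) f"
        unfolding set_integrable_def
        by (subst Bochner_Integration.integrable_cong[of "mu L" "mu L" _ "\<lambda>x. indicator (\<Union>i. A i) x * f x"]) (auto simp: indicator_def)
    qed (use union sb sets_mu_borel in \<open>auto simp: disjoint_family_on_def\<close>)
    moreover have "set_lebesgue_integral (mu L) (B \<inter> cell L) f = (\<integral>x. indicator B x * f x \<partial>mu L)" for B
      unfolding set_lebesgue_integral_def by (intro Bochner_Integration.integral_cong) (auto simp: indicator_def)
    moreover have "(\<Union>i. A i \<inter> cell L) = (\<Union>i. A i) \<inter> cell L" by blast
    ultimately show ?case using union.IH by simp
  qed simp
qed

text \<open>Testing with the set where \<open>f\<close> is positive shows that the positive part has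
  integral 0. That set is only Lebesgue measurable, so it is replaced by a Borel set
  \<open>S\<close> that agrees with it up to a null set.\<close>

lemma AE_nonpos: "AE x in mu L. f x \<le> 0"
proof -
  have fm: "f \<in> borel_measurable (mu L)" using f by simp
  then have "{x \<in> cell L. f x > 0} \<in> sets (mu L)"
    using borel_measurable_less[of "\<lambda>_. 0" "mu L" f] by simp
  then have "{x \<in> cell L. f x > 0} \<in> sets lebesgue" by (simp add: sets_restrict_space_iff)
  then obtain S N N' where S: "{x \<in> cell L. f x > 0} = S \<union> N" "N \<subseteq> N'" "N' \<in> null_sets lborel" "S \<in> sets lborel"
    by (rule sets_completionE)
  then have "AE x in lebesgue. x \<notin> N'" by (intro AE_completion AE_not_in)
  then have ae: "AE x in mu L. x \<notin> N'" by (subst AE_restrict_space_iff) (auto elim!: eventually_mono)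
  have m: "(indicator S :: _ \<Rightarrow> real) \<in> borel_measurable (mu L)"
    using S(4) by (intro indicator_mu) simp
  have eq: "max 0 (f x) = indicator S x * f x" if "x \<in> cell L" "x \<notin> N'" for x
  proof -
    have "f x > 0 \<longleftrightarrow> x \<in> S" using S(1,2) that by blast
    then show ?thesis by (auto simp: indicator_def max_def)
  qed
  have "(\<integral>x. max 0 (f x) \<partial>mu L) = (\<integral>x. indicator S x * f x \<partial>mu L)"
  proof (rule integral_cong_AE)
    show "AE x in mu L. max 0 (f x) = indicator S x * f x"
      by (rule AE_mp[OF ae], rule AE_I2) (simp add: eq)
  qed (use fm m in auto)
  also have "\<dots> = 0" using S by (intro orth_borel) auto
  finally have "AE x in mu L. max 0 (f x) = 0"
    using f by (subst (asm) integral_nonneg_eq_0_iff_AE) auto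
  then show ?thesis by eventually_elim auto
qed

end

lemma orth_trig_uminus: "orth_trig L f \<Longrightarrow> orth_trig L (\<lambda>x. - f x)"
  by (simp add: orth_trig_def)

lemma trig_complete:
  assumes "orth_trig L f" shows "AE x in mu L. f x = 0"
  using orth_trig.AE_nonpos[OF assms] orth_trig.AE_nonpos[OF orth_trig_uminus[OF assms]]
  by eventually_elim auto

section \<open>Square integrable functions and their Fourier coefficients\<close>

lemma norm_add_sq_le: "(norm (a + b))\<^sup>2 \<le> 2 * (norm a)\<^sup>2 + 2 * (norm (b::'a::real_inner))\<^sup>2"
proof -
  have "0 \<le> (norm (a - b))\<^sup>2" by simp
  then show ?thesis by (simp add: power2_norm_eq_inner inner_add inner_diff inner_commute)
qed

lemma L2_iff: "u \<in> L2 L \<longleftrightarrow> periodic L u \<and> u \<in> borel_measurable lebesgue \<and> integrable (mu L) (\<lambda>x. (norm (u x))\<^sup>2)"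
  by (simp add: L2_def set_integrable_cell)

lemma L2_D:
  assumes "u \<in> L2 L"
  shows "periodic L u" "u \<in> borel_measurable lebesgue" "integrable (mu L) (\<lambda>x. (norm (u x))\<^sup>2)"
    "u \<in> borel_measurable (mu L)"
  using assms by (auto simp: L2_iff intro: measurable_restrict_space1)

lemma L2_bound:
  assumes "periodic L u" "u \<in> borel_measurable lebesgue" "integrable (mu L) g"
    "\<And>x. (norm (u x))\<^sup>2 \<le> g x"
  shows "u \<in> L2 L"
  using assms measurable_restrict_space1[OF assms(2), of "cell L"]
  by (auto simp: L2_iff intro!: Bochner_Integration.integrable_bound[OF assms(3)] AE_I2 order.trans[OF assms(4) abs_ge_self])

lemma L2_scaleR_bounded:
  assumes u: "u \<in> L2 L" and g: "g \<in> borel_measurable lebesgue" "periodic L g" "\<And>x. \<bar>g x\<bar> \<le> C"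
  shows "(\<lambda>x. g x *\<^sub>R u x) \<in> L2 L"
proof (rule L2_bound)
  show "integrable (mu L) (\<lambda>x. C\<^sup>2 * (norm (u x))\<^sup>2)" using L2_D[OF u] by simp
  show "(norm (g x *\<^sub>R u x))\<^sup>2 \<le> C\<^sup>2 * (norm (u x))\<^sup>2" for x
    using power_mono[OF g(3), of x 2] by (simp add: power_mult_distrib mult_right_mono)
qed (use u g L2_D[OF u] in \<open>auto simp: periodic_def\<close>)

lemma L2_zero: "(\<lambda>x. 0) \<in> L2 L"
  by (rule L2_bound[where g = "\<lambda>x. 0"]) (auto simp: periodic_def)

lemma L2_scale: "u \<in> L2 L \<Longrightarrow> (\<lambda>x. a *\<^sub>R u x) \<in> L2 L"
  by (rule L2_scaleR_bounded[where C = "\<bar>a\<bar>"]) (auto simp: periodic_def)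

lemma L2_add:
  assumes "u \<in> L2 L" "v \<in> L2 L" shows "(\<lambda>x. u x + v x) \<in> L2 L"
proof (rule L2_bound)
  show "integrable (mu L) (\<lambda>x. 2 * (norm (u x))\<^sup>2 + 2 * (norm (v x))\<^sup>2)"
    using L2_D[OF assms(1)] L2_D[OF assms(2)] by simp
qed (use L2_D[OF assms(1)] L2_D[OF assms(2)] in \<open>auto simp: periodic_def norm_add_sq_le\<close>)

lemma L2_diff: "u \<in> L2 L \<Longrightarrow> v \<in> L2 L \<Longrightarrow> (\<lambda>x. u x - v x) \<in> L2 L"
  using L2_add[OF _ L2_scale[of v L "-1"]] by simp

lemma L2_minus: "u \<in> L2 L \<Longrightarrow> v \<in> L2 L \<Longrightarrow> u - v \<in> L2 L"
  using L2_diff by (simp add: fun_diff_def)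

lemma L2_sum: "(\<And>i. i \<in> I \<Longrightarrow> f i \<in> L2 L) \<Longrightarrow> (\<lambda>x. \<Sum>i\<in>I. f i x) \<in> L2 L"
  by (induction I rule: infinite_finite_induct) (auto intro: L2_add L2_zero)

lemma L2_lincomb: "u \<in> L2 L \<Longrightarrow> v \<in> L2 L \<Longrightarrow> (\<lambda>x. a *\<^sub>R u x + b *\<^sub>R v x) \<in> L2 L"
  by (intro L2_add L2_scale)

lemma L2_integrable:
  assumes "u \<in> L2 L" shows "integrable (mu L) u"
proof -
  interpret finite_measure "mu L" by (rule finite_measure_mu)
  have "integrable (mu L) (\<lambda>x. 1 + (norm (u x))\<^sup>2)" using L2_D[OF assms] by simp
  then show ?thesis
  proof (rule Bochner_Integration.integrable_bound)
    have "norm (u x) \<le> 1 + (norm (u x))\<^sup>2" for x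
    proof -
      have "2 * norm (u x) \<le> 1 + (norm (u x))\<^sup>2" using sum_squares_bound[of 1 "norm (u x)"] by simp
      then show ?thesis using norm_ge_zero[of "u x"] by linarith
    qed
    then show "AE x in mu L. norm (u x) \<le> norm (1 + (norm (u x))\<^sup>2)" by (auto intro!: AE_I2 simp: abs_of_nonneg)
  qed (use L2_D[OF assms] in auto)
qed

lemma L2_inner_integrable:
  assumes "u \<in> L2 L" "v \<in> L2 L" shows "integrable (mu L) (\<lambda>x. u x \<bullet> v x)"
proof -
  have "integrable (mu L) (\<lambda>x. (norm (u x))\<^sup>2 + (norm (v x))\<^sup>2)" using L2_D[OF assms(1)] L2_D[OF assms(2)] by simp
  then show ?thesis
  proof (rule Bochner_Integration.integrable_bound)
    have "\<bar>u x \<bullet> v x\<bar> \<le> (norm (u x))\<^sup>2 + (norm (v x))\<^sup>2" for x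
      using Cauchy_Schwarz_ineq2[of "u x" "v x"] sum_squares_bound[of "norm (u x)" "norm (v x)"]
        mult_nonneg_nonneg[OF norm_ge_zero[of "u x"] norm_ge_zero[of "v x"]] by linarith
    then show "AE x in mu L. norm (u x \<bullet> v x) \<le> norm ((norm (u x))\<^sup>2 + (norm (v x))\<^sup>2)" by (auto intro!: AE_I2)
  qed (use L2_D[OF assms(1)] L2_D[OF assms(2)] in auto)
qed

lemma l2_inner_eq: "l2_inner L u v = (\<integral>x. u x \<bullet> v x \<partial>mu L)"
  by (simp add: l2_inner_def set_integral_cell)

lemma l2_inner_commute: "l2_inner L u v = l2_inner L v u"
  by (simp add: l2_inner_eq inner_commute)

lemma l2_inner_lincomb_left:
  "u \<in> L2 L \<Longrightarrow> v \<in> L2 L \<Longrightarrow> w \<in> L2 L \<Longrightarrow>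
   l2_inner L (\<lambda>x. a *\<^sub>R u x + b *\<^sub>R v x) w = a * l2_inner L u w + b * l2_inner L v w"
  unfolding l2_inner_eq inner_add_left inner_scaleR_left
  by (subst Bochner_Integration.integral_add) (auto intro: L2_inner_integrable)

lemma l2_inner_lincomb_right:
  "u \<in> L2 L \<Longrightarrow> v \<in> L2 L \<Longrightarrow> w \<in> L2 L \<Longrightarrow>
   l2_inner L w (\<lambda>x. a *\<^sub>R u x + b *\<^sub>R v x) = a * l2_inner L w u + b * l2_inner L w v"
  using l2_inner_lincomb_left[of u L v w a b] by (simp add: l2_inner_commute)

lemma l2_inner_diff_left: "u \<in> L2 L \<Longrightarrow> v \<in> L2 L \<Longrightarrow> w \<in> L2 L \<Longrightarrow>
   l2_inner L (\<lambda>x. u x - v x) w = l2_inner L u w - l2_inner L v w"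
  using l2_inner_lincomb_left[of u L v w 1 "-1"] by simp

lemma l2_inner_self_nonneg: "0 \<le> l2_inner L u u"
  by (simp add: l2_inner_eq)

lemma l2_norm_sq: "(l2_norm L u)\<^sup>2 = l2_inner L u u"
  by (simp add: l2_norm_def l2_inner_self_nonneg)

lemma l2_norm_nonneg [simp]: "0 \<le> l2_norm L u"
  by (simp add: l2_norm_def l2_inner_self_nonneg)

lemma l2_norm_scale: "l2_norm L (\<lambda>x. a *\<^sub>R u x) = \<bar>a\<bar> * l2_norm L u"
  by (simp add: l2_norm_def l2_inner_eq power2_eq_square[symmetric] mult.assoc[symmetric] real_sqrt_mult)

lemma l2_norm_lincomb_sq:
  assumes "u \<in> L2 L" "v \<in> L2 L"
  shows "(l2_norm L (\<lambda>x. a *\<^sub>R u x + b *\<^sub>R v x))\<^sup>2 = a\<^sup>2 * (l2_norm L u)\<^sup>2 + 2 * a * b * l2_inner L u v + b\<^sup>2 * (l2_norm L v)\<^sup>2"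
  unfolding l2_norm_sq
  using assms by (simp add: l2_inner_lincomb_left l2_inner_lincomb_right L2_lincomb
      l2_inner_commute[of L v u] power2_eq_square algebra_simps)

text \<open>The squared norm of a combination is a nonnegative quadratic form in the two scalars.
  The form is only semidefinite, so a vanishing norm of \<open>v\<close> needs its own case.\<close>

lemma l2_cauchy_schwarz:
  assumes "u \<in> L2 L" "v \<in> L2 L"
  shows "\<bar>l2_inner L u v\<bar> \<le> l2_norm L u * l2_norm L v"
proof -
  define A B C where "A = l2_norm L u" and "B = l2_inner L u v" and "C = l2_norm L v"
  have pos: "0 \<le> A" "0 \<le> C" by (auto simp: A_def C_def)
  have *: "0 \<le> a\<^sup>2 * A\<^sup>2 + 2 * a * b * B + b\<^sup>2 * C\<^sup>2" for a b
    unfolding A_def B_def C_def l2_norm_lincomb_sq[OF assms, symmetric] by simp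
  have "\<bar>B\<bar> \<le> A * C"
  proof (cases "C = 0")
    case True
    have "B = 0"
    proof (rule ccontr)
      assume B: "B \<noteq> 0"
      \<comment> \<open>With the second scalar chosen this way the quadratic form has the value
        -1.\<close>
      have "0 \<le> A\<^sup>2 + 2 * (- (A\<^sup>2 + 1) / (2 * B)) * B"
        using *[of 1 "- (A\<^sup>2 + 1) / (2 * B)"] True by simp
      then show False using B by (simp add: field_simps)
    qed
    then show ?thesis using pos by simp
  next
    case False
    \<comment> \<open>The scalars \<open>C\<^sup>2\<close> and \<open>- B\<close> are those of the
      orthogonal projection, multiplied by \<open>C\<^sup>2\<close> to avoid a division.\<close>
    have "0 \<le> (C\<^sup>2)\<^sup>2 * A\<^sup>2 + 2 * C\<^sup>2 * (- B) * B + (- B)\<^sup>2 * C\<^sup>2" by (rule *[of "C\<^sup>2" "- B"])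
    then have "0 \<le> C\<^sup>2 * (C\<^sup>2 * A\<^sup>2 - B\<^sup>2)" by (simp add: power2_eq_square algebra_simps)
    then have "B\<^sup>2 \<le> (A * C)\<^sup>2" using False by (simp add: zero_le_mult_iff power_mult_distrib mult.commute)
    then show ?thesis using pos by (simp add: abs_le_square_iff[symmetric])
  qed
  then show ?thesis by (simp add: A_def B_def C_def)
qed

lemma l2_norm_lincomb_le:
  assumes "u \<in> L2 L" "v \<in> L2 L"
  shows "l2_norm L (\<lambda>x. a *\<^sub>R u x + b *\<^sub>R v x) \<le> \<bar>a\<bar> * l2_norm L u + \<bar>b\<bar> * l2_norm L v"
proof (rule power2_le_imp_le)
  have "2 * a * b * l2_inner L u v \<le> 2 * (\<bar>a\<bar> * \<bar>b\<bar>) * \<bar>l2_inner L u v\<bar>"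
    using abs_ge_self[of "a * b * l2_inner L u v"] by (simp add: abs_mult)
  also have "\<dots> \<le> 2 * (\<bar>a\<bar> * \<bar>b\<bar>) * (l2_norm L u * l2_norm L v)"
    by (intro mult_left_mono l2_cauchy_schwarz assms) auto
  finally show "(l2_norm L (\<lambda>x. a *\<^sub>R u x + b *\<^sub>R v x))\<^sup>2 \<le> (\<bar>a\<bar> * l2_norm L u + \<bar>b\<bar> * l2_norm L v)\<^sup>2"
    unfolding l2_norm_lincomb_sq[OF assms] power2_sum by (simp add: power_mult_distrib algebra_simps)
qed simp

lemma l2_norm_add_le: "u \<in> L2 L \<Longrightarrow> v \<in> L2 L \<Longrightarrow> l2_norm L (\<lambda>x. u x + v x) \<le> l2_norm L u + l2_norm L v"
  using l2_norm_lincomb_le[of u L v 1 1] by simp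

lemma l2_norm_diff_le: "u \<in> L2 L \<Longrightarrow> v \<in> L2 L \<Longrightarrow> l2_norm L (\<lambda>x. u x - v x) \<le> l2_norm L u + l2_norm L v"
  using l2_norm_lincomb_le[of u L v 1 "-1"] by simp

lemma l2_norm_triangle_diff: "u \<in> L2 L \<Longrightarrow> v \<in> L2 L \<Longrightarrow> \<bar>l2_norm L u - l2_norm L v\<bar> \<le> l2_norm L (\<lambda>x. u x - v x)"
proof -
  assume uv: "u \<in> L2 L" "v \<in> L2 L"
  have "l2_norm L (\<lambda>x. (u x - v x) + v x) \<le> l2_norm L (\<lambda>x. u x - v x) + l2_norm L v"
    using uv by (intro l2_norm_add_le L2_diff)
  moreover have "l2_norm L (\<lambda>x. u x - (u x - v x)) \<le> l2_norm L u + l2_norm L (\<lambda>x. u x - v x)"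
    using uv by (intro l2_norm_diff_le L2_diff)
  moreover have "l2_norm L (\<lambda>x. u x - (u x - v x)) \<le> l2_norm L (\<lambda>x. u x - v x) + l2_norm L u"
    using calculation by simp
  ultimately show ?thesis by simp
qed

lemma l2_inner_cong_AE:
  assumes "u \<in> L2 L" "u' \<in> L2 L" "v \<in> L2 L" "AE x in mu L. u x = u' x"
  shows "l2_inner L u v = l2_inner L u' v"
  unfolding l2_inner_eq
proof (rule integral_cong_AE)
  show "AE x in mu L. u x \<bullet> v x = u' x \<bullet> v x" using assms(4) by eventually_elim simp
qed (intro borel_measurable_inner L2_D assms)+

lemma l2_norm_cong_AE:
  assumes "u \<in> L2 L" "v \<in> L2 L" "AE x in mu L. u x = v x"
  shows "l2_norm L u = l2_norm L v"
proof -
  have "l2_inner L u u = l2_inner L v u" "l2_inner L v u = l2_inner L v v"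
    using l2_inner_cong_AE[OF assms(1,2,1,3)] l2_inner_cong_AE[OF assms(1,2,2,3)]
    by (simp_all add: l2_inner_commute[of L v u])
  then show ?thesis by (simp add: l2_norm_def)
qed

lemma trig_L2: "L > 0 \<Longrightarrow> (\<lambda>x. trig L k a b x *\<^sub>R c) \<in> L2 L"
proof -
  assume L: "L > 0"
  interpret finite_measure "mu L" by (rule finite_measure_mu)
  have "trig L k a b \<in> borel_measurable lebesgue"
    using borel_measurable_continuous_onI[OF continuous_trig[OF continuous_on_id]]
    by (intro measurable_completion) simp
  then show ?thesis
    using L periodic_trig[of L k a b]
    by (intro L2_bound[where g = "\<lambda>x. ((\<bar>a\<bar> + \<bar>b\<bar>) * norm c)\<^sup>2"])
      (auto simp: periodic_def intro!: power_mono mult_right_mono abs_trig_le)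
qed

text \<open>Cauchy-Schwarz against a constant field of length 1, whose norm is \<open>L\<close>, the
  root of the area. The scalar \<open>norm (u x)\<close> is put along a fixed axis because the inner
  product is defined for vector fields.\<close>

lemma l1_le_l2:
  assumes "L > 0" "u \<in> L2 L"
  shows "(\<integral>x. norm (u x) \<partial>mu L) \<le> L * l2_norm L u"
proof -
  interpret finite_measure "mu L" by (rule finite_measure_mu)
  let ?e = "axis 1 1 :: real^2"
  have 1: "(\<lambda>x. norm (u x) *\<^sub>R ?e) \<in> L2 L"
    using L2_D[OF assms(2)] by (intro L2_bound[where g = "\<lambda>x. (norm (u x))\<^sup>2"]) (auto simp: periodic_def)
  have 2: "(\<lambda>x. ?e) \<in> L2 L" by (rule L2_bound[where g = "\<lambda>x. 1"]) (auto simp: periodic_def)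
  have ee: "?e \<bullet> ?e = 1" by (simp add: inner_axis_axis)
  have "l2_norm L (\<lambda>x. ?e) = L"
    using assms measure_mu[OF assms(1)] by (simp add: l2_norm_def l2_inner_eq ee)
  moreover have "l2_norm L (\<lambda>x. norm (u x) *\<^sub>R ?e) = l2_norm L u"
    by (simp add: l2_norm_def l2_inner_eq ee dot_square_norm power2_eq_square)
  ultimately show ?thesis
    using l2_cauchy_schwarz[OF 1 2] by (simp add: l2_inner_eq ee mult.commute)
qed

lemma nonneg_summable_boundI:
  fixes f :: "'a \<Rightarrow> real"
  assumes "\<And>k. 0 \<le> f k" "\<And>F. finite F \<Longrightarrow> sum f F \<le> B"
  shows "f summable_on UNIV"
proof (rule nonneg_bdd_above_summable_on)
  show "bdd_above (sum f ` {F. F \<subseteq> UNIV \<and> finite F})"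
    using assms(2) by (intro bdd_aboveI[of _ B]) blast
qed (use assms in auto)

section \<open>Fourier coefficients with respect to a real orthonormal basis\<close>

locale torus =
  fixes L :: real
  assumes L: "L > 0"
begin

text \<open>The functions \<open>cos + sin\<close> form a real orthonormal basis indexed by all frequencies, and differentiation
  maps the one of frequency \<open>k\<close> to a multiple of the one of frequency \<open>- k\<close>.\<close>

definition bas :: "int \<times> int \<Rightarrow> real^2 \<Rightarrow> real" where
  "bas k = trig L k (1 / L) (1 / L)"

definition cf :: "(real^2 \<Rightarrow> real^2) \<Rightarrow> int \<times> int \<Rightarrow> real^2" where
  "cf u k = (\<integral>x. bas k x *\<^sub>R u x \<partial>mu L)"

lemma abs_bas_le: "\<bar>bas k x\<bar> \<le> 2 / L"
  using abs_trig_le[of L k "1 / L" "1 / L" x] L by (simp add: bas_def)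

lemma bas_measurable [measurable]: "bas k \<in> borel_measurable (mu L)"
  by (simp add: bas_def)

lemma bas_L2: "(\<lambda>x. bas k x *\<^sub>R c) \<in> L2 L"
  unfolding bas_def by (rule trig_L2[OF L])

lemma cf_integrable: "u \<in> L2 L \<Longrightarrow> integrable (mu L) (\<lambda>x. bas k x *\<^sub>R u x)"
  by (rule integrable_bounded_mult[OF L2_integrable _ abs_bas_le]) auto

lemma l2_inner_bas: "u \<in> L2 L \<Longrightarrow> l2_inner L u (\<lambda>x. bas k x *\<^sub>R c) = cf u k \<bullet> c"
  using integral_inner_left[where c = c, OF cf_integrable[of u k]]
  by (simp add: l2_inner_eq cf_def)

text \<open>With equal cosine and sine coefficients the product formula leaves a pure cosine at
  \<open>k - m\<close> and a pure sine at \<open>k + m\<close>. The sine integrates to 0 even if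
  \<open>k + m = 0\<close>, so opposite frequencies are orthogonal and no half lattice has to be
  singled out.\<close>

lemma lint_bas_bas: "(\<integral>x. bas k x * bas m x \<partial>mu L) = (if k = m then 1 else 0)"
proof -
  have "(\<integral>x. bas k x * bas m x \<partial>mu L) = (\<integral>x. trig L (k - m) (1 / L\<^sup>2) 0 x + trig L (k + m) 0 (1 / L\<^sup>2) x \<partial>mu L)"
    unfolding bas_def trig_mult by (simp add: power2_eq_square)
  also have "\<dots> = (if k = m then 1 else 0)"
    using L by (subst Bochner_Integration.integral_add[OF integrable_trig integrable_trig]) (auto simp: lint_trig)
  finally show ?thesis .
qed

lemma cf_bas: "cf (\<lambda>x. bas m x *\<^sub>R c) k = (if k = m then c else 0)"
proof -
  have "integrable (mu L) (\<lambda>x. bas k x * bas m x)"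
    using integrable_bounded_mult[OF integrable_trig[of L m "1 / L" "1 / L"] bas_measurable[of k] abs_bas_le]
    by (simp add: bas_def)
  then have "cf (\<lambda>x. bas m x *\<^sub>R c) k = (\<integral>x. bas k x * bas m x \<partial>mu L) *\<^sub>R c"
    unfolding cf_def by (simp add: integral_scaleR_left[symmetric] del: integral_scaleR_left)
  then show ?thesis by (simp add: lint_bas_bas)
qed

lemma cf_lincomb: "u \<in> L2 L \<Longrightarrow> v \<in> L2 L \<Longrightarrow> cf (\<lambda>x. a *\<^sub>R u x + b *\<^sub>R v x) k = a *\<^sub>R cf u k + b *\<^sub>R cf v k"
proof -
  assume uv: "u \<in> L2 L" "v \<in> L2 L"
  have "cf (\<lambda>x. a *\<^sub>R u x + b *\<^sub>R v x) k = (\<integral>x. a *\<^sub>R (bas k x *\<^sub>R u x) + b *\<^sub>R (bas k x *\<^sub>R v x) \<partial>mu L)"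
    unfolding cf_def by (simp add: scaleR_add_right mult.commute)
  also have "\<dots> = a *\<^sub>R cf u k + b *\<^sub>R cf v k"
    unfolding cf_def using uv by (subst Bochner_Integration.integral_add) (auto intro: cf_integrable simp del: scaleR_scaleR)
  finally show ?thesis .
qed

lemma cf_add: "u \<in> L2 L \<Longrightarrow> v \<in> L2 L \<Longrightarrow> cf (\<lambda>x. u x + v x) k = cf u k + cf v k"
  using cf_lincomb[of u v 1 1] by simp

lemma cf_diff: "u \<in> L2 L \<Longrightarrow> v \<in> L2 L \<Longrightarrow> cf (\<lambda>x. u x - v x) k = cf u k - cf v k"
  using cf_lincomb[of u v 1 "-1"] by simp

lemma cf_minus: "u \<in> L2 L \<Longrightarrow> v \<in> L2 L \<Longrightarrow> cf (u - v) k = cf u k - cf v k"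
  using cf_diff by (simp add: fun_diff_def)

lemma cf_zero: "cf (\<lambda>x. 0) k = 0"
  by (simp add: cf_def)

lemma cf_sum:
  "finite I \<Longrightarrow> (\<And>i. i \<in> I \<Longrightarrow> f i \<in> L2 L) \<Longrightarrow> cf (\<lambda>x. \<Sum>i\<in>I. f i x) k = (\<Sum>i\<in>I. cf (f i) k)"
  by (induction I rule: finite_induct) (auto simp: cf_zero cf_add L2_sum)

lemma cf_cong_AE: "u \<in> L2 L \<Longrightarrow> v \<in> L2 L \<Longrightarrow> AE x in mu L. u x = v x \<Longrightarrow> cf u k = cf v k"
  unfolding cf_def
proof (rule integral_cong_AE)
  assume "AE x in mu L. u x = v x"
  then show "AE x in mu L. bas k x *\<^sub>R u x = bas k x *\<^sub>R v x" by eventually_elim simp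
qed (intro borel_measurable_scaleR bas_measurable L2_D; assumption)+

definition syn :: "(int \<times> int) set \<Rightarrow> (int \<times> int \<Rightarrow> real^2) \<Rightarrow> real^2 \<Rightarrow> real^2" where
  "syn F c x = (\<Sum>k\<in>F. bas k x *\<^sub>R c k)"

lemma syn_L2: "syn F c \<in> L2 L"
  unfolding syn_def[abs_def] by (intro L2_sum bas_L2)

lemma cf_syn: "finite F \<Longrightarrow> cf (syn F c) k = (if k \<in> F then c k else 0)"
  unfolding syn_def[abs_def] by (simp add: cf_sum bas_L2 cf_bas)

lemma l2_inner_syn:
  assumes "finite F" "u \<in> L2 L" shows "l2_inner L u (syn F c) = (\<Sum>k\<in>F. cf u k \<bullet> c k)"
proof -
  have "l2_inner L u (syn F c) = (\<Sum>k\<in>F. l2_inner L u (\<lambda>x. bas k x *\<^sub>R c k))"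
    unfolding l2_inner_eq syn_def inner_sum_right
    by (intro Bochner_Integration.integral_sum L2_inner_integrable assms bas_L2)
  then show ?thesis using assms by (simp add: l2_inner_bas)
qed

lemma l2_norm_syn: "finite F \<Longrightarrow> (l2_norm L (syn F c))\<^sup>2 = (\<Sum>k\<in>F. (norm (c k))\<^sup>2)"
  by (simp add: l2_norm_sq l2_inner_syn syn_L2 cf_syn dot_square_norm)

lemma syn_diff: "finite F \<Longrightarrow> G \<subseteq> F \<Longrightarrow> syn F c x - syn G c x = syn (F - G) c x"
  unfolding syn_def by (simp add: sum_diff)

lemma bessel:
  assumes "finite F" "u \<in> L2 L" shows "(\<Sum>k\<in>F. (norm (cf u k))\<^sup>2) \<le> (l2_norm L u)\<^sup>2"
proof -
  have "0 \<le> (l2_norm L (\<lambda>x. 1 *\<^sub>R u x + (-1) *\<^sub>R syn F (cf u) x))\<^sup>2" by simp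
  also have "\<dots> = (l2_norm L u)\<^sup>2 - (\<Sum>k\<in>F. (norm (cf u k))\<^sup>2)"
    unfolding l2_norm_lincomb_sq[OF assms(2) syn_L2] using assms
    by (simp add: l2_inner_syn l2_norm_syn dot_square_norm)
  finally show ?thesis by simp
qed

lemma norm_cf_le: "u \<in> L2 L \<Longrightarrow> norm (cf u k) \<le> l2_norm L u"
  by (rule power2_le_imp_le) (use bessel[of "{k}" u] in simp_all)

lemma cf_summable:
  assumes "u \<in> L2 L" shows "(\<lambda>k. (norm (cf u k))\<^sup>2) summable_on UNIV"
  by (rule nonneg_summable_boundI[OF _ bessel[OF _ assms]]) auto

text \<open>Along these squares an unordered sum over frequencies becomes the limit of a sequence,
  the form in which dominated convergence and Fatou's lemma apply.\<close>

definition fbox :: "nat \<Rightarrow> (int \<times> int) set" where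
  "fbox n = {- int n..int n} \<times> {- int n..int n}"

lemma finite_fbox [simp]: "finite (fbox n)"
  by (simp add: fbox_def)

lemma fbox_mono: "m \<le> n \<Longrightarrow> fbox m \<subseteq> fbox n"
  by (auto simp: fbox_def)

lemma fbox_exhaust: "finite F \<Longrightarrow> \<exists>n. F \<subseteq> fbox n"
proof (induction F rule: finite_induct)
  case (insert k F)
  then obtain n where n: "F \<subseteq> fbox n" by blast
  define m where "m = n + nat \<bar>fst k\<bar> + nat \<bar>snd k\<bar>"
  have "F \<subseteq> fbox m" using n fbox_mono[of n m] by (auto simp: m_def)
  moreover have "k \<in> fbox m" by (cases k) (auto simp: fbox_def m_def)
  ultimately show ?case by blast
qed auto

lemma filterlim_fbox: "filterlim fbox (finite_subsets_at_top UNIV) sequentially"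
proof -
  have "\<forall>\<^sub>F n in sequentially. X \<subseteq> fbox n" if "finite X" for X
    using fbox_exhaust[OF that] fbox_mono unfolding eventually_sequentially by blast
  then show ?thesis by (auto simp: filterlim_finite_subsets_at_top)
qed

lemma has_sum_fbox: "(f has_sum s) UNIV \<Longrightarrow> (\<lambda>n. sum f (fbox n)) \<longlonglongrightarrow> s"
  unfolding has_sum_def by (rule filterlim_compose[OF _ filterlim_fbox])

end

lemma periodic_int_shift:
  fixes f :: "real^2 \<Rightarrow> 'b"
  assumes "periodic L f" shows "f (x + (L * of_int n) *\<^sub>R axis j 1) = f x"
proof (induction n arbitrary: x rule: int_induct[of _ 0])
  case (step1 i)
  have "x + (L * of_int (i + 1)) *\<^sub>R axis j 1 = (x + (L * of_int i) *\<^sub>R axis j 1) + L *\<^sub>R axis j (1::real)"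
    by (simp add: algebra_simps)
  then show ?case using step1(2)[of x] periodic_axis[OF assms] by metis
next
  case (step2 i)
  have "x + (L * of_int i) *\<^sub>R axis j 1 = (x + (L * of_int (i - 1)) *\<^sub>R axis j 1) + L *\<^sub>R axis j (1::real)"
    by (simp add: algebra_simps)
  then show ?case using step2(2)[of x] periodic_axis[OF assms] by metis
qed simp

lemma AE_mu_iff: "(AE x in mu L. P x) \<longleftrightarrow> (AE x in lebesgue. x \<in> cell L \<longrightarrow> P x)"
  by (subst AE_restrict_space_iff) auto

text \<open>The exceptional set in the plane is covered by countably many lattice translates of the
  exceptional set in the cell. This passes from \<open>mu L\<close>, where all computations take
  place, to statements about the whole plane.\<close>

lemma AE_periodic:
  assumes L: "L > 0" and per: "periodic L P" and ae: "AE x in mu L. P x"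
  shows "AE x in lebesgue. P x"
proof -
  define Z where "Z = {x \<in> cell L. \<not> P x}"
  define s :: "int \<times> int \<Rightarrow> real^2"
    where "s m = (L * of_int (fst m)) *\<^sub>R axis 1 1 + (L * of_int (snd m)) *\<^sub>R axis 2 1" for m
  have Z: "Z \<in> null_sets lebesgue"
    using ae unfolding AE_mu_iff Z_def by (auto simp: completion.AE_iff_null_sets)
  have "negligible (\<Union>m. (+) (s m) ` Z)"
    using Z by (intro negligible_countable_Union)
      (auto intro!: negligible_translation simp: negligible_iff_null_sets[symmetric])
  moreover have "{x. \<not> P x} \<subseteq> (\<Union>m. (+) (s m) ` Z)"
  proof
    fix x assume x: "x \<in> {x. \<not> P x}"
    define m where "m = (\<lfloor>x $ 1 / L\<rfloor>, \<lfloor>x $ 2 / L\<rfloor>)"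
    have sm: "P (y + s m) = P y" for y
      unfolding s_def add.assoc[symmetric] by (simp add: periodic_int_shift[OF per])
    have bd: "0 \<le> t - L * of_int \<lfloor>t / L\<rfloor>" "t - L * of_int \<lfloor>t / L\<rfloor> \<le> L" for t
    proof -
      have "of_int \<lfloor>t / L\<rfloor> \<le> t / L" "t / L \<le> of_int \<lfloor>t / L\<rfloor> + 1" by linarith+
      then show "0 \<le> t - L * of_int \<lfloor>t / L\<rfloor>" "t - L * of_int \<lfloor>t / L\<rfloor> \<le> L"
        using L by (simp_all only: pos_le_divide_eq pos_divide_le_eq) (simp_all add: algebra_simps)
    qed
    have "x - s m \<in> cell L"
      using bd by (auto simp: cell_def mem_box_cart s_def m_def axis_def forall_2)
    moreover have "\<not> P (x - s m)" using sm[of "x - s m"] x by simp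
    ultimately have "x - s m \<in> Z" by (simp add: Z_def)
    then show "x \<in> (\<Union>m. (+) (s m) ` Z)" by (intro UN_I[of m] image_eqI[of _ _ "x - s m"]) auto
  qed
  ultimately have "negligible {x. \<not> P x}" by (rule negligible_subset)
  then show ?thesis by (simp add: completion.AE_iff_null_sets negligible_iff_null_sets)
qed

lemma l2_norm_eq_0_AE:
  assumes "u \<in> L2 L" "l2_norm L u = 0" shows "AE x in mu L. u x = 0"
proof -
  have "(\<integral>x. (norm (u x))\<^sup>2 \<partial>mu L) = 0"
    using assms by (simp add: l2_norm_def l2_inner_eq dot_square_norm)
  then have "AE x in mu L. (norm (u x))\<^sup>2 = 0"
    using L2_D[OF assms(1)] by (subst (asm) integral_nonneg_eq_0_iff_AE) auto
  then show ?thesis by eventually_elim simp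
qed

context torus
begin

text \<open>Completeness is proved by hand: the partial sums are Cauchy in L2, hence in L1, so a
  subsequence converges almost everywhere, and Fatou's lemma bounds the distance of the limit to the
  partial sum \<open>S m\<close> by the tail \<open>r m\<close>.\<close>

lemma riesz_fischer:
  assumes c: "(\<lambda>k. (norm (c k))\<^sup>2) summable_on UNIV"
  obtains u where "u \<in> L2 L" "\<And>k. cf u k = c k" "(l2_norm L u)\<^sup>2 = (\<Sum>\<^sub>\<infinity>k. (norm (c k))\<^sup>2)"
proof -
  define S where "S n = syn (fbox n) c" for n
  define B where "B = (\<Sum>\<^sub>\<infinity>k. (norm (c k))\<^sup>2)"
  define r where "r n = B - (\<Sum>k\<in>fbox n. (norm (c k))\<^sup>2)" for n
  have S: "S n \<in> L2 L" for n by (simp add: S_def syn_L2)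
  have r0: "r \<longlonglongrightarrow> 0"
    unfolding r_def using tendsto_diff[OF tendsto_const[of B] has_sum_fbox[OF has_sum_infsum[OF c]]]
    by (simp add: B_def)
  have fin: "(\<Sum>k\<in>F. (norm (c k))\<^sup>2) \<le> B" if "finite F" for F
    unfolding B_def using c that by (intro finite_sum_le_infsum) auto
  have dist: "(l2_norm L (\<lambda>x. S n x - S m x))\<^sup>2 \<le> r m" if "m \<le> n" for m n
  proof -
    have "(l2_norm L (\<lambda>x. S n x - S m x))\<^sup>2 = (\<Sum>k\<in>fbox n - fbox m. (norm (c k))\<^sup>2)"
      using fbox_mono[OF that] by (simp add: S_def syn_diff l2_norm_syn)
    also have "\<dots> = (\<Sum>k\<in>fbox n. (norm (c k))\<^sup>2) - (\<Sum>k\<in>fbox m. (norm (c k))\<^sup>2)"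
      using fbox_mono[OF that] by (simp add: sum_diff)
    also have "\<dots> \<le> r m" unfolding r_def using fin by simp
    finally show ?thesis .
  qed
  have r_nonneg: "0 \<le> r n" for n using order.trans[OF zero_le_power2 dist[OF order_refl]] .
  have dist2: "(l2_norm L (\<lambda>x. S n x - S m x))\<^sup>2 \<le> max (r m) (r n)" for m n
  proof (cases "m \<le> n")
    case True then show ?thesis using dist[of m n] by simp
  next
    case False
    have "l2_norm L (\<lambda>x. S n x - S m x) = l2_norm L (\<lambda>x. S m x - S n x)"
      using l2_norm_scale[of L "-1" "\<lambda>x. S m x - S n x"] by simp
    then show ?thesis using False dist[of n m] by simp
  qed
  have cauchy: "\<exists>N. \<forall>i\<ge>N. \<forall>j\<ge>N. (\<integral>x. norm (S i x - S j x) \<partial>mu L) < e" if "e > 0" for e :: real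
  proof -
    have "\<forall>\<^sub>F n in sequentially. r n < (e / L)\<^sup>2"
      using r0 that L by (intro order_tendstoD(2)) auto
    then obtain N where N: "\<And>n. n \<ge> N \<Longrightarrow> r n < (e / L)\<^sup>2" by (auto simp: eventually_sequentially)
    have "(\<integral>x. norm (S i x - S j x) \<partial>mu L) < e" if ij: "i \<ge> N" "j \<ge> N" for i j
    proof -
      have "(l2_norm L (\<lambda>x. S i x - S j x))\<^sup>2 < (e / L)\<^sup>2"
        using dist2[of i j] N[OF ij(1)] N[OF ij(2)] by linarith
      then have "l2_norm L (\<lambda>x. S i x - S j x) < e / L"
        by (rule power_less_imp_less_base) (use \<open>e > 0\<close> L in simp)
      then have "L * l2_norm L (\<lambda>x. S i x - S j x) < e" using L by (simp add: field_simps)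
      then show ?thesis using l1_le_l2[OF L L2_diff[OF S S], of i j] by linarith
    qed
    then show ?thesis by blast
  qed
  obtain \<rho> where \<rho>: "strict_mono \<rho>" "AE x in mu L. Cauchy (\<lambda>i. S (\<rho> i) x)"
    by (rule cauchy_L1_AE_cauchy_subseq[OF L2_integrable[OF S] cauchy])
  \<comment> \<open>Taking the limit at every point of the plane, with an arbitrary value where the
    sequence diverges, makes \<open>u\<close> measurable and exactly periodic, because equal
    sequences have equal values of \<open>lim\<close>.\<close>
  define u where "u x = lim (\<lambda>i. S (\<rho> i) x)" for x
  have um: "u \<in> borel_measurable lebesgue"
    unfolding u_def[abs_def] by (intro borel_measurable_lim_metric L2_D[OF S])
  have per: "periodic L u"
    using L2_D(1)[OF S] unfolding u_def periodic_def by simp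
  have umu: "u \<in> borel_measurable (mu L)" using um by (rule measurable_restrict_space1)
  have conv: "AE x in mu L. (\<lambda>i. S (\<rho> i) x) \<longlonglongrightarrow> u x"
    using \<rho>(2) by eventually_elim (simp add: u_def Cauchy_convergent_iff convergent_LIMSEQ_iff)
  \<comment> \<open>Fatou's lemma along the subsequence, with \<open>S m\<close> held fixed; it
    yields both integrability and the bound.\<close>
  have close: "integrable (mu L) (\<lambda>x. (norm (u x - S m x))\<^sup>2) \<and> (\<integral>x. (norm (u x - S m x))\<^sup>2 \<partial>mu L) \<le> r m" for m
  proof -
    have ms: "(\<lambda>x. (norm (u x - S m x))\<^sup>2) \<in> borel_measurable (mu L)"
      using umu L2_D(4)[OF S[of m]] by simp
    have "(\<integral>\<^sup>+x. ennreal ((norm (u x - S m x))\<^sup>2) \<partial>mu L)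
      = (\<integral>\<^sup>+x. liminf (\<lambda>i. ennreal ((norm (S (\<rho> i) x - S m x))\<^sup>2)) \<partial>mu L)"
    proof (rule nn_integral_cong_AE)
      show "AE x in mu L. ennreal ((norm (u x - S m x))\<^sup>2) = liminf (\<lambda>i. ennreal ((norm (S (\<rho> i) x - S m x))\<^sup>2))"
        using conv
      proof eventually_elim
        case (elim x)
        then show ?case
          by (intro lim_imp_Liminf[symmetric] tendsto_ennrealI tendsto_intros) auto
      qed
    qed
    also have "\<dots> \<le> liminf (\<lambda>i. \<integral>\<^sup>+x. ennreal ((norm (S (\<rho> i) x - S m x))\<^sup>2) \<partial>mu L)"
      using L2_D(4)[OF S] by (intro nn_integral_liminf) simp
    also have "\<dots> \<le> ennreal (r m)"
    proof (rule Liminf_le)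
      have "(\<integral>\<^sup>+x. ennreal ((norm (S (\<rho> i) x - S m x))\<^sup>2) \<partial>mu L) \<le> ennreal (r m)" if "i \<ge> m" for i
      proof -
        have "m \<le> \<rho> i" using seq_suble[OF \<rho>(1), of i] that by linarith
        then show ?thesis
          using dist[of m "\<rho> i"] L2_D(3)[OF L2_diff[OF S S], of "\<rho> i" m]
          by (subst nn_integral_eq_integral) (auto simp: l2_norm_sq l2_inner_eq dot_square_norm intro!: ennreal_leI)
      qed
      then show "\<forall>\<^sub>F i in sequentially. (\<integral>\<^sup>+x. ennreal ((norm (S (\<rho> i) x - S m x))\<^sup>2) \<partial>mu L) \<le> ennreal (r m)"
        by (auto simp: eventually_sequentially)
    qed simp
    finally have le: "(\<integral>\<^sup>+x. ennreal ((norm (u x - S m x))\<^sup>2) \<partial>mu L) \<le> ennreal (r m)" .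
    then have int: "integrable (mu L) (\<lambda>x. (norm (u x - S m x))\<^sup>2)"
      by (intro integrableI_nonneg ms) (auto simp: le_less_trans)
    then show ?thesis using le r_nonneg[of m] by (subst (asm) nn_integral_eq_integral) auto
  qed
  have D: "(\<lambda>x. u x - S m x) \<in> L2 L" for m
    using close[of m] per um L2_D[OF S[of m]] by (auto simp: L2_iff periodic_def)
  have uL2: "u \<in> L2 L" using L2_add[OF D S, of 0 0] by simp
  have Dn: "(l2_norm L (\<lambda>x. u x - S m x))\<^sup>2 \<le> r m" for m
    using close[of m] by (simp add: l2_norm_sq l2_inner_eq dot_square_norm)
  have Dlim: "(\<lambda>m. l2_norm L (\<lambda>x. u x - S m x)) \<longlonglongrightarrow> 0"
  proof -
    have "(\<lambda>m. (l2_norm L (\<lambda>x. u x - S m x))\<^sup>2) \<longlonglongrightarrow> 0"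
      by (rule Lim_null_comparison[OF _ r0]) (use Dn in auto)
    from tendsto_real_sqrt[OF this] show ?thesis by simp
  qed
  have cfu: "cf u k = c k" for k
  proof -
    obtain m0 where m0: "k \<in> fbox m0" using fbox_exhaust[of "{k}"] by auto
    have "norm (cf u k - c k) \<le> l2_norm L (\<lambda>x. u x - S m x)" if "m \<ge> m0" for m
    proof -
      have "k \<in> fbox m" using m0 fbox_mono[OF that] by blast
      then have "cf u k - c k = cf (\<lambda>x. u x - S m x) k"
        using uL2 S by (simp add: cf_diff) (simp add: S_def cf_syn)
      then show ?thesis using norm_cf_le[OF D] by simp
    qed
    then have "norm (cf u k - c k) \<le> 0"
      by (intro tendsto_lowerbound[OF Dlim]) (auto simp: eventually_sequentially)
    then show ?thesis by simp
  qed
  have nl: "(\<lambda>m. l2_norm L (S m)) \<longlonglongrightarrow> l2_norm L u"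
  proof (rule Lim_transform2)
    show "(\<lambda>m. l2_norm L u) \<longlonglongrightarrow> l2_norm L u" by simp
    show "(\<lambda>m. l2_norm L u - l2_norm L (S m)) \<longlonglongrightarrow> 0"
      by (rule Lim_null_comparison[OF _ Dlim]) (use l2_norm_triangle_diff[OF uL2 S] in auto)
  qed
  have "(\<lambda>m. (l2_norm L (S m))\<^sup>2) \<longlonglongrightarrow> B"
    using has_sum_fbox[OF has_sum_infsum[OF c]] by (simp add: S_def l2_norm_syn B_def)
  then have "(l2_norm L u)\<^sup>2 = B"
    using LIMSEQ_unique tendsto_power[OF nl, of 2] by blast
  then show thesis using that[OF uL2 cfu] by (simp add: B_def)
qed

text \<open>Completeness of the trigonometric system, applied to each component of the
  difference.\<close>

lemma cf_eq_AE:
  assumes u: "u \<in> L2 L" and v: "v \<in> L2 L" and eq: "\<And>k. cf u k = cf v k"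
  shows "AE x in mu L. u x = v x"
proof -
  define w where "w x = u x - v x" for x
  have w: "w \<in> L2 L" unfolding w_def using u v by (rule L2_diff)
  have w0: "cf w k = 0" for k unfolding w_def using u v eq by (simp add: cf_diff)
  have "AE x in mu L. w x $ i = 0" for i
  proof (rule trig_complete, unfold_locales)
    have wi: "integrable (mu L) w" by (rule L2_integrable[OF w])
    then show fi: "integrable (mu L) (\<lambda>x. w x $ i)"
      using integrable_bounded_linear[OF bounded_linear_vec_nth] by blast
    fix k a b
    have bw: "(\<integral>x. bas k x * w x $ i \<partial>mu L) = 0" for k
    proof -
      have "(\<integral>x. bas k x * w x $ i \<partial>mu L) = (\<integral>x. (bas k x *\<^sub>R w x) $ i \<partial>mu L)" by simp
      also have "\<dots> = cf w k $ i"
        unfolding cf_def by (rule integral_bounded_linear[OF bounded_linear_vec_nth cf_integrable[OF w]])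
      finally show ?thesis by (simp add: w0)
    qed
    have ibw: "integrable (mu L) (\<lambda>x. bas k x * w x $ i)" for k
      using integrable_bounded_mult[OF fi bas_measurable abs_bas_le] by simp
    \<comment> \<open>Cosine and sine of frequency \<open>k\<close> are half the sum and half the
      difference of \<open>bas k\<close> and \<open>bas (- k)\<close>, up to the factor
      \<open>L\<close>.\<close>
    have "trig L k a b x = (a + b) * L / 2 * bas k x + (a - b) * L / 2 * bas (- k) x" for x
      using L by (simp add: bas_def trig_def field_simps)
    then have "(\<integral>x. trig L k a b x * w x $ i \<partial>mu L)
      = (\<integral>x. (a + b) * L / 2 * (bas k x * w x $ i) + (a - b) * L / 2 * (bas (- k) x * w x $ i) \<partial>mu L)"
      by (simp add: algebra_simps)
    also have "\<dots> = 0"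
      using ibw by (subst Bochner_Integration.integral_add) (auto simp: bw)
    finally show "(\<integral>x. trig L k a b x * w x $ i \<partial>mu L) = 0" .
  qed (rule L)
  then have "AE x in mu L. \<forall>i. w x $ i = 0" by (rule eventually_all_finite)
  then show ?thesis by eventually_elim (simp add: w_def vec_eq_iff)
qed

text \<open>Riesz-Fischer builds a function with the same coefficients whose norm is their square
  sum, and this function equals \<open>u\<close> almost everywhere.\<close>

lemma parseval_norm:
  assumes u: "u \<in> L2 L" shows "((\<lambda>k. (norm (cf u k))\<^sup>2) has_sum (l2_norm L u)\<^sup>2) UNIV"
proof -
  obtain v where v: "v \<in> L2 L" "\<And>k. cf v k = cf u k" "(l2_norm L v)\<^sup>2 = (\<Sum>\<^sub>\<infinity>k. (norm (cf u k))\<^sup>2)"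
    using riesz_fischer[OF cf_summable[OF u]] by metis
  have "l2_norm L v = l2_norm L u"
    by (intro l2_norm_cong_AE v u cf_eq_AE)
  then show ?thesis using has_sum_infsum[OF cf_summable[OF u]] v(3) by simp
qed

lemma parseval:
  assumes u: "u \<in> L2 L" and v: "v \<in> L2 L"
  shows "((\<lambda>k. cf u k \<bullet> cf v k) has_sum l2_inner L u v) UNIV"
proof -
  have "((\<lambda>k. (1 / 2) * ((norm (cf (\<lambda>x. u x + v x) k))\<^sup>2 + - (norm (cf u k))\<^sup>2 + - (norm (cf v k))\<^sup>2)) has_sum
      (1 / 2) * ((l2_norm L (\<lambda>x. u x + v x))\<^sup>2 + - (l2_norm L u)\<^sup>2 + - (l2_norm L v)\<^sup>2)) UNIV"
    by (intro has_sum_cmult_right has_sum_add has_sum_uminusI parseval_norm u v L2_add)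
  moreover have "(1 / 2) * ((norm (cf (\<lambda>x. u x + v x) k))\<^sup>2 - (norm (cf u k))\<^sup>2 - (norm (cf v k))\<^sup>2) = cf u k \<bullet> cf v k" for k
    using u v by (simp add: cf_add dot_norm)
  moreover have "(1 / 2) * ((l2_norm L (\<lambda>x. u x + v x))\<^sup>2 - (l2_norm L u)\<^sup>2 - (l2_norm L v)\<^sup>2) = l2_inner L u v"
    using l2_norm_lincomb_sq[OF u v, of 1 1] by simp
  ultimately show ?thesis by simp
qed

end

section \<open>Sobolev spaces in terms of Fourier coefficients\<close>

lemma smooth_D:
  assumes "smooth f"
  shows "f differentiable (at x)" "smooth (\<lambda>x. frechet_derivative f (at x) h)"
  using assms by (auto elim: smooth.cases)

lemma smooth_continuous: "smooth f \<Longrightarrow> continuous_on S f"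
  by (meson continuous_at_imp_continuous_on differentiable_imp_continuous_within smooth_D(1))

lemma summable_on_uminus:
  fixes f :: "'a::ab_group_add \<Rightarrow> 'b::{comm_monoid_add, t2_space}"
  shows "(\<lambda>k. f (- k)) summable_on UNIV \<longleftrightarrow> f summable_on UNIV"
  by (rule summable_on_reindex_bij_witness[of _ uminus uminus]) auto

lemma has_sum_uminus_index:
  fixes f :: "'a::ab_group_add \<Rightarrow> 'b::{comm_monoid_add, t2_space}"
  shows "((\<lambda>k. f (- k)) has_sum s) UNIV \<longleftrightarrow> (f has_sum s) UNIV"
  by (rule has_sum_reindex_bij_witness[of _ uminus uminus]) auto

lemma summable_on_nat_int:
  fixes f :: "nat \<Rightarrow> real"
  assumes f: "summable f" "\<And>n. 0 \<le> f n"
  shows "(\<lambda>m::int. f (nat \<bar>m\<bar>)) summable_on UNIV"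
proof (rule nonneg_bdd_above_summable_on)
  show "bdd_above (sum (\<lambda>m::int. f (nat \<bar>m\<bar>)) ` {F. F \<subseteq> UNIV \<and> finite F})"
  proof (rule bdd_aboveI[of _ "suminf f + suminf f"])
    fix s assume "s \<in> sum (\<lambda>m::int. f (nat \<bar>m\<bar>)) ` {F. F \<subseteq> UNIV \<and> finite F}"
    then obtain F where F: "finite F" "s = (\<Sum>m\<in>F. f (nat \<bar>m\<bar>))" by auto
    have part: "(\<Sum>m\<in>G. f (nat \<bar>m\<bar>)) \<le> suminf f" if "finite G" "inj_on (\<lambda>m. nat \<bar>m\<bar>) G" for G :: "int set"
      using sum_le_suminf[OF f(1), of "(\<lambda>m. nat \<bar>m\<bar>) ` G"] that f(2) by (simp add: sum.reindex)
    have "s = (\<Sum>m\<in>F \<inter> {0..}. f (nat \<bar>m\<bar>)) + (\<Sum>m\<in>F - {0..}. f (nat \<bar>m\<bar>))"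
      unfolding F(2) by (rule sum.Int_Diff[OF F(1)])
    also have "\<dots> \<le> suminf f + suminf f"
      using F by (intro add_mono part) (auto simp: inj_on_def)
    finally show "s \<le> suminf f + suminf f" .
  qed
qed (use f in auto)

lemma summable_on_prod_mult:
  fixes f :: "'a \<Rightarrow> real" and g :: "'b \<Rightarrow> real"
  assumes f: "f summable_on UNIV" "\<And>x. 0 \<le> f x" and g: "g summable_on UNIV" "\<And>x. 0 \<le> g x"
  shows "(\<lambda>k. f (fst k) * g (snd k)) summable_on UNIV"
proof (rule nonneg_summable_boundI)
  fix F :: "('a \<times> 'b) set" assume F: "finite F"
  have "(\<Sum>k\<in>F. f (fst k) * g (snd k)) \<le> (\<Sum>k\<in>fst ` F \<times> snd ` F. f (fst k) * g (snd k))"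
    using F f g by (intro sum_mono2 subset_fst_snd) auto
  also have "\<dots> = (\<Sum>x\<in>fst ` F. f x) * (\<Sum>y\<in>snd ` F. g y)"
    by (simp add: sum_product sum.cartesian_product case_prod_beta)
  also have "\<dots> \<le> infsum f UNIV * infsum g UNIV"
    using F f g by (intro mult_mono finite_sum_le_infsum sum_nonneg infsum_nonneg) auto
  finally show "(\<Sum>k\<in>F. f (fst k) * g (snd k)) \<le> infsum f UNIV * infsum g UNIV" .
qed (use f g in auto)

lemma H2_eq: "Sob L 2 = Sob L (Suc (Suc 0))"
  by (simp add: numeral_2_eq_2)

context torus
begin

definition q :: "int \<times> int \<Rightarrow> real" where
  "q k = (norm (kap L k))\<^sup>2"

lemma q_nonneg [simp]: "0 \<le> q k" and q_uminus [simp]: "q (- k) = q k"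
  by (simp_all add: q_def)

lemma q_sum: "(\<Sum>j\<in>UNIV. (kap L k $ j)\<^sup>2) = q k"
  unfolding q_def power2_norm_eq_inner inner_vec_def by (simp add: power2_eq_square)

lemma kap_sq_le: "(kap L k $ j)\<^sup>2 \<le> q k"
  unfolding q_sum[symmetric] by (rule member_le_sum) auto

definition sc :: "(real^2 \<Rightarrow> real) \<Rightarrow> int \<times> int \<Rightarrow> real" where
  "sc \<phi> k = (\<integral>x. bas k x * \<phi> x \<partial>mu L)"

lemma frechet_bas: "frechet_derivative (bas k) (at x) (axis j 1) = kap L k $ j * bas (- k) x"
  unfolding bas_def frechet_trig by (simp add: inner_axis trig_def)

lemma smooth_bas: "smooth (bas k)"
  unfolding bas_def by (rule smooth_trig)

lemma periodic_bas: "periodic L (bas k)"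
  unfolding bas_def by (rule periodic_trig[OF L])

lemma continuous_integrable_mu:
  fixes f :: "real^2 \<Rightarrow> real"
  assumes "continuous_on UNIV f" shows "integrable (mu L) f"
  unfolding cell_def by (rule continuous_imp_integrable[OF continuous_on_subset[OF assms subset_UNIV]])

text \<open>Integration by parts: the partial derivative of the periodic product of
  \<open>\<phi>\<close> and \<open>bas k\<close> integrates to 0, and differentiating
  \<open>bas k\<close> produces \<open>bas (- k)\<close>.\<close>

lemma sc_partial:
  assumes s: "smooth \<phi>" and p: "periodic L \<phi>"
  shows "sc (\<lambda>x. frechet_derivative \<phi> (at x) (axis j 1)) k = - kap L k $ j * sc \<phi> (- k)"
proof -
  define d where "d x = frechet_derivative \<phi> (at x) (axis j 1)" for x
  have cd: "continuous_on UNIV d" unfolding d_def[abs_def] by (rule smooth_continuous[OF smooth_D(2)[OF s]])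
  have cp: "continuous_on UNIV \<phi>" by (rule smooth_continuous[OF s])
  have cb: "continuous_on UNIV (bas k)" for k by (rule smooth_continuous[OF smooth_bas])
  let ?f = "\<lambda>x. \<phi> x * bas k x"
  have der: "(?f has_derivative (\<lambda>h. \<phi> x * frechet_derivative (bas k) (at x) h + frechet_derivative \<phi> (at x) h * bas k x)) (at x)" for x
    by (intro has_derivative_mult has_derivative_frechet smooth_D(1)[OF s] smooth_D(1)[OF smooth_bas])
  then have fr: "frechet_derivative ?f (at x) (axis j 1) = kap L k $ j * (bas (- k) x * \<phi> x) + bas k x * d x" for x
    using frechet_derivative_at[OF der, of x, symmetric] by (simp add: frechet_bas d_def)
  have "integral (cell L) (\<lambda>x. frechet_derivative ?f (at x) (axis j 1)) = 0"
  proof (rule integral_cell_partial[OF _ _ L])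
    show "?f differentiable (at x)" for x using der unfolding differentiable_def by blast
    show "periodic L ?f" using p periodic_bas unfolding periodic_def by metis
    show "continuous_on UNIV (\<lambda>x. frechet_derivative ?f (at x) (axis j 1))"
      unfolding fr by (intro continuous_intros cb cp cd)
  qed
  moreover have "integrable (mu L) (\<lambda>x. bas (- k) x * \<phi> x)" "integrable (mu L) (\<lambda>x. bas k x * d x)"
    by (intro continuous_integrable_mu continuous_intros cb cp cd)+
  ultimately have "kap L k $ j * sc \<phi> (- k) + sc d k = 0"
    unfolding fr sc_def by (subst (asm) lebesgue_integral_eq_integral[symmetric]) auto
  then show ?thesis by (simp add: d_def[abs_def])
qed

lemma smooth_scaleR_L2:
  assumes "smooth \<phi>" "periodic L \<phi>" shows "(\<lambda>x. \<phi> x *\<^sub>R a) \<in> L2 L"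
proof -
  have c: "continuous_on UNIV \<phi>" by (rule smooth_continuous[OF assms(1)])
  have "\<phi> \<in> borel_measurable lebesgue"
    using borel_measurable_continuous_onI[OF c] by (intro measurable_completion) simp
  moreover have "integrable (mu L) (\<lambda>x. (\<phi> x * norm a)\<^sup>2)"
    by (intro continuous_integrable_mu continuous_intros c)
  ultimately show ?thesis
    using assms(2) by (intro L2_bound[where g = "\<lambda>x. (\<phi> x * norm a)\<^sup>2"]) (auto simp: periodic_def power_mult_distrib)
qed

lemma periodic_partial: "smooth \<phi> \<Longrightarrow> periodic L \<phi> \<Longrightarrow> periodic L (\<lambda>x. frechet_derivative \<phi> (at x) h)"
proof -
  assume s: "smooth \<phi>" and p: "periodic L \<phi>"
  have "frechet_derivative \<phi> (at (x + L *\<^sub>R axis j 1)) = frechet_derivative \<phi> (at x)" for x j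
  proof -
    have "((\<lambda>y. \<phi> (y + L *\<^sub>R axis j 1)) has_derivative frechet_derivative \<phi> (at (x + L *\<^sub>R axis j 1))) (at x)"
    proof -
      have "((\<lambda>y. y + L *\<^sub>R axis j 1) has_derivative (\<lambda>h. h)) (at x)"
        by (auto intro!: derivative_eq_intros)
      from has_derivative_compose[OF this has_derivative_frechet[OF smooth_D(1)[OF s]]] show ?thesis .
    qed
    then have "(\<phi> has_derivative frechet_derivative \<phi> (at (x + L *\<^sub>R axis j 1))) (at x)"
      using p by (simp add: periodic_def)
    then show ?thesis by (metis frechet_derivative_at)
  qed
  then show ?thesis by (simp add: periodic_def)
qed

lemma cf_smooth:
  assumes "continuous_on UNIV \<phi>"
  shows "cf (\<lambda>x. \<phi> x *\<^sub>R a) k = sc \<phi> k *\<^sub>R a"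
proof -
  have "integrable (mu L) (\<lambda>x. bas k x * \<phi> x)"
    by (intro continuous_integrable_mu continuous_intros assms smooth_continuous[OF smooth_bas])
  then show ?thesis
    unfolding cf_def sc_def by (simp add: integral_scaleR_left[symmetric] del: integral_scaleR_left)
qed

lemma integral_smooth_inner:
  assumes u: "u \<in> L2 L" and s: "smooth \<phi>" "periodic L \<phi>"
  shows "(\<integral>x. \<phi> x *\<^sub>R u x \<partial>mu L) \<bullet> a = l2_inner L u (\<lambda>x. \<phi> x *\<^sub>R a)"
proof -
  have "integrable (mu L) (\<lambda>x. \<phi> x *\<^sub>R u x)"
  proof -
    have i: "integrable (mu L) (\<lambda>x. u x \<bullet> \<phi> x *\<^sub>R axis i 1)" for i
      by (intro L2_inner_integrable u smooth_scaleR_L2 s)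
    have e: "(\<phi> x *\<^sub>R u x) = (\<Sum>i\<in>UNIV. (u x \<bullet> \<phi> x *\<^sub>R axis i 1) *\<^sub>R axis i 1)" for x
    proof -
      have "u x \<bullet> \<phi> x *\<^sub>R axis i 1 = \<phi> x * u x $ i" for i by (simp add: inner_axis)
      then show ?thesis by (simp only:) (simp add: vec_eq_iff sum_2 axis_def forall_2)
    qed
    show ?thesis unfolding e using i by (intro Bochner_Integration.integrable_sum integrable_scaleR_left) auto
  qed
  then show ?thesis by (simp add: l2_inner_eq integral_inner_left[symmetric] del: integral_inner_left)
qed

text \<open>The basis functions are admissible test functions, which gives the coefficient relation.
  Conversely, Parseval expands both sides of the defining identity for an arbitrary test function
  and the two series agree. Everything about Sobolev spaces below rests on this equivalence.\<close>

lemma is_weak_partial_iff: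
  "is_weak_partial L j u w \<longleftrightarrow> u \<in> L2 L \<and> w \<in> L2 L \<and> (\<forall>k. cf w k = - (kap L k $ j) *\<^sub>R cf u (- k))"
proof (intro iffI conjI allI; (elim conjE)?)
  fix k assume wp: "is_weak_partial L j u w"
  then have "(\<integral>x. frechet_derivative (bas k) (at x) (axis j 1) *\<^sub>R u x \<partial>mu L) = - (\<integral>x. bas k x *\<^sub>R w x \<partial>mu L)"
    using smooth_bas periodic_bas unfolding is_weak_partial_def set_integral_cell by blast
  moreover have "(\<integral>x. frechet_derivative (bas k) (at x) (axis j 1) *\<^sub>R u x \<partial>mu L) = (kap L k $ j) *\<^sub>R cf u (- k)"
    unfolding frechet_bas cf_def scaleR_scaleR[symmetric] by (rule integral_scaleR_right)
  ultimately show "cf w k = - (kap L k $ j) *\<^sub>R cf u (- k)" by (simp add: cf_def minus_equation_iff)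
next
  assume u: "u \<in> L2 L" and w: "w \<in> L2 L" and eq: "\<forall>k. cf w k = - (kap L k $ j) *\<^sub>R cf u (- k)"
  have "(\<integral>x. frechet_derivative \<phi> (at x) (axis j 1) *\<^sub>R u x \<partial>mu L) = - (\<integral>x. \<phi> x *\<^sub>R w x \<partial>mu L)"
    if s: "smooth \<phi>" "periodic L \<phi>" for \<phi>
  proof (rule vector_eq_rdot[THEN iffD1], rule allI)
    fix a :: "real^2"
    define d where "d x = frechet_derivative \<phi> (at x) (axis j 1)" for x
    have d: "smooth d" "periodic L d"
      unfolding d_def[abs_def] by (rule smooth_D(2)[OF s(1)], rule periodic_partial[OF s])
    have "((\<lambda>k. cf u k \<bullet> cf (\<lambda>x. d x *\<^sub>R a) k) has_sum l2_inner L u (\<lambda>x. d x *\<^sub>R a)) UNIV"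
      by (intro parseval u smooth_scaleR_L2 d)
    then have "((\<lambda>k. - kap L k $ j * sc \<phi> (- k) * (cf u k \<bullet> a)) has_sum l2_inner L u (\<lambda>x. d x *\<^sub>R a)) UNIV"
      using sc_partial[OF s, of j] by (simp add: cf_smooth smooth_continuous[OF d(1)] d_def[symmetric])
    \<comment> \<open>Reindexing by \<open>- k\<close> changes the sign of \<open>kap\<close> and
      brings the series into the form of the second expansion.\<close>
    then have 1: "((\<lambda>k. kap L k $ j * sc \<phi> k * (cf u (- k) \<bullet> a)) has_sum l2_inner L u (\<lambda>x. d x *\<^sub>R a)) UNIV"
      by (subst (asm) has_sum_uminus_index[symmetric]) simp
    have "((\<lambda>k. cf w k \<bullet> cf (\<lambda>x. \<phi> x *\<^sub>R a) k) has_sum l2_inner L w (\<lambda>x. \<phi> x *\<^sub>R a)) UNIV"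
      by (intro parseval w smooth_scaleR_L2 s)
    then have "((\<lambda>k. - (kap L k $ j * sc \<phi> k * (cf u (- k) \<bullet> a))) has_sum l2_inner L w (\<lambda>x. \<phi> x *\<^sub>R a)) UNIV"
      using eq by (simp add: cf_smooth smooth_continuous[OF s(1)] mult_ac)
    then have 2: "((\<lambda>k. kap L k $ j * sc \<phi> k * (cf u (- k) \<bullet> a)) has_sum - l2_inner L w (\<lambda>x. \<phi> x *\<^sub>R a)) UNIV"
      using has_sum_uminusI by fastforce
    have "l2_inner L u (\<lambda>x. d x *\<^sub>R a) = - l2_inner L w (\<lambda>x. \<phi> x *\<^sub>R a)"
      using has_sum_unique[OF 1 2] .
    then show "(\<integral>x. frechet_derivative \<phi> (at x) (axis j 1) *\<^sub>R u x \<partial>mu L) \<bullet> a = - (\<integral>x. \<phi> x *\<^sub>R w x \<partial>mu L) \<bullet> a"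
      using integral_smooth_inner[OF u d, of a] integral_smooth_inner[OF w s, of a] by (simp add: d_def)
  qed
  then show "is_weak_partial L j u w" using u w unfolding is_weak_partial_def set_integral_cell by blast
qed (auto simp: is_weak_partial_def)

lemma weak_partial_exists:
  assumes u: "u \<in> L2 L" and s: "(\<lambda>k. q k * (norm (cf u k))\<^sup>2) summable_on UNIV"
  shows "\<exists>w. is_weak_partial L j u w"
proof -
  have "(\<lambda>k. (norm (- (kap L k $ j) *\<^sub>R cf u (- k)))\<^sup>2) summable_on UNIV"
  proof (rule summable_on_comparison_test)
    show "(\<lambda>k. q k * (norm (cf u (- k)))\<^sup>2) summable_on UNIV"
      using s summable_on_uminus[of "\<lambda>k. q k * (norm (cf u k))\<^sup>2"] by simp
  qed (auto simp: power_mult_distrib kap_sq_le intro!: mult_right_mono)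
  from riesz_fischer[OF this] obtain w where "w \<in> L2 L" "\<And>k. cf w k = - (kap L k $ j) *\<^sub>R cf u (- k)" by metis
  then show ?thesis using u by (auto simp: is_weak_partial_iff)
qed

lemma weak_partial_works: "is_weak_partial L j u w \<Longrightarrow> is_weak_partial L j u (weak_partial L j u)"
  unfolding weak_partial_def by (rule someI[of "is_weak_partial L j u"])

lemma is_weak_partial_D:
  assumes "is_weak_partial L j u w"
  shows "u \<in> L2 L" "w \<in> L2 L" "cf w k = - (kap L k $ j) *\<^sub>R cf u (- k)"
  using assms[unfolded is_weak_partial_iff] by blast+

lemma has_sum_partial:
  assumes "is_weak_partial L j u w"
  shows "((\<lambda>k. (kap L k $ j)\<^sup>2 * (norm (cf u k))\<^sup>2) has_sum (l2_norm L w)\<^sup>2) UNIV"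
proof -
  have "((\<lambda>k. (kap L k $ j)\<^sup>2 * (norm (cf u (- k)))\<^sup>2) has_sum (l2_norm L w)\<^sup>2) UNIV"
    using parseval_norm[OF is_weak_partial_D(2)[OF assms]]
    by (simp add: is_weak_partial_D(3)[OF assms] power_mult_distrib)
  then show ?thesis by (subst has_sum_uminus_index[symmetric]) simp
qed

lemma Sob1_iff: "u \<in> Sob L (Suc 0) \<longleftrightarrow> u \<in> L2 L \<and> (\<lambda>k. q k * (norm (cf u k))\<^sup>2) summable_on UNIV"
proof
  assume u: "u \<in> Sob L (Suc 0)"
  then have "\<exists>w. is_weak_partial L j u w" for j by auto
  then have "(\<lambda>k. (kap L k $ j)\<^sup>2 * (norm (cf u k))\<^sup>2) summable_on UNIV" for j
    using has_sum_partial has_sum_imp_summable by blast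
  then have "(\<lambda>k. (kap L k $ 1)\<^sup>2 * (norm (cf u k))\<^sup>2 + (kap L k $ 2)\<^sup>2 * (norm (cf u k))\<^sup>2) summable_on UNIV"
    by (intro summable_on_add)
  moreover have "q k = (kap L k $ 1)\<^sup>2 + (kap L k $ 2)\<^sup>2" for k using q_sum[of k] by (simp add: sum_2)
  ultimately show "u \<in> L2 L \<and> (\<lambda>k. q k * (norm (cf u k))\<^sup>2) summable_on UNIV"
    using u by (simp add: distrib_right)
next
  assume u: "u \<in> L2 L \<and> (\<lambda>k. q k * (norm (cf u k))\<^sup>2) summable_on UNIV"
  then have "\<exists>w\<in>L2 L. is_weak_partial L j u w" for j
    using weak_partial_exists[of u j] unfolding is_weak_partial_def by blast
  then show "u \<in> Sob L (Suc 0)" using u by simp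
qed

lemma weak_partial_Sob1:
  assumes "u \<in> Sob L (Suc 0)"
  shows "is_weak_partial L j u (weak_partial L j u)" "weak_partial L j u \<in> L2 L"
    "cf (weak_partial L j u) k = - (kap L k $ j) *\<^sub>R cf u (- k)"
proof -
  obtain w where "is_weak_partial L j u w" using assms by auto
  then show *: "is_weak_partial L j u (weak_partial L j u)" by (rule weak_partial_works)
  show "weak_partial L j u \<in> L2 L" "cf (weak_partial L j u) k = - (kap L k $ j) *\<^sub>R cf u (- k)"
    by (rule is_weak_partial_D[OF *])+
qed

text \<open>Two applications of the coefficient relation. Since \<open>Sob\<close> is recursive, the
  second order weight arises as \<open>(kap L k $ j)\<^sup>2 * q k\<close>, summed over
  \<open>j\<close>. In the converse direction \<open>q k\<close> must be dominated by
  \<open>1 + (q k)\<^sup>2\<close> to obtain the first derivatives.\<close>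

lemma H2_iff: "u \<in> H2 L \<longleftrightarrow> u \<in> L2 L \<and> (\<lambda>k. (q k)\<^sup>2 * (norm (cf u k))\<^sup>2) summable_on UNIV"
proof
  assume u: "u \<in> H2 L"
  have "(\<lambda>k. (kap L k $ j)\<^sup>2 * q k * (norm (cf u k))\<^sup>2) summable_on UNIV" for j
  proof -
    obtain w where w: "w \<in> Sob L (Suc 0)" "is_weak_partial L j u w"
      using u unfolding H2_eq Sob.simps(2)[of L "Suc 0"] by blast
    have "(\<lambda>k. (kap L k $ j)\<^sup>2 * q k * (norm (cf u (- k)))\<^sup>2) summable_on UNIV"
      using w(1)[unfolded Sob1_iff] by (simp add: is_weak_partial_D(3)[OF w(2)] power_mult_distrib mult_ac)
    then show ?thesis by (subst summable_on_uminus[symmetric]) simp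
  qed
  then have "(\<lambda>k. (kap L k $ 1)\<^sup>2 * q k * (norm (cf u k))\<^sup>2 + (kap L k $ 2)\<^sup>2 * q k * (norm (cf u k))\<^sup>2) summable_on UNIV"
    by (intro summable_on_add)
  moreover have "(kap L k $ 1)\<^sup>2 * q k * (norm (cf u k))\<^sup>2 + (kap L k $ 2)\<^sup>2 * q k * (norm (cf u k))\<^sup>2 = (q k)\<^sup>2 * (norm (cf u k))\<^sup>2" for k
    using q_sum[of k] by (simp add: sum_2 power2_eq_square[of "q k"] distrib_right[symmetric] del: power2_eq_square)
  ultimately show "u \<in> L2 L \<and> (\<lambda>k. (q k)\<^sup>2 * (norm (cf u k))\<^sup>2) summable_on UNIV"
    using u by (simp add: H2_eq)
next
  assume u: "u \<in> L2 L \<and> (\<lambda>k. (q k)\<^sup>2 * (norm (cf u k))\<^sup>2) summable_on UNIV"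
  have "(\<lambda>k. (norm (cf u k))\<^sup>2 + (q k)\<^sup>2 * (norm (cf u k))\<^sup>2) summable_on UNIV"
    using u by (intro summable_on_add cf_summable) auto
  then have q1: "(\<lambda>k. q k * (norm (cf u k))\<^sup>2) summable_on UNIV"
  proof (rule summable_on_comparison_test)
    show "q k * (norm (cf u k))\<^sup>2 \<le> (norm (cf u k))\<^sup>2 + (q k)\<^sup>2 * (norm (cf u k))\<^sup>2" for k
    proof -
      have "q k \<le> 1 + (q k)\<^sup>2"
      proof -
        have "2 * q k \<le> 1 + (q k)\<^sup>2" using sum_squares_bound[of 1 "q k"] by simp
        with q_nonneg[of k] show ?thesis by linarith
      qed
      from mult_right_mono[OF this, of "(norm (cf u k))\<^sup>2"] show ?thesis by (simp add: distrib_right)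
    qed
  qed simp
  have "\<exists>w\<in>Sob L (Suc 0). is_weak_partial L j u w" for j
  proof -
    obtain w where w: "is_weak_partial L j u w" using weak_partial_exists u q1 by blast
    have "(\<lambda>k. (q k)\<^sup>2 * (norm (cf u (- k)))\<^sup>2) summable_on UNIV"
      using u summable_on_uminus[of "\<lambda>k. (q k)\<^sup>2 * (norm (cf u k))\<^sup>2"] by simp
    then have "(\<lambda>k. q k * (norm (cf w k))\<^sup>2) summable_on UNIV"
      by (rule summable_on_comparison_test)
        (auto simp: is_weak_partial_D(3)[OF w] power_mult_distrib power2_eq_square[of "q _"] mult.assoc[symmetric]
          intro!: mult_right_mono mult_left_mono kap_sq_le)
    then have "w \<in> Sob L (Suc 0)" unfolding Sob1_iff using is_weak_partial_D(2)[OF w] by blast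
    then show ?thesis using w by blast
  qed
  then show "u \<in> H2 L" using u unfolding H2_eq by (subst Sob.simps) simp
qed

end

lemma l2_cauchy_schwarz_norm:
  assumes "u \<in> L2 L" "v \<in> L2 L"
  shows "integrable (mu L) (\<lambda>x. norm (u x) * norm (v x))"
    "(\<integral>x. norm (u x) * norm (v x) \<partial>mu L) \<le> l2_norm L u * l2_norm L v"
proof -
  let ?e = "axis 1 1 :: real^2"
  have ee: "?e \<bullet> ?e = 1" by (simp add: inner_axis_axis)
  have m: "(\<lambda>x. norm (u x) *\<^sub>R ?e) \<in> L2 L" if "u \<in> L2 L" for u
    using L2_D[OF that] by (intro L2_bound[where g = "\<lambda>x. (norm (u x))\<^sup>2"]) (auto simp: periodic_def)
  have n: "l2_norm L (\<lambda>x. norm (u x) *\<^sub>R ?e) = l2_norm L u" for u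
    by (simp add: l2_norm_def l2_inner_eq ee dot_square_norm power2_eq_square)
  show "integrable (mu L) (\<lambda>x. norm (u x) * norm (v x))"
    using L2_inner_integrable[OF m[OF assms(1)] m[OF assms(2)]] by (simp add: ee mult.commute)
  show "(\<integral>x. norm (u x) * norm (v x) \<partial>mu L) \<le> l2_norm L u * l2_norm L v"
    using l2_cauchy_schwarz[OF m[OF assms(1)] m[OF assms(2)]] by (simp add: l2_inner_eq ee n mult.commute)
qed

lemma sob_sqnorm_nonneg: "0 \<le> sob_sqnorm L k u"
  by (induction k arbitrary: u) (auto intro!: add_nonneg_nonneg sum_nonneg)

lemma h2_norm_nonneg [simp]: "0 \<le> h2_norm L u"
  by (simp add: h2_norm_def sob_sqnorm_nonneg)

lemma h2_norm_sq: "(h2_norm L u)\<^sup>2 = sob_sqnorm L 2 u"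
  by (simp add: h2_norm_def sob_sqnorm_nonneg)

context torus
begin

lemma H2_L2: "u \<in> H2 L \<Longrightarrow> u \<in> L2 L"
  by (simp add: H2_iff)

lemma weight_comparison:
  assumes u: "u \<in> L2 L" and s: "(\<lambda>k. (q k)\<^sup>2 * (norm (cf u k))\<^sup>2) summable_on UNIV"
    and f: "\<And>k. 0 \<le> f k" "\<And>k. f k \<le> C * (1 + (q k)\<^sup>2)"
  shows "(\<lambda>k. f k * (norm (cf u k))\<^sup>2) summable_on UNIV"
proof (rule summable_on_comparison_test)
  show "(\<lambda>k. C * ((norm (cf u k))\<^sup>2 + (q k)\<^sup>2 * (norm (cf u k))\<^sup>2)) summable_on UNIV"
    by (intro summable_on_cmult_right summable_on_add cf_summable[OF u] s)
  show "f k * (norm (cf u k))\<^sup>2 \<le> C * ((norm (cf u k))\<^sup>2 + (q k)\<^sup>2 * (norm (cf u k))\<^sup>2)" for k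
    using mult_right_mono[OF f(2)[of k], of "(norm (cf u k))\<^sup>2"] by (simp add: algebra_simps)
qed (use f in simp)

lemma q_le: "q k \<le> 1 + (q k)\<^sup>2"
proof -
  have "2 * q k \<le> 1 + (q k)\<^sup>2" using sum_squares_bound[of 1 "q k"] by simp
  with q_nonneg[of k] show ?thesis by linarith
qed

lemma H2_Sob1: "u \<in> H2 L \<Longrightarrow> u \<in> Sob L (Suc 0)"
  using weight_comparison[of u q 1] q_le by (simp add: Sob1_iff H2_iff del: Sob.simps)

lemma H2_partial:
  assumes u: "u \<in> H2 L" shows "weak_partial L j u \<in> Sob L (Suc 0)"
proof -
  have s: "u \<in> Sob L (Suc 0)" by (rule H2_Sob1[OF u])
  have "(\<lambda>k. (kap L k $ j)\<^sup>2 * q k * (norm (cf u k))\<^sup>2) summable_on UNIV"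
  proof (rule weight_comparison[OF H2_L2[OF u] conjunct2[OF u[unfolded H2_iff]], of _ 1])
    show "(kap L k $ j)\<^sup>2 * q k \<le> 1 * (1 + (q k)\<^sup>2)" for k
      using mult_right_mono[OF kap_sq_le[of k j] q_nonneg[of k]] by (simp add: power2_eq_square)
  qed simp
  then have "(\<lambda>k. q k * (norm (cf (weak_partial L j u) k))\<^sup>2) summable_on UNIV"
    by (subst (asm) summable_on_uminus[symmetric]) (simp add: weak_partial_Sob1(3)[OF s] power_mult_distrib mult_ac)
  then show ?thesis unfolding Sob1_iff using weak_partial_Sob1(2)[OF s] by blast
qed

lemma lap_H2:
  assumes u: "u \<in> H2 L"
  shows "lap L u \<in> L2 L" "cf (lap L u) k = - (q k *\<^sub>R cf u k)"
proof -
  have s: "weak_partial L j u \<in> Sob L (Suc 0)" for j by (rule H2_partial[OF u])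
  show "lap L u \<in> L2 L" unfolding lap_def by (intro L2_sum weak_partial_Sob1(2)[OF s])
  have "cf (lap L u) k = (\<Sum>j\<in>UNIV. cf (weak_partial L j (weak_partial L j u)) k)"
    unfolding lap_def by (intro cf_sum weak_partial_Sob1(2)[OF s]) auto
  \<comment> \<open>The second derivative leads from \<open>- k\<close> back to \<open>k\<close>. As
    \<open>kap\<close> is odd, one of the two minus signs cancels and one remains.\<close>
  also have "\<dots> = (\<Sum>j\<in>UNIV. - (((kap L k $ j)\<^sup>2) *\<^sub>R cf u k))"
    by (simp add: weak_partial_Sob1(3)[OF s] weak_partial_Sob1(3)[OF H2_Sob1[OF u]] power2_eq_square)
  also have "\<dots> = - (q k *\<^sub>R cf u k)"
    by (simp add: sum_negf scaleR_sum_left[symmetric] q_sum)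
  finally show "cf (lap L u) k = - (q k *\<^sub>R cf u k)" .
qed

lemma has_sum_sob1:
  assumes u: "u \<in> Sob L (Suc 0)"
  shows "((\<lambda>k. (1 + q k) * (norm (cf u k))\<^sup>2) has_sum sob_sqnorm L (Suc 0) u) UNIV"
proof -
  have uL: "u \<in> L2 L" using u by simp
  have "((\<lambda>k. (norm (cf u k))\<^sup>2 + ((kap L k $ 1)\<^sup>2 * (norm (cf u k))\<^sup>2 + (kap L k $ 2)\<^sup>2 * (norm (cf u k))\<^sup>2))
     has_sum (l2_norm L u)\<^sup>2 + ((l2_norm L (weak_partial L 1 u))\<^sup>2 + (l2_norm L (weak_partial L 2 u))\<^sup>2)) UNIV"
    by (intro has_sum_add parseval_norm uL has_sum_partial weak_partial_Sob1(1)[OF u])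
  moreover have "(norm (cf u k))\<^sup>2 + ((kap L k $ 1)\<^sup>2 * (norm (cf u k))\<^sup>2 + (kap L k $ 2)\<^sup>2 * (norm (cf u k))\<^sup>2) = (1 + q k) * (norm (cf u k))\<^sup>2" for k
    using q_sum[of k, symmetric] by (simp add: sum_2 algebra_simps)
  ultimately show ?thesis by (simp add: sum_2)
qed

text \<open>The weight is what the recursive norm produces, \<open>1\<close> plus the sum over
  \<open>j\<close> of \<open>(kap L k $ j)\<^sup>2 * (1 + q k)\<close>.\<close>

lemma has_sum_h2:
  assumes u: "u \<in> H2 L"
  shows "((\<lambda>k. (1 + q k + (q k)\<^sup>2) * (norm (cf u k))\<^sup>2) has_sum (h2_norm L u)\<^sup>2) UNIV"
proof -
  have s: "u \<in> Sob L (Suc 0)" by (rule H2_Sob1[OF u])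
  have 1: "((\<lambda>k. (kap L k $ j)\<^sup>2 * ((1 + q k) * (norm (cf u k))\<^sup>2)) has_sum sob_sqnorm L (Suc 0) (weak_partial L j u)) UNIV" for j
    using has_sum_sob1[OF H2_partial[OF u, of j]]
    by (subst has_sum_uminus_index[symmetric]) (simp add: weak_partial_Sob1(3)[OF s] power_mult_distrib mult_ac)
  have "((\<lambda>k. (norm (cf u k))\<^sup>2 + ((kap L k $ 1)\<^sup>2 * ((1 + q k) * (norm (cf u k))\<^sup>2) + (kap L k $ 2)\<^sup>2 * ((1 + q k) * (norm (cf u k))\<^sup>2)))
     has_sum (l2_norm L u)\<^sup>2 + (sob_sqnorm L (Suc 0) (weak_partial L 1 u) + sob_sqnorm L (Suc 0) (weak_partial L 2 u))) UNIV"
    by (intro has_sum_add parseval_norm H2_L2[OF u] 1)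
  moreover have "(norm (cf u k))\<^sup>2 + ((kap L k $ 1)\<^sup>2 * ((1 + q k) * (norm (cf u k))\<^sup>2) + (kap L k $ 2)\<^sup>2 * ((1 + q k) * (norm (cf u k))\<^sup>2)) = (1 + q k + (q k)\<^sup>2) * (norm (cf u k))\<^sup>2" for k
  proof -
    have e: "(kap L k $ 1)\<^sup>2 + (kap L k $ 2)\<^sup>2 = q k" using q_sum[of k] by (simp add: sum_2)
    show ?thesis unfolding distrib_right[symmetric] e by (simp add: power2_eq_square algebra_simps)
  qed
  moreover have "(h2_norm L u)\<^sup>2 = (l2_norm L u)\<^sup>2 + (sob_sqnorm L (Suc 0) (weak_partial L 1 u) + sob_sqnorm L (Suc 0) (weak_partial L 2 u))"
  proof -
    have "sob_sqnorm L 2 u = sob_sqnorm L (Suc (Suc 0)) u" by (simp only: numeral_2_eq_2)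
    then show ?thesis by (simp only: h2_norm_sq sob_sqnorm.simps(2)[of L "Suc 0"] sum_2)
  qed
  ultimately show ?thesis by (simp only:)
qed

lemma h2_weight_pos: "0 \<le> 1 + q k + (q k)\<^sup>2" "1 \<le> 1 + q k + (q k)\<^sup>2"
  using q_nonneg[of k] zero_le_power2[of "q k"] by linarith+

lemma l2_le_h2: "u \<in> H2 L \<Longrightarrow> l2_norm L u \<le> h2_norm L u"
  by (rule power2_le_imp_le, rule has_sum_mono[OF parseval_norm has_sum_h2])
     (auto simp: H2_L2 h2_weight_pos intro: mult_left_le_one_le order.trans[OF _ mult_right_mono[OF h2_weight_pos(2)]])

lemma lap_le_h2: "u \<in> H2 L \<Longrightarrow> l2_norm L (lap L u) \<le> h2_norm L u"
proof -
  assume u: "u \<in> H2 L"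
  have "(norm (cf (lap L u) k))\<^sup>2 \<le> (1 + q k + (q k)\<^sup>2) * (norm (cf u k))\<^sup>2" for k
    unfolding lap_H2(2)[OF u] using q_nonneg[of k] by (simp add: power_mult_distrib mult_right_mono)
  then show ?thesis
    by (intro power2_le_imp_le[OF has_sum_mono[OF parseval_norm[OF lap_H2(1)[OF u]] has_sum_h2[OF u]]] h2_norm_nonneg)
qed

lemma norm_lincomb_sq_le:
  "(norm (a *\<^sub>R x + b *\<^sub>R y))\<^sup>2 \<le> 2 * a\<^sup>2 * (norm x)\<^sup>2 + 2 * b\<^sup>2 * (norm (y::real^2))\<^sup>2"
  using norm_add_sq_le[of "a *\<^sub>R x" "b *\<^sub>R y"] by (simp add: power_mult_distrib)

lemma H2_lincomb:
  assumes u: "u \<in> H2 L" and v: "v \<in> H2 L"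
  shows "(\<lambda>x. a *\<^sub>R u x + b *\<^sub>R v x) \<in> H2 L"
proof -
  have uv: "u \<in> L2 L" "v \<in> L2 L" using u v by (auto simp: H2_L2)
  have "(\<lambda>k. 2 * a\<^sup>2 * ((q k)\<^sup>2 * (norm (cf u k))\<^sup>2) + 2 * b\<^sup>2 * ((q k)\<^sup>2 * (norm (cf v k))\<^sup>2)) summable_on UNIV"
    using u v by (intro summable_on_add summable_on_cmult_right) (auto simp: H2_iff)
  then have "(\<lambda>k. (q k)\<^sup>2 * (norm (cf (\<lambda>x. a *\<^sub>R u x + b *\<^sub>R v x) k))\<^sup>2) summable_on UNIV"
  proof (rule summable_on_comparison_test)
    fix k
    show "(q k)\<^sup>2 * (norm (cf (\<lambda>x. a *\<^sub>R u x + b *\<^sub>R v x) k))\<^sup>2 \<le> 2 * a\<^sup>2 * ((q k)\<^sup>2 * (norm (cf u k))\<^sup>2) + 2 * b\<^sup>2 * ((q k)\<^sup>2 * (norm (cf v k))\<^sup>2)"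
      unfolding cf_lincomb[OF uv]
      using mult_left_mono[OF norm_lincomb_sq_le[of a "cf u k" b "cf v k"], of "(q k)\<^sup>2"] by (simp add: algebra_simps)
  qed simp
  then show ?thesis unfolding H2_iff using uv by (simp add: L2_lincomb)
qed

lemma H2_minus: "u \<in> H2 L \<Longrightarrow> v \<in> H2 L \<Longrightarrow> u - v \<in> H2 L"
  using H2_lincomb[of u v 1 "-1"] by (simp add: fun_diff_def)

lemma h2_norm_scale:
  assumes u: "u \<in> H2 L" shows "h2_norm L (\<lambda>x. a *\<^sub>R u x) = \<bar>a\<bar> * h2_norm L u"
proof -
  have au: "(\<lambda>x. a *\<^sub>R u x) \<in> H2 L" using H2_lincomb[OF u u, of a 0] by simp
  have "cf (\<lambda>x. a *\<^sub>R u x) k = a *\<^sub>R cf u k" for k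
    using cf_lincomb[OF H2_L2[OF u] H2_L2[OF u], of a 0] by simp
  then have "((\<lambda>k. a\<^sup>2 * ((1 + q k + (q k)\<^sup>2) * (norm (cf u k))\<^sup>2)) has_sum (h2_norm L (\<lambda>x. a *\<^sub>R u x))\<^sup>2) UNIV"
    using has_sum_h2[OF au] by (simp add: power_mult_distrib mult_ac)
  then have "(h2_norm L (\<lambda>x. a *\<^sub>R u x))\<^sup>2 = a\<^sup>2 * (h2_norm L u)\<^sup>2"
    by (rule has_sum_unique[OF _ has_sum_cmult_right[OF has_sum_h2[OF u]]])
  then have "(h2_norm L (\<lambda>x. a *\<^sub>R u x))\<^sup>2 = (\<bar>a\<bar> * h2_norm L u)\<^sup>2" by (simp add: power_mult_distrib)
  then show ?thesis by (rule power2_eq_imp_eq) auto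
qed

lemma h2_norm_minus_sq_le:
  assumes u: "u \<in> H2 L" and v: "v \<in> H2 L"
  shows "(h2_norm L (u - v))\<^sup>2 \<le> 2 * (h2_norm L u)\<^sup>2 + 2 * (h2_norm L v)\<^sup>2"
proof (rule has_sum_mono[OF has_sum_h2[OF H2_minus[OF u v]]
      has_sum_add[OF has_sum_cmult_right[OF has_sum_h2[OF u]] has_sum_cmult_right[OF has_sum_h2[OF v]]]])
  fix k
  have "(norm (cf (u - v) k))\<^sup>2 \<le> 2 * (norm (cf u k))\<^sup>2 + 2 * (norm (cf v k))\<^sup>2"
    using norm_lincomb_sq_le[of 1 "cf u k" "-1" "cf v k"] by (simp add: cf_minus H2_L2 u v)
  from mult_left_mono[OF this h2_weight_pos(1)[of k]]
  show "(1 + q k + (q k)\<^sup>2) * (norm (cf (u - v) k))\<^sup>2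
    \<le> 2 * ((1 + q k + (q k)\<^sup>2) * (norm (cf u k))\<^sup>2) + 2 * ((1 + q k + (q k)\<^sup>2) * (norm (cf v k))\<^sup>2)"
    by (simp add: algebra_simps)
qed

lemma zero_H2: "(\<lambda>x. 0) \<in> H2 L"
  by (simp add: H2_iff L2_zero cf_zero)

lemma h2_norm_zero: "h2_norm L (\<lambda>x. 0) = 0"
  using h2_norm_scale[OF zero_H2, of 0] by simp

lemma syn_H2: "finite F \<Longrightarrow> syn F c \<in> H2 L"
  unfolding H2_iff by (auto simp: syn_L2 cf_syn intro!: finite_nonzero_values_imp_summable_on elim!: finite_subset[rotated] split: if_splits)

lemma bas_H2: "(\<lambda>x. bas k x *\<^sub>R a) \<in> H2 L"
  using syn_H2[of "{k}" "\<lambda>_. a"] by (simp add: syn_def[abs_def])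

section \<open>The dual norm\<close>

lemma Hm2_bdd:
  assumes F: "F \<in> Hm2 L"
  shows "bdd_above ((\<lambda>v. \<bar>F v\<bar>) ` {v \<in> H2 L. h2_norm L v \<le> 1})"
proof -
  obtain C where C: "\<And>v. v \<in> H2 L \<Longrightarrow> \<bar>F v\<bar> \<le> C * h2_norm L v"
    using F unfolding Hm2_def by blast
  show ?thesis
  proof (rule bdd_aboveI[of _ "\<bar>C\<bar>"])
    fix y assume "y \<in> (\<lambda>v. \<bar>F v\<bar>) ` {v \<in> H2 L. h2_norm L v \<le> 1}"
    then obtain v where v: "v \<in> H2 L" "h2_norm L v \<le> 1" "y = \<bar>F v\<bar>" by blast
    have "C * h2_norm L v \<le> \<bar>C\<bar> * 1" using v by (intro mult_mono) auto
    then show "y \<le> \<bar>C\<bar>" using C[OF v(1)] v(3) by linarith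
  qed
qed

text \<open>Scaling \<open>v\<close> to norm 1 fails if its seminorm is 0; in that case the bound in
  the definition of \<open>Hm2\<close> forces \<open>F v = 0\<close>.\<close>

lemma Hm2_bound:
  assumes F: "F \<in> Hm2 L" and v: "v \<in> H2 L"
  shows "\<bar>F v\<bar> \<le> hm2_norm L F * h2_norm L v"
proof -
  obtain C where C: "\<And>v. v \<in> H2 L \<Longrightarrow> \<bar>F v\<bar> \<le> C * h2_norm L v" using F unfolding Hm2_def by blast
  have lin: "F (\<lambda>x. a *\<^sub>R v x) = a * F v" for a
  proof -
    have "F (\<lambda>x. a *\<^sub>R v x + 0 *\<^sub>R v x) = a * F v + 0 * F v" using F v unfolding Hm2_def by blast
    then show ?thesis by simp
  qed
  show ?thesis
  proof (cases "h2_norm L v = 0")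
    case True
    then show ?thesis using C[OF v] by simp
  next
    case False
    then have pos: "h2_norm L v > 0" using h2_norm_nonneg[of L v] by linarith
    define w where "w = (\<lambda>x. (1 / h2_norm L v) *\<^sub>R v x)"
    have w: "w \<in> H2 L" unfolding w_def using H2_lincomb[OF v v, of "1 / h2_norm L v" 0] by simp
    have "h2_norm L w = 1" unfolding w_def h2_norm_scale[OF v] using pos by simp
    then have "\<bar>F w\<bar> \<le> hm2_norm L F" unfolding hm2_norm_def using w by (intro cSUP_upper Hm2_bdd[OF F]) auto
    moreover have "\<bar>F w\<bar> = \<bar>F v\<bar> / h2_norm L v" unfolding w_def lin using pos by (simp add: abs_mult)
    ultimately show ?thesis using pos by (simp add: pos_divide_le_eq)
  qed
qed

lemma hm2_norm_le:
  assumes "0 \<le> C" "\<And>v. v \<in> H2 L \<Longrightarrow> \<bar>F v\<bar> \<le> C * h2_norm L v"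
  shows "hm2_norm L F \<le> C"
  unfolding hm2_norm_def
proof (rule cSUP_least)
  show "{v \<in> H2 L. h2_norm L v \<le> 1} \<noteq> {}" using zero_H2 h2_norm_zero by force
  fix v assume "v \<in> {v \<in> H2 L. h2_norm L v \<le> 1}"
  then have "\<bar>F v\<bar> \<le> C * h2_norm L v" "C * h2_norm L v \<le> C * 1"
    using assms by (auto intro!: mult_left_mono simp del: mult_1_right)
  then show "\<bar>F v\<bar> \<le> C" by simp
qed

lemma hm2_norm_nonneg: "F \<in> Hm2 L \<Longrightarrow> 0 \<le> hm2_norm L F"
proof -
  assume F: "F \<in> Hm2 L"
  have "\<bar>F (\<lambda>x. 0)\<bar> \<le> hm2_norm L F"
    unfolding hm2_norm_def using zero_H2 h2_norm_zero by (intro cSUP_upper Hm2_bdd[OF F]) auto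
  then show ?thesis by linarith
qed

text \<open>The inequality \<open>(1 + a) * (1 + b) \<le> (1 + a + b)\<^sup>2\<close> dominates the
  plane sum by a product of two one-dimensional sums with terms of order
  \<open>n powr (- s)\<close>, so any exponent above 1 works. The constant \<open>c\<close> compares
  \<open>q k\<close> with the squared integer coordinates.\<close>

lemma weight_summable:
  assumes s: "s > 1" shows "(\<lambda>k. (1 + q k) powr (- s)) summable_on UNIV"
proof -
  define w where "w = 2 * pi / L"
  define c where "c = min 1 (w\<^sup>2)"
  define f where "f n = (1 + (real n)\<^sup>2) powr (- s / 2)" for n
  have w: "w > 0" using L by (simp add: w_def)
  then have c: "0 < c" "c \<le> 1" "c \<le> w\<^sup>2" by (auto simp: c_def)
  have "summable f"
  proof (rule summable_comparison_test)
    show "summable (\<lambda>n. real n powr (- s))" using s by (simp add: summable_real_powr_iff)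
    have "f n \<le> real n powr (- s)" if "n \<ge> 1" for n
    proof -
      have "f n \<le> ((real n)\<^sup>2) powr (- s / 2)" unfolding f_def using that s by (intro powr_mono2') auto
      also have "\<dots> = real n powr (- s)" using that by (simp add: powr_powr flip: powr_numeral)
      finally show ?thesis .
    qed
    then show "\<exists>N. \<forall>n\<ge>N. norm (f n) \<le> real n powr - s" by (intro exI[of _ 1]) (auto simp: f_def)
  qed
  then have fi: "(\<lambda>m::int. f (nat \<bar>m\<bar>)) summable_on UNIV" by (rule summable_on_nat_int) (simp add: f_def)
  have "(\<lambda>k::int\<times>int. c powr (- s) * (f (nat \<bar>fst k\<bar>) * f (nat \<bar>snd k\<bar>))) summable_on UNIV"
    by (intro summable_on_cmult_right summable_on_prod_mult[OF fi _ fi]) (auto simp: f_def)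
  then show ?thesis
  proof (rule summable_on_comparison_test)
    fix k :: "int \<times> int"
    define a b where "a = (real_of_int (fst k))\<^sup>2" and "b = (real_of_int (snd k))\<^sup>2"
    have ab: "0 \<le> a" "0 \<le> b" by (auto simp: a_def b_def)
    have qk: "q k = w\<^sup>2 * (a + b)"
      unfolding q_sum[symmetric] sum_2 by (simp add: kap_def w_def a_def b_def power_mult_distrib power_divide distrib_left)
    have "c * (1 + a + b) \<le> 1 + q k"
      using mult_right_mono[OF c(3), of "a + b"] c ab by (simp add: qk algebra_simps)
    moreover have "((1 + a) * (1 + b)) powr (1 / 2) \<le> 1 + a + b"
    proof -
      have "(1 + a) * (1 + b) \<le> (1 + a + b)\<^sup>2" using ab by (simp add: power2_eq_square algebra_simps)
      then show ?thesis using ab by (simp add: powr_half_sqrt real_le_lsqrt)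
    qed
    ultimately have "c * ((1 + a) * (1 + b)) powr (1 / 2) \<le> 1 + q k"
      using mult_left_mono[of "((1 + a) * (1 + b)) powr (1 / 2)" "1 + a + b" c] c by linarith
    then have "(1 + q k) powr (- s) \<le> (c * ((1 + a) * (1 + b)) powr (1 / 2)) powr (- s)"
      using c ab s by (intro powr_mono2') auto
    also have "\<dots> = c powr (- s) * (f (nat \<bar>fst k\<bar>) * f (nat \<bar>snd k\<bar>))"
      using c ab by (simp add: powr_mult powr_powr f_def a_def b_def)
    finally show "(1 + q k) powr (- s) \<le> c powr (- s) * (f (nat \<bar>fst k\<bar>) * f (nat \<bar>snd k\<bar>))" .
  qed simp
qed

end

definition h1_norm :: "real \<Rightarrow> (real^2 \<Rightarrow> real^2) \<Rightarrow> real" where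
  "h1_norm L u = sqrt (sob_sqnorm L (Suc 0) u)"

lemma h1_norm_nonneg [simp]: "0 \<le> h1_norm L u"
  by (simp add: h1_norm_def sob_sqnorm_nonneg del: sob_sqnorm.simps)

lemma h1_norm_sq: "(h1_norm L u)\<^sup>2 = sob_sqnorm L (Suc 0) u"
  by (simp add: h1_norm_def sob_sqnorm_nonneg del: sob_sqnorm.simps)

lemma l2_norm_mono:
  assumes "u \<in> L2 L" "v \<in> L2 L" "0 \<le> c" "\<And>x. norm (u x) \<le> c * norm (v x)"
  shows "l2_norm L u \<le> c * l2_norm L v"
proof (rule power2_le_imp_le)
  have "(\<integral>x. (norm (u x))\<^sup>2 \<partial>mu L) \<le> (\<integral>x. c\<^sup>2 * (norm (v x))\<^sup>2 \<partial>mu L)"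
  proof (rule integral_mono)
    show "(norm (u x))\<^sup>2 \<le> c\<^sup>2 * (norm (v x))\<^sup>2" for x
      using power_mono[OF assms(4)[of x], of 2] by (simp add: power_mult_distrib)
  qed (use L2_D(3)[OF assms(1)] L2_D(3)[OF assms(2)] in simp_all)
  then show "(l2_norm L u)\<^sup>2 \<le> (c * l2_norm L v)\<^sup>2"
    by (simp add: l2_norm_sq l2_inner_eq dot_square_norm power_mult_distrib)
qed (use assms in simp)

context torus
begin

lemma Sob1_L2: "u \<in> Sob L (Suc 0) \<Longrightarrow> u \<in> L2 L"
  by simp

lemma Sob1_minus:
  assumes u: "u \<in> Sob L (Suc 0)" and v: "v \<in> Sob L (Suc 0)"
  shows "u - v \<in> Sob L (Suc 0)"
proof -
  have uv: "u \<in> L2 L" "v \<in> L2 L" using u v by simp_all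
  have "(\<lambda>k. 2 * (q k * (norm (cf u k))\<^sup>2) + 2 * (q k * (norm (cf v k))\<^sup>2)) summable_on UNIV"
    using u[unfolded Sob1_iff] v[unfolded Sob1_iff] by (intro summable_on_add summable_on_cmult_right; blast)
  then have "(\<lambda>k. q k * (norm (cf (u - v) k))\<^sup>2) summable_on UNIV"
  proof (rule summable_on_comparison_test)
    fix k
    show "q k * (norm (cf (u - v) k))\<^sup>2 \<le> 2 * (q k * (norm (cf u k))\<^sup>2) + 2 * (q k * (norm (cf v k))\<^sup>2)"
      unfolding cf_minus[OF uv]
      using mult_left_mono[OF norm_lincomb_sq_le[of 1 "cf u k" "-1" "cf v k"] q_nonneg[of k]] by (simp add: algebra_simps)
  qed simp
  then show ?thesis unfolding Sob1_iff using L2_minus[OF uv] by blast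
qed

text \<open>\<open>weak_partial\<close> is a choice and need not be additive, but the difference of
  the chosen derivatives is a weak derivative of \<open>u - v\<close>, and its norm is determined by
  the coefficients.\<close>

lemma partial_diff_le:
  assumes u: "u \<in> Sob L (Suc 0)" and v: "v \<in> Sob L (Suc 0)"
  shows "l2_norm L (\<lambda>x. weak_partial L j u x - weak_partial L j v x) \<le> h1_norm L (u - v)"
proof (rule power2_le_imp_le)
  have uv: "u \<in> L2 L" "v \<in> L2 L" using u v by simp_all
  have wp: "is_weak_partial L j (u - v) (\<lambda>x. weak_partial L j u x - weak_partial L j v x)"
    unfolding is_weak_partial_iff
    using uv weak_partial_Sob1[OF u] weak_partial_Sob1[OF v]
    by (simp add: L2_minus L2_diff cf_diff cf_minus scaleR_diff_right del: Sob.simps)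
  show "(l2_norm L (\<lambda>x. weak_partial L j u x - weak_partial L j v x))\<^sup>2 \<le> (h1_norm L (u - v))\<^sup>2"
    unfolding h1_norm_sq
  proof (rule has_sum_mono[OF has_sum_partial[OF wp] has_sum_sob1[OF Sob1_minus[OF u v]]])
    fix k
    show "(kap L k $ j)\<^sup>2 * (norm (cf (u - v) k))\<^sup>2 \<le> (1 + q k) * (norm (cf (u - v) k))\<^sup>2"
      using kap_sq_le[of k j] by (intro mult_right_mono) auto
  qed
qed simp

lemma partial_le_h1: "u \<in> Sob L (Suc 0) \<Longrightarrow> l2_norm L (weak_partial L j u) \<le> h1_norm L u"
proof (rule power2_le_imp_le)
  assume u: "u \<in> Sob L (Suc 0)"
  show "(l2_norm L (weak_partial L j u))\<^sup>2 \<le> (h1_norm L u)\<^sup>2"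
    unfolding h1_norm_sq
  proof (rule has_sum_mono[OF has_sum_partial[OF weak_partial_Sob1(1)[OF u]] has_sum_sob1[OF u]])
    fix k show "(kap L k $ j)\<^sup>2 * (norm (cf u k))\<^sup>2 \<le> (1 + q k) * (norm (cf u k))\<^sup>2"
      using kap_sq_le[of k j] by (intro mult_right_mono) auto
  qed
qed simp

lemma l2_le_h1: "u \<in> Sob L (Suc 0) \<Longrightarrow> l2_norm L u \<le> h1_norm L u"
proof (rule power2_le_imp_le)
  assume u: "u \<in> Sob L (Suc 0)"
  show "(l2_norm L u)\<^sup>2 \<le> (h1_norm L u)\<^sup>2"
    unfolding h1_norm_sq
  proof (rule has_sum_mono[OF parseval_norm[OF Sob1_L2[OF u]] has_sum_sob1[OF u]])
    fix k show "(norm (cf u k))\<^sup>2 \<le> (1 + q k) * (norm (cf u k))\<^sup>2"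
      using mult_right_mono[of 1 "1 + q k" "(norm (cf u k))\<^sup>2"] by simp
  qed
qed simp

lemma h1_le_h2: "u \<in> H2 L \<Longrightarrow> h1_norm L u \<le> h2_norm L u"
proof (rule power2_le_imp_le)
  assume u: "u \<in> H2 L"
  show "(h1_norm L u)\<^sup>2 \<le> (h2_norm L u)\<^sup>2"
    unfolding h1_norm_sq
  proof (rule has_sum_mono[OF has_sum_sob1[OF H2_Sob1[OF u]] has_sum_h2[OF u]])
    fix k show "(1 + q k) * (norm (cf u k))\<^sup>2 \<le> (1 + q k + (q k)\<^sup>2) * (norm (cf u k))\<^sup>2"
      by (intro mult_right_mono) auto
  qed
qed simp

text \<open>Constant of the embedding of H2 into the bounded functions: \<open>2 / L\<close> bounds
  the basis functions, the lattice sum comes from Cauchy-Schwarz, and the inner factor 2 from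
  \<open>(1 + q k)\<^sup>2 \<le> 2 * (1 + q k + (q k)\<^sup>2)\<close>.\<close>

definition Csob :: real where
  "Csob = 2 / L * sqrt (2 * (\<Sum>\<^sub>\<infinity>k. (1 + q k) powr (- 2)))"

lemma Csob_nonneg: "0 \<le> Csob"
  unfolding Csob_def using L by (intro mult_nonneg_nonneg real_sqrt_ge_zero infsum_nonneg) auto

text \<open>The sup bound is stated for finite Fourier sums, which have well-defined values at every
  point. Elements of H2 enter only through limits of integrals against such sums.\<close>

lemma norm_syn_le:
  assumes F: "finite F"
  shows "norm (syn F c x) \<le> Csob * sqrt (\<Sum>k\<in>F. (1 + q k + (q k)\<^sup>2) * (norm (c k))\<^sup>2)"
proof -
  let ?S = "\<Sum>k\<in>F. (1 + q k + (q k)\<^sup>2) * (norm (c k))\<^sup>2"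
  let ?W = "\<Sum>\<^sub>\<infinity>k. (1 + q k) powr (- 2)"
  have "norm (syn F c x) \<le> (\<Sum>k\<in>F. 2 / L * norm (c k))"
    unfolding syn_def by (rule sum_norm_le) (simp add: mult_right_mono[OF abs_bas_le] del: times_divide_eq_left)
  also have "\<dots> = 2 / L * (\<Sum>k\<in>F. (1 + q k) powr (- 1) * ((1 + q k) * norm (c k)))"
    unfolding sum_distrib_left
    by (intro sum.cong refl) (simp add: powr_minus_divide add_pos_nonneg add_nonneg_eq_0_iff)
  also have "(\<Sum>k\<in>F. (1 + q k) powr (- 1) * ((1 + q k) * norm (c k))) \<le> sqrt (2 * ?W) * sqrt ?S"
  proof -
    have "(\<Sum>k\<in>F. (1 + q k) powr (- 1) * ((1 + q k) * norm (c k)))\<^sup>2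
      \<le> (\<Sum>k\<in>F. ((1 + q k) powr (- 1))\<^sup>2) * (\<Sum>k\<in>F. ((1 + q k) * norm (c k))\<^sup>2)"
      by (rule Cauchy_Schwarz_ineq_sum)
    also have "\<dots> \<le> ?W * (2 * ?S)"
    proof (rule mult_mono)
      have "((1 + q k) powr (- 1))\<^sup>2 = (1 + q k) powr (- 2)" for k
        by (subst power2_eq_square, subst powr_add[symmetric]) simp
      then show "(\<Sum>k\<in>F. ((1 + q k) powr (- 1))\<^sup>2) \<le> ?W"
        using weight_summable[of 2] F by (simp add: finite_sum_le_infsum)
      have "((1 + q k) * norm (c k))\<^sup>2 \<le> 2 * ((1 + q k + (q k)\<^sup>2) * (norm (c k))\<^sup>2)" for k
      proof -
        have "(1 + q k)\<^sup>2 \<le> 2 * (1 + q k + (q k)\<^sup>2)" by (simp add: power2_eq_square algebra_simps)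
        from mult_right_mono[OF this, of "(norm (c k))\<^sup>2"] show ?thesis by (simp only: power_mult_distrib mult.assoc) simp
      qed
      then show "(\<Sum>k\<in>F. ((1 + q k) * norm (c k))\<^sup>2) \<le> 2 * ?S" unfolding sum_distrib_left by (rule sum_mono)
    qed (auto intro: infsum_nonneg sum_nonneg)
    finally have "(\<Sum>k\<in>F. (1 + q k) powr (- 1) * ((1 + q k) * norm (c k)))\<^sup>2 \<le> 2 * ?W * ?S" by (simp add: mult_ac)
    from real_le_rsqrt[OF this] show ?thesis by (simp only: real_sqrt_mult)
  qed
  finally show ?thesis using L unfolding Csob_def by (simp add: mult_left_mono divide_right_mono mult.assoc)
qed

lemma norm_syn_cf_le:
  assumes F: "finite F" and v: "v \<in> H2 L"
  shows "norm (syn F (cf v) x) \<le> Csob * h2_norm L v"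
proof -
  have "(\<Sum>k\<in>F. (1 + q k + (q k)\<^sup>2) * (norm (cf v k))\<^sup>2) \<le> (h2_norm L v)\<^sup>2"
    using F by (intro finite_sum_le_has_sum[OF has_sum_h2[OF v]]) (auto simp: h2_weight_pos)
  then have "sqrt (\<Sum>k\<in>F. (1 + q k + (q k)\<^sup>2) * (norm (cf v k))\<^sup>2) \<le> h2_norm L v"
    by (rule real_le_lsqrt[OF h2_norm_nonneg])
  from mult_left_mono[OF this Csob_nonneg] show ?thesis using norm_syn_le[OF F, of "cf v" x] by linarith
qed

lemma l2_inner_syn_lim:
  assumes u: "u \<in> L2 L" and v: "v \<in> L2 L"
  shows "(\<lambda>n. l2_inner L u (syn (fbox n) (cf v))) \<longlonglongrightarrow> l2_inner L u v"
  using has_sum_fbox[OF parseval[OF u v]] by (simp add: l2_inner_syn u)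

lemma l2_norm_syn_cf_le: "finite F \<Longrightarrow> v \<in> L2 L \<Longrightarrow> l2_norm L (syn F (cf v)) \<le> l2_norm L v"
  by (rule power2_le_imp_le) (auto simp: l2_norm_syn bessel)

end

section \<open>The calmed advection term\<close>

locale calmed = torus +
  fixes \<eta> :: "real^2 \<Rightarrow> real^2" and M :: real
  assumes bound: "\<And>y. norm (\<eta> y) \<le> M" and lip: "1-lipschitz_on UNIV \<eta>"
begin

abbreviation adv :: "(real^2 \<Rightarrow> real^2) \<Rightarrow> real^2 \<Rightarrow> real^2" where
  "adv \<equiv> calmed_advection L \<eta>"

lemma M_nonneg: "0 \<le> M"
  using order.trans[OF norm_ge_zero bound] .

lemma comp_le: "\<bar>\<eta> y $ j\<bar> \<le> M"
  using component_le_norm_cart[of "\<eta> y" j] bound[of y] by linarith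

lemma comp_lip: "\<bar>\<eta> y $ j - \<eta> z $ j\<bar> \<le> norm (y - z)"
proof -
  have "norm (\<eta> y - \<eta> z) \<le> norm (y - z)" using lipschitz_onD[OF lip, of y z] by (simp add: dist_norm)
  then show ?thesis using component_le_norm_cart[of "\<eta> y - \<eta> z" j] by simp
qed

lemma adv_term_L2:
  assumes u: "u \<in> Sob L (Suc 0)"
  shows "(\<lambda>x. (\<eta> (u x) $ j) *\<^sub>R weak_partial L j u x) \<in> L2 L"
proof (rule L2_scaleR_bounded[OF weak_partial_Sob1(2)[OF u] _ _ comp_le])
  have uL: "u \<in> L2 L" using u by simp
  have "continuous_on UNIV (\<lambda>y. \<eta> y $ j)" by (intro continuous_intros lipschitz_on_continuous_on[OF lip])
  then show "(\<lambda>x. \<eta> (u x) $ j) \<in> borel_measurable lebesgue"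
    using measurable_compose[OF L2_D(2)[OF uL] borel_measurable_continuous_onI] by blast
  show "periodic L (\<lambda>x. \<eta> (u x) $ j)" using L2_D(1)[OF uL] by (simp add: periodic_def)
qed

lemma adv_L2: "u \<in> Sob L (Suc 0) \<Longrightarrow> adv u \<in> L2 L"
  unfolding calmed_advection_def by (intro L2_sum adv_term_L2)

lemma l2_inner_adv:
  assumes u: "u \<in> Sob L (Suc 0)" and p: "p \<in> L2 L"
  shows "l2_inner L (adv u) p = (\<Sum>j\<in>UNIV. l2_inner L (\<lambda>x. (\<eta> (u x) $ j) *\<^sub>R weak_partial L j u x) p)"
  unfolding l2_inner_eq calmed_advection_def inner_sum_left
  by (intro Bochner_Integration.integral_sum L2_inner_integrable adv_term_L2 u p)

lemma l2_norm_adv_le: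
  assumes u: "u \<in> Sob L (Suc 0)" shows "l2_norm L (adv u) \<le> 2 * M * h1_norm L u"
proof -
  let ?T = "\<lambda>j x. (\<eta> (u x) $ j) *\<^sub>R weak_partial L j u x"
  have T: "l2_norm L (?T j) \<le> M * h1_norm L u" for j
  proof -
    have "l2_norm L (?T j) \<le> M * l2_norm L (weak_partial L j u)"
      by (intro l2_norm_mono adv_term_L2 weak_partial_Sob1(2) u M_nonneg)
         (simp add: mult_right_mono comp_le)
    also have "\<dots> \<le> M * h1_norm L u" by (intro mult_left_mono partial_le_h1 u M_nonneg)
    finally show ?thesis .
  qed
  have "l2_norm L (adv u) \<le> l2_norm L (?T 1) + l2_norm L (?T 2)"
    unfolding calmed_advection_def sum_2 by (intro l2_norm_add_le adv_term_L2 u)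
  then show ?thesis using T[of 1] T[of 2] by linarith
qed

text \<open>Split the difference into \<open>\<eta> (u x)\<close> times the gradient of
  \<open>u - v\<close> and the increment of \<open>\<eta>\<close> times the gradient of
  \<open>v\<close>. The second product is only integrable, hence the pointwise bound
  \<open>P\<close> on the test function. The choice of \<open>p\<close> stays open: truncations of
  \<open>u - v\<close> serve the energy estimate, basis functions the coefficient estimate,
  truncated H2 functions the dual norm.\<close>

lemma adv_diff_inner:
  assumes u: "u \<in> Sob L (Suc 0)" and v: "v \<in> Sob L (Suc 0)" and p: "p \<in> L2 L"
    and P: "\<And>x. norm (p x) \<le> P"
  shows "\<bar>l2_inner L (adv u) p - l2_inner L (adv v) p\<bar>
    \<le> 2 * M * h1_norm L (u - v) * l2_norm L p + 2 * P * l2_norm L (u - v) * h1_norm L v"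
proof -
  define w where "w x = u x - v x" for x
  define D where "D j x = weak_partial L j u x - weak_partial L j v x" for j x
  define T where "T u j x = (\<eta> (u x) $ j) *\<^sub>R weak_partial L j u x" for u j x
  have uv: "u \<in> L2 L" "v \<in> L2 L" using u v by simp_all
  have w: "w \<in> L2 L" "w = u - v" unfolding w_def by (auto intro: L2_diff uv simp: fun_diff_def)
  have D: "D j \<in> L2 L" for j unfolding D_def by (intro L2_diff weak_partial_Sob1(2) u v)
  have wv: "weak_partial L j v \<in> L2 L" for j by (rule weak_partial_Sob1(2)[OF v])
  have T: "T u j \<in> L2 L" "T v j \<in> L2 L" for j unfolding T_def by (intro adv_term_L2 u v)+
  have P0: "0 \<le> P" using order.trans[OF norm_ge_zero P] .
  have main: "\<bar>l2_inner L (T u j) p - l2_inner L (T v j) p\<bar>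
      \<le> M * h1_norm L (u - v) * l2_norm L p + P * l2_norm L (u - v) * h1_norm L v" for j
  proof -
    have i1: "integrable (mu L) (\<lambda>x. M * (norm (D j x) * norm (p x)))"
      and i2: "integrable (mu L) (\<lambda>x. P * (norm (w x) * norm (weak_partial L j v x)))"
      by (intro integrable_mult_right l2_cauchy_schwarz_norm D p w wv)+
    have pt: "norm ((T u j x - T v j x) \<bullet> p x) \<le> M * (norm (D j x) * norm (p x)) + P * (norm (w x) * norm (weak_partial L j v x))" for x
    proof -
      have "T u j x - T v j x = (\<eta> (u x) $ j) *\<^sub>R D j x + (\<eta> (u x) $ j - \<eta> (v x) $ j) *\<^sub>R weak_partial L j v x"
        by (simp add: T_def D_def algebra_simps)
      then have "norm (T u j x - T v j x) \<le> M * norm (D j x) + norm (w x) * norm (weak_partial L j v x)"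
        using norm_triangle_ineq[of "(\<eta> (u x) $ j) *\<^sub>R D j x" "(\<eta> (u x) $ j - \<eta> (v x) $ j) *\<^sub>R weak_partial L j v x"]
          mult_right_mono[OF comp_le[of "u x" j] norm_ge_zero[of "D j x"]]
          mult_right_mono[OF comp_lip[of "u x" j "v x"] norm_ge_zero[of "weak_partial L j v x"]]
        by (simp add: w_def)
      then have "norm (T u j x - T v j x) * norm (p x) \<le> (M * norm (D j x) + norm (w x) * norm (weak_partial L j v x)) * norm (p x)"
        by (rule mult_right_mono) simp
      also have "\<dots> \<le> M * (norm (D j x) * norm (p x)) + P * (norm (w x) * norm (weak_partial L j v x))"
        using mult_right_mono[OF P[of x], of "norm (w x) * norm (weak_partial L j v x)"] by (simp add: algebra_simps)
      finally show ?thesis using Cauchy_Schwarz_ineq2[of "T u j x - T v j x" "p x"] by (simp only: real_norm_def)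
    qed
    have "l2_inner L (T u j) p - l2_inner L (T v j) p = (\<integral>x. (T u j x - T v j x) \<bullet> p x \<partial>mu L)"
      using l2_inner_diff_left[OF T p, of j j] by (simp add: l2_inner_eq)
    moreover have "norm (\<integral>x. (T u j x - T v j x) \<bullet> p x \<partial>mu L)
      \<le> (\<integral>x. M * (norm (D j x) * norm (p x)) + P * (norm (w x) * norm (weak_partial L j v x)) \<partial>mu L)"
      by (intro Bochner_Integration.integral_norm_bound_integral L2_inner_integrable L2_diff T p pt Bochner_Integration.integrable_add i1 i2)
    moreover have "\<dots> = M * (\<integral>x. norm (D j x) * norm (p x) \<partial>mu L) + P * (\<integral>x. norm (w x) * norm (weak_partial L j v x) \<partial>mu L)"
      using i1 i2 by (simp add: Bochner_Integration.integral_add)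
    moreover have "\<dots> \<le> M * (l2_norm L (D j) * l2_norm L p) + P * (l2_norm L w * l2_norm L (weak_partial L j v))"
      by (intro add_mono mult_left_mono l2_cauchy_schwarz_norm D p w wv M_nonneg P0)
    moreover have "\<dots> \<le> M * (h1_norm L (u - v) * l2_norm L p) + P * (l2_norm L w * h1_norm L v)"
      unfolding D_def by (intro add_mono mult_left_mono mult_right_mono partial_diff_le partial_le_h1 u v M_nonneg P0 l2_norm_nonneg)
    ultimately show ?thesis using w(2) by (simp add: mult.assoc)
  qed
  have "l2_inner L (adv u) p - l2_inner L (adv v) p
    = (l2_inner L (T u 1) p - l2_inner L (T v 1) p) + (l2_inner L (T u 2) p - l2_inner L (T v 2) p)"
    unfolding l2_inner_adv[OF u p] l2_inner_adv[OF v p] T_def sum_2 by (simp only: add_diff_add)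
  then show ?thesis using main[of 1] main[of 2] by linarith
qed

text \<open>The truncations of \<open>p\<close> are bounded everywhere by
  \<open>Csob * h2_norm L p\<close>, so the estimate with a bounded test function applies to them
  and survives the limit.\<close>

lemma adv_diff_H2:
  assumes u: "u \<in> Sob L (Suc 0)" and v: "v \<in> Sob L (Suc 0)" and p: "p \<in> H2 L"
  shows "\<bar>l2_inner L (adv u) p - l2_inner L (adv v) p\<bar>
    \<le> (2 * M * h1_norm L (u - v) + 2 * Csob * l2_norm L (u - v) * h1_norm L v) * h2_norm L p"
proof -
  have pL: "p \<in> L2 L" by (rule H2_L2[OF p])
  have "(\<lambda>n. \<bar>l2_inner L (adv u) (syn (fbox n) (cf p)) - l2_inner L (adv v) (syn (fbox n) (cf p))\<bar>)
     \<longlonglongrightarrow> \<bar>l2_inner L (adv u) p - l2_inner L (adv v) p\<bar>"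
    by (intro tendsto_rabs tendsto_diff l2_inner_syn_lim adv_L2 u v pL)
  moreover have "\<bar>l2_inner L (adv u) (syn (fbox n) (cf p)) - l2_inner L (adv v) (syn (fbox n) (cf p))\<bar>
      \<le> (2 * M * h1_norm L (u - v) + 2 * Csob * l2_norm L (u - v) * h1_norm L v) * h2_norm L p" for n
  proof -
    have "\<bar>l2_inner L (adv u) (syn (fbox n) (cf p)) - l2_inner L (adv v) (syn (fbox n) (cf p))\<bar>
      \<le> 2 * M * h1_norm L (u - v) * l2_norm L (syn (fbox n) (cf p)) + 2 * (Csob * h2_norm L p) * l2_norm L (u - v) * h1_norm L v"
      by (intro adv_diff_inner u v syn_L2 norm_syn_cf_le p finite_fbox)
    moreover have "2 * M * h1_norm L (u - v) * l2_norm L (syn (fbox n) (cf p)) \<le> 2 * M * h1_norm L (u - v) * h2_norm L p"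
      using l2_norm_syn_cf_le[OF finite_fbox pL, of n] l2_le_h2[OF p] M_nonneg by (intro mult_left_mono) auto
    ultimately show ?thesis by (simp add: algebra_simps)
  qed
  ultimately show ?thesis by (intro LIMSEQ_le_const2) auto
qed

text \<open>The test function is a basis function, whose bound \<open>2 / L\<close> is independent
  of the frequency. This is the Lipschitz estimate that drives the iteration.\<close>

lemma cf_adv_diff:
  assumes u: "u \<in> Sob L (Suc 0)" and v: "v \<in> Sob L (Suc 0)"
  shows "norm (cf (adv u) k - cf (adv v) k) \<le> (2 * M + 4 / L * h1_norm L v) * h1_norm L (u - v)"
proof -
  define d where "d = cf (adv u) k - cf (adv v) k"
  \<comment> \<open>The direction of the coefficient difference, so that pairing with
    \<open>a\<close> returns its length; it is 0 if \<open>d\<close> is 0.\<close>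
  define a where "a = d /\<^sub>R norm d"
  let ?p = "\<lambda>x. bas k x *\<^sub>R a"
  have na: "norm a \<le> 1" by (cases "d = 0") (simp_all add: a_def)
  have n1: "l2_norm L ?p \<le> 1"
  proof -
    have "(l2_norm L (syn {k} (\<lambda>_. a)))\<^sup>2 = (norm a)\<^sup>2" by (subst l2_norm_syn) simp_all
    then have "l2_norm L (syn {k} (\<lambda>_. a)) = norm a" by (rule power2_eq_imp_eq) simp_all
    then show ?thesis using na by (simp add: syn_def[abs_def])
  qed
  have n2: "norm (?p x) \<le> 2 / L" for x
    using mult_mono[OF abs_bas_le[of k x] na] L by simp
  have "norm d = d \<bullet> a" by (cases "d = 0") (simp_all add: a_def dot_square_norm power2_eq_square)
  also have "\<dots> = l2_inner L (adv u) ?p - l2_inner L (adv v) ?p"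
    by (simp only: l2_inner_bas[OF adv_L2[OF u]] l2_inner_bas[OF adv_L2[OF v]] d_def inner_diff_left)
  also have "\<dots> \<le> 2 * M * h1_norm L (u - v) * l2_norm L ?p + 2 * (2 / L) * l2_norm L (u - v) * h1_norm L v"
    using adv_diff_inner[OF u v bas_L2 n2] by linarith
  also have "\<dots> \<le> 2 * M * h1_norm L (u - v) * 1 + 2 * (2 / L) * h1_norm L (u - v) * h1_norm L v"
    using L M_nonneg n1 by (intro add_mono mult_left_mono mult_right_mono l2_le_h1 Sob1_minus u v) auto
  finally show ?thesis by (simp add: d_def algebra_simps)
qed

lemma cf_adv_le:
  assumes u: "u \<in> Sob L (Suc 0)" shows "norm (cf (adv u) k) \<le> 2 * M * h1_norm L u"
  using norm_cf_le[OF adv_L2[OF u], of k] l2_norm_adv_le[OF u] by linarith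

end

section \<open>Absolutely continuous functions and weak derivatives in time\<close>

text \<open>Induction on the number of steps of length \<open>d / 2\<close>; the half makes each
  step strictly shorter than \<open>d\<close>. It replaces partitions of the interval in the
  arguments below, where estimates hold only on short intervals.\<close>

lemma chain_local_to_global:
  fixes P :: "real \<Rightarrow> real \<Rightarrow> bool"
  assumes d: "d > 0" and refl: "\<And>x. x \<in> {a..b} \<Longrightarrow> P x x"
    and loc: "\<And>x y. a \<le> x \<Longrightarrow> x \<le> y \<Longrightarrow> y \<le> b \<Longrightarrow> y - x < d \<Longrightarrow> P x y"
    and trans: "\<And>x y z. a \<le> x \<Longrightarrow> x \<le> y \<Longrightarrow> y \<le> z \<Longrightarrow> z \<le> b \<Longrightarrow> P x y \<Longrightarrow> P y z \<Longrightarrow> P x z"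
    and xy: "a \<le> x" "x \<le> y" "y \<le> b"
  shows "P x y"
proof -
  have "\<forall>y. x \<le> y \<longrightarrow> y \<le> b \<longrightarrow> y - x \<le> real n * (d / 2) \<longrightarrow> P x y" for n
  proof (induction n)
    case 0
    then show ?case using refl xy by auto
  next
    case (Suc n)
    show ?case
    proof (intro allI impI)
      fix y assume y: "x \<le> y" "y \<le> b" "y - x \<le> real (Suc n) * (d / 2)"
      define z where "z = max x (y - d / 2)"
      have z: "x \<le> z" "z \<le> y" "y - z < d" "z - x \<le> real n * (d / 2)"
        using y d by (auto simp: z_def max_def algebra_simps)
      have "P x z" using Suc.IH z y by auto
      moreover have "P z y" using loc z y xy by auto
      ultimately show "P x y" using trans z y xy by blast
    qed
  qed
  moreover obtain n where "real n > (y - x) / (d / 2)" using reals_Archimedean2 by blast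
  then have "y - x \<le> real n * (d / 2)" using d by (simp add: field_simps)
  ultimately show ?thesis using xy by blast
qed

lemma lebesgue_on_subinterval:
  fixes f :: "real \<Rightarrow> 'b::euclidean_space"
  assumes "integrable (lebesgue_on {a..b}) f" "a \<le> c" "d \<le> b"
  shows "integrable (lebesgue_on {c..d}) f"
  by (rule integrable_subinterval[OF assms(1)]) (use assms in auto)

lemma lint_combine:
  fixes f :: "real \<Rightarrow> real"
  assumes "integrable (lebesgue_on {a..b}) f" "a \<le> c" "c \<le> b"
  shows "integral\<^sup>L (lebesgue_on {a..b}) f = integral\<^sup>L (lebesgue_on {a..c}) f + integral\<^sup>L (lebesgue_on {c..b}) f"
  using assms lebesgue_on_subinterval[OF assms(1), of a c] lebesgue_on_subinterval[OF assms(1), of c b]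
  by (simp add: lebesgue_integral_eq_integral Henstock_Kurzweil_Integration.integral_combine integrable_on_lebesgue_on)

lemma lint_point: "integral\<^sup>L (lebesgue_on {x}) f = (0 :: real)" for x :: real
  by (rule integral_eq_zero_null_sets) simp

lemma lint_uniformly_small:
  fixes f :: "real \<Rightarrow> real"
  assumes f: "integrable (lebesgue_on {a..b}) f" and e: "e > 0"
  shows "\<exists>d>0. \<forall>x y. a \<le> x \<longrightarrow> x \<le> y \<longrightarrow> y \<le> b \<longrightarrow> y - x < d \<longrightarrow> \<bar>integral\<^sup>L (lebesgue_on {x..y}) f\<bar> < e"
proof -
  define F where "F x = integral\<^sup>L (lebesgue_on {a..x}) f" for x
  have "continuous_on {a..b} F" unfolding F_def using f by (rule indefinite_integral_continuous_real)
  then have "uniformly_continuous_on {a..b} F" by (intro compact_uniformly_continuous) auto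
  then obtain d where d: "d > 0" "\<And>x y. x \<in> {a..b} \<Longrightarrow> y \<in> {a..b} \<Longrightarrow> dist y x < d \<Longrightarrow> dist (F y) (F x) < e"
    using e unfolding uniformly_continuous_on_def by metis
  have "\<bar>integral\<^sup>L (lebesgue_on {x..y}) f\<bar> < e" if "a \<le> x" "x \<le> y" "y \<le> b" "y - x < d" for x y
  proof -
    have "F y = F x + integral\<^sup>L (lebesgue_on {x..y}) f"
      unfolding F_def using that by (intro lint_combine lebesgue_on_subinterval[OF f]) auto
    then show ?thesis using d(2)[of x y] that by (simp add: dist_norm)
  qed
  then show ?thesis using d(1) by blast
qed

text \<open>An absolutely continuous function satisfies \<open>f\<^sup>2 = f(a)\<^sup>2 + 2 \<integral> f h\<close>: both sides have
  increments that agree up to the oscillation of \<open>f\<close> times \<open>\<integral> \<bar>h\<bar>\<close>.\<close>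

lemma square_of_integral:
  fixes f h :: "real \<Rightarrow> real"
  assumes h: "integrable (lebesgue_on {a..b}) h" and ab: "a \<le> b"
    and f: "\<And>x y. a \<le> x \<Longrightarrow> x \<le> y \<Longrightarrow> y \<le> b \<Longrightarrow> f y - f x = integral\<^sup>L (lebesgue_on {x..y}) h"
  shows "integrable (lebesgue_on {a..b}) (\<lambda>s. f s * h s)"
    "(f b)\<^sup>2 - (f a)\<^sup>2 = 2 * integral\<^sup>L (lebesgue_on {a..b}) (\<lambda>s. f s * h s)"
proof -
  have ucf: "\<exists>d>0. \<forall>x y. a \<le> x \<longrightarrow> x \<le> y \<longrightarrow> y \<le> b \<longrightarrow> y - x < d \<longrightarrow> \<bar>f y - f x\<bar> < e" if "e > 0" for e
    using lint_uniformly_small[OF h that] f by metis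
  have cf: "continuous_on {a..b} f"
    unfolding continuous_on_iff
  proof (intro ballI allI impI)
    fix x e :: real assume x: "x \<in> {a..b}" and "e > 0"
    then obtain d where d: "d > 0" "\<And>x y. a \<le> x \<Longrightarrow> x \<le> y \<Longrightarrow> y \<le> b \<Longrightarrow> y - x < d \<Longrightarrow> \<bar>f y - f x\<bar> < e"
      using ucf by metis
    have "dist (f y) (f x) < e" if "y \<in> {a..b}" "dist y x < d" for y
      using d(2)[of x y] d(2)[of y x] that x by (cases "x \<le> y") (auto simp: dist_norm abs_minus_commute)
    then show "\<exists>d>0. \<forall>x'\<in>{a..b}. dist x' x < d \<longrightarrow> dist (f x') (f x) < e" using d(1) by blast
  qed
  have mf: "f \<in> borel_measurable (lebesgue_on {a..b})"
    by (rule continuous_imp_measurable_on_sets_lebesgue[OF cf]) simp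
  have "bounded (f ` {a..b})" by (intro compact_imp_bounded compact_continuous_image cf) simp
  then obtain C where "\<forall>y\<in>f ` {a..b}. norm y \<le> C" unfolding bounded_iff by blast
  then have C: "\<bar>f x\<bar> \<le> C" if "x \<in> {a..b}" for x using that by simp
  have ifh: "integrable (lebesgue_on {a..b}) (\<lambda>s. g s * h s)"
    if "g \<in> borel_measurable (lebesgue_on {a..b})" "\<And>x. x \<in> {a..b} \<Longrightarrow> \<bar>g x\<bar> \<le> C" for g and C :: real
  proof (rule Bochner_Integration.integrable_bound)
    show "integrable (lebesgue_on {a..b}) (\<lambda>s. C * h s)" using h by simp
    have "C \<ge> 0" using order.trans[OF abs_ge_zero that(2)[of a]] ab by simp
    then show "AE s in lebesgue_on {a..b}. norm (g s * h s) \<le> norm (C * h s)"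
      using that(2) by (auto intro!: AE_I2 mult_right_mono simp: abs_mult)
  qed (use that h in auto)
  show int: "integrable (lebesgue_on {a..b}) (\<lambda>s. f s * h s)" by (rule ifh[OF mf C])
  define H where "H x y = integral\<^sup>L (lebesgue_on {x..y}) (\<lambda>s. \<bar>h s\<bar>)" for x y
  define I where "I x y = integral\<^sup>L (lebesgue_on {x..y}) (\<lambda>s. f s * h s)" for x y
  have habs: "integrable (lebesgue_on {a..b}) (\<lambda>s. \<bar>h s\<bar>)" using h by simp
  have Hab: "0 \<le> H a b" unfolding H_def by simp
  have "\<bar>(f b)\<^sup>2 - (f a)\<^sup>2 - 2 * I a b\<bar> \<le> 2 * e * H a b" if e: "e > 0" for e
  proof -
    obtain d where d: "d > 0" "\<And>x y. a \<le> x \<Longrightarrow> x \<le> y \<Longrightarrow> y \<le> b \<Longrightarrow> y - x < d \<Longrightarrow> \<bar>f y - f x\<bar> < e"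
      using ucf[OF e] by metis
    \<comment> \<open>The error is subadditive and the bound additive over adjacent intervals, so
      the local estimate chains. \<open>H a b\<close> does not depend on \<open>e\<close>, which may
      therefore tend to 0 afterwards.\<close>
    define P where "P x y \<longleftrightarrow> \<bar>(f y)\<^sup>2 - (f x)\<^sup>2 - 2 * I x y\<bar> \<le> 2 * e * H x y" for x y
    have "P a b"
    proof (rule chain_local_to_global[OF d(1)])
      show "P x x" if "x \<in> {a..b}" for x
      proof -
        have "integral\<^sup>L (lebesgue_on {x..x}) g = 0" for g :: "real \<Rightarrow> real"
          by (simp add: lint_point)
        then show ?thesis by (simp add: P_def I_def H_def lint_point)
      qed
    next
      fix x y assume xy: "a \<le> x" "x \<le> y" "y \<le> b" "y - x < d"
      have hx: "integrable (lebesgue_on {x..y}) h" "integrable (lebesgue_on {x..y}) (\<lambda>s. f s * h s)"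
        using xy by (intro lebesgue_on_subinterval[OF h] lebesgue_on_subinterval[OF int]; simp)+
      have "(f y)\<^sup>2 - (f x)\<^sup>2 - 2 * I x y = (f y + f x) * (f y - f x) - 2 * I x y"
        by (simp add: power2_eq_square algebra_simps)
      also have "\<dots> = integral\<^sup>L (lebesgue_on {x..y}) (\<lambda>s. (f y + f x) * h s - 2 * (f s * h s))"
        using hx f[OF xy(1-3)] by (simp add: I_def Bochner_Integration.integral_diff)
      finally have eq: "(f y)\<^sup>2 - (f x)\<^sup>2 - 2 * I x y = integral\<^sup>L (lebesgue_on {x..y}) (\<lambda>s. (f y + f x) * h s - 2 * (f s * h s))" .
      have "norm (integral\<^sup>L (lebesgue_on {x..y}) (\<lambda>s. (f y + f x) * h s - 2 * (f s * h s)))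
         \<le> integral\<^sup>L (lebesgue_on {x..y}) (\<lambda>s. 2 * e * \<bar>h s\<bar>)"
      proof (rule Bochner_Integration.integral_norm_bound_integral)
        fix s assume "s \<in> space (lebesgue_on {x..y})"
        then have s: "x \<le> s" "s \<le> y" by auto
        have "\<bar>f y - f s\<bar> < e" "\<bar>f s - f x\<bar> < e" using d(2) s xy by auto
        then have "\<bar>f y + f x - 2 * f s\<bar> \<le> 2 * e" by linarith
        from mult_right_mono[OF this abs_ge_zero[of "h s"]]
        show "norm ((f y + f x) * h s - 2 * (f s * h s)) \<le> 2 * e * \<bar>h s\<bar>"
          by (simp add: abs_mult[symmetric] algebra_simps)
      qed (use hx in auto)
      then show "P x y" unfolding P_def eq by (simp add: H_def)
    next
      fix x y z assume xyz: "a \<le> x" "x \<le> y" "y \<le> z" "z \<le> b" and P: "P x y" "P y z"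
      have "I x z = I x y + I y z" "H x z = H x y + H y z"
        unfolding I_def H_def using xyz
        by (intro lint_combine lebesgue_on_subinterval[OF int] lebesgue_on_subinterval[OF habs]; simp)+
      then show "P x z" using P unfolding P_def by (simp add: distrib_left)
    qed (use ab in auto)
    then show ?thesis by (simp add: P_def)
  qed
  then have *: "\<bar>(f b)\<^sup>2 - (f a)\<^sup>2 - 2 * I a b\<bar> \<le> 2 * e * H a b" if "e > 0" for e using that by blast
  have "\<bar>(f b)\<^sup>2 - (f a)\<^sup>2 - 2 * I a b\<bar> \<le> 0 + e" if "e > 0" for e
  proof -
    have "\<bar>(f b)\<^sup>2 - (f a)\<^sup>2 - 2 * I a b\<bar> \<le> 2 * (e / (2 * (H a b + 1))) * H a b"
      using Hab that by (intro *) simp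
    also have "\<dots> \<le> e" using Hab that by (simp add: field_simps)
    finally show ?thesis by simp
  qed
  then have "\<bar>(f b)\<^sup>2 - (f a)\<^sup>2 - 2 * I a b\<bar> \<le> 0" by (rule field_le_epsilon)
  then show "(f b)\<^sup>2 - (f a)\<^sup>2 = 2 * integral\<^sup>L (lebesgue_on {a..b}) (\<lambda>s. f s * h s)" by (simp add: I_def)
qed

text \<open>Locally \<open>R y \<le> R x + R y \<integral> b\<close>, and \<open>1 / (1 - t) \<le> exp (2 t)\<close> for \<open>t \<le> 1/2\<close>.\<close>

lemma gronwall_integrable:
  fixes b \<phi> :: "real \<Rightarrow> real"
  assumes T: "0 \<le> T" and b: "integrable (lebesgue_on {0..T}) b" "\<And>s. s \<in> {0..T} \<Longrightarrow> 0 \<le> b s"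
    and bp: "integrable (lebesgue_on {0..T}) (\<lambda>s. b s * \<phi> s)" and pos: "\<And>s. s \<in> {0..T} \<Longrightarrow> 0 \<le> \<phi> s"
    and a: "0 \<le> a"
    and le: "\<And>t. t \<in> {0..T} \<Longrightarrow> \<phi> t \<le> a + integral\<^sup>L (lebesgue_on {0..t}) (\<lambda>s. b s * \<phi> s)"
    and t: "t \<in> {0..T}"
  shows "a + integral\<^sup>L (lebesgue_on {0..t}) (\<lambda>s. b s * \<phi> s) \<le> a * exp (2 * integral\<^sup>L (lebesgue_on {0..t}) b)"
proof -
  define R where "R t = a + integral\<^sup>L (lebesgue_on {0..t}) (\<lambda>s. b s * \<phi> s)" for t
  define B where "B x y = integral\<^sup>L (lebesgue_on {x..y}) b" for x y
  obtain d where d: "d > 0" "\<And>x y. 0 \<le> x \<Longrightarrow> x \<le> y \<Longrightarrow> y \<le> T \<Longrightarrow> y - x < d \<Longrightarrow> \<bar>B x y\<bar> < 1 / 2"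
    using lint_uniformly_small[OF b(1), of "1 / 2"] unfolding B_def by auto
  have Bnn: "0 \<le> B x y" if "0 \<le> x" "y \<le> T" for x y
    unfolding B_def using that b(2) by (intro integral_nonneg_AE AE_I2) auto
  have comb: "R y = R x + integral\<^sup>L (lebesgue_on {x..y}) (\<lambda>s. b s * \<phi> s)" if "0 \<le> x" "x \<le> y" "y \<le> T" for x y
    unfolding R_def using that lint_combine[OF lebesgue_on_subinterval[OF bp, of 0 y], of x] by simp
  have mono: "R x \<le> R y" if "0 \<le> x" "x \<le> y" "y \<le> T" for x y
  proof -
    have "0 \<le> integral\<^sup>L (lebesgue_on {x..y}) (\<lambda>s. b s * \<phi> s)"
      using that b(2) pos by (intro integral_nonneg_AE AE_I2) auto
    then show ?thesis using comb[OF that] by simp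
  qed
  define P where "P x y \<longleftrightarrow> R y \<le> R x * exp (2 * B x y)" for x y
  have "P 0 t"
  proof (rule chain_local_to_global[OF d(1), of 0 T])
    fix x assume "x \<in> {0..T}"
    have "B x x = 0" unfolding B_def by (simp add: lint_point)
    then show "P x x" by (simp add: P_def)
  next
    fix x y assume xy: "0 \<le> x" "x \<le> y" "y \<le> T" "y - x < d"
    have "integral\<^sup>L (lebesgue_on {x..y}) (\<lambda>s. b s * \<phi> s) \<le> integral\<^sup>L (lebesgue_on {x..y}) (\<lambda>s. b s * R y)"
    proof (rule integral_mono)
      fix s assume "s \<in> space (lebesgue_on {x..y})"
      then have s: "x \<le> s" "s \<le> y" by auto
      have "\<phi> s \<le> R y" using le[of s] mono[of s y] s xy unfolding R_def by simp
      then show "b s * \<phi> s \<le> b s * R y" using b(2)[of s] s xy by (intro mult_left_mono) auto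
    qed (use xy in \<open>auto intro: lebesgue_on_subinterval[OF bp] lebesgue_on_subinterval[OF b(1)]\<close>)
    then have "R y \<le> R x + B x y * R y" using comb[OF xy(1-3)] by (simp add: B_def)
    then have 1: "R y * (1 - B x y) \<le> R x" by (simp add: algebra_simps)
    have Bs: "0 \<le> B x y" "B x y \<le> 1 / 2" using Bnn[of x y] d(2)[OF xy] xy by auto
    have "1 \<le> (1 - B x y) * (1 + 2 * B x y)"
      using mult_nonneg_nonneg[OF Bs(1), of "1 - 2 * B x y"] Bs by (simp add: algebra_simps)
    also have "\<dots> \<le> (1 - B x y) * exp (2 * B x y)"
      using Bs exp_ge_add_one_self[of "2 * B x y"] by (intro mult_left_mono) auto
    finally have 2: "1 \<le> (1 - B x y) * exp (2 * B x y)" .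
    have "0 \<le> R y" using mono[of 0 y] xy a by (simp add: R_def lint_point)
    then have "R y * 1 \<le> R y * ((1 - B x y) * exp (2 * B x y))" using 2 by (intro mult_left_mono)
    also have "\<dots> \<le> R x * exp (2 * B x y)" using mult_right_mono[OF 1, of "exp (2 * B x y)"] by (simp add: mult.assoc)
    finally show "P x y" by (simp add: P_def)
  next
    fix x y z assume xyz: "0 \<le> x" "x \<le> y" "y \<le> z" "z \<le> T" "P x y" "P y z"
    have "B x z = B x y + B y z"
      unfolding B_def using xyz by (intro lint_combine lebesgue_on_subinterval[OF b(1)]) auto
    moreover have "R z \<le> R x * exp (2 * B x y) * exp (2 * B y z)"
      using xyz(5,6) unfolding P_def by (meson exp_ge_zero mult_right_mono order.trans)
    ultimately show "P x z" by (simp add: P_def distrib_left exp_add mult.assoc)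
  qed (use t in auto)
  moreover have "R 0 = a" by (simp add: R_def lint_point)
  ultimately show ?thesis by (simp add: P_def R_def B_def)
qed

section \<open>Smooth cutoff functions on the line\<close>

lemma frechet_real:
  fixes f :: "real \<Rightarrow> real"
  assumes "(f has_real_derivative d) (at x)"
  shows "frechet_derivative f (at x) = (\<lambda>h. d * h)"
  using frechet_derivative_at[OF assms[unfolded has_field_derivative_def]] by simp

lemma smooth_realI:
  fixes f :: "real \<Rightarrow> real"
  assumes d: "\<And>x. (f has_real_derivative f' x) (at x)" and s: "\<And>h. smooth (\<lambda>x. f' x * h)"
  shows "smooth f"
proof (rule smooth.intros)
  show "\<forall>x. f differentiable at x" using d by (auto simp: differentiable_def has_field_derivative_def)
  show "\<forall>h. smooth (\<lambda>x. frechet_derivative f (at x) h)" using s by (simp add: frechet_real[OF d])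
qed

lemma smooth_lincomb:
  assumes "smooth f" "smooth g" shows "smooth (\<lambda>x. a * f x + b * g x)"
proof -
  have "\<exists>f g. smooth f \<and> smooth g \<and> F = (\<lambda>x. a * f x + b * g x) \<Longrightarrow> smooth F" for F
  proof (coinduction arbitrary: F rule: smooth.coinduct)
    case smooth
    then obtain f g where fg: "smooth f" "smooth g" "F = (\<lambda>x. a * f x + b * g x)" by blast
    have d: "(F has_derivative (\<lambda>h. a * frechet_derivative f (at x) h + b * frechet_derivative g (at x) h)) (at x)" for x
      unfolding fg(3)
      by (intro has_derivative_add has_derivative_mult_right frechet_derivative_works[THEN iffD1] smooth_D(1) fg)
    then have e: "frechet_derivative F (at x) = (\<lambda>h. a * frechet_derivative f (at x) h + b * frechet_derivative g (at x) h)" for x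
      by (rule frechet_derivative_at[symmetric])
    have "(\<lambda>x. frechet_derivative F (at x) h) = (\<lambda>x. a * frechet_derivative f (at x) h + b * frechet_derivative g (at x) h)" for h
      by (simp add: e)
    moreover have "F differentiable (at x)" for x using d unfolding differentiable_def by blast
    ultimately show ?case using smooth_D(2) fg by blast
  qed
  then show ?thesis using assms by blast
qed

lemma smooth_shift:
  fixes f :: "real \<Rightarrow> real"
  assumes "smooth f" shows "smooth (\<lambda>x. f (x - c))"
proof -
  have "\<exists>f. smooth f \<and> F = (\<lambda>x. f (x - c)) \<Longrightarrow> smooth F" for F :: "real \<Rightarrow> real"
  proof (coinduction arbitrary: F rule: smooth.coinduct)
    case smooth
    then obtain f where f: "smooth f" "F = (\<lambda>x. f (x - c))" by blast
    have d: "(F has_derivative frechet_derivative f (at (x - c))) (at x)" for x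
    proof -
      have "((\<lambda>y. y - c) has_derivative (\<lambda>h. h)) (at x)" by (auto intro!: derivative_eq_intros)
      from has_derivative_compose[OF this frechet_derivative_works[THEN iffD1, OF smooth_D(1)[OF f(1)]]]
      show ?thesis by (simp add: f(2))
    qed
    have e: "frechet_derivative F (at x) = frechet_derivative f (at (x - c))" for x
      by (rule frechet_derivative_at[OF d, symmetric])
    have "\<exists>g. smooth g \<and> (\<lambda>x. frechet_derivative F (at x) h) = (\<lambda>x. g (x - c))" for h
      by (rule exI[of _ "\<lambda>y. frechet_derivative f (at y) h"]) (simp add: e smooth_D(2)[OF f(1)])
    moreover have "F differentiable (at x)" for x using d unfolding differentiable_def by blast
    ultimately show ?case by blast
  qed
  then show ?thesis using assms by blast
qed

text \<open>A family of bump functions on \<open>{0<..<b}\<close> that is closed under differentiation.\<close>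

definition flat :: "real \<Rightarrow> real poly \<Rightarrow> nat \<Rightarrow> real \<Rightarrow> real" where
  "flat b p m t = (if 0 < t \<and> t < b then poly p t / (t * (b - t)) ^ m * exp (- 1 / (t * (b - t))) else 0)"

text \<open>A single term of the exponential series, the one of index \<open>m + 2\<close>, beats
  \<open>y ^ m\<close> and leaves two spare powers of \<open>y\<close>. These make the bump
  functions differentiable at the ends of their support.\<close>

lemma exp_inverse_le:
  assumes "(y::real) > 0" shows "exp (- 1 / y) / y ^ m \<le> fact (m + 2) * y\<^sup>2"
proof -
  have "(1 / y) ^ (m + 2) / fact (m + 2) \<le> exp (1 / y)"
  proof -
    have S: "(\<lambda>n. (1 / y) ^ n /\<^sub>R fact n) sums exp (1 / y)" by (rule exp_converges)
    then have "(\<Sum>n\<in>{m + 2}. (1 / y) ^ n /\<^sub>R fact n) \<le> exp (1 / y)"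
      unfolding sums_unique[OF S] using assms by (intro sum_le_suminf sums_summable[OF S]) auto
    then show ?thesis by (simp add: divide_inverse mult.commute)
  qed
  moreover have "0 < (1 / y) ^ (m + 2) / fact (m + 2)" using assms by simp
  ultimately have "inverse (exp (1 / y)) \<le> inverse ((1 / y) ^ (m + 2) / fact (m + 2))"
    by (rule le_imp_inverse_le)
  then have "exp (- 1 / y) \<le> fact (m + 2) * y ^ (m + 2)"
    by (simp add: exp_minus power_divide del: fact_Suc power_Suc add_2_eq_Suc add_2_eq_Suc' add: mult.commute)
  moreover have "y ^ (m + 2) = y\<^sup>2 * y ^ m" by (simp add: power_add power2_eq_square)
  ultimately have "exp (- 1 / y) \<le> (fact (m + 2) * y\<^sup>2) * y ^ m" by (simp only: mult.assoc)
  then show ?thesis using assms by (simp only: pos_divide_le_eq zero_less_power)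
qed

lemma DERIV_zero_quadratic:
  fixes f :: "real \<Rightarrow> real"
  assumes "f x = 0" "\<And>t. \<bar>f t\<bar> \<le> C * (t - x)\<^sup>2"
  shows "(f has_real_derivative 0) (at x)"
proof -
  have "((\<lambda>h. (f (x + h) - f x) / h) \<longlongrightarrow> 0) (at 0)"
  proof (rule Lim_null_comparison)
    show "\<forall>\<^sub>F h in at 0. norm ((f (x + h) - f x) / h) \<le> C * \<bar>h\<bar>"
    proof (rule eventually_at_filter[THEN iffD2], rule always_eventually, intro allI impI)
      fix h :: real assume "h \<noteq> 0"
      have "\<bar>f (x + h)\<bar> \<le> C * \<bar>h\<bar> * \<bar>h\<bar>" using assms(2)[of "x + h"] by (simp add: power2_eq_square mult.assoc)
      then show "norm ((f (x + h) - f x) / h) \<le> C * \<bar>h\<bar>"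
        using \<open>h \<noteq> 0\<close> assms(1) by (simp add: abs_divide pos_divide_le_eq)
    qed
    show "((\<lambda>h. C * \<bar>h\<bar>) \<longlongrightarrow> 0) (at 0)" by (auto intro!: tendsto_eq_intros)
  qed
  then show ?thesis by (simp add: DERIV_def)
qed

text \<open>The two spare powers of \<open>t * (b - t)\<close> give quadratic vanishing at each end
  point, since the other factor is at most \<open>b\<close>.\<close>

lemma flat_bound:
  assumes b: "b > 0"
  shows "\<exists>C\<ge>0. \<forall>t. \<bar>flat b p m t\<bar> \<le> C * t\<^sup>2 \<and> \<bar>flat b p m t\<bar> \<le> C * (t - b)\<^sup>2"
proof -
  have "bounded (poly p ` {0..b})"
    by (intro compact_imp_bounded compact_continuous_image continuous_intros) auto
  then obtain K where "\<forall>y\<in>poly p ` {0..b}. norm y \<le> K" unfolding bounded_iff by blast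
  then have K: "\<bar>poly p t\<bar> \<le> K" if "t \<in> {0..b}" for t using that by simp
  have K0: "0 \<le> K" using order.trans[OF abs_ge_zero K[of 0]] b by simp
  define C where "C = K * fact (m + 2) * b\<^sup>2"
  have C0: "0 \<le> C" using K0 by (simp add: C_def)
  have "\<bar>flat b p m t\<bar> \<le> C * t\<^sup>2 \<and> \<bar>flat b p m t\<bar> \<le> C * (t - b)\<^sup>2" for t
  proof (cases "0 < t \<and> t < b")
    case True
    define y where "y = t * (b - t)"
    have y: "y > 0" using True by (simp add: y_def)
    have "\<bar>flat b p m t\<bar> = \<bar>poly p t\<bar> * (exp (- 1 / y) / y ^ m)"
      using True y by (simp add: flat_def y_def[symmetric] abs_mult abs_divide)
    also have "\<dots> \<le> K * (fact (m + 2) * y\<^sup>2)"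
      using K[of t] exp_inverse_le[OF y] True K0 y by (intro mult_mono) auto
    finally have 1: "\<bar>flat b p m t\<bar> \<le> K * fact (m + 2) * y\<^sup>2" by simp
    have "y\<^sup>2 \<le> b\<^sup>2 * t\<^sup>2" "y\<^sup>2 \<le> b\<^sup>2 * (t - b)\<^sup>2"
      using True unfolding y_def power_mult_distrib power2_commute[of t b]
      by (auto intro!: mult_mono power_mono simp: mult.commute[of "t\<^sup>2"])
    from mult_left_mono[OF this(1), of "K * fact (m + 2)"] mult_left_mono[OF this(2), of "K * fact (m + 2)"]
    show ?thesis using 1 K0 by (simp add: C_def mult.assoc)
  next
    case False
    then have "flat b p m t = 0" by (auto simp: flat_def)
    then show ?thesis using C0 by simp
  qed
  then show ?thesis using C0 by blast
qed

text \<open>The numerator of the derivative over the common denominator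
  \<open>(t * (b - t)) ^ (m + 2)\<close>: the polynomial \<open>[:0, b, -1:]\<close> is
  \<open>t * (b - t)\<close> and \<open>[:b, -2:]\<close> is its derivative.\<close>

definition dflat :: "real \<Rightarrow> real poly \<Rightarrow> nat \<Rightarrow> real poly" where
  "dflat b p m = pderiv p * ([:0, b, -1:] * [:0, b, -1:]) - smult (real m) (p * [:b, -2:] * [:0, b, -1:]) + p * [:b, -2:]"

text \<open>Inside the interval this is the product rule, outside the function is locally 0, and at
  the two end points the quadratic bound gives the derivative 0.\<close>

lemma flat_DERIV:
  assumes b: "b > 0"
  shows "(flat b p m has_real_derivative flat b (dflat b p m) (m + 2) t) (at t)"
proof -
  consider "t < 0 \<or> t > b" | "t = 0" | "t = b" | "0 < t" "t < b" by linarith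
  then show ?thesis
  proof cases
    case 1
    have "open (- {0..b})" by (simp add: open_Compl)
    have "((\<lambda>_. 0) has_real_derivative 0) (at t)" by simp
    then have "(flat b p m has_real_derivative 0) (at t)"
      by (rule has_field_derivative_transform_within_open[OF _ \<open>open (- {0..b})\<close>]) (use 1 in \<open>auto simp: flat_def\<close>)
    then show ?thesis using 1 by (auto simp: flat_def)
  next
    case 2
    obtain C where "\<forall>t. \<bar>flat b p m t\<bar> \<le> C * t\<^sup>2" using flat_bound[OF b] by metis
    then show ?thesis using 2 DERIV_zero_quadratic[of "flat b p m" 0 C] by (simp add: flat_def)
  next
    case 3
    obtain C where "\<forall>t. \<bar>flat b p m t\<bar> \<le> C * (t - b)\<^sup>2" using flat_bound[OF b] by metis
    then show ?thesis using 3 DERIV_zero_quadratic[of "flat b p m" b C] by (simp add: flat_def)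
  next
    case 4
    define y where "y = t * (b - t)"
    have y: "y > 0" using 4 by (simp add: y_def)
    have "((\<lambda>t. poly p t * inverse (t * (b - t)) ^ m * exp (- inverse (t * (b - t)))) has_real_derivative
        (poly (pderiv p) t * inverse y ^ m * exp (- inverse y)
        + poly p t * (real m * inverse y ^ (m - 1) * (- (inverse y * (b - 2 * t) * inverse y))) * exp (- inverse y)
        + poly p t * inverse y ^ m * (exp (- inverse y) * (inverse y * (b - 2 * t) * inverse y)))) (at t)"
      using y unfolding y_def
      by (auto intro!: derivative_eq_intros poly_DERIV simp: algebra_simps)
    moreover have "poly (pderiv p) t * inverse y ^ m * exp (- inverse y)
        + poly p t * (real m * inverse y ^ (m - 1) * (- (inverse y * (b - 2 * t) * inverse y))) * exp (- inverse y)
        + poly p t * inverse y ^ m * (exp (- inverse y) * (inverse y * (b - 2 * t) * inverse y))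
      = poly (dflat b p m) t / y ^ (m + 2) * exp (- 1 / y)"
    proof -
      have yp: "y = poly [:0, b, -1:] t" by (simp add: y_def algebra_simps)
      have dp: "poly (dflat b p m) t = poly (pderiv p) t * y\<^sup>2 - real m * (poly p t * (b - 2 * t) * y) + poly p t * (b - 2 * t)"
        unfolding dflat_def yp by (simp add: power2_eq_square algebra_simps)
      have pw: "real m * inverse y ^ (m - 1) = real m * inverse y ^ m * y"
        using y by (cases m) auto
      show ?thesis unfolding dp pw using y
        by (simp add: power_add power2_eq_square divide_inverse power_inverse algebra_simps) (simp add: field_simps)
    qed
    ultimately have "((\<lambda>t. poly p t * inverse (t * (b - t)) ^ m * exp (- inverse (t * (b - t)))) has_real_derivative
        flat b (dflat b p m) (m + 2) t) (at t)"
      using 4 by (simp add: flat_def y_def)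
    then show ?thesis
      by (rule has_field_derivative_transform_within_open[where S = "{0<..<b}"])
         (use 4 in \<open>auto simp: flat_def divide_inverse power_inverse power_mult_distrib\<close>)
  qed
qed

lemma flat_smooth:
  assumes b: "b > 0" shows "smooth (flat b p m)"
proof -
  have "\<exists>p m. F = flat b p m \<Longrightarrow> smooth F" for F
  proof (coinduction arbitrary: F rule: smooth.coinduct)
    case smooth
    then obtain p m where F: "F = flat b p m" by blast
    have "(\<lambda>x. frechet_derivative F (at x) h) = flat b (smult h (dflat b p m)) (m + 2)" for h
      unfolding F frechet_real[OF flat_DERIV[OF b]] by (simp add: flat_def fun_eq_iff)
    moreover have "F differentiable (at x)" for x
      using flat_DERIV[OF b] F unfolding differentiable_def has_field_derivative_def by blast
    ultimately show ?case by blast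
  qed
  then show ?thesis by blast
qed

text \<open>The step is the antiderivative of a bump, divided by its total mass. Both functions are
  provided because the step enters test functions and its derivative acts as a mollifier.\<close>

lemma smooth_step_exists:
  assumes e: "e > 0"
  obtains \<Phi> \<rho> :: "real \<Rightarrow> real"
  where "smooth \<Phi>" "\<And>t. (\<Phi> has_real_derivative \<rho> t) (at t)" "\<And>t. t \<le> 0 \<Longrightarrow> \<Phi> t = 0"
    "\<And>t. t \<ge> e \<Longrightarrow> \<Phi> t = 1" "\<And>t. 0 \<le> \<Phi> t" "\<And>t. \<Phi> t \<le> 1" "\<And>t. 0 \<le> \<rho> t"
    "\<And>t. t \<notin> {0<..<e} \<Longrightarrow> \<rho> t = 0" "continuous_on UNIV \<rho>"
proof -
  define g where "g = flat e 1 0"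
  have gs: "smooth g" unfolding g_def by (rule flat_smooth[OF e])
  have gc: "continuous_on S g" for S
    unfolding g_def using flat_DERIV[OF e] by (meson DERIV_isCont continuous_at_imp_continuous_on)
  have g0: "0 \<le> g t" "t \<notin> {0<..<e} \<Longrightarrow> g t = 0" "t \<in> {0<..<e} \<Longrightarrow> 0 < g t" for t
    by (auto simp: g_def flat_def)
  \<comment> \<open>Starting at -1 instead of 0 makes 0 an interior point, so that the derivative
    there is two-sided.\<close>
  define G where "G t = integral {-1..t} g" for t
  have gi: "g integrable_on {x..y}" for x y by (intro integrable_continuous_interval gc)
  have Gle0: "G t = 0" if "t \<le> 0" for t
  proof -
    have "G t = integral {-1..t} (\<lambda>_. 0)" unfolding G_def using that by (intro integral_cong g0) auto
    then show ?thesis by simp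
  qed
  have GD: "(G has_real_derivative g t) (at t)" for t
  proof (cases "t < 0")
    case True
    have "((\<lambda>_. 0) has_real_derivative 0) (at t)" by simp
    then have "(G has_real_derivative 0) (at t)"
      by (rule has_field_derivative_transform_within_open[where S = "{..<0}"]) (use True Gle0 in auto)
    then show ?thesis using True g0(2)[of t] by simp
  next
    case False
    have "(G has_real_derivative g t) (at t within {-1..t + 1})"
      unfolding G_def by (rule integral_has_real_derivative[OF gc]) (use False in auto)
    moreover have "at t within {-1..t + 1} = at t" using False by (intro at_within_interior) auto
    ultimately show ?thesis by simp
  qed
  have Gdiff: "G y = G x + integral {x..y} g" if "0 \<le> x" "x \<le> y" for x y
    unfolding G_def using that gi by (subst Henstock_Kurzweil_Integration.integral_combine) auto
  have mono: "G x \<le> G y" if "x \<le> y" for x y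
    using DERIV_nonneg_imp_nondecreasing[OF that] GD g0(1) by blast
  have Ge: "G t = G e" if "t \<ge> e" for t
  proof -
    have "integral {e..t} g = integral {e..t} (\<lambda>_. 0)" by (intro integral_cong g0) auto
    then show ?thesis using Gdiff[of e t] e that by simp
  qed
  \<comment> \<open>Otherwise the monotone \<open>G\<close> would vanish on all of
    \<open>{0..e}\<close>, contradicting its positive derivative at \<open>e / 2\<close>.\<close>
  have "G e > 0"
  proof (rule ccontr)
    assume "\<not> G e > 0"
    then have "G e = G 0" using mono[of 0 e] e Gle0[of 0] by simp
    then have "G t = 0" if "0 \<le> t" "t \<le> e" for t
      using mono[OF that(1)] mono[OF that(2)] Gle0[of 0] by simp
    then have z: "G t = 0" if "t \<in> {0<..<e}" for t using that by simp
    have "((\<lambda>_. 0) has_real_derivative 0) (at (e / 2))" by simp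
    then have "(G has_real_derivative 0) (at (e / 2))"
      by (rule has_field_derivative_transform_within_open[where S = "{0<..<e}"]) (use e z in auto)
    then have "g (e / 2) = 0" using DERIV_unique GD by blast
    then show False using g0(3)[of "e / 2"] e by simp
  qed
  define c where "c = 1 / G e"
  have c: "c > 0" using \<open>G e > 0\<close> by (simp add: c_def)
  have D: "((\<lambda>t. c * G t) has_real_derivative c * g t) (at t)" for t using DERIV_cmult[OF GD] .
  show thesis
  proof (rule that[of "\<lambda>t. c * G t" "\<lambda>t. c * g t"])
    show "smooth (\<lambda>t. c * G t)"
    proof (rule smooth_realI[OF D])
      show "smooth (\<lambda>x. c * g x * h)" for h
        using smooth_lincomb[OF gs gs, of "c * h" 0] by (simp add: mult_ac)
    qed
    show "c * G t \<le> 1" for t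
      using mono[of t e] Ge[of t] \<open>G e > 0\<close> by (cases "t \<le> e") (auto simp: c_def pos_divide_le_eq)
    show "0 \<le> c * G t" for t
      using mono[of 0 t] Gle0[of 0] Gle0[of t] c by (cases "0 \<le> t") auto
    show "continuous_on UNIV (\<lambda>t. c * g t)" by (intro continuous_intros gc)
    show "((\<lambda>t. c * G t) has_real_derivative c * g t) (at t)" for t by (rule D)
    show "c * G t = 0" if "t \<le> 0" for t using Gle0[OF that] by simp
    show "c * G t = 1" if "e \<le> t" for t unfolding Ge[OF that] c_def using \<open>G e > 0\<close> by simp
    show "0 \<le> c * g t" for t using c g0(1) by simp
    show "c * g t = 0" if "t \<notin> {0<..<e}" for t using g0(2)[OF that] by simp
  qed
qed

lemma continuous_lint_mult:
  fixes h g :: "real \<Rightarrow> real"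
  assumes h: "integrable (lebesgue_on {a..b}) h" and g: "continuous_on {a..b} g"
  shows "integrable (lebesgue_on {a..b}) (\<lambda>t. g t * h t)"
proof -
  have "bounded (g ` {a..b})" by (intro compact_imp_bounded compact_continuous_image g) simp
  then obtain C where "\<forall>y\<in>g ` {a..b}. norm y \<le> C" unfolding bounded_iff by blast
  then have C: "\<bar>g t\<bar> \<le> \<bar>C\<bar>" if "t \<in> {a..b}" for t using that by force
  show ?thesis
  proof (rule Bochner_Integration.integrable_bound)
  show "integrable (lebesgue_on {a..b}) (\<lambda>t. C * h t)" using h by simp
  show "AE t in lebesgue_on {a..b}. norm (g t * h t) \<le> norm (C * h t)"
    by (rule AE_I2) (simp add: abs_mult mult_right_mono C)
  show "(\<lambda>t. g t * h t) \<in> borel_measurable (lebesgue_on {a..b})"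
    by (intro borel_measurable_times continuous_imp_measurable_on_sets_lebesgue[OF g] borel_measurable_integrable h) simp
  qed
qed

lemma DERIV_shift_arg:
  fixes F f :: "real \<Rightarrow> real"
  assumes "\<And>t. (F has_real_derivative f t) (at t)"
  shows "((\<lambda>t. F (t - z)) has_real_derivative f (t - z)) (at t)"
proof -
  have "((\<lambda>t. t - z) has_real_derivative 1) (at t)" by (auto intro!: derivative_eq_intros)
  from DERIV_chain2[OF assms this] show ?thesis by simp
qed

lemma continuous_lint:
  fixes g :: "real \<Rightarrow> real"
  assumes "continuous_on {a..b} g" shows "integrable (lebesgue_on {a..b}) g"
  using continuous_imp_integrable_real[OF assms] .

text \<open>The shifted \<open>\<rho>\<close> is a probability density on an interval of length
  \<open>e\<close> to the right of \<open>x\<close>; its mass is the total increment of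
  \<open>\<Phi>\<close>. Hence the mollified value is an average of nearby values of
  \<open>c\<close>.\<close>

lemma mollifier_limit:
  fixes c \<rho> \<Phi> :: "real \<Rightarrow> real"
  assumes e: "e > 0" and x: "0 < x" "x + e \<le> T" and c: "continuous_on {0..T} c"
    and D: "\<And>t. (\<Phi> has_real_derivative \<rho> t) (at t)" and \<Phi>: "\<And>t. t \<le> 0 \<Longrightarrow> \<Phi> t = 0" "\<And>t. t \<ge> e \<Longrightarrow> \<Phi> t = 1"
    and \<rho>: "\<And>t. 0 \<le> \<rho> t" "\<And>t. t \<notin> {0<..<e} \<Longrightarrow> \<rho> t = 0" "continuous_on UNIV \<rho>"
    and C: "\<And>t. x \<le> t \<Longrightarrow> t \<le> x + e \<Longrightarrow> \<bar>c t - c x\<bar> \<le> C"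
  shows "\<bar>integral\<^sup>L (lebesgue_on {0..T}) (\<lambda>t. \<rho> (t - x) * c t) - c x\<bar> \<le> C"
proof -
  have cr: "continuous_on {0..T} (\<lambda>t. \<rho> (t - x))"
    by (intro continuous_on_compose2[OF \<rho>(3)] continuous_intros) auto
  have i1: "integrable (lebesgue_on {0..T}) (\<lambda>t. \<rho> (t - x))" by (rule continuous_lint[OF cr])
  have i2: "integrable (lebesgue_on {0..T}) (\<lambda>t. \<rho> (t - x) * c t)" by (intro continuous_lint continuous_intros cr c)
  have "((\<lambda>t. \<rho> (t - x)) has_integral \<Phi> (T - x) - \<Phi> (0 - x)) {0..T}"
  proof (rule fundamental_theorem_of_calculus)
    fix t assume "t \<in> {0..T}"
    have "((\<lambda>t. \<Phi> (t - x)) has_real_derivative \<rho> (t - x)) (at t)"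
      by (rule DERIV_shift_arg[OF D])
    then show "((\<lambda>t. \<Phi> (t - x)) has_vector_derivative \<rho> (t - x)) (at t within {0..T})"
      by (simp add: has_real_derivative_iff_has_vector_derivative has_vector_derivative_at_within)
  qed (use x e in simp)
  then have one: "integral\<^sup>L (lebesgue_on {0..T}) (\<lambda>t. \<rho> (t - x)) = 1"
    using \<Phi>(1)[of "0 - x"] \<Phi>(2)[of "T - x"] x lebesgue_integral_eq_integral[OF i1] by (simp add: integral_unique)
  have "integral\<^sup>L (lebesgue_on {0..T}) (\<lambda>t. \<rho> (t - x) * c t) - c x
     = integral\<^sup>L (lebesgue_on {0..T}) (\<lambda>t. \<rho> (t - x) * c t - \<rho> (t - x) * c x)"
    using i1 i2 one by (simp add: Bochner_Integration.integral_diff)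
  also have "\<bar>\<dots>\<bar> \<le> integral\<^sup>L (lebesgue_on {0..T}) (\<lambda>t. \<rho> (t - x) * C)"
  proof -
    have "norm (\<rho> (t - x) * c t - \<rho> (t - x) * c x) \<le> \<rho> (t - x) * C" for t
    proof (cases "t - x \<in> {0<..<e}")
      case True
      have "\<rho> (t - x) * \<bar>c t - c x\<bar> \<le> \<rho> (t - x) * C" using True by (intro mult_left_mono C \<rho>) auto
      then show ?thesis using \<rho>(1)[of "t - x"] by (simp add: right_diff_distrib[symmetric] abs_mult)
    qed (simp add: \<rho>)
    then have "norm (integral\<^sup>L (lebesgue_on {0..T}) (\<lambda>t. \<rho> (t - x) * c t - \<rho> (t - x) * c x)) \<le> integral\<^sup>L (lebesgue_on {0..T}) (\<lambda>t. \<rho> (t - x) * C)"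
      using i1 i2 by (intro Bochner_Integration.integral_norm_bound_integral) auto
    then show ?thesis by simp
  qed
  also have "\<dots> = C" using one by simp
  finally show ?thesis .
qed

text \<open>The test function rises smoothly from 0 to 1 just after \<open>x\<close> and falls just
  after \<open>y\<close>. Its derivative is the difference of two mollifiers, which return
  \<open>c x - c y\<close>, while the function itself tends to an indicator.\<close>

lemma weak_derivative_increment_interior:
  fixes c h :: "real \<Rightarrow> real"
  assumes c: "continuous_on {0..T} c" and h: "integrable (lebesgue_on {0..T}) h"
    and eq: "\<And>\<phi>. test_function_on T \<phi> \<Longrightarrow>
      integral\<^sup>L (lebesgue_on {0..T}) (\<lambda>t. deriv \<phi> t * c t) = - integral\<^sup>L (lebesgue_on {0..T}) (\<lambda>t. \<phi> t * h t)"
    and xy: "0 < x" "x < y" "y < T"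
  shows "c y - c x = integral\<^sup>L (lebesgue_on {x..y}) h"
proof -
  \<comment> \<open>The divisor exceeds 1 already at \<open>n = 0\<close>, so
    \<open>y + e n < T\<close> holds strictly and the test functions have their support inside the
    open interval.\<close>
  define e where "e n = min (y - x) (T - y) / (real n + 2)" for n
  have m0: "0 < min (y - x) (T - y)" using xy by simp
  have e0: "e n > 0" for n unfolding e_def using m0 by (intro divide_pos_pos) auto
  have em: "e n < min (y - x) (T - y)" for n
    using m0 by (simp add: e_def pos_divide_less_eq del: min_less_iff_conj)
  have elim: "e \<longlonglongrightarrow> 0" 
  proof (rule Lim_null_comparison)
    show "\<forall>\<^sub>F n in sequentially. norm (e n) \<le> min (y - x) (T - y) * inverse (real (Suc n))"
      using m0 by (intro always_eventually allI)
        (simp add: e_def divide_inverse mult_left_mono le_imp_inverse_le abs_of_nonneg less_imp_le del: min_less_iff_conj)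
    show "(\<lambda>n. min (y - x) (T - y) * inverse (real (Suc n))) \<longlonglongrightarrow> 0"
      by (rule tendsto_mult_right_zero[OF LIMSEQ_inverse_real_of_nat])
  qed
  have "\<forall>n. \<exists>\<Phi> \<rho> :: real \<Rightarrow> real. smooth \<Phi> \<and> (\<forall>t. (\<Phi> has_real_derivative \<rho> t) (at t)) \<and> (\<forall>t. t \<le> 0 \<longrightarrow> \<Phi> t = 0)
    \<and> (\<forall>t. t \<ge> e n \<longrightarrow> \<Phi> t = 1) \<and> (\<forall>t. 0 \<le> \<Phi> t \<and> \<Phi> t \<le> 1 \<and> 0 \<le> \<rho> t)
    \<and> (\<forall>t. t \<notin> {0<..<e n} \<longrightarrow> \<rho> t = 0) \<and> continuous_on UNIV \<rho>"
    using smooth_step_exists[OF e0] by metis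
  then obtain \<Phi> \<rho> :: "nat \<Rightarrow> real \<Rightarrow> real" where \<Phi>: "\<And>n. smooth (\<Phi> n)" "\<And>n t. (\<Phi> n has_real_derivative \<rho> n t) (at t)"
    "\<And>n t. t \<le> 0 \<Longrightarrow> \<Phi> n t = 0" "\<And>n t. t \<ge> e n \<Longrightarrow> \<Phi> n t = 1" "\<And>n t. 0 \<le> \<Phi> n t" "\<And>n t. \<Phi> n t \<le> 1" "\<And>n t. 0 \<le> \<rho> n t"
    "\<And>n t. t \<notin> {0<..<e n} \<Longrightarrow> \<rho> n t = 0" "\<And>n. continuous_on UNIV (\<rho> n)" by metis
  define \<phi> where "\<phi> n t = \<Phi> n (t - x) - \<Phi> n (t - y)" for n t
  have D: "(\<phi> n has_real_derivative \<rho> n (t - x) - \<rho> n (t - y)) (at t)" for n t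
  proof -
    have "((\<lambda>t. \<Phi> n (t - z)) has_real_derivative \<rho> n (t - z)) (at t)" for z
      by (rule DERIV_shift_arg[OF \<Phi>(2)])
    then show ?thesis unfolding \<phi>_def by (intro DERIV_diff)
  qed
  have test: "test_function_on T (\<phi> n)" for n
  proof -
    have 1: "smooth (\<phi> n)"
      using smooth_lincomb[OF smooth_shift[OF \<Phi>(1)] smooth_shift[OF \<Phi>(1)], of 1 n x "-1" n y] by (simp add: \<phi>_def[abs_def])
    have 2: "y + e n < T" using em[of n] by simp
    have 3: "\<phi> n t = 0" if "t \<notin> {x..y + e n}" for t
      using that xy e0[of n] by (cases "t < x") (auto simp: \<phi>_def \<Phi>(3,4))
    show ?thesis unfolding test_function_on_def using 1 2 3 xy(1) by blast
  qed
  have cT: "continuous_on {0..T} (\<lambda>t. \<rho> n (t - z))" for n z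
    by (intro continuous_on_compose2[OF \<Phi>(9)] continuous_intros) auto
  have lhs: "integral\<^sup>L (lebesgue_on {0..T}) (\<lambda>t. deriv (\<phi> n) t * c t)
      = integral\<^sup>L (lebesgue_on {0..T}) (\<lambda>t. \<rho> n (t - x) * c t) - integral\<^sup>L (lebesgue_on {0..T}) (\<lambda>t. \<rho> n (t - y) * c t)" for n
  proof -
    have "integrable (lebesgue_on {0..T}) (\<lambda>t. \<rho> n (t - z) * c t)" for z
      by (intro continuous_lint continuous_intros cT c)
    then show ?thesis by (simp add: DERIV_imp_deriv[OF D] left_diff_distrib Bochner_Integration.integral_diff)
  qed
  have moll: "(\<lambda>n. integral\<^sup>L (lebesgue_on {0..T}) (\<lambda>t. \<rho> n (t - z) * c t)) \<longlonglongrightarrow> c z" if z: "x \<le> z" "z \<le> y" for z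
  proof (rule LIMSEQ_I)
    fix r :: real assume r: "r > 0"
    have zT: "z \<in> {0..T}" using z xy by auto
    obtain d where d: "d > 0" "\<And>t. t \<in> {0..T} \<Longrightarrow> dist t z < d \<Longrightarrow> dist (c t) (c z) < r / 2"
      using c[unfolded continuous_on_iff, rule_format, OF zT, of "r / 2"] r by auto
    obtain N where N: "\<And>n. n \<ge> N \<Longrightarrow> e n < d"
      using order_tendstoD(2)[OF elim d(1)] by (auto simp: eventually_sequentially)
    have "norm (integral\<^sup>L (lebesgue_on {0..T}) (\<lambda>t. \<rho> n (t - z) * c t) - c z) < r" if n: "n \<ge> N" for n
    proof -
      have "\<bar>integral\<^sup>L (lebesgue_on {0..T}) (\<lambda>t. \<rho> n (t - z) * c t) - c z\<bar> \<le> r / 2"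
      proof (rule mollifier_limit[where e = "e n" and \<Phi> = "\<Phi> n"])
        show "0 < z" "z + e n \<le> T" using z xy em[of n] by auto
        fix t assume t: "z \<le> t" "t \<le> z + e n"
        have "dist (c t) (c z) < r / 2" using t z xy em[of n] N[OF n] by (intro d(2)) (auto simp: dist_norm)
        then show "\<bar>c t - c z\<bar> \<le> r / 2" by (simp add: dist_norm)
      qed (use e0 c \<Phi> in auto)
      then show ?thesis using r by simp
    qed
    then show "\<exists>no. \<forall>n\<ge>no. norm (integral\<^sup>L (lebesgue_on {0..T}) (\<lambda>t. \<rho> n (t - z) * c t) - c z) < r" by blast
  qed
  have L: "(\<lambda>n. integral\<^sup>L (lebesgue_on {0..T}) (\<lambda>t. deriv (\<phi> n) t * c t)) \<longlonglongrightarrow> c x - c y"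
    unfolding lhs using xy by (intro tendsto_diff moll) auto
  \<comment> \<open>The steps lie to the right of \<open>x\<close> and \<open>y\<close>, so the
    limit is the indicator of the interval open at \<open>x\<close> and closed at
    \<open>y\<close>.\<close>
  have R: "(\<lambda>n. integral\<^sup>L (lebesgue_on {0..T}) (\<lambda>t. \<phi> n t * h t)) \<longlonglongrightarrow> integral\<^sup>L (lebesgue_on {0..T}) (\<lambda>t. indicator {x<..y} t * h t)"
  proof (rule integral_dominated_convergence[where w = "\<lambda>t. norm (h t)"])
    have cph: "continuous_on {0..T} (\<phi> n)" for n using D by (meson DERIV_isCont continuous_at_imp_continuous_on)
    show "(\<lambda>t. \<phi> n t * h t) \<in> borel_measurable (lebesgue_on {0..T})" for n
      using continuous_lint_mult[OF h cph] by auto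
    show "(\<lambda>t. indicator {x<..y} t * h t) \<in> borel_measurable (lebesgue_on {0..T})"
      by (intro borel_measurable_times borel_measurable_integrable[OF h] measurable_restrict_space1 measurable_completion) simp
    have "\<bar>\<phi> n t\<bar> \<le> 1" for n t
      using \<Phi>(5)[of n "t - x"] \<Phi>(5)[of n "t - y"] \<Phi>(6)[of n "t - x"] \<Phi>(6)[of n "t - y"] by (simp add: \<phi>_def abs_le_iff)
    then show "AE t in lebesgue_on {0..T}. norm (\<phi> n t * h t) \<le> norm (h t)" for n
      by (intro AE_I2) (simp add: abs_mult mult_left_le_one_le)
    show "AE t in lebesgue_on {0..T}. (\<lambda>n. \<phi> n t * h t) \<longlonglongrightarrow> indicator {x<..y} t * h t"
    proof (rule AE_I2)
      fix t
      have lim1: "(\<lambda>n. \<Phi> n (t - z)) \<longlonglongrightarrow> (if t > z then 1 else 0)" for z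
      proof (cases "t > z")
        case True
        then have "\<forall>\<^sub>F n in sequentially. e n < t - z" using order_tendstoD(2)[OF elim, of "t - z"] by simp
        then have "\<forall>\<^sub>F n in sequentially. \<Phi> n (t - z) = 1" by eventually_elim (simp add: \<Phi>(4))
        then show ?thesis using True by (simp add: tendsto_eventually)
      qed (simp add: \<Phi>(3))
      have "(\<lambda>n. \<phi> n t * h t) \<longlonglongrightarrow> ((if t > x then 1 else 0) - (if t > y then 1 else 0)) * h t"
        unfolding \<phi>_def by (intro tendsto_intros lim1)
      moreover have "((if t > x then 1 else 0) - (if t > y then 1 else 0)) * h t = indicator {x<..y} t * h t"
        using xy by (auto simp: indicator_def)
      ultimately show "(\<lambda>n. \<phi> n t * h t) \<longlonglongrightarrow> indicator {x<..y} t * h t" by simp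
    qed
  qed (use h in auto)
  have "integral\<^sup>L (lebesgue_on {0..T}) (\<lambda>t. indicator {x<..y} t * h t) = integral\<^sup>L (lebesgue_on {x..y}) h"
  proof -
    have "AE t in lebesgue. t \<notin> {x}" by (rule AE_not_in) simp
    then have ae: "AE t in lebesgue_on {0..T}. t \<noteq> x" by (subst AE_restrict_space_iff) auto
    have "integral\<^sup>L (lebesgue_on {0..T}) (\<lambda>t. indicator {x<..y} t * h t) = integral\<^sup>L (lebesgue_on {0..T}) (\<lambda>t. if t \<in> {x..y} then h t else 0)"
    proof (rule integral_cong_AE)
      show "AE t in lebesgue_on {0..T}. indicator {x<..y} t * h t = (if t \<in> {x..y} then h t else 0)"
        using ae by eventually_elim (auto simp: indicator_def)
      show "(\<lambda>t. indicator {x<..y} t * h t) \<in> borel_measurable (lebesgue_on {0..T})"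
        by (intro borel_measurable_times borel_measurable_integrable[OF h] measurable_restrict_space1 measurable_completion) simp
      have "(\<lambda>t. indicator {x..y} t * h t) \<in> borel_measurable (lebesgue_on {0..T})"
        by (intro borel_measurable_times borel_measurable_integrable[OF h] measurable_restrict_space1 measurable_completion) simp
      moreover have "(\<lambda>t. indicator {x..y} t * h t) = (\<lambda>t. if t \<in> {x..y} then h t else 0)" by (auto simp: indicator_def)
      ultimately show "(\<lambda>t. if t \<in> {x..y} then h t else 0) \<in> borel_measurable (lebesgue_on {0..T})" by simp
    qed
    also have "\<dots> = integral\<^sup>L (lebesgue_on {x..y}) h"
      using xy by (intro Lebesgue_Measure.integral_restrict) auto
    finally show ?thesis .
  qed
  moreover have "c x - c y = - integral\<^sup>L (lebesgue_on {0..T}) (\<lambda>t. indicator {x<..y} t * h t)"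
    by (rule LIMSEQ_unique[OF L]) (use tendsto_minus[OF R] in \<open>simp only: eq[OF test]\<close>)
  ultimately show ?thesis by simp
qed

text \<open>\<open>c\<close> minus the indefinite integral of \<open>h\<close> has no increments
  inside the interval and is continuous up to its ends. Reaching the end point 0 is essential, as
  the initial value is taken there.\<close>

lemma weak_derivative_increment:
  fixes c h :: "real \<Rightarrow> real"
  assumes T: "T > 0" and c: "continuous_on {0..T} c" and h: "integrable (lebesgue_on {0..T}) h"
    and eq: "\<And>\<phi>. test_function_on T \<phi> \<Longrightarrow>
      integral\<^sup>L (lebesgue_on {0..T}) (\<lambda>t. deriv \<phi> t * c t) = - integral\<^sup>L (lebesgue_on {0..T}) (\<lambda>t. \<phi> t * h t)"
    and xy: "0 \<le> x" "x \<le> y" "y \<le> T"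
  shows "c y - c x = integral\<^sup>L (lebesgue_on {x..y}) h"
proof -
  define F where "F t = c t - integral\<^sup>L (lebesgue_on {0..t}) h" for t
  have cF: "continuous_on {0..T} F"
    unfolding F_def by (intro continuous_intros c indefinite_integral_continuous_real h)
  have inc: "integral\<^sup>L (lebesgue_on {0..b}) h = integral\<^sup>L (lebesgue_on {0..a}) h + integral\<^sup>L (lebesgue_on {a..b}) h"
    if "0 \<le> a" "a \<le> b" "b \<le> T" for a b
    using that by (intro lint_combine lebesgue_on_subinterval[OF h]) auto
  have const: "F t = F (T / 2)" if "t \<in> {0<..<T}" for t
  proof -
    have *: "F a = F b" if "0 < a" "a < b" "b < T" for a b
      using weak_derivative_increment_interior[OF c h eq that] inc[of a b] that by (simp add: F_def)
    consider "t < T / 2" | "t = T / 2" | "T / 2 < t" by linarith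
    then show ?thesis
    proof cases
      case 2
      then show ?thesis by (simp only:)
    next
      case 1
      show ?thesis by (rule *) (use that 1 T in auto)
    next
      case 3
      show ?thesis by (rule *[symmetric]) (use that 3 T in auto)
    qed
  qed
  have cl: "closure {0<..<T} = {0..T}" using T by (simp add: closure_greaterThanLessThan)
  have "F t = F (T / 2)" if "t \<in> {0..T}" for t
    using continuous_constant_on_closure[of "{0<..<T}" F "F (T / 2)" t] cF const that unfolding cl by blast
  from this[of x] this[of y] have "F x = F y" using xy by simp
  then show ?thesis using inc[OF xy] by (simp add: F_def)
qed

section \<open>Energy inequality and stability\<close>

text \<open>Lebesgue measure is complete, so changes on a null set preserve measurability. This
  gives the measurability of limits that exist only almost everywhere.\<close>

lemma measurable_AE_lebesgue_on:
  fixes f g :: "real \<Rightarrow> 'b::euclidean_space"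
  assumes f: "f \<in> borel_measurable (lebesgue_on {a..b})" and ae: "AE t in lebesgue_on {a..b}. f t = g t"
  shows "g \<in> borel_measurable (lebesgue_on {a..b})"
proof -
  have S: "{a..b} \<in> sets lebesgue" by simp
  have "AE t in lebesgue. t \<in> {a..b} \<longrightarrow> f t = g t" using ae by (subst (asm) AE_restrict_space_iff) auto
  then have N: "negligible {t \<in> {a..b}. f t \<noteq> g t}"
    by (simp add: completion.AE_iff_null_sets negligible_iff_null_sets Collect_conj_eq[symmetric])
  have "g measurable_on {a..b}"
    by (rule measurable_on_spike[OF f[folded measurable_on_iff_borel_measurable[OF S]] N]) auto
  then show ?thesis by (simp only: measurable_on_iff_borel_measurable[OF S])
qed

lemma integral_cong_AE_lebesgue_on:
  fixes f g :: "real \<Rightarrow> real"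
  assumes "integrable (lebesgue_on {a..b}) f" "AE t in lebesgue_on {a..b}. f t = g t"
  shows "integrable (lebesgue_on {a..b}) g" "integral\<^sup>L (lebesgue_on {a..b}) g = integral\<^sup>L (lebesgue_on {a..b}) f"
proof -
  have f: "f \<in> borel_measurable (lebesgue_on {a..b})" using assms(1) by simp
  have g: "g \<in> borel_measurable (lebesgue_on {a..b})" by (rule measurable_AE_lebesgue_on[OF f assms(2)])
  show "integrable (lebesgue_on {a..b}) g" using integrable_cong_AE[OF f g assms(2)] assms(1) by simp
  show "integral\<^sup>L (lebesgue_on {a..b}) g = integral\<^sup>L (lebesgue_on {a..b}) f"
    using integral_cong_AE[OF f g assms(2)] by simp
qed

lemma AE_lebesgue_on_subset:
  assumes "AE t in lebesgue_on {a..b}. P t" "{c..d} \<subseteq> {a..b::real}"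
  shows "AE t in lebesgue_on {c..d}. P t"
proof -
  have "AE t in lebesgue. t \<in> {a..b} \<longrightarrow> P t" using assms(1) by (subst (asm) AE_restrict_space_iff) auto
  then have "AE t in lebesgue. t \<in> {c..d} \<longrightarrow> P t" by eventually_elim (use assms(2) in blast)
  then show ?thesis by (subst AE_restrict_space_iff) auto
qed

context torus
begin

lemma Hm2_minus:
  assumes F: "F \<in> Hm2 L" and G: "G \<in> Hm2 L" shows "F - G \<in> Hm2 L"
proof -
  obtain C where C: "\<And>v. v \<in> H2 L \<Longrightarrow> \<bar>F v\<bar> \<le> C * h2_norm L v" using F unfolding Hm2_def by blast
  obtain D where D: "\<And>v. v \<in> H2 L \<Longrightarrow> \<bar>G v\<bar> \<le> D * h2_norm L v" using G unfolding Hm2_def by blast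
  have "\<bar>(F - G) v\<bar> \<le> (C + D) * h2_norm L v" if "v \<in> H2 L" for v
    using C[OF that] D[OF that] by (simp add: distrib_right)
  moreover have "(F - G) (\<lambda>x. a *\<^sub>R v x + b *\<^sub>R w x) = a * (F - G) v + b * (F - G) w" if "v \<in> H2 L" "w \<in> H2 L" for v w a b
  proof -
    have "F (\<lambda>x. a *\<^sub>R v x + b *\<^sub>R w x) = a * F v + b * F w" "G (\<lambda>x. a *\<^sub>R v x + b *\<^sub>R w x) = a * G v + b * G w"
      using F G that unfolding Hm2_def by blast+
    then show ?thesis by (simp add: algebra_simps)
  qed
  ultimately show ?thesis unfolding Hm2_def by blast
qed

text \<open>Strong measurability refers to the dual norm, so pairing with a fixed \<open>v\<close>
  turns the simple approximants into scalar simple functions that still converge. The majorant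
  \<open>1 + (hm2_norm L (g t))\<^sup>2\<close> is used since only the square is known to be
  integrable.\<close>

lemma Hm2_time_integrable:
  assumes g: "g \<in> L2_time T (Hm2 L) (hm2_norm L)" and v: "v \<in> H2 L"
  shows "integrable (lebesgue_on {0..T}) (\<lambda>t. g t v)"
proof -
  have mem: "AE t in lebesgue_on {0..T}. g t \<in> Hm2 L" and sq: "integrable (lebesgue_on {0..T}) (\<lambda>t. (hm2_norm L (g t))\<^sup>2)"
    using g by (auto simp: L2_time_def)
  obtain s where s: "\<And>n. simple_function (lebesgue_on {0..T}) (s n)" "\<And>n. s n ` {0..T} \<subseteq> Hm2 L"
    "AE t in lebesgue_on {0..T}. (\<lambda>n. hm2_norm L (s n t - g t)) \<longlonglongrightarrow> 0"
    using g unfolding L2_time_def strongly_measurable_def by blast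
  have m: "(\<lambda>t. s n t v) \<in> borel_measurable (lebesgue_on {0..T})" for n
    by (intro borel_measurable_simple_function simple_function_compose1[OF s(1), of "\<lambda>F. F v"])
  have lim: "AE t in lebesgue_on {0..T}. (\<lambda>n. s n t v) \<longlonglongrightarrow> g t v"
    using s(3) mem AE_space
  proof eventually_elim
    case (elim t)
    have "(\<lambda>n. s n t v - g t v) \<longlonglongrightarrow> 0"
    proof (rule Lim_null_comparison)
      have "\<bar>s n t v - g t v\<bar> \<le> hm2_norm L (s n t - g t) * h2_norm L v" for n
        using Hm2_bound[OF Hm2_minus v, of "s n t" "g t"] s(2)[of n] elim by (auto simp: image_subset_iff)
      then show "\<forall>\<^sub>F n in sequentially. norm (s n t v - g t v) \<le> hm2_norm L (s n t - g t) * h2_norm L v"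
        by (intro always_eventually) simp
      show "(\<lambda>n. hm2_norm L (s n t - g t) * h2_norm L v) \<longlonglongrightarrow> 0"
        by (rule tendsto_mult_left_zero[OF elim(1)])
    qed
    then show ?case by (simp add: LIM_zero_iff)
  qed
  have "AE t in lebesgue_on {0..T}. lim (\<lambda>n. s n t v) = g t v" using lim by eventually_elim (rule limI)
  then have gm: "(\<lambda>t. g t v) \<in> borel_measurable (lebesgue_on {0..T})"
    by (rule measurable_AE_lebesgue_on[OF borel_measurable_lim_metric[OF m]])
  have "integrable (lebesgue_on {0..T}) (\<lambda>t. (1 + (hm2_norm L (g t))\<^sup>2) * h2_norm L v)"
    using sq by simp
  then show ?thesis
  proof (rule Bochner_Integration.integrable_bound[OF _ gm])
    show "AE t in lebesgue_on {0..T}. norm (g t v) \<le> norm ((1 + (hm2_norm L (g t))\<^sup>2) * h2_norm L v)"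
      using mem
    proof eventually_elim
      case (elim t)
      have "hm2_norm L (g t) \<le> 1 + (hm2_norm L (g t))\<^sup>2"
        using sum_squares_bound[of 1 "hm2_norm L (g t)"] hm2_norm_nonneg[OF elim] by simp
      from mult_right_mono[OF this h2_norm_nonneg[of L v]]
      have "\<bar>g t v\<bar> \<le> (1 + (hm2_norm L (g t))\<^sup>2) * h2_norm L v" using Hm2_bound[OF elim v] by linarith
      then show ?case by (simp add: abs_mult)
    qed
  qed
qed

lemma C_time_L2: "u \<in> C_time T (L2 L) (l2_norm L) \<Longrightarrow> t \<in> {0..T} \<Longrightarrow> u t \<in> L2 L"
  by (simp add: C_time_def)

lemma C_time_cf_continuous:
  assumes u: "u \<in> C_time T (L2 L) (l2_norm L)"
  shows "continuous_on {0..T} (\<lambda>t. cf (u t) k)"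
  unfolding continuous_on_def
proof
  fix t assume t: "t \<in> {0..T}"
  have "((\<lambda>s. cf (u s) k - cf (u t) k) \<longlongrightarrow> 0) (at t within {0..T})"
  proof (rule Lim_null_comparison)
    show "((\<lambda>s. l2_norm L (u s - u t)) \<longlongrightarrow> 0) (at t within {0..T})" using u t by (simp add: C_time_def)
    show "\<forall>\<^sub>F s in at t within {0..T}. norm (cf (u s) k - cf (u t) k) \<le> l2_norm L (u s - u t)"
      unfolding eventually_at_filter
    proof (intro always_eventually allI impI)
      fix s assume s: "s \<in> {0..T}"
      have uL: "u s \<in> L2 L" "u t \<in> L2 L" using C_time_L2[OF u] s t by auto
      show "norm (cf (u s) k - cf (u t) k) \<le> l2_norm L (u s - u t)"
        using norm_cf_le[OF L2_minus[OF uL], of k] by (simp only: cf_minus[OF uL])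
    qed
  qed
  then show "((\<lambda>s. cf (u s) k) \<longlongrightarrow> cf (u t) k) (at t within {0..T})" by (simp add: LIM_zero_iff)
qed

lemma C_time_norm_continuous:
  assumes u: "u \<in> C_time T (L2 L) (l2_norm L)" and v: "v \<in> C_time T (L2 L) (l2_norm L)"
  shows "continuous_on {0..T} (\<lambda>t. l2_norm L (u t - v t))"
  unfolding continuous_on_def
proof
  fix t assume t: "t \<in> {0..T}"
  have "((\<lambda>s. l2_norm L (u s - v s) - l2_norm L (u t - v t)) \<longlongrightarrow> 0) (at t within {0..T})"
  proof (rule Lim_null_comparison)
    have "((\<lambda>s. l2_norm L (u s - u t) + l2_norm L (v s - v t)) \<longlongrightarrow> 0 + 0) (at t within {0..T})"
      using u v t by (intro tendsto_add) (simp_all add: C_time_def)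
    then show "((\<lambda>s. l2_norm L (u s - u t) + l2_norm L (v s - v t)) \<longlongrightarrow> 0) (at t within {0..T})" by simp
    show "\<forall>\<^sub>F s in at t within {0..T}. norm (l2_norm L (u s - v s) - l2_norm L (u t - v t)) \<le> l2_norm L (u s - u t) + l2_norm L (v s - v t)"
      unfolding eventually_at_filter
    proof (intro always_eventually allI impI)
      fix s assume s: "s \<in> {0..T}"
      have uL: "u s \<in> L2 L" "u t \<in> L2 L" "v s \<in> L2 L" "v t \<in> L2 L"
        using C_time_L2[OF u] C_time_L2[OF v] s t by auto
      have "\<bar>l2_norm L (u s - v s) - l2_norm L (u t - v t)\<bar> \<le> l2_norm L (\<lambda>x. (u s - v s) x - (u t - v t) x)"
        by (intro l2_norm_triangle_diff L2_minus uL)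
      also have "(\<lambda>x. (u s - v s) x - (u t - v t) x) = (\<lambda>x. (u s - u t) x - (v s - v t) x)" by (simp add: fun_eq_iff)
      also have "l2_norm L (\<lambda>x. (u s - u t) x - (v s - v t) x) \<le> l2_norm L (u s - u t) + l2_norm L (v s - v t)"
        by (intro l2_norm_diff_le L2_minus uL)
      finally show "norm (l2_norm L (u s - v s) - l2_norm L (u t - v t)) \<le> l2_norm L (u s - u t) + l2_norm L (v s - v t)"
        by (simp only: real_norm_def)
    qed
  qed
  then show "((\<lambda>s. l2_norm L (u s - v s)) \<longlongrightarrow> l2_norm L (u t - v t)) (at t within {0..T})" by (simp add: LIM_zero_iff)
qed

end

context calmed
begin

definition lam :: "int \<times> int \<Rightarrow> real" where
  "lam k = (q k)\<^sup>2 - q k"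

text \<open>Testing with \<open>bas k\<close> times a coordinate vector diagonalises the linear part
  and reduces the equation to one scalar weak differential equation per frequency and component.
  Each of them says that the component is absolutely continuous.\<close>

lemma weak_solution_coefficients:
  assumes T: "T > 0" and sol: "weak_solution L T \<eta> u0 u"
  obtains G where "\<And>k i. integrable (lebesgue_on {0..T}) (G k i)"
    "AE t in lebesgue_on {0..T}. \<forall>k i. G k i t = - (lam k * cf (u t) k $ i + cf (adv (u t)) k $ i)"
    "\<And>k i x y. 0 \<le> x \<Longrightarrow> x \<le> y \<Longrightarrow> y \<le> T \<Longrightarrow> cf (u y) k $ i - cf (u x) k $ i = integral\<^sup>L (lebesgue_on {x..y}) (G k i)"
proof -
  obtain g where g: "g \<in> L2_time T (Hm2 L) (hm2_norm L)" "is_time_derivative L T u g"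
     "AE t in lebesgue_on {0..T}. \<forall>v\<in>H2 L. g t v + l2_inner L (adv (u t)) v
             + l2_inner L (lap L (u t)) v + bilap L (u t) v = 0"
    using sol unfolding weak_solution_def by blast
  have uC: "u \<in> C_time T (L2 L) (l2_norm L)" and uH: "AE t in lebesgue_on {0..T}. u t \<in> H2 L"
    using sol unfolding weak_solution_def L2_time_def by auto
  define b where "b k i = (\<lambda>x. bas k x *\<^sub>R (axis i 1 :: real^2))" for k i
  have b: "b k i \<in> H2 L" for k i unfolding b_def by (rule bas_H2)
  have ib: "l2_inner L w (b k i) = cf w k $ i" if "w \<in> L2 L" for w k i
    unfolding b_def l2_inner_bas[OF that] by (simp add: inner_axis)
  define G where "G k i t = g t (b k i)" for k i t
  have Gi: "integrable (lebesgue_on {0..T}) (G k i)" for k i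
    unfolding G_def by (rule Hm2_time_integrable[OF g(1) b])
  have eq: "AE t in lebesgue_on {0..T}. \<forall>k i. G k i t = - (lam k * cf (u t) k $ i + cf (adv (u t)) k $ i)"
    using g(3) uH
  proof eventually_elim
    case (elim t)
    show ?case
    proof (intro allI)
      fix k i
      have lapb: "lap L (b k i) \<in> L2 L" by (rule lap_H2(1)[OF b])
      have "bilap L (u t) (b k i) = (q k)\<^sup>2 * cf (u t) k $ i"
      proof -
        have "((\<lambda>m. cf (lap L (u t)) m \<bullet> cf (lap L (b k i)) m) has_sum bilap L (u t) (b k i)) UNIV"
          unfolding bilap_def by (rule parseval[OF lap_H2(1)[OF elim(2)] lapb])
        moreover have "cf (lap L (u t)) m \<bullet> cf (lap L (b k i)) m = (if m = k then (q k)\<^sup>2 * cf (u t) k $ i else 0)" for m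
          unfolding lap_H2(2)[OF elim(2)] lap_H2(2)[OF b] by (auto simp: b_def cf_bas inner_axis power2_eq_square)
        ultimately have "((\<lambda>m. if m = k then (q k)\<^sup>2 * cf (u t) k $ i else 0) has_sum bilap L (u t) (b k i)) UNIV" by simp
        moreover have "((\<lambda>m. if m = k then (q k)\<^sup>2 * cf (u t) k $ i else 0) has_sum (q k)\<^sup>2 * cf (u t) k $ i) UNIV"
          by (rule has_sum_finite_neutralI[of "{k}"]) auto
        ultimately show ?thesis by (rule has_sum_unique)
      qed
      moreover have "l2_inner L (lap L (u t)) (b k i) = - (q k * cf (u t) k $ i)"
        unfolding ib[OF lap_H2(1)[OF elim(2)]] lap_H2(2)[OF elim(2)] by simp
      moreover have "l2_inner L (adv (u t)) (b k i) = cf (adv (u t)) k $ i"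
        by (rule ib[OF adv_L2[OF H2_Sob1[OF elim(2)]]])
      moreover have "g t (b k i) + l2_inner L (adv (u t)) (b k i) + l2_inner L (lap L (u t)) (b k i) + bilap L (u t) (b k i) = 0"
        using elim(1) b by blast
      ultimately show "G k i t = - (lam k * cf (u t) k $ i + cf (adv (u t)) k $ i)"
        by (simp add: G_def lam_def algebra_simps)
    qed
  qed
  have inc: "cf (u y) k $ i - cf (u x) k $ i = integral\<^sup>L (lebesgue_on {x..y}) (G k i)"
    if xy: "0 \<le> x" "x \<le> y" "y \<le> T" for k i x y
  proof (rule weak_derivative_increment[OF T _ Gi _ xy])
    show "continuous_on {0..T} (\<lambda>t. cf (u t) k $ i)"
      by (intro continuous_intros C_time_cf_continuous[OF uC])
    fix \<phi> assume \<phi>: "test_function_on T \<phi>"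
    have "integral\<^sup>L (lebesgue_on {0..T}) (\<lambda>t. deriv \<phi> t * cf (u t) k $ i)
      = integral\<^sup>L (lebesgue_on {0..T}) (\<lambda>t. deriv \<phi> t * l2_inner L (u t) (b k i))"
      by (intro Bochner_Integration.integral_cong refl) (simp add: ib C_time_L2[OF uC])
    also have "\<dots> = - integral\<^sup>L (lebesgue_on {0..T}) (\<lambda>t. \<phi> t * g t (b k i))"
      using g(2) \<phi> b unfolding is_time_derivative_def by blast
    finally show "integral\<^sup>L (lebesgue_on {0..T}) (\<lambda>t. deriv \<phi> t * cf (u t) k $ i) = - integral\<^sup>L (lebesgue_on {0..T}) (\<lambda>t. \<phi> t * G k i t)"
      by (simp add: G_def)
  qed
  show thesis by (rule that[OF Gi eq inc])
qed

text \<open>Four times the difference of the two sides is \<open>(2 * q k - 3)\<^sup>2 + 3\<close>.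
  The linear part thus controls the H2 weight up to 4 times the L2 norm.\<close>

lemma lam_ge: "1 + q k + (q k)\<^sup>2 - 4 \<le> 2 * lam k"
proof -
  have "0 \<le> (2 * q k - 3)\<^sup>2" by simp
  then show ?thesis by (simp add: lam_def power2_eq_square algebra_simps)
qed

text \<open>The dissipation is available for the truncated frequencies only, whereas the nonlinear
  term is charged to half of the full H2 norm. As \<open>n\<close> grows the truncated sum recovers
  the full norm, and half of it is left.\<close>

lemma energy_pointwise:
  assumes u: "u \<in> H2 L" and v: "v \<in> H2 L"
  shows "- 2 * (\<Sum>k\<in>fbox n. lam k * (norm (cf (u - v) k))\<^sup>2 + (cf (adv u) k - cf (adv v) k) \<bullet> cf (u - v) k)
    \<le> - (\<Sum>k\<in>fbox n. (1 + q k + (q k)\<^sup>2) * (norm (cf (u - v) k))\<^sup>2) + (h2_norm L (u - v))\<^sup>2 / 2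
      + (4 + 16 * M\<^sup>2 + 16 * Csob\<^sup>2 * (h2_norm L v)\<^sup>2) * (l2_norm L (u - v))\<^sup>2"
proof -
  define w where "w = u - v"
  define p where "p = syn (fbox n) (cf w)"
  define h r z where "h = h2_norm L w" and "r = l2_norm L w" and "z = h2_norm L v"
  have w: "w \<in> H2 L" "w \<in> L2 L" unfolding w_def using H2_minus[OF u v] H2_L2 by auto
  have s: "u \<in> Sob L (Suc 0)" "v \<in> Sob L (Suc 0)" using u v by (auto intro: H2_Sob1 simp del: Sob.simps)
  have nn: "0 \<le> h" "0 \<le> r" "0 \<le> z" by (auto simp: h_def r_def z_def)
  have 1: "(\<Sum>k\<in>fbox n. (cf (adv u) k - cf (adv v) k) \<bullet> cf w k) = l2_inner L (adv u) p - l2_inner L (adv v) p"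
    unfolding p_def by (simp add: l2_inner_syn adv_L2 s inner_diff_left sum_subtractf del: Sob.simps)
  have "\<bar>l2_inner L (adv u) p - l2_inner L (adv v) p\<bar>
      \<le> 2 * M * h1_norm L w * l2_norm L p + 2 * (Csob * h) * r * h1_norm L v"
    unfolding w_def r_def p_def h_def by (intro adv_diff_inner s syn_L2 norm_syn_cf_le H2_minus u v finite_fbox)
  moreover have "2 * M * h1_norm L w * l2_norm L p \<le> 2 * M * h * r"
    unfolding h_def r_def p_def using M_nonneg h1_le_h2[OF w(1)] l2_norm_syn_cf_le[OF finite_fbox w(2), of n] by (intro mult_mono) auto
  moreover have "2 * (Csob * h) * r * h1_norm L v \<le> 2 * (Csob * h) * r * z"
    unfolding z_def using nn Csob_nonneg h1_le_h2[OF v] by (intro mult_left_mono) auto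
  ultimately have 2: "- 2 * (l2_inner L (adv u) p - l2_inner L (adv v) p) \<le> 4 * M * h * r + 4 * Csob * h * r * z"
    by (simp add: abs_le_iff algebra_simps)
  \<comment> \<open>Young's inequality twice, each time spending \<open>h\<^sup>2 / 4\<close>; this
    is where the constants 16 come from.\<close>
  have "0 \<le> (h / 2 - 4 * M * r)\<^sup>2" "0 \<le> (h / 2 - 4 * Csob * r * z)\<^sup>2" by simp_all
  then have 3: "4 * M * h * r + 4 * Csob * h * r * z \<le> h\<^sup>2 / 2 + (16 * M\<^sup>2 + 16 * Csob\<^sup>2 * z\<^sup>2) * r\<^sup>2"
    by (simp add: power2_eq_square algebra_simps)
  have "- 2 * (\<Sum>k\<in>fbox n. lam k * (norm (cf w k))\<^sup>2) \<le> (\<Sum>k\<in>fbox n. - ((1 + q k + (q k)\<^sup>2) * (norm (cf w k))\<^sup>2) + 4 * (norm (cf w k))\<^sup>2)"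
    unfolding sum_distrib_left
  proof (rule sum_mono)
    fix k
    show "- 2 * (lam k * (norm (cf w k))\<^sup>2) \<le> - ((1 + q k + (q k)\<^sup>2) * (norm (cf w k))\<^sup>2) + 4 * (norm (cf w k))\<^sup>2"
      using mult_right_mono[OF lam_ge[of k], of "(norm (cf w k))\<^sup>2"] by (simp add: algebra_simps)
  qed
  also have "\<dots> = - (\<Sum>k\<in>fbox n. (1 + q k + (q k)\<^sup>2) * (norm (cf w k))\<^sup>2) + 4 * (\<Sum>k\<in>fbox n. (norm (cf w k))\<^sup>2)"
    by (simp only: sum.distrib sum_negf sum_distrib_left)
  also have "\<dots> \<le> - (\<Sum>k\<in>fbox n. (1 + q k + (q k)\<^sup>2) * (norm (cf w k))\<^sup>2) + 4 * r\<^sup>2"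
    using bessel[OF finite_fbox w(2), of n] by (simp add: r_def)
  finally have 4: "- 2 * (\<Sum>k\<in>fbox n. lam k * (norm (cf w k))\<^sup>2) \<le> - (\<Sum>k\<in>fbox n. (1 + q k + (q k)\<^sup>2) * (norm (cf w k))\<^sup>2) + 4 * r\<^sup>2" .
  have 5: "(4 + 16 * M\<^sup>2 + 16 * Csob\<^sup>2 * z\<^sup>2) * r\<^sup>2 = 4 * r\<^sup>2 + (16 * M\<^sup>2 + 16 * Csob\<^sup>2 * z\<^sup>2) * r\<^sup>2"
    by (simp add: algebra_simps)
  show ?thesis
    unfolding w_def[symmetric] h_def[symmetric] r_def[symmetric] z_def[symmetric] sum.distrib 1 5
  proof -
    have "- 2 * ((\<Sum>k\<in>fbox n. lam k * (norm (cf w k))\<^sup>2) + (l2_inner L (adv u) p - l2_inner L (adv v) p))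
      = - 2 * (\<Sum>k\<in>fbox n. lam k * (norm (cf w k))\<^sup>2) + - 2 * (l2_inner L (adv u) p - l2_inner L (adv v) p)"
      by (rule distrib_left)
    also have "\<dots> \<le> (- (\<Sum>k\<in>fbox n. (1 + q k + (q k)\<^sup>2) * (norm (cf w k))\<^sup>2) + 4 * r\<^sup>2) + (h\<^sup>2 / 2 + (16 * M\<^sup>2 + 16 * Csob\<^sup>2 * z\<^sup>2) * r\<^sup>2)"
      by (rule add_mono[OF 4 order.trans[OF 2 3]])
    finally show "- 2 * ((\<Sum>k\<in>fbox n. lam k * (norm (cf w k))\<^sup>2) + (l2_inner L (adv u) p - l2_inner L (adv v) p))
      \<le> - (\<Sum>k\<in>fbox n. (1 + q k + (q k)\<^sup>2) * (norm (cf w k))\<^sup>2) + h\<^sup>2 / 2 + (4 * r\<^sup>2 + (16 * M\<^sup>2 + 16 * Csob\<^sup>2 * z\<^sup>2) * r\<^sup>2)"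
      by (simp only: add_ac)
  qed
qed

text \<open>Every component of every coefficient of \<open>w\<close> is absolutely continuous, so
  its square can be integrated in time. Sum over a square of frequencies, bound the rate by
  \<open>energy_pointwise\<close>, and let the square grow by dominated convergence.\<close>

lemma energy_inequality:
  assumes T: "T > 0" and su: "weak_solution L T \<eta> u0 u" and sv: "weak_solution L T \<eta> v0 v"
  defines "b \<equiv> \<lambda>s. 4 + 16 * M\<^sup>2 + 16 * Csob\<^sup>2 * (h2_norm L (v s))\<^sup>2"
    and "\<phi> \<equiv> \<lambda>s. (l2_norm L (u s - v s))\<^sup>2"
  shows "integrable (lebesgue_on {0..T}) (\<lambda>s. (h2_norm L (u s - v s))\<^sup>2)"
    "integrable (lebesgue_on {0..T}) b" "integrable (lebesgue_on {0..T}) (\<lambda>s. b s * \<phi> s)"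
    "t \<in> {0..T} \<Longrightarrow> \<phi> t + integral\<^sup>L (lebesgue_on {0..t}) (\<lambda>s. (h2_norm L (u s - v s))\<^sup>2) / 2
       \<le> \<phi> 0 + integral\<^sup>L (lebesgue_on {0..t}) (\<lambda>s. b s * \<phi> s)"
proof -
  have uC: "u \<in> C_time T (L2 L) (l2_norm L)" and uH: "AE t in lebesgue_on {0..T}. u t \<in> H2 L"
    and uI: "integrable (lebesgue_on {0..T}) (\<lambda>t. (h2_norm L (u t))\<^sup>2)"
    using su unfolding weak_solution_def L2_time_def by auto
  have vC: "v \<in> C_time T (L2 L) (l2_norm L)" and vH: "AE t in lebesgue_on {0..T}. v t \<in> H2 L"
    and vI: "integrable (lebesgue_on {0..T}) (\<lambda>t. (h2_norm L (v t))\<^sup>2)"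
    using sv unfolding weak_solution_def L2_time_def by auto
  obtain G where G: "\<And>k i. integrable (lebesgue_on {0..T}) (G k i)"
    "AE t in lebesgue_on {0..T}. \<forall>k i. G k i t = - (lam k * cf (u t) k $ i + cf (adv (u t)) k $ i)"
    "\<And>k i x y. 0 \<le> x \<Longrightarrow> x \<le> y \<Longrightarrow> y \<le> T \<Longrightarrow> cf (u y) k $ i - cf (u x) k $ i = integral\<^sup>L (lebesgue_on {x..y}) (G k i)"
    by (rule weak_solution_coefficients[OF T su]) blast
  obtain H where H: "\<And>k i. integrable (lebesgue_on {0..T}) (H k i)"
    "AE t in lebesgue_on {0..T}. \<forall>k i. H k i t = - (lam k * cf (v t) k $ i + cf (adv (v t)) k $ i)"
    "\<And>k i x y. 0 \<le> x \<Longrightarrow> x \<le> y \<Longrightarrow> y \<le> T \<Longrightarrow> cf (v y) k $ i - cf (v x) k $ i = integral\<^sup>L (lebesgue_on {x..y}) (H k i)"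
    by (rule weak_solution_coefficients[OF T sv]) blast
  define w where "w s = u s - v s" for s
  define W where "W k i s = cf (w s) k $ i" for k i s
  define Y where "Y n s = (\<Sum>k\<in>fbox n. (1 + q k + (q k)\<^sup>2) * (norm (cf (w s) k))\<^sup>2)" for n s
  define h where "h s = (h2_norm L (w s))\<^sup>2" for s
  have wL: "w s \<in> L2 L" if "s \<in> {0..T}" for s
    unfolding w_def by (intro L2_minus C_time_L2[OF uC] C_time_L2[OF vC] that)
  have cfw: "cf (w s) k = cf (u s) k - cf (v s) k" if "s \<in> {0..T}" for s k
    unfolding w_def by (intro cf_minus C_time_L2[OF uC] C_time_L2[OF vC] that)
  have cw: "continuous_on {0..T} (\<lambda>s. cf (w s) k)" for k
    by (rule continuous_on_eq[where f = "\<lambda>s. cf (u s) k - cf (v s) k"])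
       (auto simp: cfw intro!: continuous_on_diff C_time_cf_continuous uC vC)
  have cY: "continuous_on {0..T} (Y n)" for n
    unfolding Y_def by (intro continuous_intros cw)
  have wH: "AE s in lebesgue_on {0..T}. w s \<in> H2 L"
    using uH vH by eventually_elim (simp add: w_def H2_minus)
  have Yh: "AE s in lebesgue_on {0..T}. (\<lambda>n. Y n s) \<longlonglongrightarrow> h s"
    using wH by eventually_elim (unfold Y_def h_def, rule has_sum_fbox[OF has_sum_h2])
  have Yle: "AE s in lebesgue_on {0..T}. Y n s \<le> h s" for n
    using wH unfolding Y_def h_def
    by eventually_elim (rule finite_sum_le_has_sum[OF has_sum_h2], auto simp: h2_weight_pos)
  have Y0: "0 \<le> Y n s" for n s unfolding Y_def by (intro sum_nonneg mult_nonneg_nonneg h2_weight_pos) simp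
  \<comment> \<open>The H2 norm of the difference is measurable as an almost everywhere limit of its
    truncations \<open>Y n\<close>, which are continuous in time.\<close>
  have hm: "h \<in> borel_measurable (lebesgue_on {0..T})"
  proof (rule measurable_AE_lebesgue_on)
    show "(\<lambda>s. lim (\<lambda>n. Y n s)) \<in> borel_measurable (lebesgue_on {0..T})"
      by (intro borel_measurable_lim_metric continuous_imp_measurable_on_sets_lebesgue[OF cY]) simp
    show "AE s in lebesgue_on {0..T}. lim (\<lambda>n. Y n s) = h s" using Yh by eventually_elim (rule limI)
  qed
  have hI: "integrable (lebesgue_on {0..T}) h"
  proof (rule Bochner_Integration.integrable_bound[OF _ hm])
    show "integrable (lebesgue_on {0..T}) (\<lambda>s. 2 * (h2_norm L (u s))\<^sup>2 + 2 * (h2_norm L (v s))\<^sup>2)"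
      using uI vI by simp
    show "AE s in lebesgue_on {0..T}. norm (h s) \<le> norm (2 * (h2_norm L (u s))\<^sup>2 + 2 * (h2_norm L (v s))\<^sup>2)"
      using uH vH by eventually_elim (use h2_norm_minus_sq_le in \<open>auto simp: h_def w_def\<close>)
  qed
  then show "integrable (lebesgue_on {0..T}) (\<lambda>s. (h2_norm L (u s - v s))\<^sup>2)"
    unfolding h_def[abs_def] w_def .
  interpret fT: finite_measure "lebesgue_on {0..T}" by (rule finite_measure_lebesgue_on) simp
  show bI: "integrable (lebesgue_on {0..T}) b" unfolding b_def using vI by simp
  have c\<phi>: "continuous_on {0..T} \<phi>"
    unfolding \<phi>_def by (intro continuous_intros C_time_norm_continuous uC vC)
  show b\<phi>: "integrable (lebesgue_on {0..T}) (\<lambda>s. b s * \<phi> s)"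
    using continuous_lint_mult[OF bI c\<phi>] by (simp add: mult.commute)
  assume t: "t \<in> {0..T}"
  have t0: "0 \<le> t" "t \<le> T" using t by auto
  define D where "D k i s = G k i s - H k i s" for k i s
  have DI: "integrable (lebesgue_on {0..t}) (D k i)" for k i
    unfolding D_def using t0 by (intro Bochner_Integration.integrable_diff lebesgue_on_subinterval[OF G(1)] lebesgue_on_subinterval[OF H(1)]) auto
  have Winc: "W k i y - W k i x = integral\<^sup>L (lebesgue_on {x..y}) (D k i)" if "0 \<le> x" "x \<le> y" "y \<le> t" for k i x y
  proof -
    have "integrable (lebesgue_on {x..y}) (G k i)" "integrable (lebesgue_on {x..y}) (H k i)"
      using that t0 by (intro lebesgue_on_subinterval[OF G(1)] lebesgue_on_subinterval[OF H(1)]; simp)+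
    then show ?thesis
      using G(3)[of x y k i] H(3)[of x y k i] that t0 unfolding D_def W_def by (simp add: cfw Bochner_Integration.integral_diff)
  qed
  have WD: "integrable (lebesgue_on {0..t}) (\<lambda>s. W k i s * D k i s)"
    "(W k i t)\<^sup>2 - (W k i 0)\<^sup>2 = 2 * integral\<^sup>L (lebesgue_on {0..t}) (\<lambda>s. W k i s * D k i s)" for k i
    by (rule square_of_integral[OF DI t0(1) Winc]; assumption)+
  have hI': "integrable (lebesgue_on {0..t}) h" and b\<phi>': "integrable (lebesgue_on {0..t}) (\<lambda>s. b s * \<phi> s)"
    using t0 by (intro lebesgue_on_subinterval[OF hI] lebesgue_on_subinterval[OF b\<phi>]; simp)+
  have YI: "integrable (lebesgue_on {0..t}) (Y n)" for n
    by (rule continuous_lint[OF continuous_on_subset[OF cY]]) (use t0 in auto)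
  have sub: "AE s in lebesgue_on {0..t}. P s" if "AE s in lebesgue_on {0..T}. P s" for P
    by (rule AE_lebesgue_on_subset[OF that]) (use t0 in auto)
  define E where "E n s = (\<Sum>k\<in>fbox n. (norm (cf (w s) k))\<^sup>2)" for n s
  have nsq: "(norm (x::real^2))\<^sup>2 = (\<Sum>i\<in>UNIV. (x $ i)\<^sup>2)" for x
    unfolding power2_norm_eq_inner inner_vec_def by (simp add: power2_eq_square)
  have main: "E n t + integral\<^sup>L (lebesgue_on {0..t}) (Y n)
    \<le> \<phi> 0 + integral\<^sup>L (lebesgue_on {0..t}) (\<lambda>s. h s / 2 + b s * \<phi> s)" for n
  proof -
    let ?R = "\<lambda>s. \<Sum>k\<in>fbox n. \<Sum>i\<in>UNIV. W k i s * D k i s"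
    have RI: "integrable (lebesgue_on {0..t}) ?R" by (intro Bochner_Integration.integrable_sum WD)
    have "E n t - E n 0 = (\<Sum>k\<in>fbox n. \<Sum>i\<in>UNIV. (W k i t)\<^sup>2 - (W k i 0)\<^sup>2)"
      by (simp add: E_def nsq W_def sum_subtractf)
    also have "\<dots> = 2 * integral\<^sup>L (lebesgue_on {0..t}) ?R"
      unfolding WD(2) by (simp add: WD(1) Bochner_Integration.integral_sum Bochner_Integration.integrable_sum sum_distrib_left)
    also have "\<dots> = integral\<^sup>L (lebesgue_on {0..t}) (\<lambda>s. 2 * ?R s)" by simp
    also have "\<dots> \<le> integral\<^sup>L (lebesgue_on {0..t}) (\<lambda>s. - Y n s + (h s / 2 + b s * \<phi> s))"
    proof (rule integral_mono_AE)
      show "AE s in lebesgue_on {0..t}. 2 * ?R s \<le> - Y n s + (h s / 2 + b s * \<phi> s)"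
        using sub[OF uH] sub[OF vH] sub[OF G(2)] sub[OF H(2)] AE_space
      proof eventually_elim
        case (elim s)
        then have s: "s \<in> {0..T}" using t0 by auto
        have D: "D k i s = - (lam k * W k i s + (cf (adv (u s)) k $ i - cf (adv (v s)) k $ i))" for k i
        proof -
          have "G k i s = - (lam k * cf (u s) k $ i + cf (adv (u s)) k $ i)" "H k i s = - (lam k * cf (v s) k $ i + cf (adv (v s)) k $ i)"
            using elim by blast+
          then show ?thesis by (simp add: D_def W_def cfw[OF s] algebra_simps)
        qed
        have "?R s = - (\<Sum>k\<in>fbox n. lam k * (norm (cf (w s) k))\<^sup>2 + (cf (adv (u s)) k - cf (adv (v s)) k) \<bullet> cf (w s) k)"
          unfolding D nsq inner_vec_def
          by (simp add: W_def sum_2 sum_negf[symmetric] power2_eq_square algebra_simps)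
        then have "2 * ?R s = - 2 * (\<Sum>k\<in>fbox n. lam k * (norm (cf (w s) k))\<^sup>2 + (cf (adv (u s)) k - cf (adv (v s)) k) \<bullet> cf (w s) k)"
          by simp
        then show ?case
          using energy_pointwise[OF elim(1,2), of n] by (simp only: w_def Y_def h_def b_def \<phi>_def)
      qed
    qed (use RI YI hI' b\<phi>' in auto)
    also have "\<dots> = - integral\<^sup>L (lebesgue_on {0..t}) (Y n) + integral\<^sup>L (lebesgue_on {0..t}) (\<lambda>s. h s / 2 + b s * \<phi> s)"
      using YI hI' b\<phi>' by (subst Bochner_Integration.integral_add) auto
    finally have "E n t - E n 0 \<le> - integral\<^sup>L (lebesgue_on {0..t}) (Y n) + integral\<^sup>L (lebesgue_on {0..t}) (\<lambda>s. h s / 2 + b s * \<phi> s)" .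
    moreover have "E n 0 \<le> \<phi> 0"
      unfolding E_def \<phi>_def w_def[symmetric] by (rule bessel[OF finite_fbox wL]) (use T in auto)
    ultimately show ?thesis by linarith
  qed
  have "(\<lambda>n. integral\<^sup>L (lebesgue_on {0..t}) (Y n)) \<longlonglongrightarrow> integral\<^sup>L (lebesgue_on {0..t}) h"
  proof (rule integral_dominated_convergence[where w = h])
    show "AE s in lebesgue_on {0..t}. norm (Y n s) \<le> h s" for n
      using sub[OF Yle[of n]] by eventually_elim (simp add: Y0)
    show "AE s in lebesgue_on {0..t}. (\<lambda>n. Y n s) \<longlonglongrightarrow> h s" by (rule sub[OF Yh])
  qed (use hI' YI in auto)
  moreover have "(\<lambda>n. E n t) \<longlonglongrightarrow> \<phi> t"
    unfolding E_def \<phi>_def w_def[symmetric] by (rule has_sum_fbox[OF parseval_norm[OF wL[OF t]]])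
  ultimately have "\<phi> t + integral\<^sup>L (lebesgue_on {0..t}) h \<le> \<phi> 0 + integral\<^sup>L (lebesgue_on {0..t}) (\<lambda>s. h s / 2 + b s * \<phi> s)"
    by (intro LIMSEQ_le_const2[OF tendsto_add]) (use main in auto)
  moreover have "integral\<^sup>L (lebesgue_on {0..t}) (\<lambda>s. h s / 2 + b s * \<phi> s)
     = integral\<^sup>L (lebesgue_on {0..t}) h / 2 + integral\<^sup>L (lebesgue_on {0..t}) (\<lambda>s. b s * \<phi> s)"
    using hI' b\<phi>' by (subst Bochner_Integration.integral_add) auto
  ultimately show "\<phi> t + integral\<^sup>L (lebesgue_on {0..t}) (\<lambda>s. (h2_norm L (u s - v s))\<^sup>2) / 2
       \<le> \<phi> 0 + integral\<^sup>L (lebesgue_on {0..t}) (\<lambda>s. b s * \<phi> s)"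
    unfolding h_def w_def by linarith
qed

text \<open>Gronwall's lemma for the squared L2 norm; \<open>b\<close> involves \<open>v\<close>
  alone, so \<open>K\<close> serves every competitor. Solutions match their data only almost
  everywhere, which the norms do not see. The factor 2 in the last bound undoes the half in front of
  the dissipation.\<close>

lemma weak_solution_stability:
  assumes T: "T > 0" and sv: "weak_solution L T \<eta> v0 v" and v0: "v0 \<in> L2 L"
  obtains K where "K \<ge> 0"
    "\<And>u u0 t. weak_solution L T \<eta> u0 u \<Longrightarrow> u0 \<in> L2 L \<Longrightarrow> t \<in> {0..T} \<Longrightarrow> (l2_norm L (u t - v t))\<^sup>2 \<le> K * (l2_norm L (u0 - v0))\<^sup>2"
    "\<And>u u0. weak_solution L T \<eta> u0 u \<Longrightarrow> u0 \<in> L2 L \<Longrightarrow>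
       integral\<^sup>L (lebesgue_on {0..T}) (\<lambda>s. (h2_norm L (u s - v s))\<^sup>2) \<le> 2 * K * (l2_norm L (u0 - v0))\<^sup>2"
proof -
  define b where "b = (\<lambda>s. 4 + 16 * M\<^sup>2 + 16 * Csob\<^sup>2 * (h2_norm L (v s))\<^sup>2)"
  have b0: "0 \<le> b s" for s by (simp add: b_def)
  define K where "K = exp (2 * integral\<^sup>L (lebesgue_on {0..T}) b)"
  have main: "(l2_norm L (u t - v t))\<^sup>2 + integral\<^sup>L (lebesgue_on {0..t}) (\<lambda>s. (h2_norm L (u s - v s))\<^sup>2) / 2 \<le> K * (l2_norm L (u0 - v0))\<^sup>2"
    if su: "weak_solution L T \<eta> u0 u" and u0: "u0 \<in> L2 L" and t: "t \<in> {0..T}" for u u0 t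
  proof -
    define \<phi> where "\<phi> s = (l2_norm L (u s - v s))\<^sup>2" for s
    note e = energy_inequality[OF T su sv]
    have en: "integrable (lebesgue_on {0..T}) b" "integrable (lebesgue_on {0..T}) (\<lambda>s. b s * \<phi> s)"
      using e(2,3) unfolding b_def \<phi>_def .
    have en4: "\<phi> s + integral\<^sup>L (lebesgue_on {0..s}) (\<lambda>s. (h2_norm L (u s - v s))\<^sup>2) / 2
       \<le> \<phi> 0 + integral\<^sup>L (lebesgue_on {0..s}) (\<lambda>s. b s * \<phi> s)" if "s \<in> {0..T}" for s
      using e(4)[OF that] unfolding b_def \<phi>_def .
    have le: "\<phi> s \<le> \<phi> 0 + integral\<^sup>L (lebesgue_on {0..s}) (\<lambda>s. b s * \<phi> s)" if "s \<in> {0..T}" for s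
    proof -
      have "0 \<le> integral\<^sup>L (lebesgue_on {0..s}) (\<lambda>s. (h2_norm L (u s - v s))\<^sup>2)" by simp
      then show ?thesis using en4[OF that] by linarith
    qed
    have "\<phi> t + integral\<^sup>L (lebesgue_on {0..t}) (\<lambda>s. (h2_norm L (u s - v s))\<^sup>2) / 2 \<le> \<phi> 0 + integral\<^sup>L (lebesgue_on {0..t}) (\<lambda>s. b s * \<phi> s)"
      by (rule en4[OF t])
    also have "\<dots> \<le> \<phi> 0 * exp (2 * integral\<^sup>L (lebesgue_on {0..t}) b)"
      by (rule gronwall_integrable[OF _ en(1) b0 en(2) _ _ le t]) (use T in \<open>auto simp: \<phi>_def\<close>)
    also have "\<dots> \<le> \<phi> 0 * K"
    proof -
      have "integral\<^sup>L (lebesgue_on {0..T}) b = integral\<^sup>L (lebesgue_on {0..t}) b + integral\<^sup>L (lebesgue_on {t..T}) b"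
        using t by (intro lint_combine en(1)) auto
      moreover have "0 \<le> integral\<^sup>L (lebesgue_on {t..T}) b" by (simp add: b0)
      ultimately show ?thesis unfolding K_def by (intro mult_left_mono) (auto simp: \<phi>_def)
    qed
    also have "\<phi> 0 = (l2_norm L (u0 - v0))\<^sup>2"
    proof -
      have "AE x in lebesgue. u 0 x = u0 x" "AE x in lebesgue. v 0 x = v0 x"
        using su sv unfolding weak_solution_def by auto
      then have "AE x in lebesgue. (u 0 - v 0) x = (u0 - v0) x" by eventually_elim simp
      then have ae: "AE x in mu L. (u 0 - v 0) x = (u0 - v0) x" unfolding AE_mu_iff by eventually_elim blast
      have "u 0 \<in> L2 L" "v 0 \<in> L2 L" using su sv T unfolding weak_solution_def C_time_def by auto
      then have "l2_norm L (u 0 - v 0) = l2_norm L (u0 - v0)"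
        using u0 v0 by (intro l2_norm_cong_AE ae L2_minus)
      then show ?thesis by (simp add: \<phi>_def)
    qed
    finally have "\<phi> t + integral\<^sup>L (lebesgue_on {0..t}) (\<lambda>s. (h2_norm L (u s - v s))\<^sup>2) / 2 \<le> (l2_norm L (u0 - v0))\<^sup>2 * K" .
    then show ?thesis by (simp only: \<phi>_def mult.commute[of K])
  qed
  show thesis
  proof (rule that[of K])
    show "K \<ge> 0" by (simp add: K_def)
    fix u u0 assume su: "weak_solution L T \<eta> u0 u" and u0: "u0 \<in> L2 L"
    show "(l2_norm L (u t - v t))\<^sup>2 \<le> K * (l2_norm L (u0 - v0))\<^sup>2" if "t \<in> {0..T}" for t
    proof -
      have "0 \<le> integral\<^sup>L (lebesgue_on {0..t}) (\<lambda>s. (h2_norm L (u s - v s))\<^sup>2)" by simp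
      then show ?thesis using main[OF su u0 that] by linarith
    qed
    show "integral\<^sup>L (lebesgue_on {0..T}) (\<lambda>s. (h2_norm L (u s - v s))\<^sup>2) \<le> 2 * K * (l2_norm L (u0 - v0))\<^sup>2"
    proof -
      have "T \<in> {0..T}" using T by simp
      from main[OF su u0 this] zero_le_power2[of "l2_norm L (u T - v T)"] show ?thesis by linarith
    qed
  qed
qed

end

section \<open>Singular kernels and smoothing\<close>

lemma powr_lint:
  fixes b t :: real
  assumes b: "b < 1" and t: "0 \<le> t"
  shows "integrable (lebesgue_on {0..t}) (\<lambda>s. s powr (- b))"
    "integral\<^sup>L (lebesgue_on {0..t}) (\<lambda>s. s powr (- b)) = t powr (1 - b) / (1 - b)"
    "integrable (lebesgue_on {0..t}) (\<lambda>s. (t - s) powr (- b))"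
    "integral\<^sup>L (lebesgue_on {0..t}) (\<lambda>s. (t - s) powr (- b)) = t powr (1 - b) / (1 - b)"
proof -
  have conv: "integrable (lebesgue_on {0..t}) f \<and> integral\<^sup>L (lebesgue_on {0..t}) f = I"
    if "(f has_integral I) {0..t}" "\<And>s. 0 \<le> f s" for f :: "real \<Rightarrow> real" and I
  proof -
    have "f absolutely_integrable_on {0..t}"
      using that by (intro nonnegative_absolutely_integrable_1) (auto simp: integrable_on_def)
    then have "integrable (lebesgue_on {0..t}) f" by (rule absolutely_integrable_imp_integrable) simp
    then show ?thesis using lebesgue_integral_eq_integral[of "{0..t}" f] integral_unique[OF that(1)] by simp
  qed
  have 1: "((\<lambda>s. s powr (- b)) has_integral t powr (1 - b) / (1 - b)) {0..t}"
    using has_integral_powr_from_0[of "- b" t] b t by simp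
  have "((\<lambda>s. (t - s) powr (- b)) has_integral t powr (1 - b) / (1 - b)) {0..t}"
  proof -
    have "(\<lambda>x. - x + t) ` {0..t} = {0..t}"
      by (auto intro: image_eqI[of _ _ "t - _"])
    then show ?thesis
      using has_integral_affinity[of "\<lambda>s. s powr (- b)" "t powr (1 - b) / (1 - b)" 0 t "- 1" t] 1
      by (simp add: add.commute)
  qed
  with conv 1 show "integrable (lebesgue_on {0..t}) (\<lambda>s. s powr (- b))"
    "integral\<^sup>L (lebesgue_on {0..t}) (\<lambda>s. s powr (- b)) = t powr (1 - b) / (1 - b)"
    "integrable (lebesgue_on {0..t}) (\<lambda>s. (t - s) powr (- b))"
    "integral\<^sup>L (lebesgue_on {0..t}) (\<lambda>s. (t - s) powr (- b)) = t powr (1 - b) / (1 - b)"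
    by auto
qed

text \<open>A crude upper bound, obtained from splitting at \<open>t / 2\<close>, for the Beta
  function value at \<open>1 - a\<close> and \<open>1 - b\<close> that the convolution of the two
  powers would give exactly.\<close>

definition kernel_const :: "real \<Rightarrow> real \<Rightarrow> real" where
  "kernel_const a b = 2 powr a / (1 - b) + 2 powr b / (1 - a)"

lemma kernel_const_nonneg: "a < 1 \<Longrightarrow> b < 1 \<Longrightarrow> 0 \<le> kernel_const a b"
  by (simp add: kernel_const_def)

lemma AE_not_endpoints: "AE s in lebesgue_on {0..t}. s \<noteq> 0 \<and> s \<noteq> (t::real)"
proof -
  have "AE s in lebesgue. s \<notin> {0, t}" by (intro AE_not_in null_sets_completionI finite_imp_null_set_lborel) simp
  then show ?thesis by (subst AE_restrict_space_iff) (auto elim: eventually_mono)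
qed

text \<open>One of \<open>s\<close> and \<open>t - s\<close> is at least \<open>t / 2\<close>.\<close>

lemma kernel_convolution_bound:
  fixes F :: "real \<Rightarrow> real^2"
  assumes ab: "0 \<le> a" "a < 1" "0 \<le> b" "b < 1" and t: "0 < t" and B: "0 \<le> B"
    and F: "\<And>s. 0 < s \<Longrightarrow> s < t \<Longrightarrow> norm (F s) \<le> B * ((t - s) powr (- a) * s powr (- b))"
  shows "norm (integral\<^sup>L (lebesgue_on {0..t}) F) \<le> B * kernel_const a b * t powr (1 - a - b)"
proof -
  let ?g = "\<lambda>s. B * ((t / 2) powr (- a) * s powr (- b) + (t / 2) powr (- b) * (t - s) powr (- a))"
  have gi: "integrable (lebesgue_on {0..t}) ?g"
    using powr_lint(1)[OF ab(4), of t] powr_lint(3)[OF ab(2), of t] t by simp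
  have val: "integral\<^sup>L (lebesgue_on {0..t}) ?g = B * kernel_const a b * t powr (1 - a - b)"
  proof -
    have "integral\<^sup>L (lebesgue_on {0..t}) ?g
      = B * ((t / 2) powr (- a) * (t powr (1 - b) / (1 - b)) + (t / 2) powr (- b) * (t powr (1 - a) / (1 - a)))"
      using powr_lint[OF ab(4), of t] powr_lint[OF ab(2), of t] t by (simp add: Bochner_Integration.integral_add)
    moreover have "(t / 2) powr (- a) * t powr (1 - b) = 2 powr a * t powr (1 - a - b)"
      using t by (simp add: powr_divide powr_minus powr_diff field_simps powr_add)
    moreover have "(t / 2) powr (- b) * t powr (1 - a) = 2 powr b * t powr (1 - a - b)"
      using t by (simp add: powr_divide powr_minus powr_diff field_simps powr_add)
    ultimately show ?thesis by (simp add: kernel_const_def algebra_simps)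
  qed
  have pt: "norm (F s) \<le> ?g s" if s: "0 < s" "s < t" for s
  proof -
    have "(t - s) powr (- a) * s powr (- b) \<le> (t / 2) powr (- a) * s powr (- b) + (t / 2) powr (- b) * (t - s) powr (- a)"
    proof (cases "s \<le> t / 2")
      case True
      have "(t - s) powr (- a) \<le> (t / 2) powr (- a)" using True s ab by (intro powr_mono2') auto
      then have "(t - s) powr (- a) * s powr (- b) \<le> (t / 2) powr (- a) * s powr (- b)" by (rule mult_right_mono) simp
      then show ?thesis by (rule order.trans) simp
    next
      case False
      have "s powr (- b) \<le> (t / 2) powr (- b)" using False s ab t by (intro powr_mono2') auto
      then have "(t - s) powr (- a) * s powr (- b) \<le> (t / 2) powr (- b) * (t - s) powr (- a)"
        by (subst mult.commute, intro mult_right_mono) simp_all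
      then show ?thesis by (rule order.trans) simp
    qed
    from mult_left_mono[OF this B] F[OF s] show ?thesis by linarith
  qed
  show ?thesis
  proof (cases "integrable (lebesgue_on {0..t}) F")
    case True
    have "norm (integral\<^sup>L (lebesgue_on {0..t}) F) \<le> integral\<^sup>L (lebesgue_on {0..t}) (\<lambda>s. norm (F s))"
      by (rule integral_norm_bound)
    also have "\<dots> \<le> integral\<^sup>L (lebesgue_on {0..t}) ?g"
    proof (rule integral_mono_AE)
      show "AE s in lebesgue_on {0..t}. norm (F s) \<le> ?g s"
        using AE_not_endpoints[of t] AE_space
      proof eventually_elim
        case (elim s)
        then show ?case by (intro pt) auto
      qed
    qed (use True gi in auto)
    finally show ?thesis by (simp only: val)
  next
    case False
    \<comment> \<open>A function that is not integrable has integral 0 by convention, so the bound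
      is trivial.\<close>
    then show ?thesis using B kernel_const_nonneg[OF ab(2) ab(4)] by (simp add: not_integrable_integral_eq)
  qed
qed

text \<open>Dominated convergence for unordered sums along an arbitrary filter, as needed for
  continuity in time: the tail of \<open>g\<close> is at most \<open>e / 3\<close> outside a finite
  set, on which the sum is eventually below \<open>e / 2\<close>.\<close>

lemma infsum_tendsto_zero:
  fixes f :: "'a \<Rightarrow> 'k \<Rightarrow> real"
  assumes g: "g summable_on UNIV" and dom: "\<forall>\<^sub>F s in F. \<forall>k. 0 \<le> f s k \<and> f s k \<le> g k"
    and lim: "\<And>k. ((\<lambda>s. f s k) \<longlongrightarrow> 0) F"
  shows "((\<lambda>s. infsum (f s) UNIV) \<longlongrightarrow> 0) F"
proof (rule tendstoI)
  fix e :: real assume e: "e > 0"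
  obtain X where X: "finite X" "dist (sum g X) (infsum g UNIV) \<le> e / 3"
    using has_sum_finite_approximation[OF has_sum_infsum[OF g], of "e / 3"] e by auto
  have "((\<lambda>s. \<Sum>k\<in>X. f s k) \<longlongrightarrow> (\<Sum>k\<in>X. 0)) F" by (intro tendsto_sum lim)
  then have "\<forall>\<^sub>F s in F. (\<Sum>k\<in>X. f s k) < e / 2" using e by (intro order_tendstoD(2)) auto
  with dom show "\<forall>\<^sub>F s in F. dist (infsum (f s) UNIV) 0 < e"
  proof eventually_elim
    case (elim s)
    have fs: "f s summable_on UNIV" by (rule summable_on_comparison_test[OF g]) (use elim in auto)
    have sub: "f s summable_on (UNIV - X)" "g summable_on (UNIV - X)"
      by (rule summable_on_subset_banach[OF fs] summable_on_subset_banach[OF g]; simp)+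
    have "infsum (f s) UNIV = sum (f s) X + infsum (f s) (UNIV - X)"
      using infsum_Un_disjoint[of "f s" X "UNIV - X"] X sub by simp
    moreover have "infsum (f s) (UNIV - X) \<le> infsum g (UNIV - X)"
      using elim sub by (intro infsum_mono) auto
    moreover have "infsum g UNIV = sum g X + infsum g (UNIV - X)"
      using infsum_Un_disjoint[of g X "UNIV - X"] X sub by simp
    ultimately have "infsum (f s) UNIV < e" using elim(2) X(2) e by (simp add: dist_norm abs_le_iff)
    moreover have "0 \<le> infsum (f s) UNIV" using elim by (intro infsum_nonneg) auto
    ultimately show ?case by (simp add: dist_norm)
  qed
qed

text \<open>The approximating step functions sample \<open>w\<close> at the right end points of a uniform partition,
  so that only values at positive times are used.\<close>

lemma strongly_measurable_of_continuous:
  assumes T: "T > 0" and V: "\<And>t. 0 < t \<Longrightarrow> t \<le> T \<Longrightarrow> w t \<in> V"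
    and cont: "\<And>t e. 0 < t \<Longrightarrow> t \<le> T \<Longrightarrow> 0 < e \<Longrightarrow>
      \<exists>d>0. \<forall>s. 0 < s \<longrightarrow> s \<le> T \<longrightarrow> \<bar>s - t\<bar> < d \<longrightarrow> \<bar>N (w s - w t)\<bar> < e"
  shows "strongly_measurable T V N w"
proof -
  define \<tau> :: "nat \<Rightarrow> real \<Rightarrow> real" where
    \<comment> \<open>Rounding up would leave \<open>t = 0\<close> at 0, where membership in
      \<open>V\<close> is not assumed; the value \<open>T\<close> is used there instead.\<close>
    "\<tau> n t = (if t = 0 then T else T * of_int \<lceil>real (Suc n) * t / T\<rceil> / real (Suc n))" for n t
  have \<tau>: "0 < \<tau> n t \<and> \<tau> n t \<le> T \<and> t \<le> \<tau> n t \<and> (t > 0 \<longrightarrow> \<tau> n t - t < T / real (Suc n))" if t: "t \<in> {0..T}" for n t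
  proof (cases "t = 0")
    case True
    then show ?thesis using T by (simp add: \<tau>_def)
  next
    case False
    define m where "m = \<lceil>real (Suc n) * t / T\<rceil>"
    have N: "real (Suc n) > 0" by simp
    have t0: "t > 0" using False t by simp
    have "real (Suc n) * t / T \<le> of_int m" "of_int m < real (Suc n) * t / T + 1"
      unfolding m_def by linarith+
    then have m1: "real (Suc n) * t \<le> T * of_int m" and m2: "T * of_int m < real (Suc n) * t + T"
      using T by (simp_all add: pos_divide_le_eq pos_less_divide_eq field_simps)
    have "real (Suc n) * t / T \<le> real (Suc n)"
      using t T N by (simp add: pos_divide_le_eq)
    then have "m \<le> int (Suc n)" unfolding m_def by (simp add: ceiling_le_iff)
    then have m3: "of_int m \<le> real (Suc n)" by linarith
    have e: "\<tau> n t = T * of_int m / real (Suc n)" using False by (simp add: \<tau>_def m_def)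
    have a: "t \<le> \<tau> n t" unfolding e using m1 N by (simp add: pos_le_divide_eq mult.commute)
    have b: "\<tau> n t \<le> T" unfolding e using mult_left_mono[OF m3, of T] T N by (simp add: pos_divide_le_eq)
    have c: "\<tau> n t < t + T / real (Suc n)" 
    proof -
      have "T * of_int m / real (Suc n) < (real (Suc n) * t + T) / real (Suc n)" by (rule divide_strict_right_mono[OF m2 N])
      also have "\<dots> = t + T / real (Suc n)" using N by (simp add: add_divide_distrib del: of_nat_Suc)
      finally show ?thesis unfolding e .
    qed
    show ?thesis using a b c t0 by auto
  qed
  have fin: "finite (\<tau> n ` {0..T})" for n
  proof (rule finite_subset)
    show "\<tau> n ` {0..T} \<subseteq> insert T ((\<lambda>m. T * of_int m / real (Suc n)) ` {0..int (Suc n)})"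
    proof
      fix y assume "y \<in> \<tau> n ` {0..T}"
      then obtain t where t: "t \<in> {0..T}" "y = \<tau> n t" by auto
      show "y \<in> insert T ((\<lambda>m. T * of_int m / real (Suc n)) ` {0..int (Suc n)})"
      proof (cases "t = 0")
        case False
        have "real (Suc n) * t / T \<le> real (Suc n)" using t T by (simp add: pos_divide_le_eq)
        then have "\<lceil>real (Suc n) * t / T\<rceil> \<le> int (Suc n)" by (simp add: ceiling_le_iff)
        moreover have "0 \<le> \<lceil>real (Suc n) * t / T\<rceil>"
        proof -
          have "0 \<le> real (Suc n) * t / T" using t T by simp
          then show ?thesis by linarith
        qed
        ultimately show ?thesis using False t(2) by (auto simp: \<tau>_def)
      qed (simp add: t(2) \<tau>_def)
    qed
  qed simp
  have m: "\<tau> n \<in> borel_measurable (lebesgue_on {0..T})" for n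
  proof -
    have "\<tau> n \<in> borel_measurable borel" unfolding \<tau>_def by measurable
    then show ?thesis by (intro measurable_restrict_space1 measurable_completion) simp
  qed
  have simple: "simple_function (lebesgue_on {0..T}) (\<lambda>t. w (\<tau> n t))" for n
    by (rule simple_function_compose1[where g = w, OF simple_function_borel_measurable[OF m]]) (simp add: fin)
  have lim: "(\<lambda>n. N (w (\<tau> n t) - w t)) \<longlonglongrightarrow> 0" if t: "0 < t" "t \<le> T" for t
  proof (rule LIMSEQ_I)
    fix e :: real assume "e > 0"
    obtain d where d: "d > 0" "\<And>s. 0 < s \<Longrightarrow> s \<le> T \<Longrightarrow> \<bar>s - t\<bar> < d \<Longrightarrow> \<bar>N (w s - w t)\<bar> < e"
      using cont[OF t \<open>e > 0\<close>] by blast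
    obtain n0 where n0: "T / d < real n0" using reals_Archimedean2 by blast
    have "norm (N (w (\<tau> n t) - w t) - 0) < e" if n: "n \<ge> n0" for n
    proof -
      have "T / d < real (Suc n)" using n0 n by linarith
      then have "T / real (Suc n) < d" using d(1) by (simp add: field_simps)
      moreover have "0 < \<tau> n t" "\<tau> n t \<le> T" "t \<le> \<tau> n t" "\<tau> n t - t < T / real (Suc n)" using \<tau>[of t n] t by auto
      ultimately show ?thesis using d(2)[of "\<tau> n t"] by simp
    qed
    then show "\<exists>no. \<forall>n\<ge>no. norm (N (w (\<tau> n t) - w t) - 0) < e" by blast
  qed
  have "AE t in lebesgue_on {0..T}. (\<lambda>n. N (w (\<tau> n t) - w t)) \<longlonglongrightarrow> 0"
    using AE_not_endpoints[of T] AE_space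
  proof eventually_elim
    case (elim t)
    then show ?case by (intro lim) auto
  qed
  moreover have "(\<lambda>t. w (\<tau> n t)) ` {0..T} \<subseteq> V" for n using \<tau> V by auto
  ultimately show ?thesis unfolding strongly_measurable_def using simple by (intro exI[of _ "\<lambda>n t. w (\<tau> n t)"]) auto
qed

text \<open>\<open>x powr p\<close> is at most the larger of 1 and \<open>x\<close>, and both are at
  most \<open>exp x\<close>.\<close>

lemma exp_minus_le_powr:
  assumes "0 < x" "0 \<le> p" "p \<le> 1" shows "exp (- x) \<le> x powr (- p :: real)"
proof -
  have "x powr p \<le> exp x"
  proof (cases "x \<le> 1")
    case True
    then have "x powr p \<le> 1" using assms powr_mono2[of p x 1] by simp
    also have "1 \<le> exp x" using assms by simp
    finally show ?thesis .
  next
    case False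
    then have "x powr p \<le> x powr 1" using assms by (intro powr_mono) auto
    then have "x powr p \<le> x" using assms by simp
    then show ?thesis using exp_ge_add_one_self[of x] by linarith
  qed
  then have "inverse (exp x) \<le> inverse (x powr p)" using assms by (intro le_imp_inverse_le) auto
  then show ?thesis by (simp add: exp_minus powr_minus)
qed

context torus
begin

section \<open>Coefficient families of finite H1 norm\<close>

definition fn :: "(int \<times> int \<Rightarrow> real^2) \<Rightarrow> real^2 \<Rightarrow> real^2" where
  "fn c = (SOME u. u \<in> L2 L \<and> (\<forall>k. cf u k = c k))"

lemma fn_works:
  assumes "(\<lambda>k. (norm (c k))\<^sup>2) summable_on UNIV"
  shows "fn c \<in> L2 L" "cf (fn c) k = c k"
proof -
  obtain u where "u \<in> L2 L" "\<And>k. cf u k = c k" by (rule riesz_fischer[OF assms]) blast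
  then have "\<exists>u. u \<in> L2 L \<and> (\<forall>k. cf u k = c k)" by blast
  from someI_ex[OF this] show "fn c \<in> L2 L" "cf (fn c) k = c k" unfolding fn_def by blast+
qed

definition h1s :: "(int \<times> int \<Rightarrow> real^2) set" where
  "h1s = {c. (\<lambda>k. (1 + q k) * (norm (c k))\<^sup>2) summable_on UNIV}"

definition h1c :: "(int \<times> int \<Rightarrow> real^2) \<Rightarrow> real" where
  "h1c c = sqrt (\<Sum>\<^sub>\<infinity>k. (1 + q k) * (norm (c k))\<^sup>2)"

lemma h1s_L2: "c \<in> h1s \<Longrightarrow> (\<lambda>k. (norm (c k))\<^sup>2) summable_on UNIV"
  unfolding h1s_def
  by (elim CollectE, erule summable_on_comparison_test) (auto simp: algebra_simps)

lemma fn_Sob1: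
  assumes c: "c \<in> h1s" shows "fn c \<in> Sob L (Suc 0)" "cf (fn c) k = c k"
proof -
  note w = fn_works[OF h1s_L2[OF c]]
  show "cf (fn c) k = c k" by (rule w)
  have "(\<lambda>k. q k * (norm (c k))\<^sup>2) summable_on UNIV"
    using c unfolding h1s_def by (elim CollectE, erule_tac summable_on_comparison_test) (auto simp: algebra_simps)
  then show "fn c \<in> Sob L (Suc 0)" unfolding Sob1_iff w(2) using w(1) by blast
qed

lemma h1_norm_eq:
  assumes "u \<in> Sob L (Suc 0)" shows "h1_norm L u = h1c (cf u)"
  unfolding h1_norm_def h1c_def using infsumI[OF has_sum_sob1[OF assms]] by (simp only:)

text \<open>The factor 2 comes from
  \<open>(x + y)\<^sup>2 \<le> 2 * x\<^sup>2 + 2 * y\<^sup>2\<close>. Minkowski's inequality would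
  give 1, but all constants are absorbed later.\<close>

lemma h1s_lincomb_bound:
  assumes "c \<in> h1s" "d \<in> h1s" "\<And>k. norm (e k) \<le> norm (c k) + norm (d k)"
  shows "e \<in> h1s" "h1c e \<le> 2 * h1c c + 2 * h1c d"
proof -
  have le: "(1 + q k) * (norm (e k))\<^sup>2 \<le> 2 * ((1 + q k) * (norm (c k))\<^sup>2) + 2 * ((1 + q k) * (norm (d k))\<^sup>2)" for k
  proof -
    have "(norm (e k))\<^sup>2 \<le> (norm (c k) + norm (d k))\<^sup>2" using assms(3)[of k] by (intro power_mono) auto
    also have "\<dots> \<le> 2 * (norm (c k))\<^sup>2 + 2 * (norm (d k))\<^sup>2"
      using norm_add_sq_le[of "norm (c k)" "norm (d k)"] by simp
    finally have "(norm (e k))\<^sup>2 \<le> 2 * (norm (c k))\<^sup>2 + 2 * (norm (d k))\<^sup>2" .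
    from mult_left_mono[OF this, of "1 + q k"] show ?thesis by (simp add: algebra_simps)
  qed
  have s: "(\<lambda>k. (1 + q k) * (norm (c k))\<^sup>2) summable_on UNIV" "(\<lambda>k. (1 + q k) * (norm (d k))\<^sup>2) summable_on UNIV"
    using assms(1,2) by (simp_all add: h1s_def)
  have s2: "(\<lambda>k. 2 * ((1 + q k) * (norm (c k))\<^sup>2) + 2 * ((1 + q k) * (norm (d k))\<^sup>2)) summable_on UNIV"
    by (intro summable_on_add summable_on_cmult_right s)
  have se: "(\<lambda>k. (1 + q k) * (norm (e k))\<^sup>2) summable_on UNIV"
    by (rule summable_on_comparison_test[OF s2 le]) simp
  then show "e \<in> h1s" by (simp add: h1s_def)
  let ?C = "\<Sum>\<^sub>\<infinity>k. (1 + q k) * (norm (c k))\<^sup>2" and ?D = "\<Sum>\<^sub>\<infinity>k. (1 + q k) * (norm (d k))\<^sup>2"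
  have pos: "0 \<le> ?C" "0 \<le> ?D" by (intro infsum_nonneg; simp)+
  have "(\<Sum>\<^sub>\<infinity>k. (1 + q k) * (norm (e k))\<^sup>2) \<le> (\<Sum>\<^sub>\<infinity>k. 2 * ((1 + q k) * (norm (c k))\<^sup>2) + 2 * ((1 + q k) * (norm (d k))\<^sup>2))"
    by (rule infsum_mono[OF se s2 le])
  also have "\<dots> = 2 * ?C + 2 * ?D"
    by (subst infsum_add) (auto intro: summable_on_cmult_right s simp: infsum_cmult_right')
  also have "\<dots> \<le> (2 * sqrt ?C + 2 * sqrt ?D)\<^sup>2"
    using pos by (simp add: power2_sum power_mult_distrib)
  finally have f: "(\<Sum>\<^sub>\<infinity>k. (1 + q k) * (norm (e k))\<^sup>2) \<le> (2 * sqrt ?C + 2 * sqrt ?D)\<^sup>2" .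
  show "h1c e \<le> 2 * h1c c + 2 * h1c d"
    unfolding h1c_def by (rule real_le_lsqrt[OF _ f]) (use pos in auto)
qed

lemma h1c_nonneg [simp]: "0 \<le> h1c c"
  by (auto simp: h1c_def intro!: infsum_nonneg)

lemma fn_diff_h1:
  assumes c: "c \<in> h1s" and d: "d \<in> h1s"
  shows "h1_norm L (fn c - fn d) = h1c (\<lambda>k. c k - d k)"
proof -
  have "cf (fn c - fn d) = (\<lambda>k. c k - d k)"
    using cf_minus[OF Sob1_L2[OF fn_Sob1(1)[OF c]] Sob1_L2[OF fn_Sob1(1)[OF d]]] fn_Sob1(2)[OF c] fn_Sob1(2)[OF d] by auto
  then show ?thesis using h1_norm_eq[OF Sob1_minus[OF fn_Sob1(1)[OF c] fn_Sob1(1)[OF d]]] by simp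
qed

text \<open>The H1 norm of the model family \<open>(1 + q k) powr (- 5 / 4)\<close>: squaring and
  multiplying by \<open>1 + q k\<close> gives the exponent \<open>- 3 / 2\<close>.\<close>

definition Cz :: real where
  "Cz = sqrt (\<Sum>\<^sub>\<infinity>k. (1 + q k) powr (- 3 / 2))"

lemma Cz_nonneg: "0 \<le> Cz"
  by (auto simp: Cz_def intro!: infsum_nonneg)

lemma decay_h1:
  assumes A: "0 \<le> A" and d: "\<And>k. norm (d k) \<le> A * (1 + q k) powr (- 5 / 4)"
  shows "d \<in> h1s" "h1c d \<le> A * Cz"
proof -
  have le: "(1 + q k) * (norm (d k))\<^sup>2 \<le> A\<^sup>2 * (1 + q k) powr (- 3 / 2)" for k
  proof -
    have p: "0 < 1 + q k" using q_nonneg[of k] by linarith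
    have "(norm (d k))\<^sup>2 \<le> (A * (1 + q k) powr (- 5 / 4))\<^sup>2" using d[of k] by (intro power_mono) auto
    also have "\<dots> = A\<^sup>2 * (1 + q k) powr (- 5 / 2)"
      by (simp add: power_mult_distrib power2_eq_square powr_add[symmetric])
    finally have "(1 + q k) * (norm (d k))\<^sup>2 \<le> A\<^sup>2 * ((1 + q k) powr 1 * (1 + q k) powr (- 5 / 2))"
      using p mult_left_mono[of "(norm (d k))\<^sup>2" "A\<^sup>2 * (1 + q k) powr (- 5 / 2)" "1 + q k"] by (simp add: mult_ac)
    also have "(1 + q k) powr 1 * (1 + q k) powr (- 5 / 2) = (1 + q k) powr (- 3 / 2)"
      by (subst powr_add[symmetric]) simp
    finally show ?thesis .
  qed
  have s: "(\<lambda>k. A\<^sup>2 * (1 + q k) powr (- 3 / 2)) summable_on UNIV"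
    using weight_summable[of "3 / 2"] by (intro summable_on_cmult_right) simp
  have sd: "(\<lambda>k. (1 + q k) * (norm (d k))\<^sup>2) summable_on UNIV"
    by (rule summable_on_comparison_test[OF s le]) simp
  then show "d \<in> h1s" by (simp add: h1s_def)
  have "(\<Sum>\<^sub>\<infinity>k. (1 + q k) * (norm (d k))\<^sup>2) \<le> (\<Sum>\<^sub>\<infinity>k. A\<^sup>2 * (1 + q k) powr (- 3 / 2))"
    by (rule infsum_mono[OF sd s le])
  also have "\<dots> = A\<^sup>2 * (\<Sum>\<^sub>\<infinity>k. (1 + q k) powr (- 3 / 2))" by (rule infsum_cmult_right')
  finally have "h1c d \<le> sqrt (A\<^sup>2 * (\<Sum>\<^sub>\<infinity>k. (1 + q k) powr (- 3 / 2)))" unfolding h1c_def by (rule real_sqrt_le_mono)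
  then show "h1c d \<le> A * Cz" using A by (simp add: Cz_def real_sqrt_mult)
qed

end

lemma powr_square: "(x powr a)\<^sup>2 = x powr (2 * a)" for x a :: real
  by (simp add: power2_eq_square powr_add[symmetric])

context calmed
begin

definition NN :: "(int \<times> int \<Rightarrow> real^2) \<Rightarrow> int \<times> int \<Rightarrow> real^2" where
  "NN c k = cf (adv (fn c)) k"

lemma NN_le: "c \<in> h1s \<Longrightarrow> norm (NN c k) \<le> 2 * M * h1c c"
  using cf_adv_le[OF fn_Sob1(1), of c k] h1_norm_eq[OF fn_Sob1(1), of c] fn_Sob1(2)[of c]
  by (simp add: NN_def h1c_def del: Sob.simps)

lemma NN_diff:
  assumes c: "c \<in> h1s" and d: "d \<in> h1s"
  shows "norm (NN c k - NN d k) \<le> (2 * M + 4 / L * h1c d) * h1c (\<lambda>k. c k - d k)"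
proof -
  have "h1_norm L (fn d) = h1c d"
    unfolding h1_norm_eq[OF fn_Sob1(1)[OF d]] h1c_def by (simp add: fn_Sob1(2)[OF d])
  then show ?thesis
    using cf_adv_diff[OF fn_Sob1(1)[OF c] fn_Sob1(1)[OF d], of k] by (simp add: NN_def fn_diff_h1[OF c d])
qed

section \<open>The linear evolution and its smoothing\<close>

definition E :: "int \<times> int \<Rightarrow> real \<Rightarrow> real" where
  "E k t = exp (- (lam k * t))"

lemma E_pos [simp]: "0 < E k t" "0 \<le> E k t"
  by (simp_all add: E_def)

text \<open>Four times the difference of the two sides is \<open>3 * (q k - 1)\<^sup>2 + 4\<close>.
  Since \<open>lam k\<close> is negative for \<open>q k\<close> between 0 and 1, a constant must be
  subtracted; it reappears as \<open>exp (2 * T)\<close>.\<close>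

lemma lam_lower: "(1 + q k)\<^sup>2 / 4 - 2 \<le> lam k"
proof -
  have "0 \<le> (q k - 1)\<^sup>2" by simp
  then show ?thesis by (simp add: lam_def power2_eq_square field_simps)
qed

lemma E_exp_le:
  assumes "0 \<le> t" "t \<le> T" shows "E k t \<le> exp (2 * T) * exp (- ((1 + q k)\<^sup>2 / 4 * t))"
proof -
  have "((1 + q k)\<^sup>2 / 4 - 2) * t \<le> lam k * t" using lam_lower assms by (intro mult_right_mono) auto
  then have "- (lam k * t) \<le> 2 * t - (1 + q k)\<^sup>2 / 4 * t" by (simp add: algebra_simps)
  also have "\<dots> \<le> 2 * T - (1 + q k)\<^sup>2 / 4 * t" using assms by simp
  finally show ?thesis unfolding E_def by (simp add: exp_add[symmetric])
qed

definition Ce :: "real \<Rightarrow> real" where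
  "Ce T = 4 * exp (2 * T)"

lemma Ce_pos: "0 < Ce T"
  by (simp add: Ce_def)

text \<open>Smoothing with a free exponent: \<open>2 * p\<close> powers of \<open>1 + q k\<close>,
  that is \<open>4 * p\<close> derivatives, cost the singularity \<open>t powr (- p)\<close>. The 4
  in \<open>Ce\<close> bounds \<open>4 powr p\<close>.\<close>

lemma E_le:
  assumes t: "0 < t" "t \<le> T" and p: "0 \<le> p" "p \<le> 1"
  shows "E k t \<le> Ce T * (1 + q k) powr (- 2 * p) * t powr (- p)"
proof -
  have q1: "1 + q k > 0" using q_nonneg[of k] by linarith
  define x where "x = (1 + q k)\<^sup>2 / 4 * t"
  have x: "x > 0" using q1 t by (simp add: x_def)
  have "exp (- x) \<le> x powr (- p)" by (rule exp_minus_le_powr[OF x p])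
  also have "\<dots> = (1 + q k) powr (- 2 * p) * t powr (- p) * 4 powr p"
  proof -
    have "x powr (- p) = ((1 + q k)\<^sup>2) powr (- p) / 4 powr (- p) * t powr (- p)"
      unfolding x_def using q1 t by (simp add: powr_mult powr_divide)
    moreover have "((1 + q k)\<^sup>2) powr (- p) = (1 + q k) powr (- 2 * p)"
      using q1 powr_powr[of "1 + q k" 2 "- p"] by simp
    ultimately show ?thesis by (simp add: powr_minus divide_inverse)
  qed
  also have "\<dots> \<le> (1 + q k) powr (- 2 * p) * t powr (- p) * 4"
    using powr_mono[of p 1 4] p by (intro mult_left_mono) auto
  finally have "exp (2 * T) * exp (- x) \<le> exp (2 * T) * ((1 + q k) powr (- 2 * p) * t powr (- p) * 4)"
    by (rule mult_left_mono) simp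
  moreover have "E k t \<le> exp (2 * T) * exp (- x)" unfolding x_def using E_exp_le t by simp
  ultimately have "E k t \<le> exp (2 * T) * ((1 + q k) powr (- 2 * p) * t powr (- p) * 4)" by (rule order.trans[rotated])
  then show ?thesis unfolding Ce_def by (simp only: mult_ac)
qed

lemma E_bounded:
  assumes "0 \<le> t" "t \<le> T" shows "E k t \<le> exp (2 * T)"
proof -
  have "exp (- ((1 + q k)\<^sup>2 / 4 * t)) \<le> 1" using assms(1) by simp
  then have "exp (2 * T) * exp (- ((1 + q k)\<^sup>2 / 4 * t)) \<le> exp (2 * T) * 1" by (rule mult_left_mono) simp
  then show ?thesis using E_exp_le[OF assms, of k] by linarith
qed

text \<open>For a fixed frequency the evolution is a group, so \<open>t\<close> can be pulled out of
  the Duhamel integral. Continuity and differentiability in \<open>t\<close> are then those of an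
  indefinite integral.\<close>

lemma E_diff: "E k (t - s) = E k t * exp (lam k * s)"
  by (simp add: E_def exp_add[symmetric] algebra_simps)

lemma E_sq_le:
  assumes t: "0 < t" "t \<le> T" and p: "0 \<le> p" "p \<le> 1"
  shows "(1 + q k) powr (4 * p) * (E k t)\<^sup>2 \<le> (Ce T)\<^sup>2 * t powr (- 2 * p)"
proof -
  have q1: "0 < 1 + q k" using q_nonneg[of k] by linarith
  have "(E k t)\<^sup>2 \<le> (Ce T * (1 + q k) powr (- 2 * p) * t powr (- p))\<^sup>2"
    by (intro power_mono E_le t p) simp
  also have "\<dots> = (Ce T)\<^sup>2 * (1 + q k) powr (- (4 * p)) * t powr (- 2 * p)"
    by (simp add: power_mult_distrib powr_square)
  finally have "(1 + q k) powr (4 * p) * (E k t)\<^sup>2 \<le> (1 + q k) powr (4 * p) * ((Ce T)\<^sup>2 * (1 + q k) powr (- (4 * p)) * t powr (- 2 * p))"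
    by (rule mult_left_mono) simp
  also have "\<dots> = (Ce T)\<^sup>2 * t powr (- 2 * p)" using q1 by (simp add: powr_minus)
  finally show ?thesis .
qed

lemma E_h1_le: "0 < t \<Longrightarrow> t \<le> T \<Longrightarrow> (1 + q k) * (E k t)\<^sup>2 \<le> (Ce T)\<^sup>2 * t powr (- 1 / 2)"
  using E_sq_le[of t T "1 / 4" k] q_nonneg[of k] by (simp add: powr_one)

lemma E_smoothing_h1:
  assumes a: "u0 \<in> L2 L" and t: "0 < t" "t \<le> T"
  shows "(\<lambda>k. E k t *\<^sub>R cf u0 k) \<in> h1s" "h1c (\<lambda>k. E k t *\<^sub>R cf u0 k) \<le> Ce T * l2_norm L u0 * t powr (- 1 / 4)"
proof -
  let ?C = "(Ce T)\<^sup>2 * t powr (- 1 / 2)"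
  have le: "(1 + q k) * (norm (E k t *\<^sub>R cf u0 k))\<^sup>2 \<le> ?C * (norm (cf u0 k))\<^sup>2" for k
  proof -
    have "(1 + q k) * (E k t)\<^sup>2 \<le> ?C" by (rule E_h1_le[OF t])
    then show ?thesis
      using mult_right_mono[of "(1 + q k) * (E k t)\<^sup>2" ?C "(norm (cf u0 k))\<^sup>2"] by (simp add: power_mult_distrib mult_ac)
  qed
  have s: "(\<lambda>k. ?C * (norm (cf u0 k))\<^sup>2) summable_on UNIV" by (intro summable_on_cmult_right cf_summable a)
  have sE: "(\<lambda>k. (1 + q k) * (norm (E k t *\<^sub>R cf u0 k))\<^sup>2) summable_on UNIV"
    by (rule summable_on_comparison_test[OF s le]) simp
  then show "(\<lambda>k. E k t *\<^sub>R cf u0 k) \<in> h1s" by (simp add: h1s_def)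
  have "(\<Sum>\<^sub>\<infinity>k. (1 + q k) * (norm (E k t *\<^sub>R cf u0 k))\<^sup>2) \<le> (\<Sum>\<^sub>\<infinity>k. ?C * (norm (cf u0 k))\<^sup>2)"
    by (rule infsum_mono[OF sE s le])
  also have "\<dots> = ?C * (l2_norm L u0)\<^sup>2"
    unfolding infsum_cmult_right' infsumI[OF parseval_norm[OF a]] ..
  also have "\<dots> = (Ce T * l2_norm L u0 * t powr (- 1 / 4))\<^sup>2"
    by (simp add: power_mult_distrib power2_eq_square powr_add[symmetric])
  finally show "h1c (\<lambda>k. E k t *\<^sub>R cf u0 k) \<le> Ce T * l2_norm L u0 * t powr (- 1 / 4)"
    unfolding h1c_def using Ce_pos[of T] by (intro real_le_lsqrt) auto
qed

text \<open>\<open>11 / 16\<close> is \<open>5 / 8\<close>, the price of the decay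
  \<open>(1 + q k) powr (- 5 / 4)\<close>, plus \<open>1 / 16\<close> for the exponential weight;
  \<open>1 / 4\<close> is the growth rate of the H1 norm at time 0. Their sum \<open>15 / 16\<close>
  leaves the power \<open>1 / 16\<close> of \<open>T\<close>.\<close>

definition Ck :: "real \<Rightarrow> real" where
  "Ck T = Ce T * kernel_const (11 / 16) (1 / 4) * T powr (1 / 16)"

lemma Ck_nonneg: "0 \<le> Ck T"
  using Ce_pos[of T] kernel_const_nonneg[of "11 / 16" "1 / 4"] by (simp add: Ck_def)

text \<open>The factor \<open>\<beta> powr (- 1 / 16)\<close> comes from \<open>exp (- \<beta> r) \<le> (\<beta> r) powr (- 1 / 16)\<close>; it
  makes the Picard map a contraction in an exponentially weighted norm.\<close>

lemma duhamel_weighted: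
  fixes F :: "real \<Rightarrow> real^2"
  assumes t: "0 < t" "t \<le> T" and B: "0 \<le> B" and \<beta>: "\<beta> > 0"
    and F: "\<And>s. 0 < s \<Longrightarrow> s < t \<Longrightarrow> norm (F s) \<le> B * exp (\<beta> * s) * s powr (- 1 / 4)"
  shows "norm (integral\<^sup>L (lebesgue_on {0..t}) (\<lambda>s. E k (t - s) *\<^sub>R F s))
    \<le> Ck T * B * \<beta> powr (- 1 / 16) * exp (\<beta> * t) * (1 + q k) powr (- 5 / 4)"
proof -
  let ?B = "Ce T * B * \<beta> powr (- 1 / 16) * exp (\<beta> * t) * (1 + q k) powr (- 5 / 4)"
  have "norm (integral\<^sup>L (lebesgue_on {0..t}) (\<lambda>s. E k (t - s) *\<^sub>R F s))
    \<le> ?B * kernel_const (11 / 16) (1 / 4) * t powr (1 - 11 / 16 - 1 / 4)"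
  proof (rule kernel_convolution_bound)
    show "0 \<le> ?B" using B Ce_pos[of T] by simp
    fix s assume s: "0 < s" "s < t"
    have e1: "E k (t - s) \<le> Ce T * (1 + q k) powr (- 5 / 4) * (t - s) powr (- 5 / 8)"
      using E_le[of "t - s" T "5 / 8" k] s t by simp
    have e2: "exp (\<beta> * s) \<le> exp (\<beta> * t) * (\<beta> powr (- 1 / 16) * (t - s) powr (- 1 / 16))"
    proof -
      have "exp (- (\<beta> * (t - s))) \<le> (\<beta> * (t - s)) powr (- (1 / 16))"
        using s \<beta> by (intro exp_minus_le_powr) auto
      also have "\<dots> = \<beta> powr (- 1 / 16) * (t - s) powr (- 1 / 16)" using s \<beta> by (simp add: powr_mult)
      finally have "exp (\<beta> * t) * exp (- (\<beta> * (t - s))) \<le> exp (\<beta> * t) * (\<beta> powr (- 1 / 16) * (t - s) powr (- 1 / 16))"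
        by (rule mult_left_mono) simp
      then show ?thesis by (simp add: exp_add[symmetric] algebra_simps)
    qed
    have "norm (E k (t - s) *\<^sub>R F s) \<le> (Ce T * (1 + q k) powr (- 5 / 4) * (t - s) powr (- 5 / 8))
       * (B * (exp (\<beta> * t) * (\<beta> powr (- 1 / 16) * (t - s) powr (- 1 / 16))) * s powr (- 1 / 4))"
    proof -
      have "norm (F s) \<le> B * (exp (\<beta> * t) * (\<beta> powr (- 1 / 16) * (t - s) powr (- 1 / 16))) * s powr (- 1 / 4)"
        using F[OF s] mult_right_mono[OF mult_left_mono[OF e2 B], of "s powr (- 1 / 4)"] by simp
      then show ?thesis using e1 Ce_pos[of T] by (simp del: times_divide_eq_left times_divide_eq_right) (intro mult_mono, auto)
    qed
    also have "\<dots> = ?B * ((t - s) powr (- (11 / 16)) * s powr (- (1 / 4)))"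
    proof -
      have "(t - s) powr (- 5 / 8) * (t - s) powr (- 1 / 16) = (t - s) powr (- (11 / 16))"
        by (subst powr_add[symmetric]) simp
      then show ?thesis by (simp add: mult_ac)
    qed
    finally show "norm (E k (t - s) *\<^sub>R F s) \<le> ?B * ((t - s) powr (- (11 / 16)) * s powr (- (1 / 4)))" .
  qed (use t in auto)
  also have "\<dots> \<le> ?B * kernel_const (11 / 16) (1 / 4) * T powr (1 / 16)"
  proof (rule mult_left_mono)
    show "t powr (1 - 11 / 16 - 1 / 4) \<le> T powr (1 / 16)" using powr_mono2[of "1 / 16" t T] t by simp
  qed (use t B Ce_pos[of T] kernel_const_nonneg[of "11 / 16" "1 / 4"] in auto)
  finally show ?thesis by (simp add: Ck_def mult_ac)
qed

text \<open>Once a fixed point is known, no power has to be kept for the weight, and smoothing with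
  \<open>p = 7 / 8\<close> raises the decay to \<open>- 7 / 4\<close>, enough for H2. As
  \<open>7 / 8 + 1 / 4\<close> exceeds 1, a factor \<open>t powr (- 1 / 8)\<close> appears, whose
  square is still integrable.\<close>

lemma duhamel_H2:
  fixes F :: "real \<Rightarrow> real^2"
  assumes t: "0 < t" "t \<le> T" and B: "0 \<le> B"
    and F: "\<And>s. 0 < s \<Longrightarrow> s < t \<Longrightarrow> norm (F s) \<le> B * s powr (- 1 / 4)"
  shows "norm (integral\<^sup>L (lebesgue_on {0..t}) (\<lambda>s. E k (t - s) *\<^sub>R F s))
    \<le> Ce T * B * kernel_const (7 / 8) (1 / 4) * t powr (- 1 / 8) * (1 + q k) powr (- 7 / 4)"
proof -
  let ?B = "Ce T * B * (1 + q k) powr (- 7 / 4)"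
  have "norm (integral\<^sup>L (lebesgue_on {0..t}) (\<lambda>s. E k (t - s) *\<^sub>R F s))
    \<le> ?B * kernel_const (7 / 8) (1 / 4) * t powr (1 - 7 / 8 - 1 / 4)"
  proof (rule kernel_convolution_bound)
    show "0 \<le> ?B" using B Ce_pos[of T] by simp
    fix s assume s: "0 < s" "s < t"
    have e1: "E k (t - s) \<le> Ce T * (1 + q k) powr (- 7 / 4) * (t - s) powr (- (7 / 8))"
      using E_le[of "t - s" T "7 / 8" k] s t by simp
    have "norm (E k (t - s) *\<^sub>R F s) \<le> (Ce T * (1 + q k) powr (- 7 / 4) * (t - s) powr (- (7 / 8))) * (B * s powr (- 1 / 4))"
      using e1 F[OF s] Ce_pos[of T] by (simp del: times_divide_eq_left times_divide_eq_right) (intro mult_mono, auto)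
    then show "norm (E k (t - s) *\<^sub>R F s) \<le> ?B * ((t - s) powr (- (7 / 8)) * s powr (- (1 / 4)))"
      by (simp add: mult_ac)
  qed (use t in auto)
  then show ?thesis by (simp add: mult_ac)
qed

end

lemma measurable_half_open:
  fixes F :: "real \<Rightarrow> 'b::euclidean_space"
  assumes c: "continuous_on {0<..T} F" and t: "t \<le> T"
  shows "F \<in> borel_measurable (lebesgue_on {0..t})"
proof (rule measurable_AE_lebesgue_on)
  have "F \<in> borel_measurable (lebesgue_on {0<..T})"
    by (rule continuous_imp_measurable_on_sets_lebesgue[OF c]) simp
  then have "(\<lambda>x. if x \<in> {0<..T} then F x else 0) \<in> borel_measurable lebesgue"
    by (rule borel_measurable_if_I) simp
  then show "(\<lambda>x. if x \<in> {0<..T} then F x else 0) \<in> borel_measurable (lebesgue_on {0..t})"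
    by (rule measurable_restrict_space1)
  show "AE s in lebesgue_on {0..t}. (if s \<in> {0<..T} then F s else 0) = F s"
    using AE_not_endpoints[of t] AE_space by eventually_elim (use t in auto)
qed

lemma singular_integrable:
  fixes F :: "real \<Rightarrow> real^2"
  assumes c: "continuous_on {0<..T} F" and b: "\<And>s. 0 < s \<Longrightarrow> s \<le> T \<Longrightarrow> norm (F s) \<le> B * s powr (- 1 / 4)"
    and t: "0 \<le> t" "t \<le> T"
  shows "integrable (lebesgue_on {0..t}) F"
proof (rule Bochner_Integration.integrable_bound)
  show "integrable (lebesgue_on {0..t}) (\<lambda>s. B * s powr (- 1 / 4))" using powr_lint(1)[of "1 / 4" t] t by simp
  show "F \<in> borel_measurable (lebesgue_on {0..t})" by (rule measurable_half_open[OF c t(2)])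
  show "AE s in lebesgue_on {0..t}. norm (F s) \<le> norm (B * s powr (- 1 / 4))"
    using AE_not_endpoints[of t] AE_space
  proof eventually_elim
    case (elim s)
    then have "norm (F s) \<le> B * s powr (- 1 / 4)" using b[of s] t by auto
    then show ?case by simp
  qed
qed

section \<open>Picard iteration for the Duhamel part\<close>

lemma geometric_limit:
  fixes x :: "nat \<Rightarrow> 'a::banach"
  assumes d: "\<And>n. norm (x (Suc n) - x n) \<le> C * (1 / 2) ^ n"
  shows "x \<longlonglongrightarrow> lim x" "norm (lim x - x n) \<le> 2 * C * (1 / 2) ^ n"
proof -
  have C: "0 \<le> C" using order.trans[OF norm_ge_zero d[of 0]] by simp
  have tail: "norm (x (n + m) - x n) \<le> 2 * C * (1 / 2) ^ n * (1 - (1 / 2) ^ m)" for n m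
  proof (induction m)
    case (Suc m)
    have "x (n + Suc m) - x n = (x (Suc (n + m)) - x (n + m)) + (x (n + m) - x n)" by simp
    then have "norm (x (n + Suc m) - x n) \<le> norm (x (Suc (n + m)) - x (n + m)) + norm (x (n + m) - x n)"
      by (metis norm_triangle_ineq)
    also have "\<dots> \<le> C * (1 / 2) ^ (n + m) + 2 * C * (1 / 2) ^ n * (1 - (1 / 2) ^ m)"
      by (intro add_mono d Suc.IH)
    also have "\<dots> = 2 * C * (1 / 2) ^ n * (1 - (1 / 2) ^ Suc m)" by (simp add: power_add algebra_simps)
    finally show ?case .
  qed simp
  have tail2: "norm (x m - x n) \<le> 2 * C * (1 / 2) ^ n" if "m \<ge> n" for n m
  proof -
    have "norm (x (n + (m - n)) - x n) \<le> 2 * C * (1 / 2) ^ n * (1 - (1 / 2) ^ (m - n))" by (rule tail)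
    also have "\<dots> \<le> 2 * C * (1 / 2) ^ n * 1" using C by (intro mult_left_mono) auto
    finally show ?thesis using that by simp
  qed
  have L: "(\<lambda>n. 2 * C * (1 / 2) ^ n) \<longlonglongrightarrow> 0"
    by (rule tendsto_mult_right_zero) (rule LIMSEQ_power_zero, simp)
  have "Cauchy x"
  proof (rule CauchyI')
    fix e :: real assume "e > 0"
    then obtain N where N: "\<And>n. n \<ge> N \<Longrightarrow> 2 * C * (1 / 2) ^ n < e"
      using order_tendstoD(2)[OF L \<open>e > 0\<close>] by (auto simp: eventually_sequentially)
    have "dist (x m) (x n) < e" if "m \<ge> N" "n > m" for m n
      using tail2[of m n] N[OF that(1)] that by (simp add: dist_norm norm_minus_commute)
    then show "\<exists>M. \<forall>m\<ge>M. \<forall>n>m. dist (x m) (x n) < e" by blast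
  qed
  then show l: "x \<longlonglongrightarrow> lim x" by (simp add: Cauchy_convergent_iff convergent_LIMSEQ_iff)
  show "norm (lim x - x n) \<le> 2 * C * (1 / 2) ^ n"
    by (rule LIMSEQ_le_const2[OF tendsto_norm[OF tendsto_diff[OF l tendsto_const]]]) (use tail2 in blast)
qed

text \<open>One statement for three topologies: the weight \<open>W\<close> is \<open>1\<close>,
  \<open>1 + q k\<close> or \<open>1 + q k + (q k)\<^sup>2\<close> in the applications, for L2, H1
  and H2. Continuity of single coefficients and a common summable majorant suffice.\<close>

lemma weighted_continuity:
  fixes c :: "real \<Rightarrow> 'k \<Rightarrow> real^2" and W :: "'k \<Rightarrow> real"
  assumes G: "G summable_on UNIV" and W: "\<And>k. 0 \<le> W k"
    and dom: "\<forall>\<^sub>F s in at t within S. \<forall>k. W k * (norm (c s k))\<^sup>2 \<le> G k" "\<And>k. W k * (norm (c t k))\<^sup>2 \<le> G k"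
    and cont: "\<And>k. ((\<lambda>s. c s k) \<longlongrightarrow> c t k) (at t within S)"
  shows "((\<lambda>s. \<Sum>\<^sub>\<infinity>k. W k * (norm (c s k - c t k))\<^sup>2) \<longlongrightarrow> 0) (at t within S)"
proof (rule infsum_tendsto_zero)
  show "(\<lambda>k. 4 * G k) summable_on UNIV" by (intro summable_on_cmult_right G)
  show "\<forall>\<^sub>F s in at t within S. \<forall>k. 0 \<le> W k * (norm (c s k - c t k))\<^sup>2 \<and> W k * (norm (c s k - c t k))\<^sup>2 \<le> 4 * G k"
    using dom(1)
  proof eventually_elim
    case (elim s)
    have "W k * (norm (c s k - c t k))\<^sup>2 \<le> 4 * G k" for k
    proof -
      have "W k * (norm (c s k - c t k))\<^sup>2 \<le> W k * (2 * (norm (c s k))\<^sup>2 + 2 * (norm (c t k))\<^sup>2)"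
        using norm_add_sq_le[of "c s k" "- c t k"] by (intro mult_left_mono W) simp
      then show ?thesis using elim[rule_format, of k] dom(2)[of k] by (simp add: algebra_simps)
    qed
    then show ?case using W by simp
  qed
  show "((\<lambda>s. W k * (norm (c s k - c t k))\<^sup>2) \<longlongrightarrow> 0) (at t within S)" for k
    using cont[of k] by (auto intro!: tendsto_eq_intros)
qed

lemma exists_weight: "\<exists>\<beta>>0. x * \<beta> powr (- 1 / 16) \<le> (1::real)" if "x \<ge> 0"
proof (intro exI conjI)
  \<comment> \<open>The weight is \<open>(1 + x) ^ 16\<close>, whose power \<open>- 1 / 16\<close>
    is \<open>1 / (1 + x)\<close>.\<close>
  have "((1 + x) ^ 16) powr (- 1 / 16) = (1 + x) powr (- 1)"
    using that powr_powr[of "1 + x" 16 "- 1 / 16"] by simp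
  then show "x * ((1 + x) ^ 16) powr (- 1 / 16) \<le> 1" using that by (simp add: powr_minus field_simps)
qed (use that in simp)

locale calmed_ivp = calmed +
  fixes T :: real and u0 :: "real^2 \<Rightarrow> real^2"
  assumes T: "T > 0" and u0: "u0 \<in> L2 L"
begin

definition cc :: "(real \<Rightarrow> int \<times> int \<Rightarrow> real^2) \<Rightarrow> real \<Rightarrow> int \<times> int \<Rightarrow> real^2" where
  "cc d t k = E k t *\<^sub>R cf u0 k + d t k"

text \<open>The unknown is the Duhamel part \<open>d\<close> of the solution, whose coefficients decay at a known rate, whereas those of
  the free evolution of \<open>u0\<close> are only square summable.\<close>

definition Phi :: "(real \<Rightarrow> int \<times> int \<Rightarrow> real^2) \<Rightarrow> real \<Rightarrow> int \<times> int \<Rightarrow> real^2" where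
  "Phi d t k = - integral\<^sup>L (lebesgue_on {0..t}) (\<lambda>s. E k (t - s) *\<^sub>R NN (cc d s) k)"

text \<open>The unit ball of the weighted sup norm. Radius 1 is enough because the nonlinearity
  grows linearly, so that a large \<open>\<beta>\<close> keeps the iterates in the ball.\<close>

definition adm :: "real \<Rightarrow> (real \<Rightarrow> int \<times> int \<Rightarrow> real^2) \<Rightarrow> bool" where
  "adm \<beta> d \<longleftrightarrow> 0 \<le> \<beta> \<and> (\<forall>t\<in>{0..T}. \<forall>k. norm (d t k) \<le> exp (\<beta> * t) * (1 + q k) powr (- 5 / 4))
     \<and> (\<forall>k. continuous_on {0..T} (\<lambda>t. d t k))"

lemma adm_D:
  assumes "adm \<beta> d"
  shows "0 \<le> \<beta>" "t \<in> {0..T} \<Longrightarrow> norm (d t k) \<le> exp (\<beta> * t) * (1 + q k) powr (- 5 / 4)"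
    "continuous_on {0..T} (\<lambda>t. d t k)"
  using assms unfolding adm_def by blast+

text \<open>Size of the H1 norm of \<open>cc d t\<close>, with
  \<open>exp (\<beta> * t) * t powr (- 1 / 4)\<close> split off. The power of \<open>T\<close>
  brings the nonsingular Duhamel part to the same singular form, and each 2 is that of
  \<open>h1s_lincomb_bound\<close>.\<close>

definition R :: real where
  "R = 2 * Ce T * l2_norm L u0 + 2 * Cz * T powr (1 / 4)"

lemma R_nonneg: "0 \<le> R"
  using Ce_pos[of T] Cz_nonneg by (simp add: R_def)

lemma one_le_T_powr: "0 < t \<Longrightarrow> t \<le> T \<Longrightarrow> 1 \<le> T powr (1 / 4) * t powr (- 1 / 4)"
proof -
  assume t: "0 < t" "t \<le> T"
  have "t powr (1 / 4) * t powr (- 1 / 4) \<le> T powr (1 / 4) * t powr (- 1 / 4)"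
    using t by (intro mult_right_mono powr_mono2) auto
  then show ?thesis using t by (simp add: powr_add[symmetric])
qed

lemma adm_d:
  assumes d: "adm \<beta> d" and t: "t \<in> {0..T}"
  shows "d t \<in> h1s" "h1c (d t) \<le> exp (\<beta> * t) * Cz"
  using decay_h1[of "exp (\<beta> * t)" "d t"] d t unfolding adm_def by auto

lemma cc_h1:
  assumes d: "adm \<beta> d" and t: "0 < t" "t \<le> T"
  shows "cc d t \<in> h1s" "h1c (cc d t) \<le> R * exp (\<beta> * t) * t powr (- 1 / 4)"
proof -
  have tT: "t \<in> {0..T}" using t by simp
  have b: "0 \<le> \<beta>" using d by (simp add: adm_def)
  note e = E_smoothing_h1[OF u0 t]
  have n: "norm (cc d t k) \<le> norm (E k t *\<^sub>R cf u0 k) + norm (d t k)" for k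
    unfolding cc_def by (rule norm_triangle_ineq)
  show "cc d t \<in> h1s" by (rule h1s_lincomb_bound(1)[OF e(1) adm_d(1)[OF d tT] n])
  have "h1c (cc d t) \<le> 2 * (Ce T * l2_norm L u0 * t powr (- 1 / 4)) + 2 * (exp (\<beta> * t) * Cz)"
    using h1s_lincomb_bound(2)[OF e(1) adm_d(1)[OF d tT] n] e(2) adm_d(2)[OF d tT] by linarith
  also have "\<dots> \<le> 2 * (Ce T * l2_norm L u0 * t powr (- 1 / 4)) * exp (\<beta> * t) + 2 * (exp (\<beta> * t) * Cz) * (T powr (1 / 4) * t powr (- 1 / 4))"
  proof (rule add_mono)
    have "1 \<le> exp (\<beta> * t)" using b t by simp
    then show "2 * (Ce T * l2_norm L u0 * t powr (- 1 / 4)) \<le> 2 * (Ce T * l2_norm L u0 * t powr (- 1 / 4)) * exp (\<beta> * t)"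
      using Ce_pos[of T] mult_left_mono[of 1 "exp (\<beta> * t)" "2 * (Ce T * l2_norm L u0 * t powr (- 1 / 4))"] by simp
    show "2 * (exp (\<beta> * t) * Cz) \<le> 2 * (exp (\<beta> * t) * Cz) * (T powr (1 / 4) * t powr (- 1 / 4))"
      using Cz_nonneg mult_left_mono[OF one_le_T_powr[OF t], of "2 * (exp (\<beta> * t) * Cz)"] by simp
  qed
  also have "\<dots> = R * exp (\<beta> * t) * t powr (- 1 / 4)" by (simp add: R_def algebra_simps)
  finally show "h1c (cc d t) \<le> R * exp (\<beta> * t) * t powr (- 1 / 4)" .
qed

lemma cc_tendsto:
  assumes d: "adm \<beta> d" and t: "t \<in> {0..T}"
  shows "((\<lambda>s. cc d s k) \<longlongrightarrow> cc d t k) (at t within {0..T})"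
proof -
  have "continuous_on {0..T} (\<lambda>s. d s k)" by (rule adm_D(3)[OF d])
  then have "continuous_on {0..T} (\<lambda>s. cc d s k)" unfolding cc_def E_def by (intro continuous_intros)
  then show ?thesis using t by (simp add: continuous_on_def)
qed

text \<open>Dominated convergence in H1 together with the Lipschitz bound \<open>NN_diff\<close>.
  Time 0 is excluded because the H1 norm of the free evolution may blow up there; near
  \<open>t > 0\<close> the majorant \<open>G\<close> is valid from \<open>t / 2\<close> on.\<close>

lemma NN_cc_continuous:
  assumes d: "adm \<beta> d" shows "continuous_on {0<..T} (\<lambda>s. NN (cc d s) k)"
  unfolding continuous_on_def
proof
  fix t assume "t \<in> {0<..T}"
  then have t: "0 < t" "t \<le> T" by auto
  have b: "0 \<le> \<beta>" using d by (simp add: adm_def)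
  define G where "G j = 2 * ((Ce T)\<^sup>2 * (t / 2) powr (- 1 / 2) * (norm (cf u0 j))\<^sup>2) + 2 * (exp (2 * (\<beta> * T)) * (1 + q j) powr (- 3 / 2))" for j
  have Gs: "G summable_on UNIV"
    unfolding G_def using weight_summable[of "3 / 2"]
    by (intro summable_on_add summable_on_cmult_right cf_summable u0) simp
  have Gle: "(1 + q j) * (norm (cc d s j))\<^sup>2 \<le> G j" if s: "t / 2 \<le> s" "s \<le> T" for s j
  proof -
    have s0: "0 < s" using s t by linarith
    have q1: "0 < 1 + q j" using q_nonneg[of j] by linarith
    have "(norm (cc d s j))\<^sup>2 \<le> 2 * ((E j s)\<^sup>2 * (norm (cf u0 j))\<^sup>2) + 2 * (norm (d s j))\<^sup>2"
      using norm_add_sq_le[of "E j s *\<^sub>R cf u0 j" "d s j"] by (simp add: cc_def power_mult_distrib)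
    from mult_left_mono[OF this, of "1 + q j"]
    have "(1 + q j) * (norm (cc d s j))\<^sup>2 \<le> 2 * (((1 + q j) * (E j s)\<^sup>2) * (norm (cf u0 j))\<^sup>2) + 2 * ((1 + q j) * (norm (d s j))\<^sup>2)"
      by (simp add: algebra_simps)
    moreover have "(1 + q j) * (E j s)\<^sup>2 \<le> (Ce T)\<^sup>2 * (t / 2) powr (- 1 / 2)"
    proof -
      have "s powr (- 1 / 2) \<le> (t / 2) powr (- 1 / 2)" using s t by (intro powr_mono2') auto
      then have "(Ce T)\<^sup>2 * s powr (- 1 / 2) \<le> (Ce T)\<^sup>2 * (t / 2) powr (- 1 / 2)" by (rule mult_left_mono) simp
      then show ?thesis using E_h1_le[OF s0 s(2), of j] by linarith
    qed
    moreover have "(1 + q j) * (norm (d s j))\<^sup>2 \<le> exp (2 * (\<beta> * T)) * (1 + q j) powr (- 3 / 2)"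
    proof -
      have "norm (d s j) \<le> exp (\<beta> * s) * (1 + q j) powr (- 5 / 4)" by (rule adm_D(2)[OF d]) (use s s0 in simp)
      also have "\<dots> \<le> exp (\<beta> * T) * (1 + q j) powr (- 5 / 4)" using b s by (intro mult_right_mono) (auto intro: mult_left_mono)
      finally have "(norm (d s j))\<^sup>2 \<le> (exp (\<beta> * T) * (1 + q j) powr (- 5 / 4))\<^sup>2" by (intro power_mono) auto
      also have "\<dots> = exp (2 * (\<beta> * T)) * (1 + q j) powr (- 5 / 2)"
        by (simp add: power_mult_distrib powr_square exp_double)
      finally have "(1 + q j) * (norm (d s j))\<^sup>2 \<le> (1 + q j) powr 1 * (exp (2 * (\<beta> * T)) * (1 + q j) powr (- 5 / 2))"
        using q1 mult_left_mono[of "(norm (d s j))\<^sup>2" "exp (2 * (\<beta> * T)) * (1 + q j) powr (- 5 / 2)" "1 + q j"] by simp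
      also have "\<dots> = exp (2 * (\<beta> * T)) * ((1 + q j) powr 1 * (1 + q j) powr (- 5 / 2))" by (simp only: mult_ac)
      also have "(1 + q j) powr 1 * (1 + q j) powr (- 5 / 2) = (1 + q j) powr (- 3 / 2)" by (subst powr_add[symmetric]) simp
      finally show ?thesis .
    qed
    ultimately show ?thesis unfolding G_def
      using mult_right_mono[of "(1 + q j) * (E j s)\<^sup>2" "(Ce T)\<^sup>2 * (t / 2) powr (- 1 / 2)" "(norm (cf u0 j))\<^sup>2"] by simp
  qed
  have near: "\<forall>\<^sub>F s in at t within {0<..T}. t / 2 \<le> s \<and> 0 < s \<and> s \<le> T"
  proof -
    have "\<forall>\<^sub>F s in at t within {0<..T}. s \<in> {t / 2<..}" 
      by (rule topological_tendstoD[OF tendsto_ident_at]) (use t in auto)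
    moreover have "\<forall>\<^sub>F s in at t within {0<..T}. s \<in> {0<..T}" by (simp add: eventually_at_filter)
    ultimately show ?thesis by eventually_elim auto
  qed
  have "((\<lambda>s. \<Sum>\<^sub>\<infinity>j. (1 + q j) * (norm (cc d s j - cc d t j))\<^sup>2) \<longlongrightarrow> 0) (at t within {0<..T})"
  proof (rule weighted_continuity[OF Gs])
    show "\<forall>\<^sub>F s in at t within {0<..T}. \<forall>j. (1 + q j) * (norm (cc d s j))\<^sup>2 \<le> G j"
      using near by eventually_elim (use Gle in auto)
    show "((\<lambda>s. cc d s j) \<longlongrightarrow> cc d t j) (at t within {0<..T})" for j
      by (rule tendsto_within_subset[OF cc_tendsto[OF d]]) (use t in auto)
  qed (use Gle t in auto)
  then have lim: "((\<lambda>s. (2 * M + 4 / L * h1c (cc d t)) * h1c (\<lambda>j. cc d s j - cc d t j)) \<longlongrightarrow> 0) (at t within {0<..T})"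
    unfolding h1c_def[of "\<lambda>j. cc d _ j - cc d t j"] by (intro tendsto_mult_right_zero) (auto intro!: tendsto_eq_intros)
  have "((\<lambda>s. NN (cc d s) k - NN (cc d t) k) \<longlongrightarrow> 0) (at t within {0<..T})"
    by (rule Lim_null_comparison[OF _ lim], use near in eventually_elim) (use NN_diff cc_h1(1)[OF d] t in auto)
  then show "((\<lambda>s. NN (cc d s) k) \<longlongrightarrow> NN (cc d t) k) (at t within {0<..T})" by (simp add: LIM_zero_iff)
qed

lemma NN_cc_le:
  assumes d: "adm \<beta> d" and s: "0 < s" "s \<le> T"
  shows "norm (NN (cc d s) k) \<le> 2 * M * R * exp (\<beta> * s) * s powr (- 1 / 4)"
    "norm (NN (cc d s) k) \<le> 2 * M * R * exp (\<beta> * T) * s powr (- 1 / 4)"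
proof -
  show 1: "norm (NN (cc d s) k) \<le> 2 * M * R * exp (\<beta> * s) * s powr (- 1 / 4)"
    using NN_le[OF cc_h1(1)[OF d s], of k] mult_left_mono[OF cc_h1(2)[OF d s], of "2 * M"] M_nonneg by (simp add: mult_ac)
  have "exp (\<beta> * s) \<le> exp (\<beta> * T)" using d s by (auto simp: adm_def intro: mult_left_mono)
  then have "2 * M * R * exp (\<beta> * s) * s powr (- 1 / 4) \<le> 2 * M * R * exp (\<beta> * T) * s powr (- 1 / 4)"
    using M_nonneg R_nonneg by (intro mult_right_mono mult_left_mono) auto
  with 1 show "norm (NN (cc d s) k) \<le> 2 * M * R * exp (\<beta> * T) * s powr (- 1 / 4)" by linarith
qed

lemma duhamel_integrable:
  assumes d: "adm \<beta> d" and t: "0 \<le> t" "t \<le> T"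
  shows "integrable (lebesgue_on {0..t}) (\<lambda>s. NN (cc d s) k)"
    "integrable (lebesgue_on {0..t}) (\<lambda>s. exp (lam k * s) *\<^sub>R NN (cc d s) k)"
    "integrable (lebesgue_on {0..t}) (\<lambda>s. E k (t - s) *\<^sub>R NN (cc d s) k)"
proof -
  show "integrable (lebesgue_on {0..t}) (\<lambda>s. NN (cc d s) k)"
    by (rule singular_integrable[OF NN_cc_continuous[OF d] NN_cc_le(2)[OF d] t])
  show i: "integrable (lebesgue_on {0..t}) (\<lambda>s. exp (lam k * s) *\<^sub>R NN (cc d s) k)"
  proof (rule singular_integrable[OF _ _ t, where B = "exp (\<bar>lam k\<bar> * T) * (2 * M * R * exp (\<beta> * T))"])
    show "continuous_on {0<..T} (\<lambda>s. exp (lam k * s) *\<^sub>R NN (cc d s) k)"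
      by (intro continuous_intros NN_cc_continuous[OF d])
    fix s assume s: "0 < s" "s \<le> T"
    have "lam k * s \<le> \<bar>lam k\<bar> * T" using s mult_mono[of "lam k" "\<bar>lam k\<bar>" s T] by simp
    then have "exp (lam k * s) * norm (NN (cc d s) k) \<le> exp (\<bar>lam k\<bar> * T) * (2 * M * R * exp (\<beta> * T) * s powr (- 1 / 4))"
      by (intro mult_mono NN_cc_le(2)[OF d s]) auto
    then show "norm (exp (lam k * s) *\<^sub>R NN (cc d s) k) \<le> exp (\<bar>lam k\<bar> * T) * (2 * M * R * exp (\<beta> * T)) * s powr (- 1 / 4)"
      by simp
  qed
  have "integrable (lebesgue_on {0..t}) (\<lambda>s. E k t *\<^sub>R (exp (lam k * s) *\<^sub>R NN (cc d s) k))"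
    by (intro integrable_scaleR_right i)
  then show "integrable (lebesgue_on {0..t}) (\<lambda>s. E k (t - s) *\<^sub>R NN (cc d s) k)" by (simp only: E_diff scaleR_scaleR)
qed

lemma Phi_eq: "Phi d t k = - (E k t *\<^sub>R integral\<^sup>L (lebesgue_on {0..t}) (\<lambda>s. exp (lam k * s) *\<^sub>R NN (cc d s) k))"
  unfolding Phi_def E_diff scaleR_scaleR[symmetric] by (simp only: integral_scaleR_right)

lemma Phi_continuous: "adm \<beta> d \<Longrightarrow> continuous_on {0..T} (\<lambda>t. Phi d t k)"
  unfolding Phi_eq E_def
  by (intro continuous_intros indefinite_integral_continuous_real duhamel_integrable(2)) (use T in auto)

lemma Phi_0: "Phi d 0 k = 0"
  by (simp add: Phi_def integral_eq_zero_null_sets)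

text \<open>The bound on \<open>NN\<close> is linear in the H1 norm and carries the weight
  \<open>exp (\<beta> * s)\<close>, so the Duhamel estimate returns the same weight with the small
  factor \<open>\<beta> powr (- 1 / 16)\<close>.\<close>

lemma Phi_adm:
  assumes \<beta>: "\<beta> > 0" "Ck T * (2 * M * R) * \<beta> powr (- 1 / 16) \<le> 1" and d: "adm \<beta> d"
  shows "adm \<beta> (Phi d)"
  unfolding adm_def
proof (intro conjI ballI allI)
  fix t k assume t: "t \<in> {0..T}"
  show "norm (Phi d t k) \<le> exp (\<beta> * t) * (1 + q k) powr (- 5 / 4)"
  proof (cases "t = 0")
    case False
    then have t: "0 < t" "t \<le> T" using t by auto
    have "norm (Phi d t k) \<le> Ck T * (2 * M * R) * \<beta> powr (- 1 / 16) * exp (\<beta> * t) * (1 + q k) powr (- 5 / 4)"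
      unfolding Phi_def norm_minus_cancel
    proof (rule duhamel_weighted[OF t _ \<beta>(1)])
      show "0 \<le> 2 * M * R" using M_nonneg R_nonneg by simp
      show "norm (NN (cc d s) k) \<le> 2 * M * R * exp (\<beta> * s) * s powr (- 1 / 4)" if "0 < s" "s < t" for s
        using NN_cc_le(1)[OF d] that t by simp
    qed
    also have "\<dots> \<le> 1 * exp (\<beta> * t) * (1 + q k) powr (- 5 / 4)"
      by (intro mult_right_mono \<beta>(2)) auto
    finally show ?thesis by simp
  qed (simp add: Phi_0)
qed (use \<beta> Phi_continuous[OF d] in auto)

text \<open>Lipschitz constant of the coefficients of the nonlinearity on the ball, with
  \<open>s powr (- 1 / 4)\<close> split off. The power of \<open>T\<close> brings the constant term
  of \<open>NN_diff\<close> to this form, and \<open>Cz\<close> passes from the weighted sup norm to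
  H1.\<close>

definition Gc :: "real \<Rightarrow> real" where
  "Gc \<beta> = (2 * M * T powr (1 / 4) + 4 / L * (R * exp (\<beta> * T))) * Cz"

lemma Gc_nonneg: "0 \<le> Gc \<beta>"
  using M_nonneg R_nonneg L Cz_nonneg by (simp add: Gc_def)

text \<open>The constant \<open>Gc \<beta>\<close> grows with \<open>exp (\<beta> * T)\<close>, so
  one weight cannot serve for both invariance and contraction. Differences are measured with a
  second weight \<open>\<gamma>\<close>, chosen after \<open>\<beta>\<close>, for which the map
  halves distances.\<close>

lemma Phi_contraction:
  assumes d: "adm \<beta> d" and d': "adm \<beta> d'" and \<gamma>: "\<gamma> > 0" "Ck T * (2 * Gc \<beta>) * \<gamma> powr (- 1 / 16) \<le> 1" and D: "0 \<le> D"
    and diff: "\<And>s k. s \<in> {0..T} \<Longrightarrow> norm (d s k - d' s k) \<le> D * exp (\<gamma> * s) * (1 + q k) powr (- 5 / 4)"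
    and t: "t \<in> {0..T}"
  shows "norm (Phi d t k - Phi d' t k) \<le> D / 2 * exp (\<gamma> * t) * (1 + q k) powr (- 5 / 4)"
proof (cases "t = 0")
  case True
  then show ?thesis using D by (simp add: Phi_0)
next
  case False
  then have t: "0 < t" "t \<le> T" using t by auto
  have eq: "Phi d t k - Phi d' t k = - integral\<^sup>L (lebesgue_on {0..t}) (\<lambda>s. E k (t - s) *\<^sub>R (NN (cc d s) k - NN (cc d' s) k))"
    unfolding Phi_def scaleR_diff_right
    using duhamel_integrable(3)[OF d, of t k] duhamel_integrable(3)[OF d', of t k] t
    by (simp add: Bochner_Integration.integral_diff)
  have "norm (Phi d t k - Phi d' t k) \<le> Ck T * (Gc \<beta> * D) * \<gamma> powr (- 1 / 16) * exp (\<gamma> * t) * (1 + q k) powr (- 5 / 4)"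
    unfolding eq norm_minus_cancel
  proof (rule duhamel_weighted[OF t _ \<gamma>(1)])
    show "0 \<le> Gc \<beta> * D" using Gc_nonneg D by simp
    fix s assume s: "0 < s" "s < t"
    then have s: "0 < s" "s \<le> T" "s \<in> {0..T}" using t by auto
    have w: "h1c (\<lambda>k. d s k - d' s k) \<le> D * exp (\<gamma> * s) * Cz"
      using decay_h1(2)[of "D * exp (\<gamma> * s)" "\<lambda>k. d s k - d' s k"] diff[OF s(3)] D by simp
    have c: "(\<lambda>k. cc d s k - cc d' s k) = (\<lambda>k. d s k - d' s k)" by (simp add: cc_def)
    have h: "h1c (cc d' s) \<le> R * exp (\<beta> * T) * s powr (- 1 / 4)"
    proof -
      have "exp (\<beta> * s) \<le> exp (\<beta> * T)" using d s by (auto simp: adm_def intro: mult_left_mono)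
      then have "R * exp (\<beta> * s) * s powr (- 1 / 4) \<le> R * exp (\<beta> * T) * s powr (- 1 / 4)"
        using R_nonneg by (intro mult_right_mono mult_left_mono) auto
      then show ?thesis using cc_h1(2)[OF d' s(1,2)] by linarith
    qed
    have "norm (NN (cc d s) k - NN (cc d' s) k) \<le> (2 * M + 4 / L * h1c (cc d' s)) * h1c (\<lambda>k. d s k - d' s k)"
      using NN_diff[OF cc_h1(1)[OF d s(1,2)] cc_h1(1)[OF d' s(1,2)], of k] unfolding c .
    also have "\<dots> \<le> (2 * M * (T powr (1 / 4) * s powr (- 1 / 4)) + 4 / L * (R * exp (\<beta> * T) * s powr (- 1 / 4))) * (D * exp (\<gamma> * s) * Cz)"
    proof (rule mult_mono)
      have "2 * M * 1 \<le> 2 * M * (T powr (1 / 4) * s powr (- 1 / 4))"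
        using M_nonneg by (intro mult_left_mono one_le_T_powr s) auto
      moreover have "4 / L * h1c (cc d' s) \<le> 4 / L * (R * exp (\<beta> * T) * s powr (- 1 / 4))"
        using L by (intro mult_left_mono h) auto
      ultimately show "2 * M + 4 / L * h1c (cc d' s) \<le> 2 * M * (T powr (1 / 4) * s powr (- 1 / 4)) + 4 / L * (R * exp (\<beta> * T) * s powr (- 1 / 4))"
        by simp
      show "0 \<le> 2 * M * (T powr (1 / 4) * s powr (- 1 / 4)) + 4 / L * (R * exp (\<beta> * T) * s powr (- 1 / 4))"
        using M_nonneg R_nonneg L by simp
    qed (use w in auto)
    also have "\<dots> = Gc \<beta> * D * exp (\<gamma> * s) * s powr (- 1 / 4)" by (simp add: Gc_def algebra_simps)
    finally show "norm (NN (cc d s) k - NN (cc d' s) k) \<le> Gc \<beta> * D * exp (\<gamma> * s) * s powr (- 1 / 4)" .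
  qed
  also have "\<dots> = (Ck T * (2 * Gc \<beta>) * \<gamma> powr (- 1 / 16)) * (D / 2 * exp (\<gamma> * t) * (1 + q k) powr (- 5 / 4))" by simp
  also have "\<dots> \<le> 1 * (D / 2 * exp (\<gamma> * t) * (1 + q k) powr (- 5 / 4))"
    using D by (intro mult_right_mono \<gamma>(2)) auto
  finally show ?thesis by simp
qed

text \<open>Picard iteration from 0. The limit is formed separately for each time and frequency; for
  fixed \<open>k\<close> the convergence is uniform in time, which preserves continuity, and the
  contraction estimate between iterate and limit identifies the limit as a fixed point.\<close>

lemma mild_solution_exists:
  obtains \<beta> d where "adm \<beta> d" "\<And>t k. t \<in> {0..T} \<Longrightarrow> d t k = Phi d t k"
proof -
  obtain \<beta> where \<beta>: "\<beta> > 0" "Ck T * (2 * M * R) * \<beta> powr (- 1 / 16) \<le> 1"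
    using exists_weight[of "Ck T * (2 * M * R)"] Ck_nonneg[of T] M_nonneg R_nonneg by auto
  obtain \<gamma> where \<gamma>: "\<gamma> > 0" "Ck T * (2 * Gc \<beta>) * \<gamma> powr (- 1 / 16) \<le> 1"
    using exists_weight[of "Ck T * (2 * Gc \<beta>)"] Ck_nonneg[of T] Gc_nonneg by auto
  define x where "x n = (Phi ^^ n) (\<lambda>t k. 0)" for n
  have xS: "x (Suc n) = Phi (x n)" for n by (simp add: x_def)
  have xa: "adm \<beta> (x n)" for n
  proof (induction n)
    case 0
    show ?case using \<beta>(1) by (simp add: x_def adm_def)
  next
    case (Suc n)
    show ?case unfolding xS by (rule Phi_adm[OF \<beta> Suc.IH])
  qed
  define w where "w t k = exp (\<gamma> * t) * (1 + q k) powr (- 5 / 4)" for t k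
  \<comment> \<open>Bounds the first increment, which lies in the ball of weight
    \<open>\<beta>\<close>, when it is measured with the weight \<open>\<gamma>\<close>.\<close>
  define C where "C = exp (\<beta> * T)"
  have step: "norm (x (Suc n) t k - x n t k) \<le> C * (1 / 2) ^ n * exp (\<gamma> * t) * (1 + q k) powr (- 5 / 4)" if "t \<in> {0..T}" for n t k
    using that
  proof (induction n arbitrary: t k)
    case 0
    have "norm (x 1 t k) \<le> exp (\<beta> * t) * (1 + q k) powr (- 5 / 4)" using adm_D(2)[OF xa[of 1] 0] .
    also have "\<dots> \<le> (C * exp (\<gamma> * t)) * (1 + q k) powr (- 5 / 4)"
    proof (rule mult_right_mono)
      have "exp (\<beta> * t) \<le> C * 1" unfolding C_def using \<beta>(1) 0 by simp
      also have "\<dots> \<le> C * exp (\<gamma> * t)" using \<gamma>(1) 0 by (intro mult_left_mono) (auto simp: C_def)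
      finally show "exp (\<beta> * t) \<le> C * exp (\<gamma> * t)" .
    qed simp
    finally show ?case by (simp add: x_def)
  next
    case (Suc n)
    have "norm (Phi (x (Suc n)) t k - Phi (x n) t k) \<le> C * (1 / 2) ^ n / 2 * exp (\<gamma> * t) * (1 + q k) powr (- 5 / 4)"
      by (rule Phi_contraction[OF xa xa \<gamma> _ Suc.IH Suc.prems]) (simp_all add: C_def)
    then show ?case by (simp add: xS)
  qed
  define d where "d t k = lim (\<lambda>n. x n t k)" for t k
  have g: "(\<lambda>n. x n t k) \<longlonglongrightarrow> d t k" "norm (d t k - x n t k) \<le> 2 * (C * w t k) * (1 / 2) ^ n" if "t \<in> {0..T}" for t k n
  proof -
    have st: "norm (x (Suc n) t k - x n t k) \<le> (C * w t k) * (1 / 2) ^ n" for n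
      using step[OF that, of n k] by (simp add: w_def mult_ac)
    show "(\<lambda>n. x n t k) \<longlonglongrightarrow> d t k" "norm (d t k - x n t k) \<le> 2 * (C * w t k) * (1 / 2) ^ n"
      unfolding d_def by (rule geometric_limit[where x = "\<lambda>n. x n t k", OF st])+
  qed
  have da: "adm \<beta> d"
    unfolding adm_def
  proof (intro conjI ballI allI)
    fix t k assume t: "t \<in> {0..T}"
    show "norm (d t k) \<le> exp (\<beta> * t) * (1 + q k) powr (- 5 / 4)"
      by (rule LIMSEQ_le_const2[OF tendsto_norm[OF g(1)[OF t]]]) (use adm_D(2)[OF xa t] in blast)
  next
    fix k
    have "uniform_limit {0..T} (\<lambda>n t. x n t k) (\<lambda>t. d t k) sequentially"
    proof (rule uniform_limitI)
      fix e :: real assume e: "e > 0"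
      \<comment> \<open>The weight increases with time, so its value at \<open>T\<close> makes the
        error bound uniform on the interval.\<close>
      define K where "K = 2 * (C * w T k)"
      have "(\<lambda>n. K * (1 / 2) ^ n) \<longlonglongrightarrow> 0" by (rule tendsto_mult_right_zero) (rule LIMSEQ_power_zero, simp)
      then have "\<forall>\<^sub>F n in sequentially. K * (1 / 2) ^ n < e" using e by (rule order_tendstoD(2))
      then show "\<forall>\<^sub>F n in sequentially. \<forall>t\<in>{0..T}. dist (x n t k) (d t k) < e"
      proof eventually_elim
        case (elim n)
        show ?case
        proof
          fix t assume t: "t \<in> {0..T}"
          have "w t k \<le> w T k" unfolding w_def using t \<gamma>(1) by (intro mult_right_mono) auto
          then have "2 * (C * w t k) * (1 / 2) ^ n \<le> K * (1 / 2) ^ n"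
            unfolding K_def by (intro mult_right_mono mult_left_mono) (auto simp: C_def)
          then have "norm (d t k - x n t k) < e" using g(2)[OF t, of k n] elim by linarith
          then show "dist (x n t k) (d t k) < e" by (simp add: dist_norm norm_minus_commute)
        qed
      qed
    qed
    then show "continuous_on {0..T} (\<lambda>t. d t k)"
      by (rule uniform_limit_theorem[rotated]) (use adm_D(3)[OF xa] in auto)
  qed (use \<beta>(1) in simp)
  have "d t k = Phi d t k" if t: "t \<in> {0..T}" for t k
  proof -
    have "norm (Phi (x n) t k - Phi d t k) \<le> (2 * C * (1 / 2) ^ n) / 2 * exp (\<gamma> * t) * (1 + q k) powr (- 5 / 4)" for n
    proof (rule Phi_contraction[OF xa da \<gamma> _ _ t])
      show "norm (x n s k - d s k) \<le> 2 * C * (1 / 2) ^ n * exp (\<gamma> * s) * (1 + q k) powr (- 5 / 4)" if "s \<in> {0..T}" for s k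
        using g(2)[OF that, of k n] by (simp add: norm_minus_commute w_def mult_ac)
    qed (simp add: C_def)
    then have le: "norm (x (Suc n) t k - Phi d t k) \<le> (C * w t k) * (1 / 2) ^ n" for n by (simp add: xS w_def mult_ac)
    have "(\<lambda>n. x (Suc n) t k - Phi d t k) \<longlonglongrightarrow> 0"
    proof (rule Lim_null_comparison)
      show "\<forall>\<^sub>F n in sequentially. norm (x (Suc n) t k - Phi d t k) \<le> (C * w t k) * (1 / 2) ^ n"
        using le by simp
      show "(\<lambda>n. (C * w t k) * (1 / 2) ^ n) \<longlonglongrightarrow> 0" by (rule tendsto_mult_right_zero) (rule LIMSEQ_power_zero, simp)
    qed
    then have "(\<lambda>n. x (Suc n) t k) \<longlonglongrightarrow> Phi d t k" by (simp add: LIM_zero_iff)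
    moreover have "(\<lambda>n. x (Suc n) t k) \<longlonglongrightarrow> d t k" using LIMSEQ_Suc[OF g(1)[OF t]] .
    ultimately show ?thesis using LIMSEQ_unique by blast
  qed
  then show thesis using that da by blast
qed

end

context torus
begin

lemma h2_norm_minus_eq:
  assumes u: "u \<in> H2 L" and v: "v \<in> H2 L"
  shows "(h2_norm L (u - v))\<^sup>2 = (\<Sum>\<^sub>\<infinity>k. (1 + q k + (q k)\<^sup>2) * (norm (cf u k - cf v k))\<^sup>2)"
  using infsumI[OF has_sum_h2[OF H2_minus[OF u v]]] by (simp add: cf_minus H2_L2 u v)

lemma l2_norm_minus_eq:
  assumes u: "u \<in> L2 L" and v: "v \<in> L2 L"
  shows "(l2_norm L (u - v))\<^sup>2 = (\<Sum>\<^sub>\<infinity>k. (norm (cf u k - cf v k))\<^sup>2)"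
  using infsumI[OF parseval_norm[OF L2_minus[OF u v]]] by (simp add: cf_minus u v)

text \<open>\<open>lap\<close> is built from chosen derivatives and is additive only up to null
  sets; the coefficients show that the two sides agree almost everywhere.\<close>

lemma lap_diff_le:
  assumes u: "u \<in> H2 L" and v: "v \<in> H2 L"
  shows "l2_norm L (\<lambda>x. lap L u x - lap L v x) \<le> h2_norm L (u - v)"
proof -
  have "l2_norm L (\<lambda>x. lap L u x - lap L v x) = l2_norm L (lap L (u - v))"
  proof (rule l2_norm_cong_AE)
    show "AE x in mu L. lap L u x - lap L v x = lap L (u - v) x"
      by (rule cf_eq_AE) (auto intro: L2_diff lap_H2(1) u v H2_minus
          simp: cf_diff lap_H2 u v H2_minus cf_minus H2_L2 scaleR_diff_right)
  qed (auto intro: L2_diff lap_H2(1) u v H2_minus)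
  then show ?thesis using lap_le_h2[OF H2_minus[OF u v]] by simp
qed

end

context calmed
begin

section \<open>The prescribed time derivative as a functional on H2\<close>

definition rhs :: "(real^2 \<Rightarrow> real^2) \<Rightarrow> (real^2 \<Rightarrow> real^2) \<Rightarrow> real" where
  "rhs u v = - (l2_inner L (adv u) v + l2_inner L (lap L u) v + bilap L u v)"

lemma lap_lincomb_inner:
  assumes w: "w \<in> L2 L" and u: "u \<in> H2 L" and v: "v \<in> H2 L"
  shows "l2_inner L w (lap L (\<lambda>x. a *\<^sub>R u x + b *\<^sub>R v x)) = a * l2_inner L w (lap L u) + b * l2_inner L w (lap L v)"
proof -
  note uv = H2_lincomb[OF u v, of a b]
  have "AE x in mu L. lap L (\<lambda>x. a *\<^sub>R u x + b *\<^sub>R v x) x = a *\<^sub>R lap L u x + b *\<^sub>R lap L v x"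
    by (rule cf_eq_AE) (auto intro: L2_lincomb lap_H2(1) u v uv
        simp: cf_lincomb lap_H2 u v uv H2_L2 scaleR_add_right mult.commute)
  then have "l2_inner L (lap L (\<lambda>x. a *\<^sub>R u x + b *\<^sub>R v x)) w = l2_inner L (\<lambda>x. a *\<^sub>R lap L u x + b *\<^sub>R lap L v x) w"
    by (intro l2_inner_cong_AE L2_lincomb lap_H2(1) u v uv w)
  then show ?thesis
    using l2_inner_lincomb_left[OF lap_H2(1)[OF u] lap_H2(1)[OF v] w, of a b] by (simp add: l2_inner_commute)
qed

lemma rhs_le:
  assumes u: "u \<in> H2 L" and v: "v \<in> H2 L"
  shows "\<bar>rhs u v\<bar> \<le> (2 * M + 2) * h2_norm L u * h2_norm L v"
proof -
  have s: "u \<in> Sob L (Suc 0)" by (rule H2_Sob1[OF u])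
  have "\<bar>l2_inner L (adv u) v\<bar> \<le> (2 * M * h2_norm L u) * h2_norm L v"
  proof -
    have "\<bar>l2_inner L (adv u) v\<bar> \<le> l2_norm L (adv u) * l2_norm L v" by (rule l2_cauchy_schwarz[OF adv_L2[OF s] H2_L2[OF v]])
    also have "\<dots> \<le> (2 * M * h2_norm L u) * h2_norm L v"
    proof (rule mult_mono[OF _ l2_le_h2[OF v]])
      show "l2_norm L (adv u) \<le> 2 * M * h2_norm L u"
        using l2_norm_adv_le[OF s] mult_left_mono[OF h1_le_h2[OF u], of "2 * M"] M_nonneg by simp
    qed (use M_nonneg in auto)
    finally show ?thesis .
  qed
  moreover have "\<bar>l2_inner L (lap L u) v\<bar> \<le> h2_norm L u * h2_norm L v"
    using l2_cauchy_schwarz[OF lap_H2(1)[OF u] H2_L2[OF v]] mult_mono[OF lap_le_h2[OF u] l2_le_h2[OF v]] by simp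
  moreover have "\<bar>bilap L u v\<bar> \<le> h2_norm L u * h2_norm L v"
    unfolding bilap_def
    using l2_cauchy_schwarz[OF lap_H2(1)[OF u] lap_H2(1)[OF v]] mult_mono[OF lap_le_h2[OF u] lap_le_h2[OF v]] by simp
  ultimately have "\<bar>rhs u v\<bar> \<le> (2 * M * h2_norm L u) * h2_norm L v + h2_norm L u * h2_norm L v + h2_norm L u * h2_norm L v"
    unfolding rhs_def by linarith
  then show ?thesis by (simp add: algebra_simps)
qed

lemma rhs_Hm2:
  assumes u: "u \<in> H2 L" shows "rhs u \<in> Hm2 L"
proof -
  have "rhs u (\<lambda>x. a *\<^sub>R v x + b *\<^sub>R w x) = a * rhs u v + b * rhs u w" if v: "v \<in> H2 L" and w: "w \<in> H2 L" for v w a b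
    unfolding rhs_def bilap_def
    using l2_inner_lincomb_right[OF H2_L2[OF v] H2_L2[OF w] adv_L2[OF H2_Sob1[OF u]], of a b]
      l2_inner_lincomb_right[OF H2_L2[OF v] H2_L2[OF w] lap_H2(1)[OF u], of a b]
      lap_lincomb_inner[OF lap_H2(1)[OF u] v w, of a b]
    by (simp add: algebra_simps)
  then show ?thesis unfolding Hm2_def using rhs_le[OF u] by blast
qed

text \<open>Locally Lipschitz from H2 to its dual: the test function is bounded by H2, which handles
  the product of \<open>u - v\<close> with the gradient of \<open>v\<close>. Continuity of a
  solution in H2 thus carries over to its time derivative.\<close>

lemma rhs_diff_le:
  assumes u: "u \<in> H2 L" and v: "v \<in> H2 L"
  shows "hm2_norm L (rhs u - rhs v) \<le> (2 * M + 2 + 2 * Csob * h2_norm L v) * h2_norm L (u - v)"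
proof (rule hm2_norm_le)
  note w = H2_minus[OF u v]
  show "0 \<le> (2 * M + 2 + 2 * Csob * h2_norm L v) * h2_norm L (u - v)" using M_nonneg Csob_nonneg by simp
  fix p assume p: "p \<in> H2 L"
  have "\<bar>l2_inner L (adv u) p - l2_inner L (adv v) p\<bar> \<le> ((2 * M + 2 * Csob * h2_norm L v) * h2_norm L (u - v)) * h2_norm L p"
  proof -
    have "2 * M * h1_norm L (u - v) + 2 * Csob * l2_norm L (u - v) * h1_norm L v
      \<le> 2 * M * h2_norm L (u - v) + 2 * Csob * h2_norm L (u - v) * h2_norm L v"
      using M_nonneg Csob_nonneg h1_le_h2[OF w] l2_le_h2[OF w] h1_le_h2[OF v]
      by (intro add_mono mult_left_mono mult_mono) auto
    from mult_right_mono[OF this h2_norm_nonneg[of L p]] adv_diff_H2[OF H2_Sob1[OF u] H2_Sob1[OF v] p]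
    show ?thesis by (simp add: algebra_simps)
  qed
  moreover have lapd: "\<bar>l2_inner L (lap L u) f - l2_inner L (lap L v) f\<bar> \<le> h2_norm L (u - v) * h2_norm L p"
    if f: "f \<in> L2 L" "l2_norm L f \<le> h2_norm L p" for f
  proof -
    have "\<bar>l2_inner L (lap L u) f - l2_inner L (lap L v) f\<bar> \<le> l2_norm L (\<lambda>x. lap L u x - lap L v x) * l2_norm L f"
      using l2_cauchy_schwarz[OF L2_diff[OF lap_H2(1)[OF u] lap_H2(1)[OF v]] f(1)]
      by (simp add: l2_inner_diff_left[OF lap_H2(1)[OF u] lap_H2(1)[OF v] f(1)])
    also have "\<dots> \<le> h2_norm L (u - v) * h2_norm L p"
      using lap_diff_le[OF u v] f(2) by (intro mult_mono) auto
    finally show ?thesis .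
  qed
  have "\<bar>l2_inner L (lap L u) p - l2_inner L (lap L v) p\<bar> \<le> h2_norm L (u - v) * h2_norm L p"
    by (rule lapd[OF H2_L2[OF p] l2_le_h2[OF p]])
  moreover have "\<bar>bilap L u p - bilap L v p\<bar> \<le> h2_norm L (u - v) * h2_norm L p"
    unfolding bilap_def by (rule lapd[OF lap_H2(1)[OF p] lap_le_h2[OF p]])
  ultimately have "\<bar>(rhs u - rhs v) p\<bar> \<le> ((2 * M + 2 * Csob * h2_norm L v) * h2_norm L (u - v)) * h2_norm L p
      + h2_norm L (u - v) * h2_norm L p + h2_norm L (u - v) * h2_norm L p"
    unfolding rhs_def minus_apply by linarith
  then show "\<bar>(rhs u - rhs v) p\<bar> \<le> (2 * M + 2 + 2 * Csob * h2_norm L v) * h2_norm L (u - v) * h2_norm L p"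
    by (simp add: algebra_simps)
qed

lemma hm2_norm_rhs_le: "u \<in> H2 L \<Longrightarrow> hm2_norm L (rhs u) \<le> (2 * M + 2) * h2_norm L u"
  using rhs_le M_nonneg by (intro hm2_norm_le) auto

text \<open>Against a truncated test function the functional is a finite sum of right-hand sides of
  coefficient equations, the form in which Duhamel's formula delivers derivatives.\<close>

lemma rhs_syn:
  assumes u: "u \<in> H2 L"
  shows "rhs u (syn (fbox n) (cf v)) = - (\<Sum>k\<in>fbox n. (lam k *\<^sub>R cf u k + cf (adv u) k) \<bullet> cf v k)"
proof -
  have "bilap L u (syn (fbox n) (cf v)) = (\<Sum>k\<in>fbox n. ((q k)\<^sup>2 *\<^sub>R cf u k) \<bullet> cf v k)"
  proof -
    have s: "syn (fbox n) (cf v) \<in> H2 L" by (rule syn_H2) simp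
    have "((\<lambda>k. cf (lap L u) k \<bullet> cf (lap L (syn (fbox n) (cf v))) k) has_sum bilap L u (syn (fbox n) (cf v))) UNIV"
      unfolding bilap_def by (rule parseval[OF lap_H2(1)[OF u] lap_H2(1)[OF s]])
    moreover have "((\<lambda>k. cf (lap L u) k \<bullet> cf (lap L (syn (fbox n) (cf v))) k) has_sum (\<Sum>k\<in>fbox n. ((q k)\<^sup>2 *\<^sub>R cf u k) \<bullet> cf v k)) UNIV"
      by (rule has_sum_finite_neutralI[of "fbox n"])
        (auto simp: lap_H2[OF u] lap_H2[OF s] cf_syn power2_eq_square intro!: sum.cong split: if_splits)
    ultimately show ?thesis by (rule has_sum_unique)
  qed
  moreover have "l2_inner L (lap L u) (syn (fbox n) (cf v)) = (\<Sum>k\<in>fbox n. - (q k *\<^sub>R cf u k) \<bullet> cf v k)"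
    by (simp add: l2_inner_syn lap_H2 u)
  moreover have "l2_inner L (adv u) (syn (fbox n) (cf v)) = (\<Sum>k\<in>fbox n. cf (adv u) k \<bullet> cf v k)"
    by (simp add: l2_inner_syn adv_L2 H2_Sob1 u del: Sob.simps)
  ultimately show ?thesis
    unfolding rhs_def lam_def
    by (simp add: sum.distrib[symmetric] sum_negf[symmetric] inner_add_left algebra_simps del: sum_negf)
qed

lemma rhs_syn_lim:
  assumes u: "u \<in> H2 L" and v: "v \<in> H2 L"
  shows "(\<lambda>n. rhs u (syn (fbox n) (cf v))) \<longlonglongrightarrow> rhs u v"
proof -
  have "(\<lambda>n. bilap L u (syn (fbox n) (cf v))) \<longlonglongrightarrow> bilap L u v"
  proof -
    have s: "syn (fbox n) (cf v) \<in> H2 L" for n by (rule syn_H2) simp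
    have "bilap L u (syn (fbox n) (cf v)) = (\<Sum>k\<in>fbox n. cf (lap L u) k \<bullet> cf (lap L v) k)" for n
    proof -
      have "((\<lambda>k. cf (lap L u) k \<bullet> cf (lap L (syn (fbox n) (cf v))) k) has_sum bilap L u (syn (fbox n) (cf v))) UNIV"
        unfolding bilap_def by (rule parseval[OF lap_H2(1)[OF u] lap_H2(1)[OF s]])
      moreover have "((\<lambda>k. cf (lap L u) k \<bullet> cf (lap L (syn (fbox n) (cf v))) k) has_sum (\<Sum>k\<in>fbox n. cf (lap L u) k \<bullet> cf (lap L v) k)) UNIV"
        by (rule has_sum_finite_neutralI[of "fbox n"])
          (auto simp: lap_H2[OF s] lap_H2[OF v] cf_syn intro!: sum.cong split: if_splits)
      ultimately show ?thesis by (rule has_sum_unique)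
    qed
    then show ?thesis
      using has_sum_fbox[OF parseval[OF lap_H2(1)[OF u] lap_H2(1)[OF v]]] by (simp add: bilap_def)
  qed
  then show ?thesis
    unfolding rhs_def by (intro tendsto_intros l2_inner_syn_lim adv_L2 H2_Sob1 lap_H2 H2_L2 u v)
qed

end

lemma test_function_D:
  assumes "test_function_on T \<phi>"
  shows "(\<phi> has_real_derivative deriv \<phi> t) (at t)" "continuous_on S (deriv \<phi>)" "continuous_on S \<phi>"
    "T > 0 \<Longrightarrow> \<phi> 0 = 0" "T > 0 \<Longrightarrow> \<phi> T = 0"
proof -
  have s: "smooth \<phi>" using assms by (simp add: test_function_on_def)
  have d: "(\<phi> has_real_derivative deriv \<phi> t) (at t)" for t
    using smooth_D(1)[OF s, of t] by (simp add: DERIV_deriv_iff_real_differentiable)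
  show "(\<phi> has_real_derivative deriv \<phi> t) (at t)" by (rule d)
  have "deriv \<phi> = (\<lambda>x. frechet_derivative \<phi> (at x) 1)" by (simp add: frechet_real[OF d])
  then show "continuous_on S (deriv \<phi>)" using smooth_continuous[OF smooth_D(2)[OF s, of 1]] by simp
  show "continuous_on S \<phi>" by (rule smooth_continuous[OF s])
  obtain a b where ab: "0 < a" "b < T" "\<And>t. t \<notin> {a..b} \<Longrightarrow> \<phi> t = 0"
    using assms by (auto simp: test_function_on_def)
  show "\<phi> 0 = 0" "\<phi> T = 0" using ab by auto
qed

lemma tendsto_within_metric:
  fixes f :: "real \<Rightarrow> real"
  assumes lim: "(f \<longlongrightarrow> 0) (at t within {0<..T})" and "f t = 0" "e > 0"
  shows "\<exists>d>0. \<forall>s. 0 < s \<longrightarrow> s \<le> T \<longrightarrow> \<bar>s - t\<bar> < d \<longrightarrow> \<bar>f s\<bar> < e"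
proof -
  obtain d where d: "d > 0" "\<forall>s\<in>{0<..T}. s \<noteq> t \<and> dist s t < d \<longrightarrow> dist (f s) 0 < e"
    using tendstoD[OF lim \<open>e > 0\<close>] unfolding eventually_at by blast
  have "\<bar>f s\<bar> < e" if "0 < s" "s \<le> T" "\<bar>s - t\<bar> < d" for s
    using d(2) that assms(2,3) by (cases "s = t") (auto simp: dist_norm)
  then show ?thesis using d(1) by blast
qed

context torus
begin

lemma h2_norm_syn_le:
  assumes v: "v \<in> H2 L" shows "h2_norm L (syn (fbox n) (cf v)) \<le> h2_norm L v"
proof (rule power2_le_imp_le)
  have "(h2_norm L (syn (fbox n) (cf v)))\<^sup>2 \<le> (h2_norm L v)\<^sup>2"
    by (rule has_sum_mono[OF has_sum_h2[OF syn_H2[OF finite_fbox]] has_sum_h2[OF v]]) (simp add: cf_syn h2_weight_pos)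
  then show "(h2_norm L (syn (fbox n) (cf v)))\<^sup>2 \<le> (h2_norm L v)\<^sup>2" .
qed simp

lemma hm2_norm_triangle:
  assumes "F \<in> Hm2 L" "G \<in> Hm2 L"
  shows "\<bar>hm2_norm L F - hm2_norm L G\<bar> \<le> hm2_norm L (F - G)"
proof -
  have FG: "F - G \<in> Hm2 L" by (rule Hm2_minus[OF assms])
  have "hm2_norm L F \<le> hm2_norm L G + hm2_norm L (F - G)"
  proof (rule hm2_norm_le)
    show "0 \<le> hm2_norm L G + hm2_norm L (F - G)" using hm2_norm_nonneg assms FG by simp
    fix v assume v: "v \<in> H2 L"
    show "\<bar>F v\<bar> \<le> (hm2_norm L G + hm2_norm L (F - G)) * h2_norm L v"
      using Hm2_bound[OF assms(2) v] Hm2_bound[OF FG v] by (simp add: distrib_right abs_le_iff)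
  qed
  moreover have "hm2_norm L G \<le> hm2_norm L F + hm2_norm L (F - G)"
  proof (rule hm2_norm_le)
    show "0 \<le> hm2_norm L F + hm2_norm L (F - G)" using hm2_norm_nonneg assms FG by simp
    fix v assume v: "v \<in> H2 L"
    show "\<bar>G v\<bar> \<le> (hm2_norm L F + hm2_norm L (F - G)) * h2_norm L v"
      using Hm2_bound[OF assms(1) v] Hm2_bound[OF FG v] by (simp add: distrib_right abs_le_iff)
  qed
  ultimately show ?thesis by linarith
qed

end

section \<open>Mild solutions are weak solutions\<close>

locale mild_solution = calmed_ivp +
  fixes \<beta> :: real and d :: "real \<Rightarrow> int \<times> int \<Rightarrow> real^2"
  assumes adm: "adm \<beta> d" and fixed_point: "\<And>t k. t \<in> {0..T} \<Longrightarrow> d t k = Phi d t k"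
begin

abbreviation c :: "real \<Rightarrow> int \<times> int \<Rightarrow> real^2" where
  "c \<equiv> cc d"

definition Dh :: real where
  "Dh = Ce T * (2 * M * R * exp (\<beta> * T)) * kernel_const (7 / 8) (1 / 4)"

lemma d_decay: "0 < t \<Longrightarrow> t \<le> T \<Longrightarrow> norm (d t k) \<le> Dh * t powr (- 1 / 8) * (1 + q k) powr (- 7 / 4)"
proof -
  assume t: "0 < t" "t \<le> T"
  have "norm (integral\<^sup>L (lebesgue_on {0..t}) (\<lambda>s. E k (t - s) *\<^sub>R NN (c s) k))
    \<le> Ce T * (2 * M * R * exp (\<beta> * T)) * kernel_const (7 / 8) (1 / 4) * t powr (- 1 / 8) * (1 + q k) powr (- 7 / 4)"
  proof (rule duhamel_H2[OF t])
    show "0 \<le> 2 * M * R * exp (\<beta> * T)" using M_nonneg R_nonneg by simp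
    show "norm (NN (c s) k) \<le> 2 * M * R * exp (\<beta> * T) * s powr (- 1 / 4)" if "0 < s" "s < t" for s
      using NN_cc_le(2)[OF adm] that t by simp
  qed
  then show ?thesis using fixed_point[of t k] t by (simp add: Phi_def Dh_def)
qed

text \<open>Summable majorant of the H2-weighted squares for all times from \<open>t\<close> on:
  smoothing with \<open>p = 1 / 2\<close> for the free part, \<open>d_decay\<close> for the rest.
  The factor \<open>t powr (- 1)\<close> is not integrable at 0, so this serves continuity at
  positive times but not square integrability in time.\<close>

definition GH :: "real \<Rightarrow> int \<times> int \<Rightarrow> real" where
  "GH t k = 2 * ((Ce T)\<^sup>2 * t powr (- 1) * (norm (cf u0 k))\<^sup>2) + 2 * (Dh\<^sup>2 * t powr (- 1 / 4) * (1 + q k) powr (- 3 / 2))"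

lemma GH_summable: "GH t summable_on UNIV"
  unfolding GH_def using weight_summable[of "3 / 2"]
  by (intro summable_on_add summable_on_cmult_right cf_summable u0) simp

text \<open>The factor \<open>E k t\<close> of the free part is kept, because its pointwise bound of
  order \<open>1 / t\<close> in the squared H2 norm would diverge when integrated over time.\<close>

lemma c_sq_split:
  assumes t: "0 < t" "t \<le> T"
  shows "(1 + q k)\<^sup>2 * (norm (c t k))\<^sup>2
    \<le> 2 * (((1 + q k)\<^sup>2 * (E k t)\<^sup>2) * (norm (cf u0 k))\<^sup>2) + 2 * (Dh\<^sup>2 * t powr (- 1 / 4) * (1 + q k) powr (- 3 / 2))"
proof -
  have q1: "0 < 1 + q k" using q_nonneg[of k] by linarith
  have "(norm (d t k))\<^sup>2 \<le> (Dh * t powr (- 1 / 8) * (1 + q k) powr (- 7 / 4))\<^sup>2"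
    by (rule power_mono[OF d_decay[OF t]]) simp
  also have "\<dots> = Dh\<^sup>2 * t powr (- 1 / 4) * (1 + q k) powr (- 7 / 2)"
    by (simp add: power_mult_distrib powr_square)
  finally have "(1 + q k)\<^sup>2 * (norm (d t k))\<^sup>2 \<le> (1 + q k)\<^sup>2 * (Dh\<^sup>2 * t powr (- 1 / 4) * (1 + q k) powr (- 7 / 2))"
    by (rule mult_left_mono) simp
  also have "\<dots> = Dh\<^sup>2 * t powr (- 1 / 4) * ((1 + q k) powr 2 * (1 + q k) powr (- 7 / 2))"
    using q1 by simp
  also have "(1 + q k) powr 2 * (1 + q k) powr (- 7 / 2) = (1 + q k) powr (- 3 / 2)"
    by (subst powr_add[symmetric]) simp
  finally have 1: "(1 + q k)\<^sup>2 * (norm (d t k))\<^sup>2 \<le> Dh\<^sup>2 * t powr (- 1 / 4) * (1 + q k) powr (- 3 / 2)" .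
  have "(norm (c t k))\<^sup>2 \<le> 2 * ((E k t)\<^sup>2 * (norm (cf u0 k))\<^sup>2) + 2 * (norm (d t k))\<^sup>2"
    using norm_add_sq_le[of "E k t *\<^sub>R cf u0 k" "d t k"] by (simp add: cc_def power_mult_distrib)
  then have "(1 + q k)\<^sup>2 * (norm (c t k))\<^sup>2 \<le> (1 + q k)\<^sup>2 * (2 * ((E k t)\<^sup>2 * (norm (cf u0 k))\<^sup>2) + 2 * (norm (d t k))\<^sup>2)"
    by (rule mult_left_mono) simp
  also have "\<dots> = 2 * (((1 + q k)\<^sup>2 * (E k t)\<^sup>2) * (norm (cf u0 k))\<^sup>2) + 2 * ((1 + q k)\<^sup>2 * (norm (d t k))\<^sup>2)"
    by (simp only: distrib_left mult.assoc mult.left_commute)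
  finally show ?thesis using 1 by linarith
qed

lemma c_H2_le:
  assumes s: "0 < s" "s \<le> t" "t \<le> T"
  shows "(1 + q k)\<^sup>2 * (norm (c t k))\<^sup>2 \<le> GH s k"
proof -
  have t: "0 < t" using s by linarith
  have q1: "0 < 1 + q k" using q_nonneg[of k] by linarith
  have "(1 + q k)\<^sup>2 * (E k t)\<^sup>2 \<le> (Ce T)\<^sup>2 * t powr (- 1)"
    using E_sq_le[OF t s(3), of "1 / 2" k] q1 by simp
  also have "\<dots> \<le> (Ce T)\<^sup>2 * s powr (- 1)" using s by (intro mult_left_mono powr_mono2') auto
  finally have "((1 + q k)\<^sup>2 * (E k t)\<^sup>2) * (norm (cf u0 k))\<^sup>2 \<le> ((Ce T)\<^sup>2 * s powr (- 1)) * (norm (cf u0 k))\<^sup>2"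
    by (rule mult_right_mono) simp
  moreover have "Dh\<^sup>2 * t powr (- 1 / 4) * (1 + q k) powr (- 3 / 2) \<le> Dh\<^sup>2 * s powr (- 1 / 4) * (1 + q k) powr (- 3 / 2)"
    using s by (intro mult_right_mono mult_left_mono powr_mono2') auto
  ultimately show ?thesis using c_sq_split[OF t s(3), of k] unfolding GH_def by linarith
qed

definition GL :: "int \<times> int \<Rightarrow> real" where
  "GL k = 2 * ((exp (2 * T))\<^sup>2 * (norm (cf u0 k))\<^sup>2) + 2 * ((exp (\<beta> * T))\<^sup>2 * (1 + q k) powr (- 5 / 2))"

lemma GL_summable: "GL summable_on UNIV"
  unfolding GL_def using weight_summable[of "5 / 2"]
  by (intro summable_on_add summable_on_cmult_right cf_summable u0) simp

lemma c_L2_le: "t \<in> {0..T} \<Longrightarrow> (norm (c t k))\<^sup>2 \<le> GL k"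
proof -
  assume t: "t \<in> {0..T}"
  have 0: "(E k t)\<^sup>2 \<le> (exp (2 * T))\<^sup>2" using t by (intro power_mono E_bounded) auto
  from mult_right_mono[OF 0, of "(norm (cf u0 k))\<^sup>2"]
  have 1: "(E k t)\<^sup>2 * (norm (cf u0 k))\<^sup>2 \<le> (exp (2 * T))\<^sup>2 * (norm (cf u0 k))\<^sup>2" by simp
  have "norm (d t k) \<le> exp (\<beta> * t) * (1 + q k) powr (- 5 / 4)" by (rule adm_D(2)[OF adm t])
  also have "\<dots> \<le> exp (\<beta> * T) * (1 + q k) powr (- 5 / 4)"
    using t adm_D(1)[OF adm] by (intro mult_right_mono) (auto intro: mult_left_mono)
  finally have "(norm (d t k))\<^sup>2 \<le> (exp (\<beta> * T) * (1 + q k) powr (- 5 / 4))\<^sup>2" by (rule power_mono) simp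
  also have "\<dots> = (exp (\<beta> * T))\<^sup>2 * (1 + q k) powr (- 5 / 2)" by (simp add: power_mult_distrib powr_square)
  finally have 2: "(norm (d t k))\<^sup>2 \<le> (exp (\<beta> * T))\<^sup>2 * (1 + q k) powr (- 5 / 2)" .
  have "(norm (c t k))\<^sup>2 \<le> 2 * ((E k t)\<^sup>2 * (norm (cf u0 k))\<^sup>2) + 2 * (norm (d t k))\<^sup>2"
    using norm_add_sq_le[of "E k t *\<^sub>R cf u0 k" "d t k"] by (simp add: cc_def power_mult_distrib)
  then show ?thesis using 1 2 unfolding GL_def by linarith
qed

text \<open>At time 0 the coefficients are those of \<open>u0\<close>, which need not lie in
  \<open>h1s\<close>; inserting \<open>u0\<close> itself also makes the initial condition
  immediate.\<close>

definition u :: "real \<Rightarrow> real^2 \<Rightarrow> real^2" where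
  "u t = (if t = 0 then u0 else fn (c t))"

lemma u_L2: "t \<in> {0..T} \<Longrightarrow> u t \<in> L2 L" and cf_u: "t \<in> {0..T} \<Longrightarrow> cf (u t) k = c t k"
proof -
  assume t: "t \<in> {0..T}"
  show "u t \<in> L2 L"
  proof (cases "t = 0")
    case False
    then show ?thesis using Sob1_L2[OF fn_Sob1(1)[OF cc_h1(1)[OF adm, of t]]] t by (simp add: u_def)
  qed (simp add: u_def u0)
  show "cf (u t) k = c t k"
  proof (cases "t = 0")
    case True
    then show ?thesis using fixed_point[of 0 k] T by (simp add: u_def cc_def E_def Phi_0)
  next
    case False
    then show ?thesis using fn_Sob1(2)[OF cc_h1(1)[OF adm, of t]] t by (simp add: u_def)
  qed
qed

lemma NN_c: "0 < t \<Longrightarrow> NN (c t) k = cf (adv (u t)) k"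
  by (simp add: NN_def u_def)

lemma h2_weight_le: "1 + q k + (q k)\<^sup>2 \<le> (1 + q k)\<^sup>2"
  by (simp add: power2_eq_square algebra_simps)

lemma u_H2:
  assumes t: "0 < t" "t \<le> T" shows "u t \<in> H2 L"
proof -
  have "(\<lambda>k. (q k)\<^sup>2 * (norm (cf (u t) k))\<^sup>2) summable_on UNIV"
  proof (rule summable_on_comparison_test[OF GH_summable[of t]])
    fix k
    have "(q k)\<^sup>2 * (norm (c t k))\<^sup>2 \<le> (1 + q k)\<^sup>2 * (norm (c t k))\<^sup>2"
      by (intro mult_right_mono power_mono) auto
    then show "(q k)\<^sup>2 * (norm (cf (u t) k))\<^sup>2 \<le> GH t k"
      using c_H2_le[OF t(1) order_refl t(2), of k] t by (simp add: cf_u)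
  qed simp
  then show ?thesis unfolding H2_iff using u_L2[of t] t by simp
qed

lemma AE_u_H2: "AE t in lebesgue_on {0..T}. u t \<in> H2 L"
  using AE_not_endpoints[of T] AE_space by eventually_elim (auto intro: u_H2)

lemma u_C_time: "u \<in> C_time T (L2 L) (l2_norm L)"
  unfolding C_time_def
proof (intro CollectI ballI conjI)
  fix t assume t: "t \<in> {0..T}"
  show "u t \<in> L2 L" by (rule u_L2[OF t])
  have "((\<lambda>s. \<Sum>\<^sub>\<infinity>k. 1 * (norm (c s k - c t k))\<^sup>2) \<longlongrightarrow> 0) (at t within {0..T})"
  proof (rule weighted_continuity[OF GL_summable])
    show "\<forall>\<^sub>F s in at t within {0..T}. \<forall>k. 1 * (norm (c s k))\<^sup>2 \<le> GL k"
      unfolding eventually_at_filter by (intro always_eventually) (simp add: c_L2_le)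
  qed (use c_L2_le[OF t] cc_tendsto[OF adm t] in auto)
  then have "((\<lambda>s. (l2_norm L (u s - u t))\<^sup>2) \<longlongrightarrow> 0) (at t within {0..T})"
  proof (rule Lim_transform_eventually)
    show "\<forall>\<^sub>F s in at t within {0..T}. (\<Sum>\<^sub>\<infinity>k. 1 * (norm (c s k - c t k))\<^sup>2) = (l2_norm L (u s - u t))\<^sup>2"
      unfolding eventually_at_filter
    proof (intro always_eventually allI impI)
      fix s assume s: "s \<in> {0..T}"
      show "(\<Sum>\<^sub>\<infinity>k. 1 * (norm (c s k - c t k))\<^sup>2) = (l2_norm L (u s - u t))\<^sup>2"
        by (simp only: l2_norm_minus_eq[OF u_L2[OF s] u_L2[OF t]] cf_u[OF s] cf_u[OF t] mult_1)
    qed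
  qed
  from tendsto_real_sqrt[OF this] show "((\<lambda>s. l2_norm L (u s - u t)) \<longlongrightarrow> 0) (at t within {0..T})" by simp
qed

lemma u_H2_continuous:
  assumes t: "0 < t" "t \<le> T"
  shows "((\<lambda>s. h2_norm L (u s - u t)) \<longlongrightarrow> 0) (at t within {0<..T})"
proof -
  have near: "\<forall>\<^sub>F s in at t within {0<..T}. t / 2 \<le> s \<and> 0 < s \<and> s \<le> T"
  proof -
    have "\<forall>\<^sub>F s in at t within {0<..T}. s \<in> {t / 2<..}"
      by (rule topological_tendstoD[OF tendsto_ident_at]) (use t in auto)
    moreover have "\<forall>\<^sub>F s in at t within {0<..T}. s \<in> {0<..T}" by (simp add: eventually_at_filter)
    ultimately show ?thesis by eventually_elim auto
  qed
  have le: "(1 + q k + (q k)\<^sup>2) * (norm (c s k))\<^sup>2 \<le> GH (t / 2) k" if "t / 2 \<le> s" "s \<le> T" for s k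
  proof -
    have "(1 + q k + (q k)\<^sup>2) * (norm (c s k))\<^sup>2 \<le> (1 + q k)\<^sup>2 * (norm (c s k))\<^sup>2"
      by (rule mult_right_mono[OF h2_weight_le]) simp
    then show ?thesis using c_H2_le[of "t / 2" s k] that t by linarith
  qed
  have "((\<lambda>s. \<Sum>\<^sub>\<infinity>k. (1 + q k + (q k)\<^sup>2) * (norm (c s k - c t k))\<^sup>2) \<longlongrightarrow> 0) (at t within {0<..T})"
  proof (rule weighted_continuity[OF GH_summable[of "t / 2"]])
    show "\<forall>\<^sub>F s in at t within {0<..T}. \<forall>k. (1 + q k + (q k)\<^sup>2) * (norm (c s k))\<^sup>2 \<le> GH (t / 2) k"
      using near by eventually_elim (use le in blast)
    show "((\<lambda>s. c s k) \<longlongrightarrow> c t k) (at t within {0<..T})" for k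
      by (rule tendsto_within_subset[OF cc_tendsto[OF adm]]) (use t in auto)
    show "(1 + q k + (q k)\<^sup>2) * (norm (c t k))\<^sup>2 \<le> GH (t / 2) k" for k using le[of t k] t by simp
  qed (rule h2_weight_pos)
  then have "((\<lambda>s. (h2_norm L (u s - u t))\<^sup>2) \<longlongrightarrow> 0) (at t within {0<..T})"
  proof (rule Lim_transform_eventually)
    show "\<forall>\<^sub>F s in at t within {0<..T}. (\<Sum>\<^sub>\<infinity>k. (1 + q k + (q k)\<^sup>2) * (norm (c s k - c t k))\<^sup>2) = (h2_norm L (u s - u t))\<^sup>2"
      using near by eventually_elim (use t in \<open>simp add: h2_norm_minus_eq u_H2 cf_u\<close>)
  qed
  from tendsto_real_sqrt[OF this] show ?thesis by simp
qed

lemma h2_norm_self_diff: "h2_norm L (w - w) = 0"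
  using h2_norm_zero by (simp add: fun_diff_def)

text \<open>\<open>y * exp (- (y / 2 * t))\<close> has integral at most 2 whatever \<open>y\<close>
  is. Integrating each frequency separately in time avoids the logarithmic divergence of the
  pointwise smoothing bound.\<close>

lemma E_time_integral:
  "integral\<^sup>L (lebesgue_on {0..T}) (\<lambda>t. (1 + q k)\<^sup>2 * (E k t)\<^sup>2) \<le> 2 * (exp (2 * T))\<^sup>2"
proof -
  define y where "y = (1 + q k)\<^sup>2"
  have "0 < 1 + q k" using q_nonneg[of k] by linarith
  then have y: "y > 0" by (simp add: y_def)
  have cE: "continuous_on {0..T} (\<lambda>t. y * (E k t)\<^sup>2)" unfolding E_def by (intro continuous_intros)
  have cF: "continuous_on {0..T} (\<lambda>t. (exp (2 * T))\<^sup>2 * (y * exp (- (y / 2 * t))))" by (intro continuous_intros)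
  have hi: "((\<lambda>t. y * exp (- (y / 2 * t))) has_integral (- 2 * exp (- (y / 2 * T)) - - 2 * exp (- (y / 2 * 0)))) {0..T}"
    using T by (intro fundamental_theorem_of_calculus)
      (auto intro!: derivative_eq_intros simp: has_real_derivative_iff_has_vector_derivative[symmetric])
  have I: "integral {0..T} (\<lambda>t. y * exp (- (y / 2 * t))) \<le> 2" unfolding integral_unique[OF hi] by simp
  have "integral\<^sup>L (lebesgue_on {0..T}) (\<lambda>t. y * (E k t)\<^sup>2)
      \<le> integral\<^sup>L (lebesgue_on {0..T}) (\<lambda>t. (exp (2 * T))\<^sup>2 * (y * exp (- (y / 2 * t))))"
  proof (rule integral_mono[OF continuous_lint[OF cE] continuous_lint[OF cF]])
    fix t assume "t \<in> space (lebesgue_on {0..T})"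
    then have t: "0 \<le> t" "t \<le> T" by auto
    have "(E k t)\<^sup>2 \<le> (exp (2 * T) * exp (- (y / 4 * t)))\<^sup>2"
      unfolding y_def by (intro power_mono E_exp_le t) simp
    also have "\<dots> = (exp (2 * T))\<^sup>2 * exp (- (y / 2 * t))"
      by (simp add: power_mult_distrib exp_double[symmetric])
    finally show "y * (E k t)\<^sup>2 \<le> (exp (2 * T))\<^sup>2 * (y * exp (- (y / 2 * t)))"
      using y mult_left_mono[of "(E k t)\<^sup>2" _ y] by (simp add: mult.left_commute)
  qed
  also have "\<dots> = (exp (2 * T))\<^sup>2 * integral\<^sup>L (lebesgue_on {0..T}) (\<lambda>t. y * exp (- (y / 2 * t)))" by (rule integral_mult_right_zero)
  also have "\<dots> \<le> (exp (2 * T))\<^sup>2 * 2"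
  proof (rule mult_left_mono)
    have "integrable (lebesgue_on {0..T}) (\<lambda>t. y * exp (- (y / 2 * t)))" by (intro continuous_lint continuous_intros)
    then have "integral\<^sup>L (lebesgue_on {0..T}) (\<lambda>t. y * exp (- (y / 2 * t))) = integral {0..T} (\<lambda>t. y * exp (- (y / 2 * t)))"
      by (rule lebesgue_integral_eq_integral) simp
    then show "integral\<^sup>L (lebesgue_on {0..T}) (\<lambda>t. y * exp (- (y / 2 * t))) \<le> 2" using I by (simp only:)
  qed simp
  finally show ?thesis by (simp add: y_def)
qed

lemma c_continuous: "continuous_on {0..T} (\<lambda>t. c t k)"
  unfolding continuous_on_def using cc_tendsto[OF adm] by blast

text \<open>The time integrals of the truncated norms \<open>Y n\<close> are bounded by
  \<open>B\<close>: the free part through \<open>E_time_integral\<close> and Bessel's inequality,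
  the Duhamel part since \<open>t powr (- 1 / 4)\<close> is integrable. Fatou's lemma passes to the
  full norm.\<close>

lemma u_H2_integrable: "integrable (lebesgue_on {0..T}) (\<lambda>t. (h2_norm L (u t))\<^sup>2)"
proof -
  define Y where "Y n t = (\<Sum>k\<in>fbox n. (1 + q k + (q k)\<^sup>2) * (norm (c t k))\<^sup>2)" for n t
  define h where "h t = (h2_norm L (u t))\<^sup>2" for t
  define S where "S = (\<Sum>\<^sub>\<infinity>k. (1 + q k) powr (- 3 / 2))"
  define Z where "Z n t = 2 * (\<Sum>k\<in>fbox n. ((1 + q k)\<^sup>2 * (E k t)\<^sup>2) * (norm (cf u0 k))\<^sup>2) + 2 * (Dh\<^sup>2 * t powr (- (1 / 4)) * S)" for n t
  define B where "B = 4 * (exp (2 * T))\<^sup>2 * (l2_norm L u0)\<^sup>2 + 2 * (Dh\<^sup>2 * (T powr (1 - 1 / 4) / (1 - 1 / 4)) * S)"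
  have cY: "continuous_on {0..T} (Y n)" for n unfolding Y_def by (intro continuous_intros c_continuous)
  have Y0: "0 \<le> Y n t" for n t unfolding Y_def by (intro sum_nonneg mult_nonneg_nonneg h2_weight_pos) simp
  have lim: "AE t in lebesgue_on {0..T}. (\<lambda>n. Y n t) \<longlonglongrightarrow> h t"
    using AE_u_H2 AE_space
  proof eventually_elim
    case (elim t)
    then show ?case using has_sum_fbox[OF has_sum_h2[OF elim(1)]] by (simp add: Y_def h_def cf_u)
  qed
  have mY: "Y n \<in> borel_measurable (lebesgue_on {0..T})" for n
    by (rule continuous_imp_measurable_on_sets_lebesgue[OF cY]) simp
  have hm: "h \<in> borel_measurable (lebesgue_on {0..T})"
  proof (rule measurable_AE_lebesgue_on)
    show "(\<lambda>t. lim (\<lambda>n. Y n t)) \<in> borel_measurable (lebesgue_on {0..T})" by (intro borel_measurable_lim_metric mY)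
    show "AE t in lebesgue_on {0..T}. lim (\<lambda>n. Y n t) = h t" using lim by eventually_elim (rule limI)
  qed
  have iE: "integrable (lebesgue_on {0..T}) (\<lambda>t. ((1 + q k)\<^sup>2 * (E k t)\<^sup>2) * (norm (cf u0 k))\<^sup>2)" for k
    unfolding E_def by (intro continuous_lint continuous_intros)
  have ip: "integrable (lebesgue_on {0..T}) (\<lambda>t. 2 * (Dh\<^sup>2 * t powr (- (1 / 4)) * S))"
    using powr_lint(1)[of "1 / 4" T] T by simp
  have isum: "integrable (lebesgue_on {0..T}) (\<lambda>t. 2 * (\<Sum>k\<in>fbox n. ((1 + q k)\<^sup>2 * (E k t)\<^sup>2) * (norm (cf u0 k))\<^sup>2))" for n
    by (intro integrable_mult_right Bochner_Integration.integrable_sum iE)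
  have bound: "integral\<^sup>L (lebesgue_on {0..T}) (Y n) \<le> B" for n
  proof -
    have "integral\<^sup>L (lebesgue_on {0..T}) (Y n) \<le> integral\<^sup>L (lebesgue_on {0..T}) (Z n)"
    proof (rule integral_mono_AE[OF continuous_lint[OF cY]])
      show "integrable (lebesgue_on {0..T}) (Z n)" unfolding Z_def by (rule Bochner_Integration.integrable_add[OF isum ip])
      show "AE t in lebesgue_on {0..T}. Y n t \<le> Z n t"
        using AE_not_endpoints[of T] AE_space
      proof eventually_elim
        case (elim t)
        then have t: "0 < t" "t \<le> T" by auto
        have "Y n t \<le> (\<Sum>k\<in>fbox n. 2 * (((1 + q k)\<^sup>2 * (E k t)\<^sup>2) * (norm (cf u0 k))\<^sup>2) + 2 * (Dh\<^sup>2 * t powr (- 1 / 4) * (1 + q k) powr (- 3 / 2)))"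
          unfolding Y_def
        proof (rule sum_mono)
          fix k
          show "(1 + q k + (q k)\<^sup>2) * (norm (c t k))\<^sup>2 \<le> 2 * (((1 + q k)\<^sup>2 * (E k t)\<^sup>2) * (norm (cf u0 k))\<^sup>2) + 2 * (Dh\<^sup>2 * t powr (- 1 / 4) * (1 + q k) powr (- 3 / 2))"
            using mult_right_mono[OF h2_weight_le[of k], of "(norm (c t k))\<^sup>2"] c_sq_split[OF t, of k] by simp
        qed
        also have "\<dots> = 2 * (\<Sum>k\<in>fbox n. ((1 + q k)\<^sup>2 * (E k t)\<^sup>2) * (norm (cf u0 k))\<^sup>2) + 2 * (Dh\<^sup>2 * t powr (- 1 / 4) * (\<Sum>k\<in>fbox n. (1 + q k) powr (- 3 / 2)))"
          by (simp only: sum.distrib sum_distrib_left)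
        also have "\<dots> \<le> Z n t"
        proof -
          have "(\<Sum>k\<in>fbox n. (1 + q k) powr (- 3 / 2)) \<le> S"
            unfolding S_def using weight_summable[of "3 / 2"] by (intro finite_sum_le_infsum) auto
          then have "Dh\<^sup>2 * t powr (- 1 / 4) * (\<Sum>k\<in>fbox n. (1 + q k) powr (- 3 / 2)) \<le> Dh\<^sup>2 * t powr (- 1 / 4) * S"
            by (intro mult_left_mono) auto
          then show ?thesis unfolding Z_def by simp
        qed
        finally show ?case .
      qed
    qed
    also have "\<dots> = 2 * (\<Sum>k\<in>fbox n. integral\<^sup>L (lebesgue_on {0..T}) (\<lambda>t. (1 + q k)\<^sup>2 * (E k t)\<^sup>2) * (norm (cf u0 k))\<^sup>2)
       + 2 * (Dh\<^sup>2 * (T powr (1 - 1 / 4) / (1 - 1 / 4)) * S)"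
    proof -
      have "integral\<^sup>L (lebesgue_on {0..T}) (Z n) = integral\<^sup>L (lebesgue_on {0..T}) (\<lambda>t. 2 * (\<Sum>k\<in>fbox n. ((1 + q k)\<^sup>2 * (E k t)\<^sup>2) * (norm (cf u0 k))\<^sup>2))
        + integral\<^sup>L (lebesgue_on {0..T}) (\<lambda>t. 2 * (Dh\<^sup>2 * t powr (- (1 / 4)) * S))"
        unfolding Z_def by (rule Bochner_Integration.integral_add[OF isum ip])
      moreover have "integral\<^sup>L (lebesgue_on {0..T}) (\<lambda>t. 2 * (\<Sum>k\<in>fbox n. ((1 + q k)\<^sup>2 * (E k t)\<^sup>2) * (norm (cf u0 k))\<^sup>2))
        = 2 * (\<Sum>k\<in>fbox n. integral\<^sup>L (lebesgue_on {0..T}) (\<lambda>t. (1 + q k)\<^sup>2 * (E k t)\<^sup>2) * (norm (cf u0 k))\<^sup>2)"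
        by (simp only: integral_mult_right_zero Bochner_Integration.integral_sum[OF iE] integral_mult_left_zero)
      moreover have "integral\<^sup>L (lebesgue_on {0..T}) (\<lambda>t. 2 * (Dh\<^sup>2 * t powr (- (1 / 4)) * S)) = 2 * (Dh\<^sup>2 * (T powr (1 - 1 / 4) / (1 - 1 / 4)) * S)"
        using T by (simp only: integral_mult_right_zero integral_mult_left_zero powr_lint(2)[of "1 / 4" T])
      ultimately show ?thesis by simp
    qed
    also have "\<dots> \<le> B"
    proof -
      have "(\<Sum>k\<in>fbox n. integral\<^sup>L (lebesgue_on {0..T}) (\<lambda>t. (1 + q k)\<^sup>2 * (E k t)\<^sup>2) * (norm (cf u0 k))\<^sup>2)
        \<le> (\<Sum>k\<in>fbox n. (2 * (exp (2 * T))\<^sup>2) * (norm (cf u0 k))\<^sup>2)"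
        by (intro sum_mono mult_right_mono E_time_integral) simp
      also have "\<dots> \<le> (2 * (exp (2 * T))\<^sup>2) * (l2_norm L u0)\<^sup>2"
        unfolding sum_distrib_left[symmetric] by (intro mult_left_mono bessel u0) auto
      finally show ?thesis unfolding B_def by linarith
    qed
    finally show ?thesis .
  qed
  have B0: "0 \<le> B"
  proof -
    have "0 \<le> integral\<^sup>L (lebesgue_on {0..T}) (Y 0)" by (simp add: Y0)
    then show ?thesis using bound[of 0] by linarith
  qed
  have "(\<integral>\<^sup>+t. ennreal (h t) \<partial>lebesgue_on {0..T}) = (\<integral>\<^sup>+t. liminf (\<lambda>n. ennreal (Y n t)) \<partial>lebesgue_on {0..T})"
  proof (rule nn_integral_cong_AE)
    show "AE t in lebesgue_on {0..T}. ennreal (h t) = liminf (\<lambda>n. ennreal (Y n t))"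
      using lim by eventually_elim (intro lim_imp_Liminf[symmetric] tendsto_ennrealI, auto)
  qed
  also have "\<dots> \<le> liminf (\<lambda>n. \<integral>\<^sup>+t. ennreal (Y n t) \<partial>lebesgue_on {0..T})"
    by (intro nn_integral_liminf measurable_compose[OF mY] measurable_ennreal)
  also have "\<dots> \<le> ennreal B"
  proof (rule Liminf_le)
    show "\<forall>\<^sub>F n in sequentially. (\<integral>\<^sup>+t. ennreal (Y n t) \<partial>lebesgue_on {0..T}) \<le> ennreal B"
      using bound B0 by (intro always_eventually allI, subst nn_integral_eq_integral[OF continuous_lint[OF cY]])
        (auto simp: Y0 intro!: ennreal_leI)
  qed simp
  finally have "(\<integral>\<^sup>+t. ennreal (h t) \<partial>lebesgue_on {0..T}) \<le> ennreal B" .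
  then have "integrable (lebesgue_on {0..T}) h"
    by (intro integrableI_nonneg hm) (auto simp: h_def le_less_trans)
  then show ?thesis by (simp add: h_def[abs_def])
qed

lemma u_L2_time: "u \<in> L2_time T (H2 L) (h2_norm L)"
  unfolding L2_time_def
proof (intro CollectI conjI)
  show "strongly_measurable T (H2 L) (h2_norm L) u"
    by (rule strongly_measurable_of_continuous[OF T u_H2])
       (auto intro!: tendsto_within_metric[OF u_H2_continuous] simp: h2_norm_self_diff simp del: abs_of_nonneg)
qed (rule AE_u_H2, rule u_H2_integrable)

lemma rhs_u_continuous:
  assumes t: "0 < t" "t \<le> T"
  shows "((\<lambda>s. hm2_norm L (rhs (u s) - rhs (u t))) \<longlongrightarrow> 0) (at t within {0<..T})"
proof (rule tendsto_sandwich[OF _ _ tendsto_const])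
  have near: "\<forall>\<^sub>F s in at t within {0<..T}. 0 < s \<and> s \<le> T" by (simp add: eventually_at_filter)
  show "\<forall>\<^sub>F s in at t within {0<..T}. 0 \<le> hm2_norm L (rhs (u s) - rhs (u t))"
    using near by eventually_elim (auto intro!: hm2_norm_nonneg Hm2_minus rhs_Hm2 u_H2 simp: t)
  show "\<forall>\<^sub>F s in at t within {0<..T}. hm2_norm L (rhs (u s) - rhs (u t)) \<le> (2 * M + 2 + 2 * Csob * h2_norm L (u t)) * h2_norm L (u s - u t)"
    using near by eventually_elim (intro rhs_diff_le u_H2 t, auto)
  show "((\<lambda>s. (2 * M + 2 + 2 * Csob * h2_norm L (u t)) * h2_norm L (u s - u t)) \<longlongrightarrow> 0) (at t within {0<..T})"
    by (rule tendsto_mult_right_zero[OF u_H2_continuous[OF t]])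
qed

lemma hm2_rhs_continuous: "continuous_on {0<..T} (\<lambda>t. hm2_norm L (rhs (u t)))"
  unfolding continuous_on_def
proof
  fix t assume "t \<in> {0<..T}"
  then have t: "0 < t" "t \<le> T" by auto
  have "\<forall>\<^sub>F s in at t within {0<..T}. norm (hm2_norm L (rhs (u s)) - hm2_norm L (rhs (u t))) \<le> hm2_norm L (rhs (u s) - rhs (u t))"
    unfolding eventually_at_filter real_norm_def
    by (intro always_eventually allI impI hm2_norm_triangle rhs_Hm2 u_H2 t) auto
  then have "((\<lambda>s. hm2_norm L (rhs (u s)) - hm2_norm L (rhs (u t))) \<longlongrightarrow> 0) (at t within {0<..T})"
    by (rule Lim_null_comparison[OF _ rhs_u_continuous[OF t]])
  then show "((\<lambda>s. hm2_norm L (rhs (u s))) \<longlongrightarrow> hm2_norm L (rhs (u t))) (at t within {0<..T})"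
    by (rule LIM_zero_cancel)
qed

lemma rhs_u_L2_time: "(\<lambda>t. rhs (u t)) \<in> L2_time T (Hm2 L) (hm2_norm L)"
  unfolding L2_time_def
proof (intro CollectI conjI)
  show "AE t in lebesgue_on {0..T}. rhs (u t) \<in> Hm2 L"
    using AE_u_H2 by eventually_elim (rule rhs_Hm2)
  show "strongly_measurable T (Hm2 L) (hm2_norm L) (\<lambda>t. rhs (u t))"
  proof (rule strongly_measurable_of_continuous[OF T])
    fix t assume t: "0 < t" "t \<le> T"
    show "rhs (u t) \<in> Hm2 L" by (rule rhs_Hm2[OF u_H2[OF t]])
    have self: "hm2_norm L (rhs (u t) - rhs (u t)) = 0"
    proof (rule antisym)
      show "hm2_norm L (rhs (u t) - rhs (u t)) \<le> 0" by (rule hm2_norm_le) auto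
      show "0 \<le> hm2_norm L (rhs (u t) - rhs (u t))" by (intro hm2_norm_nonneg Hm2_minus rhs_Hm2 u_H2 t)
    qed
    show "\<exists>d>0. \<forall>s. 0 < s \<longrightarrow> s \<le> T \<longrightarrow> \<bar>s - t\<bar> < d \<longrightarrow> \<bar>hm2_norm L (rhs (u s) - rhs (u t))\<bar> < e" if "e > 0" for e
      by (rule tendsto_within_metric[OF rhs_u_continuous[OF t] self that])
  qed
  show "integrable (lebesgue_on {0..T}) (\<lambda>t. (hm2_norm L (rhs (u t)))\<^sup>2)"
  proof (rule Bochner_Integration.integrable_bound)
    show "integrable (lebesgue_on {0..T}) (\<lambda>t. (2 * M + 2)\<^sup>2 * (h2_norm L (u t))\<^sup>2)"
      by (intro integrable_mult_right u_H2_integrable)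
    show "(\<lambda>t. (hm2_norm L (rhs (u t)))\<^sup>2) \<in> borel_measurable (lebesgue_on {0..T})"
      by (intro borel_measurable_power measurable_half_open[OF hm2_rhs_continuous] order_refl)
    show "AE t in lebesgue_on {0..T}. norm ((hm2_norm L (rhs (u t)))\<^sup>2) \<le> norm ((2 * M + 2)\<^sup>2 * (h2_norm L (u t))\<^sup>2)"
      using AE_u_H2
    proof eventually_elim
      case (elim t)
      have "(hm2_norm L (rhs (u t)))\<^sup>2 \<le> ((2 * M + 2) * h2_norm L (u t))\<^sup>2"
        by (rule power_mono[OF hm2_norm_rhs_le[OF elim] hm2_norm_nonneg[OF rhs_Hm2[OF elim]]])
      then show ?case by (simp add: power_mult_distrib)
    qed
  qed
qed

text \<open>With \<open>E k t\<close> pulled out of the Duhamel integral, the coefficient is a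
  product of a smooth function and the indefinite integral of a function that is continuous at
  positive times.\<close>

lemma c_derivative:
  assumes t: "0 < t" "t < T"
  shows "((\<lambda>t. c t k) has_vector_derivative - (lam k *\<^sub>R c t k + NN (c t) k)) (at t)"
proof -
  define f where "f s = exp (lam k * s) *\<^sub>R NN (c s) k" for s
  define I where "I s = integral {0..s} f" for s
  have int: "integrable (lebesgue_on {0..s}) f" if "0 \<le> s" "s \<le> T" for s
    unfolding f_def by (rule duhamel_integrable(2)[OF adm that])
  have cI: "c s k = E k s *\<^sub>R (cf u0 k - I s)" if s: "0 \<le> s" "s \<le> T" for s
  proof -
    have "integral\<^sup>L (lebesgue_on {0..s}) f = I s"
      unfolding I_def by (rule lebesgue_integral_eq_integral[OF int[OF s]]) simp
    then have "Phi d s k = - (E k s *\<^sub>R I s)" by (simp add: Phi_eq f_def[abs_def])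
    then show ?thesis using fixed_point[of s k] s by (simp add: cc_def scaleR_diff_right)
  qed
  have cf0: "continuous_on {0<..T} f" unfolding f_def
    by (intro continuous_intros NN_cc_continuous[OF adm])
  \<comment> \<open>The exceptional set \<open>{0}\<close> removes the end point at which the
    integrand may be singular.\<close>
  have "(I has_vector_derivative f t) (at t within {0..T} - {0})"
    unfolding I_def
  proof (rule integral_has_vector_derivative_continuous_at)
    show "f integrable_on {0..T}" using integrable_on_lebesgue_on[OF int[of T]] T by simp
    have "{0..T} - {0} = {0<..T}" by auto
    then show "continuous (at t within {0..T} - {0}) f"
      using cf0 t by (simp add: continuous_on_eq_continuous_within)
  qed (use t in auto)
  then have "(I has_vector_derivative f t) (at t within {0<..<T})"
    by (rule has_vector_derivative_within_subset) auto
  then have I': "(I has_vector_derivative f t) (at t)" using at_within_open[of t "{0<..<T}"] t by simp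
  have E': "(E k has_real_derivative - lam k * E k t) (at t)"
    unfolding E_def[abs_def] by (auto intro!: derivative_eq_intros)
  have "((\<lambda>s. E k s *\<^sub>R (cf u0 k - I s)) has_vector_derivative
      (E k t *\<^sub>R (0 - f t) + (- lam k * E k t) *\<^sub>R (cf u0 k - I t))) (at t)"
    by (rule has_vector_derivative_scaleR[OF E' has_vector_derivative_diff[OF has_vector_derivative_const I']])
  also have "E k t *\<^sub>R (0 - f t) + (- lam k * E k t) *\<^sub>R (cf u0 k - I t) = - (lam k *\<^sub>R c t k + NN (c t) k)"
  proof -
    have "E k t *\<^sub>R f t = NN (c t) k" by (simp add: f_def E_def exp_minus)
    then show ?thesis using cI[of t] t by (simp add: scaleR_scaleR[symmetric] del: scaleR_scaleR)
  qed
  finally show ?thesis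
    by (rule has_vector_derivative_transform_within_open[of _ _ _ "{0<..<T}"]) (use t cI in auto)
qed

lemma l2_norm_u_le:
  assumes t: "t \<in> {0..T}" shows "l2_norm L (u t) \<le> sqrt (infsum GL UNIV)"
proof (rule real_le_rsqrt)
  show "(l2_norm L (u t))\<^sup>2 \<le> infsum GL UNIV"
    by (rule has_sum_mono[OF parseval_norm[OF u_L2[OF t]] has_sum_infsum[OF GL_summable]])
      (simp only: cf_u[OF t] c_L2_le[OF t])
qed

text \<open>Integration by parts for a finite sum of coefficients. The fundamental theorem is used
  in the form that asks for derivatives only in the interior, so the singularity of \<open>B\<close>
  at 0 is harmless, and the boundary terms vanish with \<open>\<phi>\<close>.\<close>

lemma truncated_derivative:
  assumes \<phi>: "test_function_on T \<phi>"
  shows "(LINT t|lebesgue_on {0..T}. deriv \<phi> t * l2_inner L (u t) (syn (fbox n) (cf v)))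
    = - (LINT t|lebesgue_on {0..T}. \<phi> t * rhs (u t) (syn (fbox n) (cf v)))"
proof -
  define A where "A t = (\<Sum>k\<in>fbox n. c t k \<bullet> cf v k)" for t
  define B where "B t = (\<Sum>k\<in>fbox n. - (lam k *\<^sub>R c t k + NN (c t) k) \<bullet> cf v k)" for t
  note \<phi>D = test_function_D[OF \<phi>]
  have cA: "continuous_on {0..T} A" unfolding A_def by (intro continuous_intros c_continuous)
  have ic: "integrable (lebesgue_on {0..T}) (\<lambda>t. lam k *\<^sub>R c t k)" for k
    by (intro continuous_imp_integrable_real continuous_intros c_continuous)
  have iB: "integrable (lebesgue_on {0..T}) B"
    unfolding B_def
    by (intro Bochner_Integration.integrable_sum integrable_inner_left Bochner_Integration.integrable_minus
        Bochner_Integration.integrable_add duhamel_integrable(1)[OF adm] ic)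
      (use T in auto)
  have iA: "integrable (lebesgue_on {0..T}) (\<lambda>t. deriv \<phi> t * A t)"
    by (intro continuous_lint continuous_intros cA \<phi>D(2))
  have i\<phi>B: "integrable (lebesgue_on {0..T}) (\<lambda>t. \<phi> t * B t)" by (rule continuous_lint_mult[OF iB \<phi>D(3)])
  have dA: "(A has_real_derivative B t) (at t)" if "0 < t" "t < T" for t
    unfolding A_def[abs_def] B_def has_real_derivative_iff_has_vector_derivative
    by (intro has_vector_derivative_sum bounded_linear.has_vector_derivative[OF bounded_linear_inner_left] c_derivative that)
  have "((\<lambda>t. deriv \<phi> t * A t + \<phi> t * B t) has_integral (\<phi> T * A T - \<phi> 0 * A 0)) {0..T}"
  proof (rule fundamental_theorem_of_calculus_interior)
    show "continuous_on {0..T} (\<lambda>t. \<phi> t * A t)" by (intro continuous_intros cA \<phi>D(3))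
    fix t assume "t \<in> {0<..<T}"
    then have "((\<lambda>t. \<phi> t * A t) has_real_derivative deriv \<phi> t * A t + B t * \<phi> t) (at t)"
      by (intro DERIV_mult \<phi>D(1) dA) auto
    then show "((\<lambda>t. \<phi> t * A t) has_vector_derivative deriv \<phi> t * A t + \<phi> t * B t) (at t)"
      by (simp add: has_real_derivative_iff_has_vector_derivative mult.commute)
  qed (use T in simp)
  then have "integral {0..T} (\<lambda>t. deriv \<phi> t * A t + \<phi> t * B t) = 0"
    using \<phi>D(4,5) T by (simp add: integral_unique)
  moreover have "integral\<^sup>L (lebesgue_on {0..T}) (\<lambda>t. deriv \<phi> t * A t + \<phi> t * B t) = integral {0..T} (\<lambda>t. deriv \<phi> t * A t + \<phi> t * B t)"
    by (rule lebesgue_integral_eq_integral[OF Bochner_Integration.integrable_add[OF iA i\<phi>B]]) simp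
  ultimately have "integral\<^sup>L (lebesgue_on {0..T}) (\<lambda>t. deriv \<phi> t * A t) + integral\<^sup>L (lebesgue_on {0..T}) (\<lambda>t. \<phi> t * B t) = 0"
    using Bochner_Integration.integral_add[OF iA i\<phi>B] by linarith
  moreover have "integral\<^sup>L (lebesgue_on {0..T}) (\<lambda>t. deriv \<phi> t * l2_inner L (u t) (syn (fbox n) (cf v))) = integral\<^sup>L (lebesgue_on {0..T}) (\<lambda>t. deriv \<phi> t * A t)"
    by (rule Bochner_Integration.integral_cong) (auto simp: A_def l2_inner_syn u_L2 cf_u)
  moreover have "integral\<^sup>L (lebesgue_on {0..T}) (\<lambda>t. \<phi> t * rhs (u t) (syn (fbox n) (cf v))) = integral\<^sup>L (lebesgue_on {0..T}) (\<lambda>t. \<phi> t * B t)"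
  proof (rule integral_cong_AE_lebesgue_on(2)[OF i\<phi>B])
    show "AE t in lebesgue_on {0..T}. \<phi> t * B t = \<phi> t * rhs (u t) (syn (fbox n) (cf v))"
      using AE_not_endpoints[of T] AE_space
    proof eventually_elim
      case (elim t)
      then have t: "0 < t" "t \<le> T" by auto
      have "rhs (u t) (syn (fbox n) (cf v)) = B t"
        unfolding B_def inner_minus_left sum_negf rhs_syn[OF u_H2[OF t]] NN_c[OF t(1)] using t by (simp add: cf_u)
      then show ?case by simp
    qed
  qed
  ultimately show ?thesis by linarith
qed

text \<open>The identity holds for the truncations of \<open>v\<close> and passes to
  \<open>v\<close> by dominated convergence on both sides. The majorants are the uniform L2 bound of
  \<open>u\<close> on the left and \<open>1\<close> plus the squared dual norm of
  \<open>rhs (u t)\<close> on the right.\<close>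

lemma u_time_derivative: "is_time_derivative L T u (\<lambda>t. rhs (u t))"
  unfolding is_time_derivative_def
proof (intro allI impI, elim conjE)
  fix \<phi> v assume \<phi>: "test_function_on T \<phi>" and v: "v \<in> H2 L"
  note \<phi>D = test_function_D[OF \<phi>]
  define vn where "vn n = syn (fbox n) (cf v)" for n
  have vn: "vn n \<in> H2 L" for n unfolding vn_def by (rule syn_H2) simp
  have vn_le: "h2_norm L (vn n) \<le> h2_norm L v" for n unfolding vn_def by (rule h2_norm_syn_le[OF v])
  have 1: "(\<lambda>n. LINT t|lebesgue_on {0..T}. deriv \<phi> t * l2_inner L (u t) (vn n))
      \<longlonglongrightarrow> (LINT t|lebesgue_on {0..T}. deriv \<phi> t * l2_inner L (u t) v)"
  proof (rule integral_dominated_convergence)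
    show m: "(\<lambda>t. deriv \<phi> t * l2_inner L (u t) (vn n)) \<in> borel_measurable (lebesgue_on {0..T})" for n
    proof -
      have "continuous_on {0..T} (\<lambda>t. deriv \<phi> t * (\<Sum>k\<in>fbox n. c t k \<bullet> cf v k))"
        by (intro continuous_intros c_continuous \<phi>D(2))
      then have "(\<lambda>t. deriv \<phi> t * (\<Sum>k\<in>fbox n. c t k \<bullet> cf v k)) \<in> borel_measurable (lebesgue_on {0..T})"
        by (rule continuous_imp_measurable_on_sets_lebesgue) simp
      then show ?thesis
        by (rule measurable_cong[THEN iffD1, rotated]) (auto simp: vn_def l2_inner_syn u_L2 cf_u)
    qed
    have lim: "(\<lambda>n. deriv \<phi> t * l2_inner L (u t) (vn n)) \<longlonglongrightarrow> deriv \<phi> t * l2_inner L (u t) v" if "t \<in> {0..T}" for t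
      unfolding vn_def by (intro tendsto_intros l2_inner_syn_lim u_L2 that H2_L2 v)
    show "(\<lambda>t. deriv \<phi> t * l2_inner L (u t) v) \<in> borel_measurable (lebesgue_on {0..T})"
      by (rule borel_measurable_LIMSEQ_metric[OF m lim]) simp
    show "AE t in lebesgue_on {0..T}. (\<lambda>n. deriv \<phi> t * l2_inner L (u t) (vn n)) \<longlonglongrightarrow> deriv \<phi> t * l2_inner L (u t) v"
      by (rule AE_I2[OF lim]) simp
    show "integrable (lebesgue_on {0..T}) (\<lambda>t. \<bar>deriv \<phi> t\<bar> * (sqrt (infsum GL UNIV) * h2_norm L v))"
      by (intro continuous_lint continuous_intros \<phi>D(2))
    fix n
    show "AE t in lebesgue_on {0..T}. norm (deriv \<phi> t * l2_inner L (u t) (vn n)) \<le> \<bar>deriv \<phi> t\<bar> * (sqrt (infsum GL UNIV) * h2_norm L v)"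
    proof (rule AE_I2)
      fix t assume "t \<in> space (lebesgue_on {0..T})"
      then have t: "t \<in> {0..T}" by simp
      have "\<bar>l2_inner L (u t) (vn n)\<bar> \<le> l2_norm L (u t) * l2_norm L (vn n)"
        by (rule l2_cauchy_schwarz[OF u_L2[OF t] H2_L2[OF vn]])
      also have "\<dots> \<le> sqrt (infsum GL UNIV) * h2_norm L v"
        by (rule mult_mono'[OF l2_norm_u_le[OF t] order.trans[OF l2_le_h2[OF vn] vn_le]]) simp_all
      finally show "norm (deriv \<phi> t * l2_inner L (u t) (vn n)) \<le> \<bar>deriv \<phi> t\<bar> * (sqrt (infsum GL UNIV) * h2_norm L v)"
        by (simp add: abs_mult mult_left_mono)
    qed
  qed
  have 2: "(\<lambda>n. LINT t|lebesgue_on {0..T}. \<phi> t * rhs (u t) (vn n)) \<longlonglongrightarrow> (LINT t|lebesgue_on {0..T}. \<phi> t * rhs (u t) v)"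
  proof (rule integral_dominated_convergence)
    have i: "integrable (lebesgue_on {0..T}) (\<lambda>t. \<phi> t * rhs (u t) w)" if "w \<in> H2 L" for w
      by (rule continuous_lint_mult[OF Hm2_time_integrable[OF rhs_u_L2_time that] \<phi>D(3)])
    show "(\<lambda>t. \<phi> t * rhs (u t) v) \<in> borel_measurable (lebesgue_on {0..T})" using i[OF v] by simp
    show "(\<lambda>t. \<phi> t * rhs (u t) (vn n)) \<in> borel_measurable (lebesgue_on {0..T})" for n using i[OF vn] by simp
    show "AE t in lebesgue_on {0..T}. (\<lambda>n. \<phi> t * rhs (u t) (vn n)) \<longlonglongrightarrow> \<phi> t * rhs (u t) v"
      using AE_u_H2 by eventually_elim (simp only: vn_def, intro tendsto_intros rhs_syn_lim v)
    have "integrable (lebesgue_on {0..T}) (\<lambda>t. (1 + (hm2_norm L (rhs (u t)))\<^sup>2) * h2_norm L v)"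
      using rhs_u_L2_time unfolding L2_time_def
      by (intro integrable_mult_left Bochner_Integration.integrable_add continuous_lint[OF continuous_on_const]) simp
    then show "integrable (lebesgue_on {0..T}) (\<lambda>t. \<bar>\<phi> t\<bar> * ((1 + (hm2_norm L (rhs (u t)))\<^sup>2) * h2_norm L v))"
      by (rule continuous_lint_mult) (intro continuous_intros \<phi>D(3))
    fix n
    show "AE t in lebesgue_on {0..T}. norm (\<phi> t * rhs (u t) (vn n)) \<le> \<bar>\<phi> t\<bar> * ((1 + (hm2_norm L (rhs (u t)))\<^sup>2) * h2_norm L v)"
      using AE_u_H2
    proof eventually_elim
      case (elim t)
      have le: "x \<le> 1 + x\<^sup>2" for x :: real using sum_power2_ge_zero[of "x - 1" x] by (simp add: power2_eq_square algebra_simps)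
      have "\<bar>rhs (u t) (vn n)\<bar> \<le> hm2_norm L (rhs (u t)) * h2_norm L (vn n)" by (rule Hm2_bound[OF rhs_Hm2[OF elim] vn])
      also have "\<dots> \<le> (1 + (hm2_norm L (rhs (u t)))\<^sup>2) * h2_norm L v"
        by (rule mult_mono[OF le vn_le]) (auto intro: add_nonneg_nonneg)
      finally show ?case by (simp add: abs_mult mult_left_mono)
    qed
  qed
  have "(LINT t|lebesgue_on {0..T}. deriv \<phi> t * l2_inner L (u t) (vn n)) = - (LINT t|lebesgue_on {0..T}. \<phi> t * rhs (u t) (vn n))" for n
    unfolding vn_def by (rule truncated_derivative[OF \<phi>])
  then show "(LINT t|lebesgue_on {0..T}. deriv \<phi> t * l2_inner L (u t) v) = - (LINT t|lebesgue_on {0..T}. \<phi> t * rhs (u t) v)"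
    using LIMSEQ_unique[OF 1] tendsto_minus[OF 2] by simp
qed

lemma u_weak_solution: "weak_solution L T \<eta> u0 u"
  unfolding weak_solution_def
proof (intro conjI bexI)
  show "u \<in> L2_time T (H2 L) (h2_norm L)" by (rule u_L2_time)
  show "u \<in> C_time T (L2 L) (l2_norm L)" by (rule u_C_time)
  show "is_time_derivative L T u (\<lambda>t. rhs (u t))" by (rule u_time_derivative)
  show "AE t in lebesgue_on {0..T}. \<forall>v\<in>H2 L. rhs (u t) v + l2_inner L (adv (u t)) v + l2_inner L (lap L (u t)) v + bilap L (u t) v = 0"
    by (simp add: rhs_def)
  show "AE x in lebesgue. u 0 x = u0 x" by (simp add: u_def)
  show "(\<lambda>t. rhs (u t)) \<in> L2_time T (Hm2 L) (hm2_norm L)" by (rule rhs_u_L2_time)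
qed

end

section \<open>Well-posedness\<close>

context calmed
begin

lemma weak_solution_D:
  assumes "weak_solution L T \<eta> u0 u"
  shows "u \<in> C_time T (L2 L) (l2_norm L)" "t \<in> {0..T} \<Longrightarrow> u t \<in> L2 L" "AE t in lebesgue_on {0..T}. u t \<in> H2 L"
proof -
  show C: "u \<in> C_time T (L2 L) (l2_norm L)" using assms unfolding weak_solution_def by (elim conjE)
  show "t \<in> {0..T} \<Longrightarrow> u t \<in> L2 L" by (rule C_time_L2[OF C])
  have "u \<in> L2_time T (H2 L) (h2_norm L)" using assms unfolding weak_solution_def by (elim conjE)
  then show "AE t in lebesgue_on {0..T}. u t \<in> H2 L" unfolding L2_time_def by (elim CollectE conjE)
qed

text \<open>The stability estimate with equal data. It holds at every time because the solutions are
  continuous into L2.\<close>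

lemma weak_solution_unique_AE_mu:
  assumes T: "T > 0" and u0: "u0 \<in> L2 L"
    and u: "weak_solution L T \<eta> u0 u" and v: "weak_solution L T \<eta> u0 v" and t: "t \<in> {0..T}"
  shows "AE x in mu L. u t x = v t x"
proof -
  obtain K where K: "K \<ge> 0"
    "\<And>u w0 t. weak_solution L T \<eta> w0 u \<Longrightarrow> w0 \<in> L2 L \<Longrightarrow> t \<in> {0..T} \<Longrightarrow> (l2_norm L (u t - v t))\<^sup>2 \<le> K * (l2_norm L (w0 - u0))\<^sup>2"
    "\<And>u w0. weak_solution L T \<eta> w0 u \<Longrightarrow> w0 \<in> L2 L \<Longrightarrow>
       integral\<^sup>L (lebesgue_on {0..T}) (\<lambda>s. (h2_norm L (u s - v s))\<^sup>2) \<le> 2 * K * (l2_norm L (w0 - u0))\<^sup>2"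
    by (rule weak_solution_stability[OF T v u0]) blast
  have "(l2_norm L (u0 - u0))\<^sup>2 = 0" unfolding l2_norm_minus_eq[OF u0 u0] by simp
  then have "(l2_norm L (u t - v t))\<^sup>2 \<le> 0" using K(2)[OF u u0 t] by simp
  then have "l2_norm L (u t - v t) = 0" by simp
  then have "AE x in mu L. (u t - v t) x = 0"
    by (intro l2_norm_eq_0_AE L2_minus weak_solution_D(2)[OF u] weak_solution_D(2)[OF v] t)
  then show ?thesis by simp
qed

lemma weak_solution_unique:
  assumes "T > 0" "u0 \<in> L2 L" "weak_solution L T \<eta> u0 u" "weak_solution L T \<eta> u0 v" "t \<in> {0..T}"
  shows "AE x in lebesgue. u t x = v t x"
proof (rule AE_periodic[OF L _ weak_solution_unique_AE_mu[OF assms]])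
  have "periodic L (u t)" "periodic L (v t)"
    using weak_solution_D(2)[OF assms(3,5)] weak_solution_D(2)[OF assms(4,5)] by (simp_all add: L2_def)
  then show "periodic L (\<lambda>x. u t x = v t x)" by (simp add: periodic_def)
qed

text \<open>The stability constant depends only on the solution it refers to, so a single solution
  \<open>u1\<close> with data \<open>u0\<close> provides one that serves all others.\<close>

lemma weak_solution_dependence:
  assumes T: "T > 0" and u0: "u0 \<in> L2 L" and u1: "weak_solution L T \<eta> u0 u1"
  obtains K where "K \<ge> 0"
    "\<And>u v v0 t. weak_solution L T \<eta> u0 u \<Longrightarrow> weak_solution L T \<eta> v0 v \<Longrightarrow> v0 \<in> L2 L \<Longrightarrow> t \<in> {0..T} \<Longrightarrow>
       (l2_norm L (v t - u t))\<^sup>2 \<le> K * (l2_norm L (v0 - u0))\<^sup>2"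
    "\<And>u v v0. weak_solution L T \<eta> u0 u \<Longrightarrow> weak_solution L T \<eta> v0 v \<Longrightarrow> v0 \<in> L2 L \<Longrightarrow>
       integral\<^sup>L (lebesgue_on {0..T}) (\<lambda>s. (h2_norm L (v s - u s))\<^sup>2) \<le> 2 * K * (l2_norm L (v0 - u0))\<^sup>2"
proof -
  obtain K where K: "K \<ge> 0"
    "\<And>v v0 t. weak_solution L T \<eta> v0 v \<Longrightarrow> v0 \<in> L2 L \<Longrightarrow> t \<in> {0..T} \<Longrightarrow> (l2_norm L (v t - u1 t))\<^sup>2 \<le> K * (l2_norm L (v0 - u0))\<^sup>2"
    "\<And>v v0. weak_solution L T \<eta> v0 v \<Longrightarrow> v0 \<in> L2 L \<Longrightarrow>
       integral\<^sup>L (lebesgue_on {0..T}) (\<lambda>s. (h2_norm L (v s - u1 s))\<^sup>2) \<le> 2 * K * (l2_norm L (v0 - u0))\<^sup>2"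
    by (rule weak_solution_stability[OF T u1 u0]) blast
  have cf_eq: "cf (u t) k = cf (u1 t) k" if u: "weak_solution L T \<eta> u0 u" and t: "t \<in> {0..T}" for u t k
    by (rule cf_cong_AE[OF weak_solution_D(2)[OF u t] weak_solution_D(2)[OF u1 t] weak_solution_unique_AE_mu[OF T u0 u u1 t]])
  show ?thesis
  proof (rule that[OF K(1)])
    fix u v v0 t
    assume u: "weak_solution L T \<eta> u0 u" and v: "weak_solution L T \<eta> v0 v" and v0: "v0 \<in> L2 L" and t: "t \<in> {0..T}"
    have "(l2_norm L (v t - u t))\<^sup>2 = (l2_norm L (v t - u1 t))\<^sup>2"
      by (simp only: l2_norm_minus_eq weak_solution_D(2)[OF u t] weak_solution_D(2)[OF u1 t] weak_solution_D(2)[OF v t] cf_eq[OF u t])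
    then show "(l2_norm L (v t - u t))\<^sup>2 \<le> K * (l2_norm L (v0 - u0))\<^sup>2" using K(2)[OF v v0 t] by simp
  next
    fix u v v0
    assume u: "weak_solution L T \<eta> u0 u" and v: "weak_solution L T \<eta> v0 v" and v0: "v0 \<in> L2 L"
    have "AE s in lebesgue_on {0..T}. (h2_norm L (v s - u1 s))\<^sup>2 = (h2_norm L (v s - u s))\<^sup>2"
      using weak_solution_D(3)[OF u] weak_solution_D(3)[OF u1] weak_solution_D(3)[OF v] AE_space
    proof eventually_elim
      case (elim s)
      then have s: "s \<in> {0..T}" by simp
      show ?case by (simp only: h2_norm_minus_eq elim(1-3) cf_eq[OF u s])
    qed
    from integral_cong_AE_lebesgue_on(2)[OF energy_inequality(1)[OF T v u1] this]
    show "integral\<^sup>L (lebesgue_on {0..T}) (\<lambda>s. (h2_norm L (v s - u s))\<^sup>2) \<le> 2 * K * (l2_norm L (v0 - u0))\<^sup>2"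
      using K(3)[OF v v0] by simp
  qed
qed

lemma weak_solution_continuous_dependence:
  assumes T: "T > 0" and u0: "u0 \<in> L2 L" and u1: "weak_solution L T \<eta> u0 u1" and r: "r > 0"
  shows "\<exists>\<delta>>0. \<forall>v0\<in>L2 L. l2_norm L (v0 - u0) < \<delta> \<longrightarrow>
    (\<forall>u v. weak_solution L T \<eta> u0 u \<and> weak_solution L T \<eta> v0 v \<longrightarrow>
      Linf_time_norm T (l2_norm L) (\<lambda>t. v t - u t) < ereal r \<and> L2_time_norm T (h2_norm L) (\<lambda>t. v t - u t) < r)"
proof -
  obtain K where K: "K \<ge> 0"
    "\<And>u v v0 t. weak_solution L T \<eta> u0 u \<Longrightarrow> weak_solution L T \<eta> v0 v \<Longrightarrow> v0 \<in> L2 L \<Longrightarrow> t \<in> {0..T} \<Longrightarrow>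
       (l2_norm L (v t - u t))\<^sup>2 \<le> K * (l2_norm L (v0 - u0))\<^sup>2"
    "\<And>u v v0. weak_solution L T \<eta> u0 u \<Longrightarrow> weak_solution L T \<eta> v0 v \<Longrightarrow> v0 \<in> L2 L \<Longrightarrow>
       integral\<^sup>L (lebesgue_on {0..T}) (\<lambda>s. (h2_norm L (v s - u s))\<^sup>2) \<le> 2 * K * (l2_norm L (v0 - u0))\<^sup>2"
    by (rule weak_solution_dependence[OF T u0 u1]) blast
  \<comment> \<open>The summand 1 keeps the root positive when \<open>K = 0\<close>, and
    \<open>2 * K\<close> covers the larger of the two stability bounds.\<close>
  define \<delta> where "\<delta> = r / sqrt (2 * K + 1)"
  have \<delta>: "\<delta> > 0" "\<delta>\<^sup>2 * (2 * K + 1) = r\<^sup>2" using r K(1) by (simp_all add: \<delta>_def power_divide)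
  have "Linf_time_norm T (l2_norm L) (\<lambda>t. v t - u t) < ereal r \<and> L2_time_norm T (h2_norm L) (\<lambda>t. v t - u t) < r"
    if v0: "v0 \<in> L2 L" and less: "l2_norm L (v0 - u0) < \<delta>" and u: "weak_solution L T \<eta> u0 u" and v: "weak_solution L T \<eta> v0 v" for v0 u v
  proof -
    define m where "m = (l2_norm L (v0 - u0))\<^sup>2"
    have "0 \<le> m" by (simp add: m_def)
    have "m < \<delta>\<^sup>2" unfolding m_def using less by (intro power_strict_mono) auto
    then have "m * (2 * K + 1) < r\<^sup>2" unfolding \<delta>(2)[symmetric] using K(1) by (intro mult_strict_right_mono) auto
    then have m: "2 * K * m < r\<^sup>2" using \<open>0 \<le> m\<close> by (simp add: algebra_simps)
    moreover have "K * m \<le> 2 * K * m" using \<open>0 \<le> m\<close> K(1) by simp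
    ultimately have m': "K * m < r\<^sup>2" by linarith
    have "L2_time_norm T (h2_norm L) (\<lambda>t. v t - u t) \<le> sqrt (2 * K * m)"
      unfolding L2_time_norm_def m_def by (rule real_sqrt_le_mono[OF K(3)[OF u v v0]])
    also have "\<dots> < r" using m r by (intro real_less_lsqrt) auto
    finally have 1: "L2_time_norm T (h2_norm L) (\<lambda>t. v t - u t) < r" .
    have "Linf_time_norm T (l2_norm L) (\<lambda>t. v t - u t) \<le> ereal (sqrt (K * m))"
      unfolding Linf_time_norm_def
    proof (rule esssup_I)
      have "(\<lambda>t. l2_norm L (v t - u t)) \<in> borel_measurable (lebesgue_on {0..T})"
        by (rule continuous_imp_measurable_on_sets_lebesgue[OF C_time_norm_continuous[OF weak_solution_D(1)[OF v] weak_solution_D(1)[OF u]]]) simp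
      then show "(\<lambda>t. ereal (l2_norm L (v t - u t))) \<in> borel_measurable (lebesgue_on {0..T})" by simp
      show "AE t in lebesgue_on {0..T}. ereal (l2_norm L (v t - u t)) \<le> ereal (sqrt (K * m))"
      proof (rule AE_I2)
        fix t assume "t \<in> space (lebesgue_on {0..T})"
        then have "t \<in> {0..T}" by simp
        then show "ereal (l2_norm L (v t - u t)) \<le> ereal (sqrt (K * m))"
          unfolding ereal_less_eq m_def by (intro real_le_rsqrt K(2)[OF u v v0])
      qed
    qed
    also have "\<dots> < ereal r" unfolding ereal_less(1) using m' r by (simp add: real_less_lsqrt)
    finally show ?thesis using 1 by blast
  qed
  then show ?thesis using \<delta>(1) by blast
qed

end

theorem theorem1p6:
  fixes L T \<epsilon> :: real
    and \<eta> :: "real \<Rightarrow> real^2 \<Rightarrow> real^2"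
    and u0 :: "real^2 \<Rightarrow> real^2"
  assumes "L > 0" and "T > 0" and "\<epsilon> > 0"
    and "u0 \<in> L2 L"
    and "bounded (range (\<eta> \<epsilon>))"
    and "1-lipschitz_on UNIV (\<eta> \<epsilon>)"
  shows "(\<exists>u. weak_solution L T (\<eta> \<epsilon>) u0 u)
    \<and> (\<forall>u v. weak_solution L T (\<eta> \<epsilon>) u0 u \<and> weak_solution L T (\<eta> \<epsilon>) u0 v \<longrightarrow>
         (\<forall>t\<in>{0..T}. AE x in lebesgue. u t x = v t x))
    \<and> (\<forall>r>0. \<exists>\<delta>>0. \<forall>v0\<in>L2 L. l2_norm L (v0 - u0) < \<delta> \<longrightarrow>
         (\<forall>u v. weak_solution L T (\<eta> \<epsilon>) u0 u \<and> weak_solution L T (\<eta> \<epsilon>) v0 v \<longrightarrow>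
            Linf_time_norm T (l2_norm L) (\<lambda>t. v t - u t) < ereal r \<and>
            L2_time_norm T (h2_norm L) (\<lambda>t. v t - u t) < r))"
proof -
  obtain M where M: "\<And>y. norm (\<eta> \<epsilon> y) \<le> M"
    using \<open>bounded (range (\<eta> \<epsilon>))\<close> by (auto simp: bounded_iff)
  interpret calmed_ivp L "\<eta> \<epsilon>" M T u0
    using assms M by unfold_locales
  obtain \<beta> d where d: "adm \<beta> d" "\<And>t k. t \<in> {0..T} \<Longrightarrow> d t k = Phi d t k"
    by (rule mild_solution_exists) blast
  interpret mild_solution L "\<eta> \<epsilon>" M T u0 \<beta> d
    using d by unfold_locales
  show ?thesis
    by (intro conjI allI impI ballI exI[of _ u] u_weak_solution
        weak_solution_continuous_dependence[OF \<open>T > 0\<close> \<open>u0 \<in> L2 L\<close> u_weak_solution])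
      (elim conjE, rule weak_solution_unique[OF \<open>T > 0\<close> \<open>u0 \<in> L2 L\<close>])
qed

end
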